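(* Let $T\in(0,\infty)$, let $A,B,B_1$ be continuous matrix-valued functions on $[0,T]$ with values in $\mathbb{R}^{n\times n}$, $\mathbb{R}^{n\times m}$, $\mathbb{R}^{n\times p}$ respectively, with $(A,B)$ controllable (in the Gramian sense recalled in the context), and let $\Sigma_0,\Sigma_T$ be symmetric positive definite $n\times n$ matrices. Assume that $\{(\Pi(t),\mathrm{H}(t))\mid 0\le t\le T\}$ is a pair of symmetric $n\times n$ matrix-valued functions on $[0,T]$ satisfying \begin{align*} \dot{\Pi}(t) &= -A(t)'\Pi(t)-\Pi(t)A(t)+\Pi(t)B(t)B(t)'\Pi(t),\\ \dot{\mathrm{H}}(t) &= -A(t)'\mathrm{H}(t)-\mathrm{H}(t)A(t)-\mathrm{H}(t)B(t)B(t)'\mathrm{H}(t)\\ &\quad+\left(\Pi(t)+\mathrm{H}(t)\right)\left(B(t)B(t)'-B_1(t)B_1(t)'\right)\left(\Pi(t)+\mathrm{H}(t)\right),\\ \Sigma_0^{-1}&=\Pi(0)+\mathrm{H}(0),\\ \Sigma_T^{-1}&=\Pi(T)+\mathrm{H}(T). \end{align*} Then the feedback control law $u(x,t)=-B(t)'\Pi(t)x$ solves the following problem: minimize $$J(u)=\mathbb{E}\left\{\int_0^T u(t)'u(t)\,dt\right\}$$ over all $u\in\mathcal{U}$, where $\mathcal{U}$ is the class of admissible controls (defined in the context) steering the state from the Gaussian density with mean zero and covariance $\Sigma_0$ at time $0$ to the Gaussian density with mean zero and covariance $\Sigma_T$ at time $T$. The corresponding optimal evolution is given by $$dx^*(t)=\left(A(t)-B(t)B(t)'\Pi(t)\right)x^*(t)\,dt+B_1(t)\,dw(t),\qquad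 x^*(0)=x_0 \text{ a.s.},$$ that is, the control $u^*(t)=-B(t)'\Pi(t)x^*(t)$ belongs to $\mathcal{U}$ and attains the minimum of $J$ over $\mathcal{U}$.
   Context: A prime denotes matrix transpose. The controlled process is $$dx^u(t)=A(t)x^u(t)\,dt+B(t)u(t)\,dt+B_1(t)\,dw(t),\qquad x^u(0)=x_0\text{ a.s.},$$ where $\{w(t)\mid 0\le t\le T\}$ is a standard $p$-dimensional Wiener process and $x_0$ is an $n$-dimensional Gaussian random vector, independent of $w$, with mean zero and covariance $\Sigma_0$. The class $\mathcal{U}$ of admissible controls consists of the $\mathbb{R}^m$-valued control functions $u$ that (i) are adapted, meaning that $u(t)$ depends only on $t$ and on $\{x^u(s)\mid 0\le s\le t\}$ for each $t\in[0,T]$; (ii) have finite energy, $J(u)=\mathbb{E}\{\int_0^T u(t)'u(t)\,dt\}<\infty$; (iii) are such that the stochastic differential equation $dx^u(t)=A(t)x^u(t)\,dt+B(t)u(t)\,dt+B_1(t)\,dw(t)$ with $x^u(0)=x_0$ a.s. has a strong solution on $[0,T]$; and (iv) are such that $x^u(T)$ is distributed according to the density $$\rho_T(x)=(2\pi)^{-n/2}\det(\Sigma_T)^{-1/2}\exp\left(-\tfrac12 x'\Sigma_T^{-1}x\right).$$ Standing assumption (controllability): with $\Phi(t,\tau)$ the state-transition matrix of $\dot x(t)=A(t)x(t)$, the Gramian $\int_0^t\Phi(t,\tau)B(\tau)B(\tau)'\Phi(t,\tau)'\,d\tau$ is positive definite for all $0<t\le T$. *)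

theory Defs
  imports "HOL-Probability.Probability"
begin

definition pos_def :: "real^'n^'n \<Rightarrow> bool" where
  "pos_def S \<longleftrightarrow> transpose S = S \<and> (\<forall>v. v \<noteq> 0 \<longrightarrow> 0 < v \<bullet> (S *v v))"

definition gaussian_density :: "real^'n^'n \<Rightarrow> real^'n \<Rightarrow> real" where
  "gaussian_density S x =
     (2 * pi) powr (- real CARD('n) / 2) * det S powr (- 1 / 2)
       * exp (- (1 / 2) * (x \<bullet> (matrix_inv S *v x)))"

definition state_transition ::
    "real \<Rightarrow> (real \<Rightarrow> real^'n^'n) \<Rightarrow> (real \<Rightarrow> real \<Rightarrow> real^'n^'n) \<Rightarrow> bool" where
  "state_transition T A \<Phi> \<longleftrightarrow>
     (\<forall>\<tau>\<in>{0..T}. \<Phi> \<tau> \<tau> = mat 1 \<and>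
       (\<forall>t\<in>{0..T}. ((\<lambda>r. \<Phi> r \<tau>) has_vector_derivative (A t ** \<Phi> t \<tau>)) (at t within {0..T})))"

text \<open>For continuous \<open>A\<close> the transition matrix exists and is unique on \<open>[0,T]\<times>[0,T]\<close>, so the
  existential quantifier merely names it.\<close>

definition controllable ::
    "real \<Rightarrow> (real \<Rightarrow> real^'n^'n) \<Rightarrow> (real \<Rightarrow> real^'m^'n) \<Rightarrow> bool" where
  "controllable T A B \<longleftrightarrow>
     (\<exists>\<Phi>. state_transition T A \<Phi> \<and>
       (\<forall>t. 0 < t \<and> t \<le> T \<longrightarrow>
         pos_def (integral {0..t}
           (\<lambda>\<tau>. \<Phi> t \<tau> ** B \<tau> ** transpose (B \<tau>) ** transpose (\<Phi> t \<tau>)))))"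

definition generated_algebra ::
    "'w measure \<Rightarrow> 'i set \<Rightarrow> ('i \<Rightarrow> 'w \<Rightarrow> 'b::topological_space) \<Rightarrow> 'w measure" where
  "generated_algebra M S X =
     sigma (space M) (\<Union>s\<in>S. {X s -` E \<inter> space M | E. E \<in> sets borel})"

definition wiener_process :: "'w measure \<Rightarrow> real \<Rightarrow> (real \<Rightarrow> 'w \<Rightarrow> real^'p) \<Rightarrow> bool" where
  "wiener_process M T w \<longleftrightarrow>
     (\<forall>t\<in>{0..T}. w t \<in> borel_measurable M) \<and>
     (AE \<omega> in M. w 0 \<omega> = 0) \<and>
     (AE \<omega> in M. continuous_on {0..T} (\<lambda>t. w t \<omega>)) \<and>
     (\<forall>s t. 0 \<le> s \<and> s < t \<and> t \<le> T \<longrightarrow>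
        distributed M lborel (\<lambda>\<omega>. w t \<omega> - w s \<omega>) (gaussian_density ((t - s) *\<^sub>R mat 1)) \<and>
        prob_space.indep_set M
          (sets (generated_algebra M {0..s} w))
          (sets (vimage_algebra (space M) (\<lambda>\<omega>. w t \<omega> - w s \<omega>) borel)))"

text \<open>The integral \<open>\<integral>\<^sub>0\<^sup>t F dw\<close> of a deterministic square-integrable matrix function: the
  \<open>L\<^sup>2\<close>-limit of the integrals of step functions approximating \<open>F\<close> in \<open>L\<^sup>2[0,t]\<close>. By the Ito
  isometry it is unique up to null sets and independent of the approximating sequence.\<close>

definition partition_upto :: "real \<Rightarrow> nat \<Rightarrow> (nat \<Rightarrow> real) \<Rightarrow> bool" where
  "partition_upto t k \<tau> \<longleftrightarrow> \<tau> 0 = 0 \<and> \<tau> k = t \<and> (\<forall>i<k. \<tau> i \<le> \<tau> (Suc i))"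

definition step_function :: "nat \<Rightarrow> (nat \<Rightarrow> real) \<Rightarrow> (nat \<Rightarrow> real^'p^'n) \<Rightarrow> real \<Rightarrow> real^'p^'n" where
  "step_function k \<tau> C s = (\<Sum>i<k. indicator {\<tau> i<..\<tau> (Suc i)} s *\<^sub>R C i)"

definition step_integral ::
    "(real \<Rightarrow> 'w \<Rightarrow> real^'p) \<Rightarrow> nat \<Rightarrow> (nat \<Rightarrow> real) \<Rightarrow> (nat \<Rightarrow> real^'p^'n) \<Rightarrow> 'w \<Rightarrow> real^'n" where
  "step_integral w k \<tau> C \<omega> = (\<Sum>i<k. C i *v (w (\<tau> (Suc i)) \<omega> - w (\<tau> i) \<omega>))"

definition has_wiener_integral ::
    "'w measure \<Rightarrow> (real \<Rightarrow> 'w \<Rightarrow> real^'p) \<Rightarrow> (real \<Rightarrow> real^'p^'n) \<Rightarrow> real \<Rightarrow> ('w \<Rightarrow> real^'n) \<Rightarrow> bool"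
  where
  "has_wiener_integral M w F t I \<longleftrightarrow>
     I \<in> borel_measurable M \<and>
     (\<exists>k \<tau> C. (\<forall>j. partition_upto t (k j) (\<tau> j)) \<and>
        (\<lambda>j. \<integral>\<^sup>+s\<in>{0..t}. ennreal ((norm (step_function (k j) (\<tau> j) (C j) s - F s))\<^sup>2) \<partial>lborel)
          \<longlonglongrightarrow> 0 \<and>
        (\<lambda>j. \<integral>\<^sup>+\<omega>. ennreal ((norm (step_integral w (k j) (\<tau> j) (C j) \<omega> - I \<omega>))\<^sup>2) \<partial>M)
          \<longlonglongrightarrow> 0)"

definition augmented_filtration ::
    "'w measure \<Rightarrow> (real \<Rightarrow> 'w \<Rightarrow> real^'p) \<Rightarrow> ('w \<Rightarrow> real^'n) \<Rightarrow> real \<Rightarrow> 'w measure" where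
  "augmented_filtration M w x0 t =
     sigma (space M)
       (sets (vimage_algebra (space M) x0 borel) \<union> sets (generated_algebra M {0..t} w) \<union> null_sets M)"

text \<open>Strong solution on \<open>[0,T]\<close> of \<open>dx = b dt + F dw\<close>, \<open>x(0) = x0\<close> a.s., on the given probability
  space and for the given \<open>w\<close> and \<open>x0\<close>. The drift \<open>b\<close> is passed as a process, in
  which \<open>x\<close> itself may occur.\<close>

definition strong_solution ::
    "'w measure \<Rightarrow> real \<Rightarrow> (real \<Rightarrow> 'w \<Rightarrow> real^'p) \<Rightarrow> ('w \<Rightarrow> real^'n) \<Rightarrow>
     (real \<Rightarrow> 'w \<Rightarrow> real^'n) \<Rightarrow> (real \<Rightarrow> real^'p^'n) \<Rightarrow> (real \<Rightarrow> 'w \<Rightarrow> real^'n) \<Rightarrow> bool" where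
  "strong_solution M T w x0 b F x \<longleftrightarrow>
     (\<forall>\<omega>\<in>space M. continuous_on {0..T} (\<lambda>t. x t \<omega>)) \<and>
     (\<forall>t\<in>{0..T}. x t \<in> borel_measurable (augmented_filtration M w x0 t)) \<and>
     (AE \<omega> in M. x 0 \<omega> = x0 \<omega>) \<and>
     (AE \<omega> in M. set_integrable lborel {0..T} (\<lambda>s. b s \<omega>)) \<and>
     (\<forall>t\<in>{0..T}. \<exists>I. has_wiener_integral M w F t I \<and>
        (AE \<omega> in M. x t \<omega> = x0 \<omega> + (LINT s:{0..t}|lborel. b s \<omega>) + I \<omega>))"

definition controlled_state ::
    "'w measure \<Rightarrow> real \<Rightarrow> (real \<Rightarrow> 'w \<Rightarrow> real^'p) \<Rightarrow> ('w \<Rightarrow> real^'n) \<Rightarrow>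
     (real \<Rightarrow> real^'n^'n) \<Rightarrow> (real \<Rightarrow> real^'m^'n) \<Rightarrow> (real \<Rightarrow> real^'p^'n) \<Rightarrow>
     (real \<Rightarrow> 'w \<Rightarrow> real^'m) \<Rightarrow> (real \<Rightarrow> 'w \<Rightarrow> real^'n) \<Rightarrow> bool" where
  "controlled_state M T w x0 A B B1 u x \<longleftrightarrow>
     strong_solution M T w x0 (\<lambda>s \<omega>. A s *v x s \<omega> + B s *v u s \<omega>) B1 x"

text \<open>The integrand is nonnegative, so the energy is taken in \<open>[0,\<infinity>]\<close>.\<close>

definition energy :: "'w measure \<Rightarrow> real \<Rightarrow> (real \<Rightarrow> 'w \<Rightarrow> real^'m) \<Rightarrow> ennreal" where
  "energy M T u = (\<integral>\<^sup>+\<omega>. (\<integral>\<^sup>+t\<in>{0..T}. ennreal (u t \<omega> \<bullet> u t \<omega>) \<partial>lborel) \<partial>M)"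

text \<open>That \<open>u(t)\<close> depends only on the past of the state is measurability with respect to the
  sigma-algebra generated by \<open>x(s)\<close>, \<open>s \<le> t\<close>. Joint measurability is what gives the energy its meaning.
  The state belonging to \<open>u\<close> is unique up to indistinguishability.\<close>

definition admissible_controls ::
    "'w measure \<Rightarrow> real \<Rightarrow> (real \<Rightarrow> 'w \<Rightarrow> real^'p) \<Rightarrow> ('w \<Rightarrow> real^'n) \<Rightarrow>
     (real \<Rightarrow> real^'n^'n) \<Rightarrow> (real \<Rightarrow> real^'m^'n) \<Rightarrow> (real \<Rightarrow> real^'p^'n) \<Rightarrow>
     real^'n^'n \<Rightarrow> (real \<Rightarrow> 'w \<Rightarrow> real^'m) set" where
  "admissible_controls M T w x0 A B B1 ST =
     {u. (\<lambda>(t, \<omega>). u t \<omega>) \<in> borel_measurable (restrict_space borel {0..T} \<Otimes>\<^sub>M M) \<and>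
         energy M T u < \<infinity> \<and>
         (\<exists>x. controlled_state M T w x0 A B B1 u x \<and>
              (\<forall>t\<in>{0..T}. u t \<in> borel_measurable (generated_algebra M {0..t} x)) \<and>
              distributed M lborel (x T) (gaussian_density ST))}"

end

theory Submission imports Defs begin

text \<open>
  Because \<open>B\<^sub>1\<close> is deterministic, every state is \<open>x = y + I\<close> with \<open>y\<close> absolutely continuous and
  \<open>I\<close> a continuous version of the Wiener integral of \<open>B\<^sub>1\<close>.  So no Ito formula is needed: Lebesgue integration
  by parts along each path, and \<open>E (Z \<bullet> (I t - I s)) = 0\<close> for \<open>Z\<close> in the past of \<open>s\<close>, give
  the completion of squares
  \<open>E \<integral> |v|\<^sup>2 = E \<integral> |v + B' \<Pi> x|\<^sup>2 + E x(0)' \<Pi>(0) x(0) - E x(T)' \<Pi>(T) x(T) + c\<close>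
  for every admissible \<open>v\<close>, where \<open>c\<close> depends on \<open>\<Pi>\<close> and \<open>I\<close> only.  As the terminal law is prescribed, the
  last three terms are the same for all \<open>v\<close>, and the feedback law makes the first one vanish.

  It remains to see that the feedback law reaches the prescribed distribution.  The terminal state is an almost sure
  limit of sums of independent Gaussian vectors, hence Gaussian, and the Riccati equations say precisely that
  \<open>Q = \<Pi> + H\<close> solves the equation of the inverse covariance of the closed loop.
\<close>

text \<open>Taking expectations first removes the obstacle. Later increments of \<open>I\<close> are
  orthogonal to the past, so E b(s)' R I(t) = E b(s)' R I(s) for s \<le> t, where b is the drift.
  Hence E y(t)' R I(t) is the inner product of R with the time integral of the matrix E b(s) I(s)',
  a deterministic absolutely continuous function that can be integrated by parts against
  \<open>P\<close>.

  Two gaps separate the definitions from this argument. The Wiener integral is given for each time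
  separately, as a mean square limit, so one continuous adapted process must be built and identified
  with it at all times outside one null set. And a strong solution carries no moment condition, so
  square integrability of the state has to be drawn from finite energy by Gronwall's inequality.

  Working with densities forces nondegenerate covariances: the Gaussian sums start from
  \<open>x0\<close>, so that adding singular Gram matrices does no harm.\<close>

declare transpose_matrix_vector [simp del] vector_transpose_matrix [simp del]

section \<open>Matrices\<close>

text \<open>In finite dimension bilinear maps are bounded. Being a bounded bilinear map is what
  gives matrix products their product rule, continuity and limits.\<close>

lemma bounded_bilinear_matrix_mult:
  "bounded_bilinear (\<lambda>(A::real^'n^'m) (B::real^'k^'n). A ** B)"
proof -
  have "bilinear (\<lambda>(A::real^'n^'m) (B::real^'k^'n). A ** B)"
    unfolding bilinear_def linear_iff
    by (auto simp: matrix_add_ldistrib matrix_scalar_ac scalar_matrix_assoc)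
       (auto simp: matrix_matrix_mult_def vec_eq_iff sum.distrib algebra_simps)
  then show ?thesis by (simp add: bilinear_conv_bounded_bilinear)
qed

lemma bounded_bilinear_matrix_vector_mult:
  "bounded_bilinear (\<lambda>(A::real^'n^'m) x. A *v x)"
proof -
  have "bilinear (\<lambda>(A::real^'n^'m) x. A *v x)"
    unfolding bilinear_def linear_iff
    by (auto simp: algebra_simps matrix_vector_mult_scaleR scaleR_matrix_vector_assoc)
  then show ?thesis by (simp add: bilinear_conv_bounded_bilinear)
qed

lemma matrix_vector_minus_left: "(- X) *v z = - (X *v z)" for X :: "real^'n^'m"
  using bounded_bilinear.minus_left[OF bounded_bilinear_matrix_vector_mult] .

lemma matrix_vector_minus_right: "X *v (- z) = - (X *v z)" for X :: "real^'n^'m"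
  using bounded_bilinear.minus_right[OF bounded_bilinear_matrix_vector_mult] .

lemma bounded_linear_transpose: "bounded_linear (transpose :: real^'n^'m \<Rightarrow> real^'m^'n)"
  by (simp add: linear_conv_bounded_linear [symmetric] linear_iff transpose_def vec_eq_iff)

text \<open>The norm on matrices is the Frobenius norm, so Cauchy-Schwarz applies to each row
  separately.\<close>

lemma norm_matrix_vector_le: "norm (A *v x) \<le> norm A * norm (x::real^'n)" for A :: "real^'n^'m"
proof -
  have "norm (A *v x) \<le> L2_set (\<lambda>i. norm (A $ i) * norm x) UNIV"
    unfolding norm_vec_def[of "A *v x"]
    by (rule L2_set_mono)
       (auto simp: matrix_vector_mul_component Cauchy_Schwarz_ineq2)
  also have "\<dots> = norm A * norm x"
    by (simp add: L2_set_left_distrib[symmetric] norm_vec_def[of A])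
  finally show ?thesis .
qed

text \<open>Column i of the product is \<open>A\<close> applied to column i of \<open>B\<close>.
  Transposition preserves the Frobenius norm and turns columns into the rows by which the norm is
  defined.\<close>

lemma norm_matrix_mult_le: "norm (A ** B) \<le> norm A * norm B" for A :: "real^'n^'m" and B :: "real^'k^'n"
proof -
  have tr: "norm (transpose X) = norm X" for X :: "real^'b^'a"
    unfolding norm_vec_def L2_set_def transpose_def
    by (simp add: real_sqrt_pow2 sum_nonneg, subst sum.swap, simp)
  have "norm (transpose (A ** B)) \<le> L2_set (\<lambda>i. norm A * norm (transpose B $ i)) UNIV"
    unfolding norm_vec_def[of "transpose (A ** B)"]
  proof (rule L2_set_mono)
    fix i
    have "transpose (A ** B) $ i = A *v (transpose B $ i)"
      by (simp add: vec_eq_iff transpose_def matrix_matrix_mult_def matrix_vector_mult_def)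
    then show "norm (transpose (A ** B) $ i) \<le> norm A * norm (transpose B $ i)"
      using norm_matrix_vector_le by simp
  qed auto
  also have "\<dots> = norm A * norm (transpose B)"
    by (simp add: L2_set_right_distrib[symmetric] norm_vec_def[of "transpose B"])
  finally show ?thesis by (simp add: tr)
qed

lemma invertible_matrix_inv:
  fixes A :: "real^'n^'n"
  assumes "invertible A"
  shows "A ** matrix_inv A = mat 1" "matrix_inv A ** A = mat 1"
  using someI_ex[OF assms[unfolded invertible_def]] by (auto simp: matrix_inv_def)

lemma matrix_inv_unique:
  fixes A B :: "real^'n^'n"
  assumes "A ** B = mat 1"
  shows "matrix_inv A = B"
proof -
  have "invertible A" using assms by (auto simp: invertible_right_inverse)
  then have "matrix_inv A = matrix_inv A ** (A ** B)"
    by (simp add: assms)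
  also have "\<dots> = B"
    using \<open>invertible A\<close> by (simp add: matrix_mul_assoc invertible_matrix_inv)
  finally show ?thesis .
qed

lemma inner_matrix_vector: "(x::real^'m) \<bullet> (A *v y) = (transpose A *v x) \<bullet> y" for A :: "real^'n^'m"
  by (simp add: dot_lmul_matrix transpose_matrix_vector)

lemma pos_def_invertible:
  assumes "pos_def S"
  shows "invertible S"
proof -
  have "S *v x = 0 \<Longrightarrow> x = 0" for x
    using assms unfolding pos_def_def by (metis inner_zero_right less_irrefl)
  then show ?thesis
    by (simp add: invertible_left_inverse matrix_left_invertible_ker)
qed

lemma transpose_matrix_inv:
  fixes S :: "real^'n^'n"
  assumes "invertible S"
  shows "transpose (matrix_inv S) = matrix_inv (transpose S)"
proof -
  have "transpose S ** transpose (matrix_inv S) = mat 1"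
    by (simp add: matrix_transpose_mul[symmetric] invertible_matrix_inv assms)
  then show ?thesis by (simp add: matrix_inv_unique)
qed

lemma pos_def_congruence:
  fixes S G :: "real^'n^'n"
  assumes S: "pos_def S" and G: "invertible G"
  shows "pos_def (G ** S ** transpose G)"
  unfolding pos_def_def
proof (intro conjI allI impI)
  show "transpose (G ** S ** transpose G) = G ** S ** transpose G"
    using S by (simp add: pos_def_def matrix_transpose_mul matrix_mul_assoc)
  fix v :: "real^'n" assume "v \<noteq> 0"
  have "invertible (transpose G)" using G by (simp add: invertible_det_nz)
  then have "transpose G *v v \<noteq> 0"
    using \<open>v \<noteq> 0\<close> by (metis invertible_matrix_inv(2) matrix_vector_mul_assoc matrix_vector_mul_lid matrix_vector_mult_0_right)
  then show "0 < v \<bullet> (G ** S ** transpose G *v v)"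
    using S by (simp add: pos_def_def matrix_vector_mul_assoc[symmetric] inner_matrix_vector[of v G])
qed

text \<open>Congruence of \<open>S\<close> by its own inverse gives the inverse back, because the
  inverse is symmetric.\<close>

lemma pos_def_matrix_inv:
  fixes S :: "real^'n^'n"
  assumes S: "pos_def S"
  shows "pos_def (matrix_inv S)"
proof -
  have i: "invertible S" by (rule pos_def_invertible[OF S])
  have sym: "transpose S = S" using S by (simp add: pos_def_def)
  have "invertible (matrix_inv S)"
    using i invertible_def invertible_matrix_inv by blast
  from pos_def_congruence[OF S this] show ?thesis
    by (simp add: transpose_matrix_inv i sym invertible_matrix_inv)
qed

lemma pos_def_add_semidef:
  fixes S :: "real^'n^'n"
  assumes "pos_def S" "transpose R = R" "\<And>v. 0 \<le> v \<bullet> (R *v v)"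
  shows "pos_def (S + R)"
proof -
  have "transpose (S + R) = transpose S + transpose R" 
    by (simp add: transpose_def vec_eq_iff)
  then show ?thesis
    using assms by (auto simp: pos_def_def inner_add_right matrix_vector_mult_add_rdistrib add_pos_nonneg)
qed

lemma inner_Gram: "v \<bullet> ((C ** transpose C) *v v) = (norm (transpose C *v v))\<^sup>2"
  for C :: "real^'p^'n"
  by (simp add: matrix_vector_mul_assoc[symmetric] inner_matrix_vector power2_norm_eq_inner)

lemma pos_def_add_Gram:
  fixes S :: "real^'n^'n" and C :: "real^'p^'n"
  assumes "pos_def S" "0 \<le> d"
  shows "pos_def (S + d *\<^sub>R (C ** transpose C))"
proof (rule pos_def_add_semidef[OF assms(1)])
  show "transpose (d *\<^sub>R (C ** transpose C)) = d *\<^sub>R (C ** transpose C)"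
    by (simp add: transpose_scalar matrix_transpose_mul)
  fix v :: "real^'n"
  have "(d *\<^sub>R (C ** transpose C)) *v v = d *\<^sub>R ((C ** transpose C) *v v)"
    by (simp only: scaleR_matrix_vector_assoc)
  then show "0 \<le> v \<bullet> ((d *\<^sub>R (C ** transpose C)) *v v)"
    using assms(2) by (simp add: inner_Gram)
qed

text \<open>Gram--Schmidt with respect to the inner product defined by \<open>Q\<close>, one vector per index.\<close>

lemma pos_def_factorization:
  fixes Q :: "real^'n^'n"
  assumes Q: "pos_def Q"
  shows "\<exists>L::real^'n^'n. transpose L ** Q ** L = mat 1"
proof -
  have "\<exists>v. \<forall>i\<in>I. \<forall>j\<in>I. v i \<bullet> (Q *v v j) = (if i = j then 1 else 0)" if "finite I" for I :: "'n set"
    using that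
  proof (induction I rule: finite_induct)
    case (insert a I)
    then obtain v where v: "\<And>i j. i\<in>I \<Longrightarrow> j\<in>I \<Longrightarrow> v i \<bullet> (Q *v v j) = (if i = j then 1 else 0)" by blast
    \<comment> \<open>Fewer vectors than the dimension have been chosen, so some nonzero
      \<open>x\<close> is orthogonal to all \<open>Q *v v i\<close>. This existence by dimension
      replaces the projection step of the usual procedure.\<close>
    have "card I < CARD('n)"
      using insert.hyps by (metis UNIV_I finite psubset_card_mono psubsetI subset_UNIV)
    then have "dim ((\<lambda>i. Q *v v i) ` I) < DIM(real^'n)"
      using dim_le_card'[of "(\<lambda>i. Q *v v i) ` I"] card_image_le[of I "\<lambda>i. Q *v v i"] insert.hyps by simp
    then obtain x where x: "x \<noteq> 0" "\<And>i. i \<in> I \<Longrightarrow> x \<bullet> (Q *v v i) = 0"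
      by (rule orthogonal_to_subspace_exists) (auto simp: orthogonal_def span_base)
    have pos: "0 < x \<bullet> (Q *v x)" using Q x by (auto simp: pos_def_def)
    define y where "y = (1 / sqrt (x \<bullet> (Q *v x))) *\<^sub>R x"
    have y: "y \<bullet> (Q *v y) = 1"
      using pos by (simp add: y_def matrix_vector_mult_scaleR)
    have yv: "y \<bullet> (Q *v v i) = 0" if "i \<in> I" for i
      using x that by (simp add: y_def)
    have vy: "v i \<bullet> (Q *v y) = 0" if "i \<in> I" for i
      using yv[OF that] Q by (metis inner_commute inner_matrix_vector pos_def_def)
    show ?case
      using v y yv vy insert.hyps by (intro exI[of _ "v(a := y)"]) auto
  qed auto
  from this[of UNIV] obtain v :: "'n \<Rightarrow> real^'n"
    where v: "\<And>i j. v i \<bullet> (Q *v v j) = (if i = j then 1 else 0)" by auto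
  have "transpose (transpose (\<chi> i. v i)) ** Q ** transpose (\<chi> i. v i) = mat 1"
  proof -
    have "((\<chi> i. v i) ** (Q ** transpose (\<chi> i. v i))) $ i $ j = v i \<bullet> (Q *v v j)" for i j
      by (simp add: matrix_matrix_mult_def matrix_vector_mult_def transpose_def inner_vec_def)
    then show ?thesis by (simp add: vec_eq_iff v mat_def matrix_mul_assoc)
  qed
  then show ?thesis by blast
qed

text \<open>With the factor \<open>L\<close> of the previous lemma, the determinant of
  \<open>S\<close> times a square equals 1.\<close>

lemma pos_def_det:
  fixes S :: "real^'n^'n"
  assumes "pos_def S"
  shows "0 < det S"
proof -
  obtain L :: "real^'n^'n" where L: "transpose L ** S ** L = mat 1" using pos_def_factorization[OF assms] by blast
  have "det (transpose L ** S ** L) = 1" by (simp add: L)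
  then have "(det L)\<^sup>2 * det S = 1" by (simp add: det_mul power2_eq_square mult_ac)
  then have "0 < (det L)\<^sup>2 * det S" by simp
  then show ?thesis by (simp add: zero_less_mult_iff)
qed

section \<open>Gaussian densities\<close>

lemma measurable_matrix_vector [measurable]: "(*v) (L::real^'n^'m) \<in> borel_measurable borel"
  by (simp add: borel_measurable_continuous_onI matrix_vector_mult_linear_continuous_on)

section \<open>Linear substitution in Lebesgue integrals\<close>

lemma nn_integral_lborel_translate:
  fixes a :: "'a::euclidean_space"
  assumes [measurable]: "f \<in> borel_measurable borel"
  shows "(\<integral>\<^sup>+x. f (a + x) \<partial>lborel) = (\<integral>\<^sup>+x. f x \<partial>lborel)"
proof -
  have "(\<integral>\<^sup>+x. f x \<partial>lborel) = (\<integral>\<^sup>+x. f x \<partial>distr lborel borel ((+) a))"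
    by (simp add: lborel_distr_plus)
  then show ?thesis by (simp add: nn_integral_distr)
qed

text \<open>Uniqueness of Haar measure in miniature. The function \<open>g\<close> has integral 1,
  so the integral may be averaged against it; translation invariance and Fubini then free the
  argument of \<open>f\<close> from \<open>L\<close>, and all that remains of \<open>L\<close> is
  the constant \<open>c\<close>.\<close>

lemma nn_integral_lborel_linear_aux:
  fixes L :: "real^'n^'n"
  assumes L: "invertible L"
  shows "\<exists>c. \<forall>f\<in>borel_measurable borel. (\<integral>\<^sup>+x. f (L *v x) \<partial>lborel) = c * (\<integral>\<^sup>+x. f x \<partial>lborel)"
proof -
  define g :: "real^'n \<Rightarrow> ennreal" where "g = indicator (cbox 0 One)"
  have [measurable]: "g \<in> borel_measurable borel" by (simp add: g_def)
  have g1: "(\<integral>\<^sup>+y. g y \<partial>lborel) = 1" by (simp add: g_def)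
  have LL: "L *v (matrix_inv L *v x) = x" for x
    by (simp add: matrix_vector_mul_assoc invertible_matrix_inv L)
  define c where "c = (\<integral>\<^sup>+x. g (- (L *v x)) \<partial>lborel)"
  have "(\<integral>\<^sup>+x. f (L *v x) \<partial>lborel) = c * (\<integral>\<^sup>+x. f x \<partial>lborel)"
    if [measurable]: "f \<in> borel_measurable borel" for f :: "real^'n \<Rightarrow> ennreal"
  proof -
    \<comment> \<open>Every \<open>y\<close> lies in the range of \<open>L\<close>, so it may be
      inserted as a shift inside \<open>f\<close>.\<close>
    have tr: "(\<integral>\<^sup>+x. f (L *v x) \<partial>lborel) = (\<integral>\<^sup>+x. f (L *v x + y) \<partial>lborel)" for y
      using nn_integral_lborel_translate[of "\<lambda>x. f (L *v x)" "matrix_inv L *v y"]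
      by (simp add: matrix_vector_right_distrib LL add.commute)
    have gc: "(\<integral>\<^sup>+x. g (y - L *v x) \<partial>lborel) = c" for y
      using nn_integral_lborel_translate[of "\<lambda>x. g (y - L *v x)" "matrix_inv L *v y"]
      by (simp add: matrix_vector_right_distrib LL c_def)
    have "(\<integral>\<^sup>+x. f (L *v x) \<partial>lborel) = (\<integral>\<^sup>+y. (\<integral>\<^sup>+x. f (L *v x) \<partial>lborel) * g y \<partial>lborel)"
      by (simp add: nn_integral_cmult g1)
    also have "\<dots> = (\<integral>\<^sup>+y. (\<integral>\<^sup>+x. f (L *v x + y) * g y \<partial>lborel) \<partial>lborel)"
      by (simp add: nn_integral_multc tr[symmetric])
    also have "\<dots> = (\<integral>\<^sup>+x. (\<integral>\<^sup>+y. f (L *v x + y) * g y \<partial>lborel) \<partial>lborel)"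
      by (rule lborel_pair.Fubini') measurable
    also have "\<dots> = (\<integral>\<^sup>+x. (\<integral>\<^sup>+y. f y * g (y - L *v x) \<partial>lborel) \<partial>lborel)"
    proof (rule nn_integral_cong)
      fix x
      show "(\<integral>\<^sup>+y. f (L *v x + y) * g y \<partial>lborel) = (\<integral>\<^sup>+y. f y * g (y - L *v x) \<partial>lborel)"
        using nn_integral_lborel_translate[of "\<lambda>y. f y * g (y - L *v x)" "L *v x"] by simp
    qed
    also have "\<dots> = (\<integral>\<^sup>+y. (\<integral>\<^sup>+x. f y * g (y - L *v x) \<partial>lborel) \<partial>lborel)"
      by (rule lborel_pair.Fubini') measurable
    also have "\<dots> = c * (\<integral>\<^sup>+y. f y \<partial>lborel)"
      by (simp add: nn_integral_cmult gc nn_integral_multc mult.commute)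
    finally show ?thesis .
  qed
  then show ?thesis by blast
qed

text \<open>The library's version of this needs a well-ordered index type.  Here the factor is first obtained
  from the uniqueness of Haar measure; an involution then has factor 1, and swaps and shears are
  products of a diagonal matrix and an involution.\<close>

lemma nn_integral_lborel_linear:
  fixes L :: "real^'n^'n"
  assumes "invertible L" and "f \<in> borel_measurable borel"
  shows "(\<integral>\<^sup>+x. f x \<partial>lborel) = ennreal \<bar>det L\<bar> * (\<integral>\<^sup>+x. f (L *v x) \<partial>lborel)"
proof -
  define D where "D L \<longleftrightarrow> (\<forall>f\<in>borel_measurable borel.
      (\<integral>\<^sup>+x. f x \<partial>lborel) = ennreal \<bar>det L\<bar> * (\<integral>\<^sup>+x. f (L *v x) \<partial>lborel))" for L :: "real^'n^'n"
  have mult: "D (K ** L)" if "D K" "D L" for K L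
    unfolding D_def
  proof
    fix f :: "real^'n \<Rightarrow> ennreal" assume f: "f \<in> borel_measurable borel"
    have f': "(\<lambda>x. f (K *v x)) \<in> borel_measurable borel"
      by (rule measurable_compose[OF measurable_matrix_vector f])
    have "(\<integral>\<^sup>+x. f x \<partial>lborel) = ennreal \<bar>det K\<bar> * (ennreal \<bar>det L\<bar> * (\<integral>\<^sup>+x. f (K *v (L *v x)) \<partial>lborel))"
      using that(1)[unfolded D_def, rule_format, OF f] that(2)[unfolded D_def, rule_format, OF f'] by simp
    then show "(\<integral>\<^sup>+x. f x \<partial>lborel) = ennreal \<bar>det (K ** L)\<bar> * (\<integral>\<^sup>+x. f (K ** L *v x) \<partial>lborel)"
      by (simp add: matrix_vector_mul_assoc det_mul abs_mult ennreal_mult' mult.assoc)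
  qed
  \<comment> \<open>\<open>K\<close> scales all integrals by one factor \<open>c\<close>. Applying
    \<open>K\<close> twice gives c * c = 1, and 1 is the only such element of
    [0,\<infinity>].\<close>
  have invol: "D K" if K: "K ** K = mat 1" for K
  proof -
    have iK: "invertible K" using K by (auto simp: invertible_right_inverse)
    have "det K * det K = 1" using K by (metis det_I det_mul)
    then have dK: "\<bar>det K\<bar> = 1" by (metis abs_mult abs_one abs_square_eq_1 power2_eq_square)
    obtain c where c: "\<And>f. f \<in> borel_measurable borel \<Longrightarrow> (\<integral>\<^sup>+x. f (K *v x) \<partial>lborel) = c * (\<integral>\<^sup>+x. f x \<partial>lborel)"
      using nn_integral_lborel_linear_aux[OF iK] by blast
    define g :: "real^'n \<Rightarrow> ennreal" where "g = indicator (cbox 0 One)"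
    have g: "g \<in> borel_measurable borel" "(\<integral>\<^sup>+y. g y \<partial>lborel) = 1" by (simp_all add: g_def)
    have "(\<integral>\<^sup>+x. g (K *v (K *v x)) \<partial>lborel) = c * (c * 1)"
      using c[of "\<lambda>x. g (K *v x)"] c[of g] g by simp
    then have "c * c = 1" using g by (simp add: matrix_vector_mul_assoc K)
    then have "c = 1"
    proof (cases c)
      case (real r)
      then have "ennreal (r * r) = ennreal 1" using \<open>c * c = 1\<close>
        by (simp add: ennreal_mult')
      then have "r * r = 1" using real by (subst (asm) ennreal_inj) auto
      then show ?thesis using real by (metis abs_of_nonneg abs_square_eq_1 ennreal_1 power2_eq_square)
    qed simp
    then show ?thesis using c by (simp add: D_def dK)
  qed
  \<comment> \<open>The affine change of variables for Lebesgue measure takes one factor per basis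
    vector; \<open>c\<close> reads that factor off the diagonal.\<close>
  have diag: "D A" if A: "\<And>i j. i \<noteq> j \<Longrightarrow> A$i$j = 0" "det A \<noteq> 0" for A :: "real^'n^'n"
    unfolding D_def
  proof
    fix f :: "real^'n \<Rightarrow> ennreal" assume [measurable]: "f \<in> borel_measurable borel"
    define c :: "real^'n \<Rightarrow> real" where "c b = b \<bullet> (A *v b)" for b
    have cax: "c (axis i 1) = A $ i $ i" for i
      by (simp add: c_def inner_axis' matrix_vector_mul_component inner_axis)
    have dA: "det A = (\<Prod>i\<in>UNIV. A $ i $ i)" using A(1) by (rule det_diagonal)
    have B: "(Basis :: (real^'n) set) = (\<lambda>i. axis i 1) ` UNIV" by (auto simp: Basis_vec_def)
    have inj: "inj (\<lambda>i::'n. axis i (1::real))" by (auto simp: inj_on_def axis_eq_axis)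
    have nz: "A $ i $ i \<noteq> 0" for i using A(2) by (simp add: dA)
    have lin: "(\<Sum>j\<in>Basis. (c j * (x \<bullet> j)) *\<^sub>R j) = A *v x" for x :: "real^'n"
    proof -
      have "(A *v x) $ i = A $ i $ i * x $ i" for i
      proof -
        have "(A *v x) $ i = (\<Sum>j\<in>{i}. A $ i $ j * x $ j)"
          unfolding matrix_vector_mult_def vec_lambda_beta
          by (rule sum.mono_neutral_right) (auto simp: A(1))
        then show ?thesis by simp
      qed
      then show ?thesis
        unfolding B by (subst sum.reindex[OF inj])
          (simp add: vec_eq_iff cax inner_axis axis_def inner_vec_def cax[unfolded axis_def] if_distrib cong: if_cong)
    qed
    have pr: "(\<Prod>j\<in>(Basis::(real^'n) set). \<bar>c j\<bar>) = \<bar>det A\<bar>"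
      unfolding B by (subst prod.reindex[OF inj]) (simp add: cax dA abs_prod)
    have "lborel = density (distr lborel borel (\<lambda>x. 0 + (\<Sum>j\<in>Basis. (c j * (x \<bullet> j)) *\<^sub>R j))) (\<lambda>_. ennreal (\<Prod>j\<in>(Basis::(real^'n) set). \<bar>c j\<bar>))"
      by (rule lborel_affine_euclidean) (auto simp: B cax nz)
    then have *: "lborel = density (distr lborel borel ((*v) A)) (\<lambda>_. ennreal \<bar>det A\<bar>)"
      by (simp add: lin pr)
    show "(\<integral>\<^sup>+x. f x \<partial>lborel) = ennreal \<bar>det A\<bar> * (\<integral>\<^sup>+x. f (A *v x) \<partial>lborel)"
      by (subst *) (simp add: nn_integral_density nn_integral_distr nn_integral_cmult)
  qed
  have "det L \<noteq> 0 \<longrightarrow> D L"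
  proof (rule induct_matrix_elementary_alt)
    fix A B :: "real^'n^'n" assume "det A \<noteq> 0 \<longrightarrow> D A" "det B \<noteq> 0 \<longrightarrow> D B"
    then show "det (A ** B) \<noteq> 0 \<longrightarrow> D (A ** B)" using mult by (simp add: det_mul)
  next
    fix A :: "real^'n^'n" and i assume "row i A = 0" then show "det A \<noteq> 0 \<longrightarrow> D A"
      by (simp add: det_zero_row)
  next
    fix A :: "real^'n^'n" assume "\<And>i j. i \<noteq> j \<Longrightarrow> A $ i $ j = 0"
    then show "det A \<noteq> 0 \<longrightarrow> D A" using diag by blast
  next
    fix m n :: 'n assume "m \<noteq> n"
    have "(\<chi> i j. mat 1 $ i $ Transposition.transpose m n j) ** (\<chi> i j. mat 1 $ i $ Transposition.transpose m n j) = (mat 1 :: real^'n^'n)"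
      by (auto simp: vec_eq_iff matrix_matrix_mult_def mat_def if_distrib[of "\<lambda>x. x * _"] if_distrib[of "\<lambda>x. _ * x"]
          Transposition.transpose_def cong: if_cong)
    then show "det ((\<chi> i j. mat 1 $ i $ Transposition.transpose m n j)::real^'n^'n) \<noteq> 0 \<longrightarrow>
        D (\<chi> i j. mat 1 $ i $ Transposition.transpose m n j)"
      using invol by blast
  next
    fix m n :: 'n assume mn: "m \<noteq> n"
    define E :: "real^'n^'n" where "E = (\<chi> i j. of_bool (i = m \<and> j = n \<or> i = j))"
    \<comment> \<open>\<open>S\<close> reflects coordinate m. Then \<open>S ** E\<close> sends x_m
      to -x_m - x_n and fixes the other coordinates, which is an involution because n differs from
      m. The shear is recovered as \<open>S ** (S ** E)\<close>.\<close>
    define S :: "real^'n^'n" where "S = (\<chi> i j. if i = j then if i = m then -1 else 1 else 0)"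
    have S2: "S ** S = mat 1"
      by (auto simp: vec_eq_iff matrix_matrix_mult_def mat_def S_def if_distrib[of "\<lambda>x. x * _"] if_distrib[of "\<lambda>x. _ * x"]  cong: if_cong)
    have SE: "S ** E = (\<chi> i j. if i = m then - E $ m $ j else E $ i $ j)"
      by (auto simp: vec_eq_iff matrix_matrix_mult_def S_def if_distrib[of "\<lambda>x. x * _"] if_distrib[of "\<lambda>x. _ * x"]  cong: if_cong)
    have SEv: "(S ** E) *v x = (\<chi> i. if i = m then - x $ m - x $ n else x $ i)" for x
    proof -
      have "(\<Sum>j\<in>UNIV. of_bool (i = m \<and> j = n \<or> i = j) * x $ j) = (\<Sum>j\<in>UNIV. (if j = i then x $ j else 0) + (if i = m \<and> j = n then x $ j else 0))" for i
        using mn by (intro sum.cong) auto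
      also have "\<dots> i = x $ i + (if i = m then x $ n else 0)" for i
        by (subst sum.distrib) (cases "i = m"; simp)
      finally have *: "(\<Sum>j\<in>UNIV. of_bool (i = m \<and> j = n \<or> i = j) * x $ j) = x $ i + (if i = m then x $ n else 0)" for i .
      have **: "E *v x = (\<chi> i. x $ i + (if i = m then x $ n else 0))"
        by (simp only: E_def matrix_vector_mult_def vec_lambda_beta *)
      show ?thesis
        unfolding matrix_vector_mul_assoc[symmetric] **
        by (auto simp: S_def matrix_vector_mult_def vec_eq_iff if_distrib[of "\<lambda>x. x * _"] cong: if_cong)
    qed
    have "(S ** E) ** (S ** E) = mat 1"
      unfolding matrix_eq
      by (subst matrix_vector_mul_assoc[symmetric]) (use mn in \<open>auto simp: SEv vec_eq_iff\<close>)
    then have "D (S ** (S ** E))" using invol S2 mult by blast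
    then have "D E" by (simp add: matrix_mul_assoc S2)
    then show "det ((\<chi> i j. of_bool (i = m \<and> j = n \<or> i = j))::real^'n^'n) \<noteq> 0 \<longrightarrow>
       D (\<chi> i j. of_bool (i = m \<and> j = n \<or> i = j))"
      by (simp add: E_def)
  qed
  moreover have "det L \<noteq> 0" using assms(1) invertible_det_nz by blast
  ultimately have "D L" by blast
  then show ?thesis using assms(2) unfolding D_def by blast
qed

text \<open>The integrand factors over the coordinates, which reduces the claim to the
  one-dimensional normal density.\<close>

lemma nn_integral_standard_gaussian:
  "(\<integral>\<^sup>+x. ennreal (exp (- (1/2) * (x \<bullet> x))) \<partial>(lborel :: (real^'n) measure))
     = ennreal ((2 * pi) powr (real CARD('n) / 2))"
proof -
  have "(\<integral>\<^sup>+x. ennreal (exp (- (1/2) * (x \<bullet> x))) \<partial>(lborel :: (real^'n) measure))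
      = (\<integral>\<^sup>+x. (\<Prod>b\<in>Basis. ennreal (sqrt (2*pi) * normal_density 0 1 (x \<bullet> b))) \<partial>(lborel :: (real^'n) measure))"
  proof (rule nn_integral_cong)
    fix x :: "real^'n"
    have "exp (- (1/2) * (x \<bullet> x)) = exp (\<Sum>b\<in>Basis. - (x \<bullet> b)\<^sup>2 / 2)"
      by (subst euclidean_inner) (simp add: sum_negf sum_divide_distrib power2_eq_square)
    also have "\<dots> = (\<Prod>b\<in>Basis. exp (- (x \<bullet> b)\<^sup>2 / 2))"
      by (simp add: exp_sum)
    also have "\<dots> = (\<Prod>b\<in>Basis. sqrt (2*pi) * normal_density 0 1 (x \<bullet> b))"
      by (simp add: normal_density_def)
    finally show "ennreal (exp (- (1/2) * (x \<bullet> x))) = (\<Prod>b\<in>Basis. ennreal (sqrt (2*pi) * normal_density 0 1 (x \<bullet> b)))"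
      by (simp add: prod_ennreal)
  qed
  also have "\<dots> = (\<Prod>b\<in>(Basis::(real^'n) set). (\<integral>\<^sup>+x. ennreal (sqrt (2*pi) * normal_density 0 1 x) \<partial>lborel))"
    by (rule nn_integral_lborel_prod) auto
  also have "(\<integral>\<^sup>+x. ennreal (sqrt (2*pi) * normal_density 0 1 x) \<partial>lborel) = ennreal (sqrt (2*pi))"
  proof -
    have "(\<integral>\<^sup>+x. ennreal (sqrt (2*pi) * normal_density 0 1 x) \<partial>lborel)
        = ennreal (sqrt (2*pi)) * (\<integral>\<^sup>+x. ennreal (normal_density 0 1 x) \<partial>lborel)"
      by (subst nn_integral_cmult[symmetric]) (auto simp: ennreal_mult')
    also have "(\<integral>\<^sup>+x. ennreal (normal_density 0 1 x) \<partial>lborel) = 1"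
      by (subst nn_integral_eq_integral) (auto simp: integrable_normal_density integral_normal_density)
    finally show ?thesis by simp
  qed
  also have "(\<Prod>b\<in>(Basis::(real^'n) set). ennreal (sqrt (2*pi))) = ennreal ((2 * pi) powr (real CARD('n) / 2))"
    by (simp add: ennreal_power powr_half_sqrt[symmetric] powr_realpow[symmetric] powr_powr)
  finally show ?thesis .
qed

text \<open>Substituting \<open>L *v x\<close> with \<open>transpose L ** Q ** L = mat 1\<close>
  makes the form standard. The Jacobian of \<open>L\<close> is the power -1/2 of the determinant of
  \<open>Q\<close>, which plays the part of an inverse covariance.\<close>

lemma nn_integral_gaussian:
  fixes Q :: "real^'n^'n"
  assumes Q: "pos_def Q"
  shows "(\<integral>\<^sup>+x. ennreal (exp (- (1/2) * (x \<bullet> (Q *v x)))) \<partial>lborel)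
     = ennreal ((2 * pi) powr (real CARD('n) / 2) * det Q powr (- 1/2))"
proof -
  obtain L :: "real^'n^'n" where L: "transpose L ** Q ** L = mat 1" using pos_def_factorization[OF Q] by blast
  have quad: "(L *v x) \<bullet> (Q *v (L *v x)) = x \<bullet> x" for x
  proof -
    have "(L *v x) \<bullet> (Q *v (L *v x)) = x \<bullet> ((transpose L ** Q ** L) *v x)"
      by (simp add: matrix_vector_mul_assoc[symmetric] inner_matrix_vector[of x])
    then show ?thesis by (simp add: L)
  qed
  from L have iL: "invertible L" unfolding invertible_left_inverse by blast
  have "det (transpose L ** Q ** L) = 1" by (simp add: L)
  then have "(det L)\<^sup>2 * det Q = 1" by (simp add: det_mul power2_eq_square mult_ac)
  then have dQ: "det Q = inverse ((det L)\<^sup>2)"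
    by (metis inverse_unique mult.commute)
  have nz: "det L \<noteq> 0" using iL by (simp add: invertible_det_nz)
  have d: "det Q powr (- 1/2) = \<bar>det L\<bar>"
    using nz by (simp add: dQ powr_minus powr_half_sqrt real_sqrt_inverse inverse_powr)
  have "(\<integral>\<^sup>+x. ennreal (exp (- (1/2) * (x \<bullet> (Q *v x)))) \<partial>lborel)
      = ennreal \<bar>det L\<bar> * (\<integral>\<^sup>+x. ennreal (exp (- (1/2) * ((L *v x) \<bullet> (Q *v (L *v x))))) \<partial>lborel)"
    by (rule nn_integral_lborel_linear[OF iL])
       measurable
  then show ?thesis
    by (simp add: quad nn_integral_standard_gaussian[simplified] d[simplified] ennreal_mult' mult.commute)
qed

section \<open>Gaussian laws under linear maps and independent sums\<close>

lemma borel_measurable_gaussian_density [measurable]: "gaussian_density S \<in> borel_measurable borel"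
  unfolding gaussian_density_def by measurable

lemma gaussian_density_nonneg [simp]: "0 \<le> gaussian_density S x"
  by (simp add: gaussian_density_def)

lemma det_matrix_inv:
  fixes S :: "real^'n^'n"
  assumes "invertible S"
  shows "det (matrix_inv S) = inverse (det S)"
proof -
  have "det S * det (matrix_inv S) = 1"
    by (simp add: det_mul[symmetric] invertible_matrix_inv assms)
  then show ?thesis by (simp add: inverse_unique)
qed

lemma nn_integral_gaussian_density:
  fixes S :: "real^'n^'n"
  assumes S: "pos_def S"
  shows "(\<integral>\<^sup>+x. ennreal (gaussian_density S x) \<partial>lborel) = 1"
proof -
  note i = pos_def_invertible[OF S]
  have "(\<integral>\<^sup>+x. ennreal (gaussian_density S x) \<partial>lborel)
     = ennreal ((2 * pi) powr (- real CARD('n) / 2) * det S powr (- 1 / 2)) *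
       (\<integral>\<^sup>+x. ennreal (exp (- (1/2) * (x \<bullet> (matrix_inv S *v x)))) \<partial>lborel)"
    unfolding gaussian_density_def
    by (subst nn_integral_cmult[symmetric])
       (auto simp: ennreal_mult'[symmetric])
  also have "\<dots> = ennreal ((2 * pi) powr (- real CARD('n) / 2) * det S powr (- 1 / 2) *
      ((2 * pi) powr (real CARD('n) / 2) * inverse (det S) powr (- 1/2)))"
    by (subst nn_integral_gaussian[OF pos_def_matrix_inv[OF S]]) (simp add: ennreal_mult' det_matrix_inv i)
  also have "(2 * pi) powr (- real CARD('n) / 2) * det S powr (- 1 / 2) *
      ((2 * pi) powr (real CARD('n) / 2) * inverse (det S) powr (- 1/2)) = 1"
    using pos_def_det[OF S] 
    by (simp add: powr_minus inverse_powr) (simp add: powr_def field_simps)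
  finally show ?thesis by simp
qed

text \<open>The inverse of a congruence is a congruence of the inverse; \<open>K\<close> is the
  transposed inverse of \<open>G\<close>.\<close>

lemma inner_matrix_inv_congruence:
  fixes S G :: "real^'n^'n"
  assumes "invertible G" "invertible S"
  shows "(G *v x) \<bullet> (matrix_inv (G ** S ** transpose G) *v (G *v x)) = x \<bullet> (matrix_inv S *v x)"
proof -
  define K where "K = transpose (matrix_inv G)"
  have K: "K ** transpose G = mat 1" "transpose G ** K = mat 1"
    unfolding K_def by (simp_all add: matrix_transpose_mul[symmetric] invertible_matrix_inv assms)
  have "(G ** S ** transpose G) ** (K ** matrix_inv S ** matrix_inv G)
      = G ** S ** (transpose G ** K) ** matrix_inv S ** matrix_inv G"
    by (simp only: matrix_mul_assoc)
  also have "\<dots> = G ** (S ** matrix_inv S) ** matrix_inv G"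
    by (simp only: K matrix_mul_rid matrix_mul_assoc)
  finally have "(G ** S ** transpose G) ** (K ** matrix_inv S ** matrix_inv G) = mat 1"
    by (simp add: invertible_matrix_inv assms)
  then have "matrix_inv (G ** S ** transpose G) = K ** matrix_inv S ** matrix_inv G"
    by (rule matrix_inv_unique)
  then have "(G *v x) \<bullet> (matrix_inv (G ** S ** transpose G) *v (G *v x))
      = (G *v x) \<bullet> (K *v (matrix_inv S *v ((matrix_inv G ** G) *v x)))"
    by (simp only: matrix_vector_mul_assoc[symmetric])
  also have "\<dots> = (transpose K *v (G *v x)) \<bullet> (matrix_inv S *v x)"
    by (simp add: invertible_matrix_inv assms inner_matrix_vector[of _ K])
  also have "transpose K *v (G *v x) = x"
    by (simp add: K_def matrix_vector_mul_assoc invertible_matrix_inv assms)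
  finally show ?thesis .
qed

text \<open>In the change of variables the Jacobian is absorbed exactly by the normalizing factor,
  since the new covariance has determinant det(G)^2 det(S).\<close>

lemma distributed_gaussian_linear:
  fixes S G :: "real^'n^'n"
  assumes X: "distributed M lborel X (gaussian_density S)" and S: "pos_def S" and G: "invertible G"
  shows "distributed M lborel (\<lambda>\<omega>. G *v X \<omega>) (gaussian_density (G ** S ** transpose G))"
proof -
  have [measurable]: "X \<in> borel_measurable M" using X by (auto simp: distributed_def)
  note iS = pos_def_invertible[OF S]
  have dG: "det G \<noteq> 0" using G invertible_det_nz by blast
  have dS: "0 < det S" by (rule pos_def_det[OF S])
  have c: "\<bar>det G\<bar> * det (G ** S ** transpose G) powr (-1/2) = det S powr (-1/2)"
  proof -
    have "det (G ** S ** transpose G) = \<bar>det G\<bar>\<^sup>2 * det S"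
      by (simp add: det_mul power2_eq_square mult_ac)
    moreover have "(\<bar>det G\<bar>\<^sup>2) powr (-1/2) = inverse \<bar>det G\<bar>"
      using dG by (simp add: powr_realpow[symmetric] powr_powr powr_minus)
    ultimately show ?thesis using dG dS by (simp add: powr_mult)
  qed
  have eq: "\<bar>det G\<bar> * gaussian_density (G ** S ** transpose G) (G *v x) = gaussian_density S x" for x
    unfolding gaussian_density_def inner_matrix_inv_congruence[OF G iS] c[symmetric]
    by simp
  have "distr M lborel (\<lambda>\<omega>. G *v X \<omega>) = density lborel (gaussian_density (G ** S ** transpose G))"
  proof (rule measure_eqI)
    fix E assume "E \<in> sets (distr M lborel (\<lambda>\<omega>. G *v X \<omega>))"
    then have [measurable]: "E \<in> sets borel" by simp
    have "emeasure (distr M lborel (\<lambda>\<omega>. G *v X \<omega>)) E = (\<integral>\<^sup>+\<omega>. indicator E (G *v X \<omega>) \<partial>M)"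
      by (subst nn_integral_indicator[symmetric], simp, subst nn_integral_distr) simp_all
    also have "\<dots> = (\<integral>\<^sup>+x. ennreal (gaussian_density S x) * indicator E (G *v x) \<partial>lborel)"
      by (rule distributed_nn_integral[OF X, symmetric]) simp
    also have "\<dots> = ennreal \<bar>det G\<bar> * (\<integral>\<^sup>+x. ennreal (gaussian_density (G ** S ** transpose G) (G *v x)) * indicator E (G *v x) \<partial>lborel)"
      by (subst nn_integral_cmult[symmetric])
         (simp_all add: eq[symmetric] ennreal_mult' mult.assoc)
    also have "\<dots> = (\<integral>\<^sup>+x. ennreal (gaussian_density (G ** S ** transpose G) x) * indicator E x \<partial>lborel)"
      by (rule nn_integral_lborel_linear[OF G, symmetric]) simp
    also have "\<dots> = emeasure (density lborel (gaussian_density (G ** S ** transpose G))) E"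
      by (simp add: emeasure_density)
    finally show "emeasure (distr M lborel (\<lambda>\<omega>. G *v X \<omega>)) E = emeasure (density lborel (gaussian_density (G ** S ** transpose G))) E" .
  qed simp
  then show ?thesis by (simp add: distributed_def)
qed

text \<open>The Woodbury identity. In probabilistic terms \<open>N\<close> is the inverse covariance
  of Y given X + C Y, for independent Gaussian X and Y with covariances \<open>S\<close> and
  \<open>d *\<^sub>R mat 1\<close>.\<close>

lemma matrix_inv_add_Gram:
  fixes S :: "real^'n^'n" and C :: "real^'p^'n"
  assumes S: "pos_def S" and d: "0 < d"
  defines "N \<equiv> transpose C ** matrix_inv S ** C + (1 / d) *\<^sub>R mat 1"
  shows "pos_def N"
    and "matrix_inv (S + d *\<^sub>R (C ** transpose C))
      = matrix_inv S - matrix_inv S ** C ** matrix_inv N ** transpose C ** matrix_inv S"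
proof -
  let ?S = "matrix_inv S"
  have iS: "S ** ?S = mat 1" by (simp add: invertible_matrix_inv pos_def_invertible[OF S])
  have pS: "pos_def ?S" by (rule pos_def_matrix_inv[OF S])
  have sS: "transpose ?S = ?S" using pS by (simp add: pos_def_def)
  have pI: "pos_def ((1 / d) *\<^sub>R (mat 1 :: real^'p^'p))"
    using d by (simp add: pos_def_def transpose_scalar scaleR_matrix_vector_assoc[symmetric])
  have "pos_def ((1 / d) *\<^sub>R (mat 1 :: real^'p^'p) + transpose C ** ?S ** C)"
  proof (rule pos_def_add_semidef[OF pI])
    show "transpose (transpose C ** ?S ** C) = transpose C ** ?S ** C"
      by (simp add: matrix_transpose_mul sS matrix_mul_assoc)
    fix v :: "real^'p"
    have "v \<bullet> ((transpose C ** ?S ** C) *v v) = (C *v v) \<bullet> (?S *v (C *v v))"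
      by (simp add: matrix_vector_mul_assoc[symmetric] inner_matrix_vector[of v])
    then show "0 \<le> v \<bullet> ((transpose C ** ?S ** C) *v v)"
      using pS unfolding pos_def_def by (metis inner_zero_left less_eq_real_def)
  qed
  then show pN: "pos_def N" by (simp add: N_def add.commute)
  let ?N = "matrix_inv N"
  have iN: "N ** ?N = mat 1" by (simp add: invertible_matrix_inv pos_def_invertible[OF pN])
  \<comment> \<open>This expands d N N^-1 = d, and collapses the terms of the product below in which
    \<open>d\<close> occurs.\<close>
  have 1: "d *\<^sub>R ((transpose C ** ?S ** C) ** ?N) + ?N = d *\<^sub>R mat 1"
  proof -
    have "d *\<^sub>R (N ** ?N) = d *\<^sub>R ((transpose C ** ?S ** C) ** ?N) + ?N"
      unfolding N_def using d
      by (simp add: bounded_bilinear.add_left[OF bounded_bilinear_matrix_mult] 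
         bounded_bilinear.scaleR_left[OF bounded_bilinear_matrix_mult] scaleR_add_right)
    then show ?thesis by (simp add: iN)
  qed
  let ?X = "transpose C ** ?S"
  have "(S + d *\<^sub>R (C ** transpose C)) ** (?S - ?S ** C ** ?N ** transpose C ** ?S)
     = S ** ?S - (S ** ?S) ** (C ** ?N ** ?X) + (C ** (d *\<^sub>R mat 1) ** ?X
       - C ** (d *\<^sub>R ((transpose C ** ?S ** C) ** ?N)) ** ?X)"
    by (simp add: bounded_bilinear.add_left[OF bounded_bilinear_matrix_mult] 
        bounded_bilinear.diff_right[OF bounded_bilinear_matrix_mult]
        bounded_bilinear.scaleR_right[OF bounded_bilinear_matrix_mult]
         bounded_bilinear.scaleR_left[OF bounded_bilinear_matrix_mult] matrix_mul_assoc)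
  also have "C ** (d *\<^sub>R mat 1) ** ?X - C ** (d *\<^sub>R ((transpose C ** ?S ** C) ** ?N)) ** ?X
      = C ** ?N ** ?X"
    unfolding 1[symmetric]
    by (simp add: bounded_bilinear.add_left[OF bounded_bilinear_matrix_mult] 
        bounded_bilinear.add_right[OF bounded_bilinear_matrix_mult])
  finally have "(S + d *\<^sub>R (C ** transpose C)) ** (?S - ?S ** C ** ?N ** transpose C ** ?S) = mat 1"
    by (simp add: iS)
  then show "matrix_inv (S + d *\<^sub>R (C ** transpose C)) = ?S - ?S ** C ** ?N ** transpose C ** ?S"
    by (rule matrix_inv_unique)
qed


lemma matrix_inv_scaleR_mat:
  assumes "d \<noteq> 0"
  shows "matrix_inv (d *\<^sub>R (mat 1 :: real^'n^'n)) = (1 / d) *\<^sub>R mat 1"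
  using assms
  by (intro matrix_inv_unique)
     (simp add: bounded_bilinear.scaleR_left[OF bounded_bilinear_matrix_mult]
         bounded_bilinear.scaleR_right[OF bounded_bilinear_matrix_mult])

text \<open>The left side comes from the exponent of the joint density of independent X and Y at X =
  z - C y, Y = y. Completing the square in \<open>y\<close> separates the marginal law of z = X + C
  Y from the conditional law of Y, whose mean is the vector subtracted from
  \<open>y\<close>.\<close>

lemma gaussian_density_completed_square:
  fixes S :: "real^'n^'n" and C :: "real^'p^'n"
  assumes S: "pos_def S" and d: "0 < d"
  defines "N \<equiv> transpose C ** matrix_inv S ** C + (1 / d) *\<^sub>R mat 1"
  shows "(z - C *v y) \<bullet> (matrix_inv S *v (z - C *v y)) + y \<bullet> (matrix_inv (d *\<^sub>R mat 1) *v y)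
    = z \<bullet> (matrix_inv (S + d *\<^sub>R (C ** transpose C)) *v z)
     + (y - matrix_inv N *v (transpose C *v (matrix_inv S *v z)))
         \<bullet> (N *v (y - matrix_inv N *v (transpose C *v (matrix_inv S *v z))))"
proof -
  have pN: "pos_def N" and inv: "matrix_inv (S + d *\<^sub>R (C ** transpose C))
      = matrix_inv S - matrix_inv S ** C ** matrix_inv N ** transpose C ** matrix_inv S"
    unfolding N_def by (rule matrix_inv_add_Gram[OF S d])+
  define q where "q = matrix_inv S *v z"
  define r where "r = transpose C *v q"
  define m where "m = matrix_inv N *v r"
  have sym: "u \<bullet> (matrix_inv S *v v) = (matrix_inv S *v u) \<bullet> v" for u v
    using pos_def_matrix_inv[OF S] by (metis inner_matrix_vector pos_def_def)
  have symN: "u \<bullet> (N *v v) = (N *v u) \<bullet> v" for u v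
    using pN by (metis inner_matrix_vector pos_def_def)
  have adj: "u \<bullet> (C *v v) = (transpose C *v u) \<bullet> v" for u v by (rule inner_matrix_vector)
  have Nm: "N *v m = r"
    by (simp add: m_def matrix_vector_mul_assoc invertible_matrix_inv pos_def_invertible[OF pN])
  have yNy: "y \<bullet> (N *v y) = (C *v y) \<bullet> (matrix_inv S *v (C *v y)) + (1/d) * (y \<bullet> y)"
    unfolding N_def
    by (simp add: matrix_vector_mult_add_rdistrib inner_add_right scaleR_matrix_vector_assoc[symmetric]
       matrix_vector_mul_assoc[symmetric] inner_matrix_vector[of y "transpose C"])
  have L: "(z - C *v y) \<bullet> (matrix_inv S *v (z - C *v y)) + y \<bullet> (matrix_inv (d *\<^sub>R mat 1) *v y)
     = z \<bullet> q - 2 * (r \<bullet> y) + y \<bullet> (N *v y)"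
  proof -
    have "(C *v y) \<bullet> q = r \<bullet> y" by (metis adj inner_commute r_def)
    moreover have "z \<bullet> (matrix_inv S *v (C *v y)) = r \<bullet> y"
      by (simp add: sym q_def[symmetric] r_def adj)
    moreover have "y \<bullet> (matrix_inv (d *\<^sub>R mat 1) *v y) = (1/d) * (y \<bullet> y)"
      using d by (simp add: matrix_inv_scaleR_mat scaleR_matrix_vector_assoc[symmetric])
    ultimately show ?thesis
      by (simp add: yNy matrix_vector_mult_diff_distrib inner_diff_left inner_diff_right q_def[symmetric])
  qed
  have "(y - m) \<bullet> (N *v (y - m)) = y \<bullet> (N *v y) - 2 * (r \<bullet> y) + m \<bullet> r"
    using symN[of m y] 
    by (simp add: matrix_vector_mult_diff_distrib inner_diff_left inner_diff_right Nm inner_commute)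
  moreover have "z \<bullet> (matrix_inv (S + d *\<^sub>R (C ** transpose C)) *v z) = z \<bullet> q - m \<bullet> r"
  proof -
    have "z \<bullet> ((matrix_inv S ** C ** matrix_inv N ** transpose C ** matrix_inv S) *v z)
       = z \<bullet> (matrix_inv S *v (C *v m))"
      by (simp only: matrix_vector_mul_assoc[symmetric] m_def r_def q_def)
    also have "\<dots> = r \<bullet> m" by (simp add: sym q_def[symmetric] r_def adj)
    finally show ?thesis
      unfolding inv matrix_vector_mult_diff_rdistrib inner_diff_right q_def[symmetric]
      by (simp add: inner_commute)
  qed
  ultimately show ?thesis unfolding L by (simp add: m_def r_def q_def)
qed

text \<open>Product probabilities on rectangles determine the joint law.\<close>

lemma (in prob_space) distr_pair_indep:
  assumes X[measurable]: "X \<in> measurable M S" and Y[measurable]: "Y \<in> measurable M T"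
    and ind: "\<And>D E. D \<in> sets S \<Longrightarrow> E \<in> sets T \<Longrightarrow>
       prob ((X -` D \<inter> space M) \<inter> (Y -` E \<inter> space M)) = prob (X -` D \<inter> space M) * prob (Y -` E \<inter> space M)"
  shows "distr M S X \<Otimes>\<^sub>M distr M T Y = distr M (S \<Otimes>\<^sub>M T) (\<lambda>\<omega>. (X \<omega>, Y \<omega>))"
proof (rule pair_measure_eqI)
  interpret D1: prob_space "distr M S X" by (rule prob_space_distr) simp
  interpret D2: prob_space "distr M T Y" by (rule prob_space_distr) simp
  show "sigma_finite_measure (distr M S X)" "sigma_finite_measure (distr M T Y)"
    by unfold_locales
  show "sets (distr M S X \<Otimes>\<^sub>M distr M T Y) = sets (distr M (S \<Otimes>\<^sub>M T) (\<lambda>\<omega>. (X \<omega>, Y \<omega>)))"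
    by (simp cong: sets_pair_measure_cong)
  fix D E assume "D \<in> sets (distr M S X)" "E \<in> sets (distr M T Y)"
  then have DE[measurable]: "D \<in> sets S" "E \<in> sets T" by auto
  have "(\<lambda>\<omega>. (X \<omega>, Y \<omega>)) -` (D \<times> E) \<inter> space M = (X -` D \<inter> space M) \<inter> (Y -` E \<inter> space M)" by auto
  then show "emeasure (distr M S X) D * emeasure (distr M T Y) E = emeasure (distr M (S \<Otimes>\<^sub>M T) (\<lambda>\<omega>. (X \<omega>, Y \<omega>))) (D \<times> E)"
    using ind[OF DE] by (simp add: emeasure_distr emeasure_eq_measure ennreal_mult'[symmetric])
qed

text \<open>The matrix \<open>C\<close> may be singular or not square, so \<open>C *v Y\<close> need
  not have a density and two densities cannot simply be convolved. Instead the joint density of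
  \<open>X\<close> and \<open>Y\<close> is integrated over \<open>y\<close> after completing the
  square; by translation invariance the inner Gaussian integral is the same for every z.\<close>

lemma distributed_gaussian_add:
  fixes S :: "real^'n^'n" and C :: "real^'p^'n"
    and X :: "'w \<Rightarrow> real^'n" and Y :: "'w \<Rightarrow> real^'p"
  assumes "prob_space M"
    and X: "distributed M lborel X (gaussian_density S)" and S: "pos_def S"
    and Y: "distributed M lborel Y (gaussian_density (d *\<^sub>R mat 1))" and d: "0 < d"
    and ind: "\<And>D E. D \<in> sets borel \<Longrightarrow> E \<in> sets borel \<Longrightarrow>
       measure M ((X -` D \<inter> space M) \<inter> (Y -` E \<inter> space M))
         = measure M (X -` D \<inter> space M) * measure M (Y -` E \<inter> space M)"
  shows "distributed M lborel (\<lambda>\<omega>. X \<omega> + C *v Y \<omega>) (gaussian_density (S + d *\<^sub>R (C ** transpose C)))"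
proof -
  interpret prob_space M by fact
  have [measurable]: "X \<in> borel_measurable M" "Y \<in> borel_measurable M"
    using X Y by (auto simp: distributed_def)
  define R where "R = S + d *\<^sub>R (C ** transpose C)"
  have pR: "pos_def R" unfolding R_def using S d by (intro pos_def_add_Gram) auto
  define N where "N = transpose C ** matrix_inv S ** C + (1 / d) *\<^sub>R mat 1"
  have pN: "pos_def N" unfolding N_def by (rule matrix_inv_add_Gram(1)[OF S d])
  define m where "m z = matrix_inv N *v (transpose C *v (matrix_inv S *v z))" for z
  define k where "k = ((2 * pi) powr (- real CARD('n) / 2) * det S powr (- 1 / 2)) *
      ((2 * pi) powr (- real CARD('p) / 2) * det (d *\<^sub>R (mat 1 :: real^'p^'p)) powr (- 1 / 2))"
  define kR where "kR = (2 * pi) powr (- real CARD('n) / 2) * det R powr (- 1 / 2)"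
  have kR: "0 < kR" using pos_def_det[OF pR] by (simp add: kR_def)
  have pt: "gaussian_density S (z - C *v y) * gaussian_density (d *\<^sub>R mat 1) y
      = (k / kR) * gaussian_density R z * exp (- (1/2) * ((- m z + y) \<bullet> (N *v (- m z + y))))" for z y
  proof -
    have "gaussian_density S (z - C *v y) * gaussian_density (d *\<^sub>R mat 1) y
      = k * exp (- (1/2) * ((z - C *v y) \<bullet> (matrix_inv S *v (z - C *v y)) + y \<bullet> (matrix_inv (d *\<^sub>R mat 1) *v y)))"
      by (simp add: gaussian_density_def k_def exp_add[symmetric] distrib_left)
    also have "\<dots> = k * exp (- (1/2) * (z \<bullet> (matrix_inv R *v z))) * exp (- (1/2) * ((- m z + y) \<bullet> (N *v (- m z + y))))"
      unfolding gaussian_density_completed_square[OF S d] R_def[symmetric] N_def[symmetric] m_def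
      by (simp add: exp_add[symmetric] distrib_left)
    moreover have "gaussian_density R z = kR * exp (- (1/2) * (z \<bullet> (matrix_inv R *v z)))"
      by (simp only: gaussian_density_def kR_def)
    ultimately show ?thesis using kR by simp
  qed
  define c where "c = ennreal (k / kR) * (\<integral>\<^sup>+y. ennreal (exp (- (1/2) * (y \<bullet> (N *v y)))) \<partial>lborel)"
  have k0: "0 \<le> k / kR" using kR by (simp add: k_def)
  have inner: "(\<integral>\<^sup>+y. ennreal (gaussian_density S (z - C *v y)) * ennreal (gaussian_density (d *\<^sub>R mat 1) y) \<partial>lborel)
      = c * ennreal (gaussian_density R z)" for z
  proof -
    have "(\<integral>\<^sup>+y. ennreal (gaussian_density S (z - C *v y)) * ennreal (gaussian_density (d *\<^sub>R mat 1) y) \<partial>lborel)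
      = (\<integral>\<^sup>+y. (ennreal (k / kR) * ennreal (gaussian_density R z)) * ennreal (exp (- (1/2) * ((- m z + y) \<bullet> (N *v (- m z + y))))) \<partial>lborel)"
      using k0 by (intro nn_integral_cong) (simp only: ennreal_mult'[symmetric] pt gaussian_density_nonneg mult_nonneg_nonneg)
    also have "\<dots> = (ennreal (k / kR) * ennreal (gaussian_density R z)) *
        (\<integral>\<^sup>+y. ennreal (exp (- (1/2) * ((- m z + y) \<bullet> (N *v (- m z + y))))) \<partial>lborel)"
      by (rule nn_integral_cmult) measurable
    also have "(\<integral>\<^sup>+y. ennreal (exp (- (1/2) * ((- m z + y) \<bullet> (N *v (- m z + y))))) \<partial>lborel)
       = (\<integral>\<^sup>+y. ennreal (exp (- (1/2) * (y \<bullet> (N *v y)))) \<partial>lborel)"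
      by (rule nn_integral_lborel_translate) measurable
    finally show ?thesis by (simp add: c_def mult_ac)
  qed
  have ind': "distr M lborel X \<Otimes>\<^sub>M distr M lborel Y = distr M (lborel \<Otimes>\<^sub>M lborel) (\<lambda>\<omega>. (X \<omega>, Y \<omega>))"
    using ind by (intro distr_pair_indep) auto
  have joint: "distributed M (lborel \<Otimes>\<^sub>M lborel) (\<lambda>\<omega>. (X \<omega>, Y \<omega>))
      (\<lambda>(x, y). ennreal (gaussian_density S x) * ennreal (gaussian_density (d *\<^sub>R mat 1) y))"
    by (rule distributed_joint_indep'[OF _ _ X Y ind']) (rule lborel.sigma_finite_measure_axioms)+
  have law: "emeasure (distr M lborel (\<lambda>\<omega>. X \<omega> + C *v Y \<omega>)) E
     = c * (\<integral>\<^sup>+z. ennreal (gaussian_density R z) * indicator E z \<partial>lborel)" if [measurable]: "E \<in> sets borel" for E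
  proof -
    have "emeasure (distr M lborel (\<lambda>\<omega>. X \<omega> + C *v Y \<omega>)) E = (\<integral>\<^sup>+\<omega>. indicator E (X \<omega> + C *v Y \<omega>) \<partial>M)"
      by (subst nn_integral_indicator[symmetric], simp, subst nn_integral_distr) simp_all
    also have "\<dots> = (\<integral>\<^sup>+p. (case p of (x, y) \<Rightarrow> ennreal (gaussian_density S x) * ennreal (gaussian_density (d *\<^sub>R mat 1) y))
        * (case p of (x, y) \<Rightarrow> indicator E (x + C *v y)) \<partial>(lborel \<Otimes>\<^sub>M lborel))"
      by (subst distributed_nn_integral[OF joint]) simp_all
    also have "\<dots> = (\<integral>\<^sup>+y. (\<integral>\<^sup>+x. ennreal (gaussian_density S x) * ennreal (gaussian_density (d *\<^sub>R mat 1) y)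
        * indicator E (x + C *v y) \<partial>lborel) \<partial>lborel)"
      by (subst lborel_pair.nn_integral_snd[symmetric]) simp_all
    also have "\<dots> = (\<integral>\<^sup>+y. (\<integral>\<^sup>+z. ennreal (gaussian_density S (z - C *v y)) * ennreal (gaussian_density (d *\<^sub>R mat 1) y)
        * indicator E z \<partial>lborel) \<partial>lborel)"
    proof (rule nn_integral_cong)
      fix y
      show "(\<integral>\<^sup>+x. ennreal (gaussian_density S x) * ennreal (gaussian_density (d *\<^sub>R mat 1) y)
        * indicator E (x + C *v y) \<partial>lborel) = (\<integral>\<^sup>+z. ennreal (gaussian_density S (z - C *v y)) * ennreal (gaussian_density (d *\<^sub>R mat 1) y)
        * indicator E z \<partial>lborel)"
        using nn_integral_lborel_translate[of "\<lambda>z. ennreal (gaussian_density S (z - C *v y)) * ennreal (gaussian_density (d *\<^sub>R mat 1) y)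
        * indicator E z" "C *v y"] by (simp add: add.commute)
    qed
    also have "\<dots> = (\<integral>\<^sup>+z. (\<integral>\<^sup>+y. ennreal (gaussian_density S (z - C *v y)) * ennreal (gaussian_density (d *\<^sub>R mat 1) y)
        * indicator E z \<partial>lborel) \<partial>lborel)"
      by (rule lborel_pair.Fubini') measurable
    also have "\<dots> = (\<integral>\<^sup>+z. c * (ennreal (gaussian_density R z) * indicator E z) \<partial>lborel)"
      by (intro nn_integral_cong, subst nn_integral_multc) (simp_all only: inner mult.assoc, measurable)
    also have "\<dots> = c * (\<integral>\<^sup>+z. ennreal (gaussian_density R z) * indicator E z \<partial>lborel)"
      by (rule nn_integral_cmult) measurable
    finally show ?thesis .
  qed
  interpret D: prob_space "distr M lborel (\<lambda>\<omega>. X \<omega> + C *v Y \<omega>)" by (rule prob_space_distr) simp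
  \<comment> \<open>The constant need not be evaluated: both sides are measures of total mass
    1.\<close>
  have c1: "c = 1"
    using law[of UNIV] D.emeasure_space_1 by (simp add: nn_integral_gaussian_density[OF pR])
  have "distr M lborel (\<lambda>\<omega>. X \<omega> + C *v Y \<omega>) = density lborel (gaussian_density R)"
    by (rule measure_eqI) (simp_all add: law c1 emeasure_density)
  then show ?thesis by (simp add: distributed_def R_def)
qed

text \<open>Based on S_j^-1 - R^-1 = S_j^-1 (R - S_j) R^-1. Once the norm of (R - S_j) R^-1 is below
  1/2, the norm of S_j^-1 is at most twice that of R^-1, and the difference of the inverses tends to
  0 with R - S_j.\<close>

lemma tendsto_matrix_inv:
  fixes S :: "nat \<Rightarrow> real^'n^'n"
  assumes S: "S \<longlonglongrightarrow> R" and iS: "\<And>j. invertible (S j)" and iR: "invertible R"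
  shows "(\<lambda>j. matrix_inv (S j)) \<longlonglongrightarrow> matrix_inv R"
proof -
  let ?P = "matrix_inv R"
  have diff: "matrix_inv (S j) - ?P = matrix_inv (S j) ** ((R - S j) ** ?P)" for j
  proof -
    have "matrix_inv (S j) ** ((R - S j) ** ?P) = matrix_inv (S j) ** (R ** ?P) - (matrix_inv (S j) ** S j) ** ?P"
      by (simp add: bounded_bilinear.diff_left[OF bounded_bilinear_matrix_mult] 
        bounded_bilinear.diff_right[OF bounded_bilinear_matrix_mult] matrix_mul_assoc)
    then show ?thesis by (simp add: invertible_matrix_inv iS iR)
  qed
  have z: "(\<lambda>j. norm ((R - S j) ** ?P)) \<longlonglongrightarrow> 0"
  proof -
    have "(\<lambda>j. (R - S j) ** ?P) \<longlonglongrightarrow> (R - R) ** ?P"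
      by (intro bounded_bilinear.tendsto[OF bounded_bilinear_matrix_mult] tendsto_intros S)
    then show ?thesis by (simp add: tendsto_norm_zero bounded_bilinear.zero_left[OF bounded_bilinear_matrix_mult])
  qed
  have "\<forall>\<^sub>F j in sequentially. norm ((R - S j) ** ?P) < 1/2"
    using order_tendstoD(2)[OF z, of "1/2"] by simp
  then have ev: "\<forall>\<^sub>F j in sequentially. norm (matrix_inv (S j) - ?P) \<le> 2 * norm ?P * norm ((R - S j) ** ?P)"
  proof eventually_elim
    case (elim j)
    have "norm (matrix_inv (S j) - ?P) \<le> norm (matrix_inv (S j)) * norm ((R - S j) ** ?P)"
      unfolding diff by (rule norm_matrix_mult_le)
    moreover have "norm (matrix_inv (S j)) \<le> norm (matrix_inv (S j) - ?P) + norm ?P"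
      by (metis diff_add_cancel norm_triangle_ineq)
    moreover have "norm (matrix_inv (S j)) * norm ((R - S j) ** ?P) \<le> norm (matrix_inv (S j)) * (1/2)"
      using elim by (intro mult_left_mono) auto
    ultimately have "norm (matrix_inv (S j)) \<le> 2 * norm ?P" by linarith
    then have "norm (matrix_inv (S j)) * norm ((R - S j) ** ?P) \<le> 2 * norm ?P * norm ((R - S j) ** ?P)"
      by (rule mult_right_mono) simp
    then show ?case
      using \<open>norm (matrix_inv (S j) - ?P) \<le> norm (matrix_inv (S j)) * norm ((R - S j) ** ?P)\<close> by linarith
  qed
  have "(\<lambda>j. 2 * norm ?P * norm ((R - S j) ** ?P)) \<longlonglongrightarrow> 0"
    using tendsto_mult_left[OF z, of "2 * norm ?P"] by simp
  then have "(\<lambda>j. matrix_inv (S j) - ?P) \<longlonglongrightarrow> 0"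
    using ev by (rule Lim_null_comparison[rotated])
  then show ?thesis by (simp add: LIM_zero_iff)
qed

lemma tendsto_gaussian_density:
  fixes S :: "nat \<Rightarrow> real^'n^'n"
  assumes S: "S \<longlonglongrightarrow> R" and pS: "\<And>j. pos_def (S j)" and pR: "pos_def R"
  shows "(\<lambda>j. gaussian_density (S j) x) \<longlonglongrightarrow> gaussian_density R x"
proof -
  have "(\<lambda>j. det (S j)) \<longlonglongrightarrow> det R"
    unfolding det_def by (intro tendsto_intros S)
  moreover have "(\<lambda>j. matrix_inv (S j)) \<longlonglongrightarrow> matrix_inv R"
    using S by (rule tendsto_matrix_inv) (auto intro: pos_def_invertible pS pR)
  ultimately show ?thesis
    unfolding gaussian_density_def using pos_def_det[OF pR]
    by (intro tendsto_intros bounded_bilinear.tendsto[OF bounded_bilinear_matrix_vector_mult]) auto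
qed

text \<open>Convergence of the densities yields, by Fatou's lemma, one inequality between
  expectations of continuous functions with values in [0,1]. Applied to 1 - f as well it becomes an
  equality, since both measures have mass 1. Such functions approximate the indicators of closed
  sets, which generate the Borel sets and are stable under intersection.\<close>

lemma distributed_gaussian_limit:
  fixes S :: "nat \<Rightarrow> real^'n^'n"
  assumes "prob_space M"
    and Y: "\<And>j. distributed M lborel (Y j) (gaussian_density (S j))"
    and S: "S \<longlonglongrightarrow> R" and pS: "\<And>j. pos_def (S j)" and pR: "pos_def R"
    and X[measurable]: "X \<in> borel_measurable M" and lim: "AE \<omega> in M. (\<lambda>j. Y j \<omega>) \<longlonglongrightarrow> X \<omega>"
  shows "distributed M lborel X (gaussian_density R)"
proof -
  interpret prob_space M by fact
  have [measurable]: "Y j \<in> borel_measurable M" for j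
    using Y[of j] by (auto simp: distributed_def)
  define \<mu> where "\<mu> = density lborel (gaussian_density R)"
  interpret \<mu>: prob_space \<mu>
    by (rule prob_spaceI) (simp add: \<mu>_def emeasure_density nn_integral_gaussian_density[OF pR])
  have [simp]: "sets \<mu> = sets borel" "space \<mu> = UNIV" by (simp_all add: \<mu>_def)
  have m\<mu>: "g \<in> borel_measurable borel \<Longrightarrow> g \<in> borel_measurable \<mu>" for g :: "real^'n \<Rightarrow> ennreal"
    by (simp add: \<mu>_def)
  have m\<mu>': "g \<in> borel_measurable borel \<Longrightarrow> g \<in> borel_measurable \<mu>" for g :: "real^'n \<Rightarrow> real"
    by (simp add: \<mu>_def)
  have le: "(\<integral>\<^sup>+x. ennreal (f x) \<partial>\<mu>) \<le> (\<integral>\<^sup>+\<omega>. ennreal (f (X \<omega>)) \<partial>M)"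
    if f: "continuous_on UNIV f" "\<And>x. 0 \<le> f x" "\<And>x. f x \<le> 1" for f :: "real^'n \<Rightarrow> real"
  proof -
    have [measurable]: "f \<in> borel_measurable borel" using f(1) by (rule borel_measurable_continuous_onI)
    have "(\<integral>\<^sup>+x. ennreal (f x) \<partial>\<mu>) = (\<integral>\<^sup>+x. ennreal (gaussian_density R x) * ennreal (f x) \<partial>lborel)"
      by (simp add: \<mu>_def nn_integral_density)
    also have "\<dots> = (\<integral>\<^sup>+x. liminf (\<lambda>j. ennreal (gaussian_density (S j) x) * ennreal (f x)) \<partial>lborel)"
    proof (rule nn_integral_cong)
      fix x
      have *: "(\<lambda>j. ennreal (gaussian_density (S j) x * f x)) \<longlonglongrightarrow> ennreal (gaussian_density R x * f x)"
        by (intro tendsto_intros tendsto_gaussian_density S pS pR)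
      show "ennreal (gaussian_density R x) * ennreal (f x) = liminf (\<lambda>j. ennreal (gaussian_density (S j) x) * ennreal (f x))"
        using lim_imp_Liminf[OF trivial_limit_sequentially *] by (simp add: ennreal_mult'[symmetric] f)
    qed
    also have "\<dots> \<le> liminf (\<lambda>j. \<integral>\<^sup>+x. ennreal (gaussian_density (S j) x) * ennreal (f x) \<partial>lborel)"
      by (rule nn_integral_liminf) measurable
    also have "(\<lambda>j. \<integral>\<^sup>+x. ennreal (gaussian_density (S j) x) * ennreal (f x) \<partial>lborel) = (\<lambda>j. \<integral>\<^sup>+\<omega>. ennreal (f (Y j \<omega>)) \<partial>M)"
      by (intro ext distributed_nn_integral[OF Y]) measurable
    also have "liminf (\<lambda>j. \<integral>\<^sup>+\<omega>. ennreal (f (Y j \<omega>)) \<partial>M) = (\<integral>\<^sup>+\<omega>. ennreal (f (X \<omega>)) \<partial>M)"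
    proof (rule lim_imp_Liminf)
      show "(\<lambda>j. \<integral>\<^sup>+\<omega>. ennreal (f (Y j \<omega>)) \<partial>M) \<longlonglongrightarrow> (\<integral>\<^sup>+\<omega>. ennreal (f (X \<omega>)) \<partial>M)"
      proof (rule nn_integral_dominated_convergence[where w="\<lambda>_. 1"])
        show "AE \<omega> in M. (\<lambda>j. ennreal (f (Y j \<omega>))) \<longlonglongrightarrow> ennreal (f (X \<omega>))"
          using lim
        proof eventually_elim
          case (elim \<omega>)
          have "isCont f (X \<omega>)" using f(1) by (simp add: continuous_on_eq_continuous_at)
          then have "(\<lambda>j. f (Y j \<omega>)) \<longlonglongrightarrow> f (X \<omega>)" using elim by (rule isCont_tendsto_compose)
          then show ?case by (rule tendsto_ennrealI)
        qed
      qed (auto simp: f emeasure_space_1)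
    qed simp
    finally show ?thesis .
  qed
  have eq: "(\<integral>\<^sup>+x. ennreal (f x) \<partial>\<mu>) = (\<integral>\<^sup>+\<omega>. ennreal (f (X \<omega>)) \<partial>M)"
    if f: "continuous_on UNIV f" "\<And>x. 0 \<le> f x" "\<And>x. f x \<le> 1" for f :: "real^'n \<Rightarrow> real"
  proof (rule antisym[OF le[OF f]])
    have [measurable]: "f \<in> borel_measurable borel" using f(1) by (rule borel_measurable_continuous_onI)
    have c: "(\<integral>\<^sup>+x. ennreal (1 - f x) \<partial>\<mu>) \<le> (\<integral>\<^sup>+\<omega>. ennreal (1 - f (X \<omega>)) \<partial>M)"
      by (rule le) (auto intro!: continuous_intros f simp: f)
    have s1: "(\<integral>\<^sup>+x. ennreal (f x) \<partial>\<mu>) + (\<integral>\<^sup>+x. ennreal (1 - f x) \<partial>\<mu>) = 1"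
      by (subst nn_integral_add[symmetric]) (simp_all add: m\<mu>' f \<mu>.emeasure_space_1[simplified] flip: ennreal_plus)
    have s2: "(\<integral>\<^sup>+\<omega>. ennreal (f (X \<omega>)) \<partial>M) + (\<integral>\<^sup>+\<omega>. ennreal (1 - f (X \<omega>)) \<partial>M) = 1"
      by (subst nn_integral_add[symmetric]) (simp_all add: f emeasure_space_1 flip: ennreal_plus)
    have fin: "(\<integral>\<^sup>+\<omega>. ennreal (1 - f (X \<omega>)) \<partial>M) \<noteq> \<top>"
    proof -
      have "(\<integral>\<^sup>+\<omega>. ennreal (1 - f (X \<omega>)) \<partial>M) \<le> 1" unfolding s2[symmetric] by simp
      then show ?thesis by (auto simp: top_unique)
    qed
    have "(\<integral>\<^sup>+\<omega>. ennreal (f (X \<omega>)) \<partial>M) + (\<integral>\<^sup>+\<omega>. ennreal (1 - f (X \<omega>)) \<partial>M)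
        \<le> (\<integral>\<^sup>+x. ennreal (f x) \<partial>\<mu>) + (\<integral>\<^sup>+\<omega>. ennreal (1 - f (X \<omega>)) \<partial>M)"
      unfolding s2 s1[symmetric] by (rule add_left_mono[OF c])
    then show "(\<integral>\<^sup>+\<omega>. ennreal (f (X \<omega>)) \<partial>M) \<le> (\<integral>\<^sup>+x. ennreal (f x) \<partial>\<mu>)"
      using fin by (subst (asm) (1 2) add.commute) (simp add: ennreal_add_left_cancel_le)
  qed
  have closed: "emeasure \<mu> F = emeasure (distr M lborel X) F" if F: "closed F" for F
  proof (cases "F = {}")
    case False
    \<comment> \<open>These functions are 1 on \<open>F\<close> and eventually vanish at each point
      outside, since such a point has positive distance from a closed set.\<close>
    define f where "f k x = max 0 (1 - real k * infdist x F)" for k and x :: "real^'n"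
    have cf: "continuous_on UNIV (f k)" for k
      unfolding f_def by (intro continuous_intros)
    have [measurable]: "f k \<in> borel_measurable borel" for k using cf by (rule borel_measurable_continuous_onI)
    have [measurable]: "F \<in> sets borel" using F by simp
    have f01: "0 \<le> f k x" "f k x \<le> 1" for k x by (auto simp: f_def infdist_nonneg)
    have lim: "(\<lambda>k. ennreal (f k x)) \<longlonglongrightarrow> indicator F x" for x
    proof (cases "x \<in> F")
      case True then show ?thesis by (simp add: f_def)
    next
      case nF: False
      have p: "0 < infdist x F"
        using nF F False in_closed_iff_infdist_zero[of F x] infdist_nonneg[of x F] by (auto simp: less_le)
      obtain k0 where k0: "1 < real k0 * infdist x F"
        using p ex_less_of_nat_mult by blast
      have "\<forall>\<^sub>F k in sequentially. ennreal (f k x) = 0"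
        using eventually_ge_at_top[of k0]
      proof eventually_elim
        case (elim k)
        have "real k0 * infdist x F \<le> real k * infdist x F" using elim p by (intro mult_right_mono) auto
        then show ?case using k0 by (simp add: f_def)
      qed
      then show ?thesis using nF by (simp add: tendsto_eventually)
    qed
    have "(\<lambda>k. \<integral>\<^sup>+x. ennreal (f k x) \<partial>\<mu>) \<longlonglongrightarrow> (\<integral>\<^sup>+x. indicator F x \<partial>\<mu>)"
      by (rule nn_integral_dominated_convergence[where w="\<lambda>_. 1"])
         (use lim in \<open>auto simp: f01 \<mu>.emeasure_space_1[simplified] intro!: m\<mu> m\<mu>' borel_measurable_indicator\<close>)
    moreover have "(\<lambda>k. \<integral>\<^sup>+\<omega>. ennreal (f k (X \<omega>)) \<partial>M) \<longlonglongrightarrow> (\<integral>\<^sup>+\<omega>. indicator F (X \<omega>) \<partial>M)"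
      by (rule nn_integral_dominated_convergence[where w="\<lambda>_. 1"])
         (use lim in \<open>auto simp: f01 emeasure_space_1\<close>)
    ultimately have "(\<integral>\<^sup>+x. indicator F x \<partial>\<mu>) = (\<integral>\<^sup>+\<omega>. indicator F (X \<omega>) \<partial>M)"
      using eq[OF cf f01] LIMSEQ_unique by simp
    moreover have "(\<integral>\<^sup>+\<omega>. indicator F (X \<omega>) \<partial>M) = emeasure (distr M lborel X) F"
      by (subst nn_integral_distr[of X M lborel "indicator F", symmetric]) simp_all
    ultimately show ?thesis by simp
  qed simp
  have "\<mu> = distr M lborel X"
  proof (rule measure_eqI_generator_eq[where E="Collect closed" and \<Omega>=UNIV and A="\<lambda>_. UNIV"])
    show "Int_stable (Collect (closed :: (real^'n) set \<Rightarrow> bool))" by (auto simp: Int_stable_def)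
    show "sets \<mu> = sigma_sets UNIV (Collect closed)" "sets (distr M lborel X) = sigma_sets UNIV (Collect closed)"
      by (simp_all add: borel_eq_closed)
  qed (auto simp: closed \<mu>.emeasure_space_1[simplified])
  then show ?thesis by (simp add: distributed_def \<mu>_def)
qed



section \<open>Moments of Gaussian vectors\<close>

lemma borel_measurable_vec_nth [measurable (raw)]:
  "f \<in> borel_measurable M \<Longrightarrow> (\<lambda>x. f x $ i) \<in> borel_measurable M" for f :: "'a \<Rightarrow> real^'n"
  unfolding cart_eq_inner_axis by (intro borel_measurable_inner borel_measurable_const)


text \<open>Exponential tilting: multiplying a centred Gaussian density by the exponential of a
  linear form translates it by \<open>S *v \<theta>\<close> and scales it, so what is left to
  integrate is again a density.\<close>

lemma gaussian_mgf:
  fixes S :: "real^'n^'n"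
  assumes "prob_space M" and X: "distributed M lborel X (gaussian_density S)" and S: "pos_def S"
  shows "integrable M (\<lambda>\<omega>. exp (\<theta> \<bullet> X \<omega>))"
    and "(LINT \<omega>|M. exp (\<theta> \<bullet> X \<omega>)) = exp ((1/2) * (\<theta> \<bullet> (S *v \<theta>)))"
proof -
  interpret prob_space M by fact
  have [measurable]: "X \<in> borel_measurable M" using X by (auto simp: distributed_def)
  have sym: "u \<bullet> (matrix_inv S *v v) = (matrix_inv S *v u) \<bullet> v" for u v
    using pos_def_matrix_inv[OF S] by (metis inner_matrix_vector pos_def_def)
  have PS: "matrix_inv S *v (S *v \<theta>) = \<theta>"
    by (simp add: matrix_vector_mul_assoc invertible_matrix_inv pos_def_invertible[OF S])
  have shift: "gaussian_density S x * exp (\<theta> \<bullet> x) = exp ((1/2) * (\<theta> \<bullet> (S *v \<theta>))) * gaussian_density S (- (S *v \<theta>) + x)" for x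
  proof -
    have 1: "(- (S *v \<theta>) + x) \<bullet> (matrix_inv S *v (- (S *v \<theta>) + x))
       = x \<bullet> (matrix_inv S *v x) - 2 * (\<theta> \<bullet> x) + \<theta> \<bullet> (S *v \<theta>)"
    proof -
      have "(S *v \<theta>) \<bullet> (matrix_inv S *v x) = \<theta> \<bullet> x" by (simp add: sym PS)
      then show ?thesis
        using PS by (simp add: matrix_vector_mult_diff_distrib inner_diff_left inner_diff_right inner_commute)
    qed
    have "exp (- (1/2) * (x \<bullet> (matrix_inv S *v x))) * exp (\<theta> \<bullet> x)
      = exp ((1/2) * (\<theta> \<bullet> (S *v \<theta>))) * exp (- (1/2) * ((- (S *v \<theta>) + x) \<bullet> (matrix_inv S *v (- (S *v \<theta>) + x))))"
      unfolding exp_add[symmetric] 1 by (simp add: field_simps)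
    then show ?thesis unfolding gaussian_density_def by (simp only: mult.assoc mult.left_commute)
  qed
  have "(\<integral>\<^sup>+\<omega>. ennreal (exp (\<theta> \<bullet> X \<omega>)) \<partial>M) = (\<integral>\<^sup>+x. ennreal (gaussian_density S x) * ennreal (exp (\<theta> \<bullet> x)) \<partial>lborel)"
    by (rule distributed_nn_integral[OF X, symmetric]) measurable
  also have "\<dots> = (\<integral>\<^sup>+x. ennreal (exp ((1/2) * (\<theta> \<bullet> (S *v \<theta>)))) * ennreal (gaussian_density S (- (S *v \<theta>) + x)) \<partial>lborel)"
    by (intro nn_integral_cong) (simp only: ennreal_mult'[symmetric] shift gaussian_density_nonneg exp_ge_zero)
  also have "\<dots> = ennreal (exp ((1/2) * (\<theta> \<bullet> (S *v \<theta>)))) * (\<integral>\<^sup>+x. ennreal (gaussian_density S (- (S *v \<theta>) + x)) \<partial>lborel)"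
    by (rule nn_integral_cmult) measurable
  also have "(\<integral>\<^sup>+x. ennreal (gaussian_density S (- (S *v \<theta>) + x)) \<partial>lborel) = 1"
    by (subst nn_integral_lborel_translate) (measurable, rule nn_integral_gaussian_density[OF S])
  finally have e: "(\<integral>\<^sup>+\<omega>. ennreal (exp (\<theta> \<bullet> X \<omega>)) \<partial>M) = ennreal (exp ((1/2) * (\<theta> \<bullet> (S *v \<theta>))))"
    by simp
  show i: "integrable M (\<lambda>\<omega>. exp (\<theta> \<bullet> X \<omega>))"
    by (rule integrableI_nonneg) (auto simp: e)
  show "(LINT \<omega>|M. exp (\<theta> \<bullet> X \<omega>)) = exp ((1/2) * (\<theta> \<bullet> (S *v \<theta>)))"
    by (rule integral_eq_nn_integral[THEN trans]) (auto simp: e)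
qed

text \<open>Serves twice: it shows that the second difference of the exponential is nonnegative, and
  it turns the second difference quotient into the square of a first one.\<close>

lemma exp_symmetric_square: "exp t + exp (- t) - 2 = (exp (t / 2) - exp (- (t / 2)))\<^sup>2" for t :: real
proof -
  have "exp t = (exp (t / 2))\<^sup>2" "exp (- t) = (exp (- (t / 2)))\<^sup>2"
    by (simp_all add: power2_eq_square exp_add[symmetric])
  moreover have "exp (t / 2) * exp (- (t / 2)) = 1" by (simp add: exp_add[symmetric])
  ultimately show ?thesis by (simp add: power2_diff)
qed

text \<open>Divided by e^2, the left side is a second difference quotient in \<open>e\<close>; the
  bound that remains does not depend on \<open>e\<close>. It becomes the dominating function in the
  computation of the second moment, where it is integrable by the moment generating
  function.\<close>

lemma sinh_sq_bound:
  fixes a e :: real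
  assumes "0 \<le> e" "e \<le> 1"
  shows "(exp (e * a) + exp (- (e * a)) - 2) \<le> e\<^sup>2 * (2 * (exp (2 * a) + exp (- (2 * a))))"
proof -
  \<comment> \<open>The left side is even in \<open>a\<close>, so the absolute value may be used;
    the half prepares for \<open>exp_symmetric_square\<close>.\<close>
  define u where "u = e * \<bar>a\<bar> / 2"
  have u0: "0 \<le> u" using assms by (simp add: u_def)
  have "exp (e * a) + exp (- (e * a)) = exp (2 * u) + exp (- (2 * u))"
    by (cases "0 \<le> a") (simp_all add: u_def)
  also have "exp (2 * u) + exp (- (2 * u)) - 2 = (exp u - exp (- u))\<^sup>2"
    by (simp add: exp_symmetric_square)
  also have "\<dots> \<le> (2 * u * exp u)\<^sup>2"
  proof (rule power_mono)
    have "1 - exp (- (2 * u)) \<le> 2 * u" using exp_ge_add_one_self[of "- (2 * u)"] by linarith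
    then have "exp u * (1 - exp (- (2 * u))) \<le> exp u * (2 * u)" by (rule mult_left_mono) simp
    moreover have "exp u * exp (- (2 * u)) = exp (- u)" by (simp add: exp_add[symmetric])
    ultimately show "exp u - exp (- u) \<le> 2 * u * exp u" by (simp add: algebra_simps)
    show "0 \<le> exp u - exp (- u)" using u0 by simp
  qed
  also have "(2 * u * exp u)\<^sup>2 = e\<^sup>2 * (a\<^sup>2 * exp (e * \<bar>a\<bar>))"
    by (simp add: u_def power_mult_distrib exp_double[symmetric])
  also have "\<dots> \<le> e\<^sup>2 * (2 * (exp (2 * a) + exp (- (2 * a))))"
  proof (rule mult_left_mono)
    have "a\<^sup>2 \<le> 2 * exp \<bar>a\<bar>" using exp_lower_Taylor_quadratic[of "\<bar>a\<bar>"] by simp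
    moreover have "exp (e * \<bar>a\<bar>) \<le> exp \<bar>a\<bar>" using assms by (simp add: mult_left_le_one_le)
    ultimately have "a\<^sup>2 * exp (e * \<bar>a\<bar>) \<le> 2 * exp \<bar>a\<bar> * exp \<bar>a\<bar>"
      by (intro mult_mono) auto
    also have "\<dots> = 2 * exp (2 * \<bar>a\<bar>)" by (simp add: exp_add[symmetric])
    also have "\<dots> \<le> 2 * (exp (2 * a) + exp (- (2 * a)))" by (cases "0 \<le> a") simp_all
    finally show "a\<^sup>2 * exp (e * \<bar>a\<bar>) \<le> 2 * (exp (2 * a) + exp (- (2 * a)))" .
  qed simp
  finally show ?thesis .
qed

text \<open>The second moment is the second derivative at 0 of the moment generating function,
  obtained as a limit of symmetric difference quotients with steps \<open>e j\<close> by dominated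
  convergence.\<close>

lemma gaussian_second_moment:
  fixes S :: "real^'n^'n"
  assumes "prob_space M" and X: "distributed M lborel X (gaussian_density S)" and S: "pos_def S"
  shows "integrable M (\<lambda>\<omega>. (\<theta> \<bullet> X \<omega>)\<^sup>2)"
    and "(LINT \<omega>|M. (\<theta> \<bullet> X \<omega>)\<^sup>2) = \<theta> \<bullet> (S *v \<theta>)"
proof -
  interpret prob_space M by fact
  have [measurable]: "X \<in> borel_measurable M" using X by (auto simp: distributed_def)
  define a where "a \<omega> = \<theta> \<bullet> X \<omega>" for \<omega>
  have [measurable]: "a \<in> borel_measurable M" unfolding a_def by measurable
  define \<sigma> where "\<sigma> = \<theta> \<bullet> (S *v \<theta>)"
  have mgf: "integrable M (\<lambda>\<omega>. exp (c * a \<omega>))" "(LINT \<omega>|M. exp (c * a \<omega>)) = exp (c\<^sup>2 * \<sigma> / 2)" for c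
    using gaussian_mgf[OF assms, of "c *\<^sub>R \<theta>"]
    by (simp_all add: a_def \<sigma>_def matrix_vector_mult_scaleR power2_eq_square)
  define e where "e j = 1 / real (Suc j)" for j
  have e0: "0 < e j" "e j \<le> 1" for j by (simp_all add: e_def)
  have elim: "filterlim e (at 0) sequentially"
    unfolding filterlim_at using LIMSEQ_inverse_real_of_nat by (auto simp: e_def[abs_def] inverse_eq_divide)
  define s where "s j \<omega> = (exp (e j * a \<omega>) + exp (- (e j * a \<omega>)) - 2) / (e j)\<^sup>2" for j \<omega>
  have [measurable]: "s j \<in> borel_measurable M" for j unfolding s_def[abs_def] by measurable
  define W where "W \<omega> = 2 * (exp (2 * a \<omega>) + exp (- (2 * a \<omega>)))" for \<omega>
  have iW: "integrable M W"
    unfolding W_def using mgf(1)[of 2] mgf(1)[of "-2"] by (intro integrable_mult_right integrable_add) auto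
  have sW: "norm (s j \<omega>) \<le> W \<omega>" for j \<omega>
  proof -
    have "0 \<le> exp (e j * a \<omega>) + exp (- (e j * a \<omega>)) - 2"
    proof -
      show ?thesis by (simp only: exp_symmetric_square zero_le_power2)
    qed
    moreover have "(exp (e j * a \<omega>) + exp (- (e j * a \<omega>)) - 2) \<le> (e j)\<^sup>2 * W \<omega>"
      unfolding W_def by (rule sinh_sq_bound) (use e0[of j] in auto)
    ultimately show ?thesis using e0(1)[of j] by (simp add: s_def divide_le_eq mult.commute)
  qed
  have slim: "(\<lambda>j. s j \<omega>) \<longlonglongrightarrow> (a \<omega>)\<^sup>2" for \<omega>
  proof -
    have "((\<lambda>t. exp (t * (a \<omega> / 2)) - exp (- (t * (a \<omega> / 2)))) has_real_derivative a \<omega>) (at 0)"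
      by (auto intro!: derivative_eq_intros)
    then have "((\<lambda>h. (exp (h * (a \<omega> / 2)) - exp (- (h * (a \<omega> / 2)))) / h) \<longlongrightarrow> a \<omega>) (at 0)"
      by (simp add: DERIV_def)
    then have "(\<lambda>j. (exp (e j * (a \<omega> / 2)) - exp (- (e j * (a \<omega> / 2)))) / e j) \<longlonglongrightarrow> a \<omega>"
      using elim by (rule filterlim_compose)
    then have "(\<lambda>j. ((exp (e j * (a \<omega> / 2)) - exp (- (e j * (a \<omega> / 2)))) / e j)\<^sup>2) \<longlonglongrightarrow> (a \<omega>)\<^sup>2"
      by (rule tendsto_power)
    moreover have "((exp (e j * (a \<omega> / 2)) - exp (- (e j * (a \<omega> / 2)))) / e j)\<^sup>2 = s j \<omega>" for j
      unfolding s_def power_divide exp_symmetric_square by simp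
    ultimately show ?thesis by simp
  qed
  have i: "integrable M (\<lambda>\<omega>. (a \<omega>)\<^sup>2)" and l: "(\<lambda>j. LINT \<omega>|M. s j \<omega>) \<longlonglongrightarrow> (LINT \<omega>|M. (a \<omega>)\<^sup>2)"
    using iW sW slim
    by (auto intro!: integrable_dominated_convergence[of _ _ s W] integral_dominated_convergence[of _ _ s W])
  \<comment> \<open>The generating function is even in the step, so both exponentials have the same
    mean; what remains is a first difference quotient in (e j)^2 / 2.\<close>
  have "(LINT \<omega>|M. s j \<omega>) = (exp ((e j)\<^sup>2 / 2 * \<sigma>) - 1) / ((e j)\<^sup>2 / 2)" for j
    unfolding s_def using mgf[of "e j"] mgf[of "- e j"]
    by (simp add: prob_space field_simps)
  moreover have "(\<lambda>j. (exp ((e j)\<^sup>2 / 2 * \<sigma>) - 1) / ((e j)\<^sup>2 / 2)) \<longlonglongrightarrow> \<sigma>"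
  proof -
    have "((\<lambda>t. exp (t * \<sigma>) - 1) has_real_derivative \<sigma>) (at 0)"
      by (auto intro!: derivative_eq_intros)
    then have "((\<lambda>h. (exp (h * \<sigma>) - 1) / h) \<longlongrightarrow> \<sigma>) (at 0)"
      by (simp add: DERIV_def)
    moreover have "filterlim (\<lambda>j. (e j)\<^sup>2 / 2) (at 0) sequentially"
    proof -
      have "e \<longlonglongrightarrow> 0" using elim unfolding filterlim_at by simp
      then have "(\<lambda>j. (e j)\<^sup>2 / 2) \<longlonglongrightarrow> 0\<^sup>2 / 2" by (intro tendsto_intros) auto
      moreover have "(e j)\<^sup>2 / 2 \<noteq> 0" for j using e0(1)[of j] by simp
      ultimately show ?thesis unfolding filterlim_at by simp
    qed
    ultimately show ?thesis by (rule filterlim_compose)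
  qed
  ultimately have "(LINT \<omega>|M. (a \<omega>)\<^sup>2) = \<sigma>" using l LIMSEQ_unique by simp
  with i show "integrable M (\<lambda>\<omega>. (\<theta> \<bullet> X \<omega>)\<^sup>2)" "(LINT \<omega>|M. (\<theta> \<bullet> X \<omega>)\<^sup>2) = \<theta> \<bullet> (S *v \<theta>)"
    by (simp_all add: a_def \<sigma>_def)
qed

text \<open>Polarization: the product of two coordinates comes from the squares of their sum and of
  each one alone.\<close>

lemma gaussian_covariance:
  fixes S :: "real^'n^'n"
  assumes P: "prob_space M" and X: "distributed M lborel X (gaussian_density S)" and S: "pos_def S"
  shows "integrable M (\<lambda>\<omega>. X \<omega> $ i * X \<omega> $ j)"
    and "(LINT \<omega>|M. X \<omega> $ i * X \<omega> $ j) = S $ i $ j"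
proof -
  note m = gaussian_second_moment[OF P X S]
  have ax: "axis k 1 \<bullet> x = x $ k" for k and x :: "real^'n" by (simp add: inner_axis')
  have Sax: "axis k 1 \<bullet> (S *v axis l 1) = S $ k $ l" for k l
    by (simp add: ax matrix_vector_mult_basis column_def)
  have "transpose S $ i $ j = S $ i $ j" using S by (simp add: pos_def_def)
  then have sym: "S $ j $ i = S $ i $ j" by (simp add: transpose_def)
  have eq: "X \<omega> $ i * X \<omega> $ j = (((axis i 1 + axis j 1) \<bullet> X \<omega>)\<^sup>2 - (axis i 1 \<bullet> X \<omega>)\<^sup>2 - (axis j 1 \<bullet> X \<omega>)\<^sup>2) / 2" for \<omega>
    by (simp add: inner_add_left ax power2_sum)
  show "integrable M (\<lambda>\<omega>. X \<omega> $ i * X \<omega> $ j)"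
    unfolding eq by (intro integrable_divide Bochner_Integration.integrable_diff m(1))
  show "(LINT \<omega>|M. X \<omega> $ i * X \<omega> $ j) = S $ i $ j"
  proof -
    let ?a = "axis i 1 + axis j 1 :: real^'n"
    have "(LINT \<omega>|M. X \<omega> $ i * X \<omega> $ j)
        = (?a \<bullet> (S *v ?a) - axis i 1 \<bullet> (S *v axis i 1) - axis j 1 \<bullet> (S *v axis j 1)) / 2"
      unfolding eq by (simp add: m)
    then show ?thesis
      by (simp add: inner_add_left inner_add_right matrix_vector_right_distrib Sax sym)
  qed
qed

text \<open>The law is invariant under the reflection \<open>- mat 1\<close>, so each mean equals
  its own negative.\<close>

lemma gaussian_mean:
  fixes S :: "real^'n^'n"
  assumes P: "prob_space M" and X: "distributed M lborel X (gaussian_density S)" and S: "pos_def S"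
  shows "integrable M (\<lambda>\<omega>. X \<omega> $ i)" and "(LINT \<omega>|M. X \<omega> $ i) = 0"
proof -
  interpret prob_space M by fact
  have [measurable]: "X \<in> borel_measurable M" using X by (auto simp: distributed_def)
  have "integrable M (\<lambda>\<omega>. (X \<omega> $ i)\<^sup>2)"
    using gaussian_covariance(1)[OF P X S, of i i] by (simp add: power2_eq_square)
  then show "integrable M (\<lambda>\<omega>. X \<omega> $ i)"
    by (rule square_integrable_imp_integrable[rotated]) simp
  define G :: "real^'n^'n" where "G = - mat 1"
  have G2: "G ** G = mat 1"
    by (simp add: G_def vec_eq_iff matrix_matrix_mult_def mat_def sum_negf[symmetric])
       (simp add: if_distrib[of "\<lambda>x. x * _"] cong: if_cong)
  then have iG: "invertible G" unfolding invertible_right_inverse by blast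
  have Gv: "G *v x = - x" for x
    by (simp add: G_def vec_eq_iff matrix_vector_mult_def mat_def sum_negf if_distrib[of "\<lambda>x. x * _"] cong: if_cong)
  have "G ** S ** transpose G = S"
  proof -
    have "(G ** S ** transpose G) *v x = S *v x" for x
    proof -
      have "transpose G = G" by (simp add: G_def transpose_def vec_eq_iff mat_def)
      then show ?thesis by (simp add: matrix_vector_mul_assoc[symmetric] Gv)
         (simp add: matrix_vector_mult_def sum_negf vec_eq_iff)
    qed
    then show ?thesis by (simp add: matrix_eq)
  qed
  then have X': "distributed M lborel (\<lambda>\<omega>. - X \<omega>) (gaussian_density S)"
    using distributed_gaussian_linear[OF X S iG] by (simp add: Gv)
  have "(LINT \<omega>|M. X \<omega> $ i) = (LINT x|lborel. gaussian_density S x * x $ i)"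
    by (rule distributed_integral[OF X, symmetric]) simp_all
  also have "\<dots> = (LINT \<omega>|M. (- X \<omega>) $ i)"
    by (rule distributed_integral[OF X']) simp_all
  finally show "(LINT \<omega>|M. X \<omega> $ i) = 0" by simp
qed

lemma gaussian_norm_square_integrable:
  fixes S :: "real^'n^'n"
  assumes P: "prob_space M" and X: "distributed M lborel X (gaussian_density S)" and S: "pos_def S"
  shows "integrable M (\<lambda>\<omega>. (norm (X \<omega>))\<^sup>2)"
proof -
  have "(norm (X \<omega>))\<^sup>2 = (\<Sum>i\<in>UNIV. X \<omega> $ i * X \<omega> $ i)" for \<omega>
    by (simp add: power2_norm_eq_inner inner_vec_def)
  then show ?thesis by (auto intro!: gaussian_covariance[OF P X S])
qed



section \<open>Analytic preliminaries\<close>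

lemma set_integral_eq_restrict_space:
  fixes f :: "real \<Rightarrow> 'a::euclidean_space"
  assumes "t \<le> T"
  shows "(LINT s:{0..t}|lborel. f s) = (LINT s|restrict_space lborel {0..T}. indicator {0..t} s *\<^sub>R f s)"
  unfolding set_lebesgue_integral_def using assms
  by (subst integral_restrict_space)
     (auto intro!: Bochner_Integration.integral_cong split: split_indicator)

lemma set_integrable_eq_restrict_space:
  fixes f :: "real \<Rightarrow> 'a::euclidean_space"
  shows "set_integrable lborel {0..T} f \<longleftrightarrow> integrable (restrict_space lborel {0..T}) f"
  by (simp add: integrable_restrict_space set_integrable_def)

text \<open>Fubini for the product of f(s) and g(t), with the plane cut along the diagonal: on each
  side one of the two integrations produces a primitive. A general \<open>prod\<close> serves
  matrix-vector products and inner products alike.\<close>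

lemma lebesgue_integration_by_parts_zero:
  fixes f :: "real \<Rightarrow> 'a::euclidean_space" and g :: "real \<Rightarrow> 'b::euclidean_space"
    and prod :: "'a \<Rightarrow> 'b \<Rightarrow> 'c::euclidean_space"
  assumes bb: "bounded_bilinear prod"
    and f: "integrable lborel f" and g: "integrable lborel g"
  shows "integrable lborel (\<lambda>t. prod (f t) (LINT s:{..t}|lborel. g s))"
    and "prod (LINT s|lborel. f s) (LINT s|lborel. g s)
      = (LINT t|lborel. prod (f t) (LINT s:{..t}|lborel. g s)) + (LINT t|lborel. prod (LINT s:{..t}|lborel. f s) (g t))"
proof -
  interpret bounded_bilinear prod by fact
  obtain K where K: "\<And>a b. norm (prod a b) \<le> norm a * norm b * K" "0 \<le> K"
    using nonneg_bounded by blast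
  have [measurable]: "f \<in> borel_measurable borel" "g \<in> borel_measurable borel" using f g by auto
  have [measurable]: "(\<lambda>x. prod (fst x) (snd x)) \<in> borel_measurable borel"
    by (intro borel_measurable_continuous_onI continuous_on continuous_intros)
  have mp: "(\<lambda>x. prod (u x) (v x)) \<in> borel_measurable N" if [measurable]: "u \<in> borel_measurable N" "v \<in> borel_measurable N" for u v and N :: "'d measure"
    using measurable_compose[of "\<lambda>x. (u x, v x)" N borel "\<lambda>x. prod (fst x) (snd x)" borel] by simp
  define h where "h = (\<lambda>(s, t). prod (f s) (g t))"
  have mh[measurable]: "h \<in> borel_measurable (lborel \<Otimes>\<^sub>M lborel)"
    unfolding h_def case_prod_beta by (rule mp) measurable
  have ih: "integrable (lborel \<Otimes>\<^sub>M lborel) h"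
  proof (rule Bochner_Integration.integrable_bound)
    show "integrable (lborel \<Otimes>\<^sub>M lborel) (\<lambda>(s, t). norm (f s) * norm (g t) * K)"
    proof (rule lborel_pair.Fubini_integrable)
      show "integrable lborel (\<lambda>x. LINT y|lborel. norm (case (x, y) of (s, t) \<Rightarrow> norm (f s) * norm (g t) * K))"
        using f g K(2) by (simp add: abs_mult mult.assoc)
      show "AE x in lborel. integrable lborel (\<lambda>y. case (x, y) of (s, t) \<Rightarrow> norm (f s) * norm (g t) * K)"
        using g by simp
    qed simp
    show "AE x in lborel \<Otimes>\<^sub>M lborel. norm (h x) \<le> norm (case x of (s, t) \<Rightarrow> norm (f s) * norm (g t) * K)"
      using K by (auto simp: h_def)
  qed simp
  \<comment> \<open>The diagonal itself goes to \<open>h1\<close>; in the inner integral of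
    \<open>h2\<close> this affects a single point, hence the almost everywhere argument
    there.\<close>
  define h1 where "h1 = (\<lambda>p. indicator {p. snd p \<le> fst p} p *\<^sub>R h p)"
  define h2 where "h2 = (\<lambda>p. indicator {p. fst p < snd p} p *\<^sub>R h p)"
  have sets2: "sets (lborel \<Otimes>\<^sub>M lborel) = sets (borel :: (real \<times> real) measure)"
    by (metis borel_prod sets_lborel sets_pair_measure_cong)
  have [measurable]: "{p::real \<times> real. snd p \<le> fst p} \<in> sets (lborel \<Otimes>\<^sub>M lborel)"
    "{p::real \<times> real. fst p < snd p} \<in> sets (lborel \<Otimes>\<^sub>M lborel)"
    unfolding sets2 by (intro borel_closed closed_Collect_le borel_open open_Collect_less continuous_intros)+
  have ih1: "integrable (lborel \<Otimes>\<^sub>M lborel) h1"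
    unfolding h1_def by (rule integrable_mult_indicator[OF _ ih]) measurable
  have ih2: "integrable (lborel \<Otimes>\<^sub>M lborel) h2"
    unfolding h2_def by (rule integrable_mult_indicator[OF _ ih]) measurable
  have 1: "(LINT t|lborel. h1 (s, t)) = prod (f s) (LINT t:{..s}|lborel. g t)" for s
  proof -
    have "(LINT t|lborel. h1 (s, t)) = (LINT t|lborel. prod (f s) (indicator {..s} t *\<^sub>R g t))"
      by (intro Bochner_Integration.integral_cong) (auto simp: h1_def h_def zero_right split: split_indicator)
    also have "\<dots> = prod (f s) (LINT t|lborel. indicator {..s} t *\<^sub>R g t)"
      by (rule integral_bounded_linear[OF bounded_linear_right]) (rule integrable_mult_indicator[OF _ g], simp)
    finally show ?thesis by (simp add: set_lebesgue_integral_def)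
  qed
  have 2: "(LINT s|lborel. h2 (s, t)) = prod (LINT s:{..t}|lborel. f s) (g t)" for t
  proof -
    have "(LINT s|lborel. h2 (s, t)) = (LINT s|lborel. prod (indicator {..t} s *\<^sub>R f s) (g t))"
    proof (rule integral_cong_AE)
      have [measurable]: "h2 \<in> borel_measurable (lborel \<Otimes>\<^sub>M lborel)" using ih2 by simp
      show "(\<lambda>s. h2 (s, t)) \<in> borel_measurable lborel" by measurable
      show "(\<lambda>s. prod (indicator {..t} s *\<^sub>R f s) (g t)) \<in> borel_measurable lborel" by (rule mp) measurable
      show "AE s in lborel. h2 (s, t) = prod (indicator {..t} s *\<^sub>R f s) (g t)"
        using AE_lborel_singleton[of t]
        by eventually_elim (auto simp: h2_def h_def zero_left split: split_indicator)
    qed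
    also have "\<dots> = prod (LINT s|lborel. indicator {..t} s *\<^sub>R f s) (g t)"
      by (rule integral_bounded_linear[OF bounded_linear_left]) (rule integrable_mult_indicator[OF _ f], simp)
    finally show ?thesis by (simp add: set_lebesgue_integral_def)
  qed
  show "integrable lborel (\<lambda>t. prod (f t) (LINT s:{..t}|lborel. g s))"
    using lborel_pair.integrable_fst'[OF ih1] by (simp add: 1)
  have "prod (LINT s|lborel. f s) (LINT s|lborel. g s) = (LINT s|lborel. prod (f s) (LINT t|lborel. g t))"
    by (rule integral_bounded_linear[OF bounded_linear_left f, symmetric])
  also have "\<dots> = (LINT s|lborel. (LINT t|lborel. prod (f s) (g t)))"
    by (simp add: integral_bounded_linear[OF bounded_linear_right g])
  also have "\<dots> = integral\<^sup>L (lborel \<Otimes>\<^sub>M lborel) h"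
    using lborel_pair.integral_fst'[OF ih] by (simp add: h_def)
  also have "\<dots> = integral\<^sup>L (lborel \<Otimes>\<^sub>M lborel) (\<lambda>p. h1 p + h2 p)"
    by (intro Bochner_Integration.integral_cong) (auto simp: h1_def h2_def split: split_indicator)
  also have "\<dots> = integral\<^sup>L (lborel \<Otimes>\<^sub>M lborel) h1 + integral\<^sup>L (lborel \<Otimes>\<^sub>M lborel) h2"
    using ih1 ih2 by simp
  also have "integral\<^sup>L (lborel \<Otimes>\<^sub>M lborel) h1 = (LINT s|lborel. prod (f s) (LINT t:{..s}|lborel. g t))"
    using lborel_pair.integral_fst'[OF ih1] by (simp add: 1)
  also have "integral\<^sup>L (lborel \<Otimes>\<^sub>M lborel) h2 = (LINT t|lborel. prod (LINT s:{..t}|lborel. f s) (g t))"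
    using lborel_pair.integral_snd[of "\<lambda>s t. h2 (s, t)"] ih2 by (simp add: 2)
  finally show "prod (LINT s|lborel. f s) (LINT s|lborel. g s)
      = (LINT t|lborel. prod (f t) (LINT s:{..t}|lborel. g s)) + (LINT t|lborel. prod (LINT s:{..t}|lborel. f s) (g t))" .
qed

text \<open>Cutting the densities off outside [0,T] makes their integrals over \<open>{..t}\<close>
  equal to the increments of \<open>F\<close> and \<open>G\<close> from 0; the initial values are
  then restored by bilinearity. No differentiability is assumed, as a drift is only integrable in
  time.\<close>

lemma lebesgue_integration_by_parts:
  fixes f :: "real \<Rightarrow> 'a::euclidean_space" and g :: "real \<Rightarrow> 'b::euclidean_space"
    and prod :: "'a \<Rightarrow> 'b \<Rightarrow> 'c::euclidean_space"
  assumes bb: "bounded_bilinear prod" and T: "0 \<le> T"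
    and f: "set_integrable lborel {0..T} f" and g: "set_integrable lborel {0..T} g"
    and F: "\<And>t. t \<in> {0..T} \<Longrightarrow> F t = F 0 + (LINT s:{0..t}|lborel. f s)"
    and G: "\<And>t. t \<in> {0..T} \<Longrightarrow> G t = G 0 + (LINT s:{0..t}|lborel. g s)"
  shows "set_integrable lborel {0..T} (\<lambda>t. prod (f t) (G t))"
    and "set_integrable lborel {0..T} (\<lambda>t. prod (F t) (g t))"
    and "prod (F T) (G T) = prod (F 0) (G 0) + (LINT t:{0..T}|lborel. prod (f t) (G t) + prod (F t) (g t))"
proof -
  interpret bounded_bilinear prod by fact
  interpret flip: bounded_bilinear "\<lambda>x y. prod y x" by (rule flip)
  define f' where "f' s = indicator {0..T} s *\<^sub>R f s" for s
  define g' where "g' s = indicator {0..T} s *\<^sub>R g s" for s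
  have i: "integrable lborel f'" "integrable lborel g'"
    using f g by (simp_all add: f'_def[abs_def] g'_def[abs_def] set_integrable_def)
  have lef: "(LINT s:{..t}|lborel. f' s) = F t - F 0" if "t \<in> {0..T}" for t
  proof -
    have "(LINT s:{..t}|lborel. f' s) = (LINT s:{0..t}|lborel. f s)"
      unfolding set_lebesgue_integral_def f'_def using that
      by (intro Bochner_Integration.integral_cong) (auto split: split_indicator)
    then show ?thesis using F[OF that] by simp
  qed
  have leg: "(LINT s:{..t}|lborel. g' s) = G t - G 0" if "t \<in> {0..T}" for t
  proof -
    have "(LINT s:{..t}|lborel. g' s) = (LINT s:{0..t}|lborel. g s)"
      unfolding set_lebesgue_integral_def g'_def using that
      by (intro Bochner_Integration.integral_cong) (auto split: split_indicator)
    then show ?thesis using G[OF that] by simp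
  qed
  have tot: "(LINT s|lborel. f' s) = F T - F 0" "(LINT s|lborel. g' s) = G T - G 0"
    using F[of T] G[of T] T by (simp_all add: f'_def g'_def set_lebesgue_integral_def)
  have 1: "prod (f' t) (LINT s:{..t}|lborel. g' s) = indicator {0..T} t *\<^sub>R prod (f t) (G t - G 0)" for t
    using leg[of t] by (auto simp: f'_def zero_left split: split_indicator)
  have 2: "prod (LINT s:{..t}|lborel. f' s) (g' t) = indicator {0..T} t *\<^sub>R prod (F t - F 0) (g t)" for t
    using lef[of t] by (auto simp: g'_def zero_right split: split_indicator)
  note ip = lebesgue_integration_by_parts_zero[OF bb i, unfolded 1 2 tot]
  \<comment> \<open>Exchanging the factors yields integrability of the second integrand, which the
    previous lemma asserts only for the first.\<close>
  note ipf = lebesgue_integration_by_parts_zero(1)[OF flip.bounded_bilinear_axioms i(2) i(1), unfolded 2]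
  have j1: "set_integrable lborel {0..T} (\<lambda>t. prod (f t) (G t - G 0))"
    using ip(1) by (simp add: set_integrable_def)
  have j2: "set_integrable lborel {0..T} (\<lambda>t. prod (F t - F 0) (g t))"
    using ipf by (simp add: set_integrable_def)
  have k1: "set_integrable lborel {0..T} (\<lambda>t. prod (f t) (G 0))"
    using integrable_bounded_linear[OF bounded_linear_left f[unfolded set_integrable_def], of "G 0"]
    by (simp add: set_integrable_def scaleR_left)
  have k2: "set_integrable lborel {0..T} (\<lambda>t. prod (F 0) (g t))"
    using integrable_bounded_linear[OF bounded_linear_right g[unfolded set_integrable_def], of "F 0"]
    by (simp add: set_integrable_def scaleR_right)
  show l1: "set_integrable lborel {0..T} (\<lambda>t. prod (f t) (G t))"
    using set_integral_add(1)[OF j1 k1] by (simp add: diff_right)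
  show l2: "set_integrable lborel {0..T} (\<lambda>t. prod (F t) (g t))"
    using set_integral_add(1)[OF j2 k2] by (simp add: diff_left)
  have m1: "(LINT t:{0..T}|lborel. prod (f t) (G 0)) = prod (F T - F 0) (G 0)"
    using integral_bounded_linear[OF bounded_linear_left f[unfolded set_integrable_def], of "G 0"] tot(1)
    by (simp add: set_lebesgue_integral_def scaleR_left f'_def)
  have m2: "(LINT t:{0..T}|lborel. prod (F 0) (g t)) = prod (F 0) (G T - G 0)"
    using integral_bounded_linear[OF bounded_linear_right g[unfolded set_integrable_def], of "F 0"] tot(2)
    by (simp add: set_lebesgue_integral_def scaleR_right g'_def)
  have "(LINT t:{0..T}|lborel. prod (f t) (G t) + prod (F t) (g t))
     = (LINT t:{0..T}|lborel. prod (f t) (G t - G 0)) + (LINT t:{0..T}|lborel. prod (f t) (G 0))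
      + ((LINT t:{0..T}|lborel. prod (F t - F 0) (g t)) + (LINT t:{0..T}|lborel. prod (F 0) (g t)))"
    unfolding set_integral_add(2)[OF l1 l2] set_integral_add(2)[OF j1 k1, symmetric] set_integral_add(2)[OF j2 k2, symmetric]
    by (simp add: diff_right diff_left)
  also have "\<dots> = prod (F T - F 0) (G T - G 0) + prod (F T - F 0) (G 0) + prod (F 0) (G T - G 0)"
    using ip(2) unfolding m1 m2 by (simp add: set_lebesgue_integral_def)
  also have "\<dots> = prod (F T) (G T) - prod (F 0) (G 0)"
    by (simp add: diff_left diff_right)
  finally show "prod (F T) (G T) = prod (F 0) (G 0) + (LINT t:{0..T}|lborel. prod (f t) (G t) + prod (F t) (g t))"
    by simp
qed

text \<open>The function \<open>g\<close> is not assumed monotone, so its integral over the whole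
  interval enters the bound. The auxiliary \<open>\<psi>\<close> is nonincreasing because its
  derivative at s is at most (exp(-K s) - 1) g(s).\<close>

lemma gronwall:
  fixes u g :: "real \<Rightarrow> real"
  assumes u: "continuous_on {0..T} u" and g: "continuous_on {0..T} g" and g0: "\<And>t. t \<in> {0..T} \<Longrightarrow> 0 \<le> g t"
    and K: "0 \<le> K" and le: "\<And>t. t \<in> {0..T} \<Longrightarrow> u t \<le> g t + K * integral {0..t} u"
    and t: "t \<in> {0..T}"
  shows "u t \<le> g t + K * exp (K * T) * integral {0..T} g"
proof -
  define \<phi> where "\<phi> t = integral {0..t} u" for t
  define \<psi> where "\<psi> t = exp (- K * t) * \<phi> t - integral {0..t} g" for t
  have d\<phi>: "(\<phi> has_real_derivative u s) (at s within {0..T})" if "s \<in> {0..T}" for s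
    unfolding \<phi>_def has_real_derivative_iff_has_vector_derivative
    by (rule integral_has_vector_derivative[OF u that])
  have dg: "((\<lambda>t. integral {0..t} g) has_real_derivative g s) (at s within {0..T})" if "s \<in> {0..T}" for s
    unfolding has_real_derivative_iff_has_vector_derivative
    by (rule integral_has_vector_derivative[OF g that])
  have d\<psi>: "(\<psi> has_real_derivative (exp (- K * s) * (u s - K * \<phi> s) - g s)) (at s within {0..T})" if "s \<in> {0..T}" for s
    unfolding \<psi>_def
    by (rule derivative_eq_intros d\<phi>[OF that] dg[OF that] refl)+ (simp add: algebra_simps)
  have "\<psi> t \<le> \<psi> 0"
  proof (cases "t = 0")
    case False
    then have t0: "0 < t" using t by auto
    have "\<exists>x\<in>{0<..<t}. \<psi> t - \<psi> 0 = (exp (- K * x) * (u x - K * \<phi> x) - g x) * (t - 0)"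
    proof (rule mvt_simple[OF t0])
      fix x assume "0 \<le> x" "x \<le> t"
      then have "x \<in> {0..T}" using t by auto
      from d\<psi>[OF this] show "(\<psi> has_derivative (*) (exp (- K * x) * (u x - K * \<phi> x) - g x)) (at x within {0..t})"
        unfolding has_field_derivative_def by (rule has_derivative_subset) (use t in auto)
    qed
    then obtain x where x: "x \<in> {0<..<t}" "\<psi> t - \<psi> 0 = (exp (- K * x) * (u x - K * \<phi> x) - g x) * t" by auto
    then have xT: "x \<in> {0..T}" using t by auto
    have "exp (- K * x) * (u x - K * \<phi> x) \<le> exp (- K * x) * g x"
      using le[OF xT] by (intro mult_left_mono) (auto simp: \<phi>_def)
    also have "\<dots> \<le> 1 * g x" using x K g0[OF xT] by (intro mult_right_mono) auto
    finally have "(exp (- K * x) * (u x - K * \<phi> x) - g x) * t \<le> 0"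
      using t0 by (simp add: mult_nonpos_nonneg)
    then show ?thesis using x by simp
  qed simp
  then have "exp (- K * t) * \<phi> t \<le> integral {0..t} g" by (simp add: \<psi>_def \<phi>_def)
  also have "\<dots> \<le> integral {0..T} g"
    using t by (intro integral_subset_le integrable_continuous_interval g continuous_on_subset[OF g]) (auto intro: g0)
  finally have "exp (K * t) * (exp (- K * t) * \<phi> t) \<le> exp (K * t) * integral {0..T} g"
    by (intro mult_left_mono) auto
  then have "\<phi> t \<le> exp (K * t) * integral {0..T} g"
    by (simp add: mult.assoc[symmetric] exp_add[symmetric])
  also have "\<dots> \<le> exp (K * T) * integral {0..T} g"
    using t K by (intro mult_right_mono integral_nonneg integrable_continuous_interval g) (auto simp: mult_left_mono intro: g0)
  finally have "K * \<phi> t \<le> K * (exp (K * T) * integral {0..T} g)"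
    using K by (intro mult_left_mono)
  then show ?thesis using le[OF t] by (simp add: \<phi>_def mult.assoc)
qed

text \<open>Gronwall's inequality with zero inhomogeneity. Only a growth bound on the derivative is
  asked for, so that matrix equations with multiplication on either side are covered.\<close>

lemma linear_ode_zero:
  fixes x :: "real \<Rightarrow> 'a::euclidean_space"
  assumes d: "\<And>t. t \<in> {0..T} \<Longrightarrow> (x has_vector_derivative y t) (at t within {0..T})"
    and y: "\<And>t. t \<in> {0..T} \<Longrightarrow> norm (y t) \<le> K * norm (x t)"
    and K: "0 \<le> K" and x0: "x 0 = 0" and t: "t \<in> {0..T}"
  shows "x t = 0"
proof -
  have cx: "continuous_on {0..T} x"
    using d by (meson continuous_on_eq_continuous_within has_vector_derivative_continuous)
  have "norm (x s) \<le> 0 + K * integral {0..s} (\<lambda>r. norm (x r))" if s: "s \<in> {0..T}" for s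
  proof -
    have "(y has_integral (x s - x 0)) {0..s}"
      using s by (intro fundamental_theorem_of_calculus has_vector_derivative_within_subset[OF d]) auto
    moreover have "((\<lambda>r. K * norm (x r)) has_integral (K * integral {0..s} (\<lambda>r. norm (x r)))) {0..s}"
      using s by (intro has_integral_mult_right integrable_integral integrable_continuous_interval continuous_intros
         continuous_on_subset[OF cx]) auto
    ultimately have "norm (integral {0..s} y) \<le> integral {0..s} (\<lambda>r. K * norm (x r))"
      using s y by (intro integral_norm_bound_integral) auto
    then show ?thesis
      using \<open>(y has_integral (x s - x 0)) {0..s}\<close> x0 by (simp add: integral_unique)
  qed
  from gronwall[OF _ _ _ K this t] have "norm (x t) \<le> 0 + K * exp (K * T) * integral {0..T} (\<lambda>_. 0::real)"
    using cx by (auto intro: continuous_intros)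
  then show ?thesis by simp
qed



text \<open>Picard iteration written as a series: by linearity \<open>X k\<close> is the k-fold
  iterated integral, bounded by the norm of \<open>x0\<close> times (K t)^k / k!. This is summable
  uniformly in time, also for the derivatives, so the series may be differentiated term by
  term.\<close>

lemma linear_ode_exists:
  fixes f :: "real \<Rightarrow> 'a::euclidean_space \<Rightarrow> 'a"
  assumes T: "0 < T" and lin: "\<And>t. t \<in> {0..T} \<Longrightarrow> linear (f t)"
    and cont: "\<And>x. continuous_on {0..T} x \<Longrightarrow> continuous_on {0..T} (\<lambda>t. f t (x t))"
    and K: "0 \<le> K" "\<And>t x. t \<in> {0..T} \<Longrightarrow> norm (f t x) \<le> K * norm x"
  shows "\<exists>x. x 0 = x0 \<and> (\<forall>t\<in>{0..T}. (x has_vector_derivative f t (x t)) (at t within {0..T}))"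
proof -
  define X where "X = rec_nat (\<lambda>_. x0) (\<lambda>_ y t. integral {0..t} (\<lambda>s. f s (y s)))"
  have X0: "X 0 = (\<lambda>_. x0)" and XS: "X (Suc k) = (\<lambda>t. integral {0..t} (\<lambda>s. f s (X k s)))" for k
    by (simp_all add: X_def)
  have cX: "continuous_on {0..T} (X k)" for k
  proof (induction k)
    case (Suc k)
    show ?case unfolding XS by (intro indefinite_integral_continuous_1 integrable_continuous_interval cont Suc)
  qed (simp add: X0)
  have dX: "(X (Suc k) has_vector_derivative f t (X k t)) (at t within {0..T})" if "t \<in> {0..T}" for k t
    unfolding XS by (rule integral_has_vector_derivative[OF cont[OF cX] that])
  have XS0: "X (Suc k) 0 = 0" for k by (simp add: XS)
  have bX: "norm (X k t) \<le> norm x0 * ((K * t) ^ k / fact k)" if "t \<in> {0..T}" for k t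
    using that
  proof (induction k arbitrary: t)
    case (Suc k)
    have cb: "((\<lambda>s. norm x0 * K * ((K * s) ^ k / fact k)) has_integral
        norm x0 * ((K * t) ^ Suc k / fact (Suc k)) - norm x0 * ((K * 0) ^ Suc k / fact (Suc k))) {0..t}"
    proof (rule fundamental_theorem_of_calculus)
      fix s assume "s \<in> {0..t}"
      have "((\<lambda>s. norm x0 * ((K * s) ^ Suc k / fact (Suc k))) has_real_derivative
          norm x0 * (real (Suc k) * (K * (K * s) ^ (Suc k - Suc 0)) / fact (Suc k))) (at s within {0..t})"
        by (intro DERIV_cmult DERIV_cdivide DERIV_power) (rule DERIV_cmult_Id)
      moreover have "norm x0 * (real (Suc k) * (K * (K * s) ^ (Suc k - Suc 0)) / fact (Suc k)) = norm x0 * K * ((K * s) ^ k / fact k)"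
        by (simp add: field_simps del: of_nat_Suc)
      ultimately show "((\<lambda>s. norm x0 * ((K * s) ^ Suc k / fact (Suc k))) has_vector_derivative norm x0 * K * ((K * s) ^ k / fact k)) (at s within {0..t})"
        by (simp only: has_real_derivative_iff_has_vector_derivative)
    qed (use Suc.prems in auto)
    have "norm (X (Suc k) t) \<le> integral {0..t} (\<lambda>s. norm x0 * K * ((K * s) ^ k / fact k))"
      unfolding XS
    proof (rule integral_norm_bound_integral)
      show "(\<lambda>s. f s (X k s)) integrable_on {0..t}"
        using Suc.prems by (intro integrable_continuous_interval continuous_on_subset[OF cont[OF cX]]) auto
      show "(\<lambda>s. norm x0 * K * ((K * s) ^ k / fact k)) integrable_on {0..t}"
        using cb by blast
      fix s assume s: "s \<in> {0..t}"
      then have sT: "s \<in> {0..T}" using Suc.prems by auto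
      have "norm (f s (X k s)) \<le> K * norm (X k s)" by (rule K(2)[OF sT])
      also have "\<dots> \<le> K * (norm x0 * ((K * s) ^ k / fact k))" by (rule mult_left_mono[OF Suc.IH[OF sT] K(1)])
      finally show "norm (f s (X k s)) \<le> norm x0 * K * ((K * s) ^ k / fact k)" by (simp add: mult_ac)
    qed
    also have "\<dots> = norm x0 * ((K * t) ^ Suc k / fact (Suc k))"
      using integral_unique[OF cb] by simp
    finally show ?case .
  qed (simp add: X0)
  define c where "c k = norm x0 * ((K * T) ^ k / fact k)" for k
  have cpos: "norm (X k t) \<le> c k" if t: "t \<in> {0..T}" for k t
  proof -
    have "(K * t) ^ k \<le> (K * T) ^ k" using t K by (intro power_mono mult_left_mono) auto
    then have "norm x0 * ((K * t) ^ k / fact k) \<le> c k"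
      unfolding c_def by (intro mult_left_mono divide_right_mono) auto
    then show ?thesis using bX[OF t, of k] by linarith
  qed
  have sc: "summable c"
    unfolding c_def using summable_exp[of "K * T"] by (intro summable_mult) (simp add: inverse_eq_divide field_simps)
  define x where "x t = (\<Sum>k. X k t)" for t
  have ul: "uniform_limit {0..T} (\<lambda>n t. \<Sum>k<n. X k t) x sequentially"
    unfolding x_def by (rule Weierstrass_m_test[OF _ sc]) (rule cpos)
  \<comment> \<open>\<open>Y k\<close> is the derivative of \<open>X k\<close>. It lags by one
    index, so the first \<open>Suc n\<close> derivatives add up to \<open>f t\<close> applied to the
    first n terms.\<close>
  define Y where "Y k t = (case k of 0 \<Rightarrow> 0 | Suc k \<Rightarrow> f t (X k t))" for k t
  have "\<exists>g. \<forall>t\<in>{0..T}. (\<lambda>k. X k t) sums g t \<and> (g has_derivative (\<lambda>h. h *\<^sub>R f t (x t))) (at t within {0..T})"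
  proof (rule has_derivative_series[where f'="\<lambda>k t h. h *\<^sub>R Y k t"])
    show "(X k has_derivative (\<lambda>h. h *\<^sub>R Y k t)) (at t within {0..T})" if "t \<in> {0..T}" for k t
      using dX[OF that] by (cases k) (auto simp: Y_def X0 has_vector_derivative_def)
    show "(\<lambda>k. X k 0) sums x0"
      using sums_single[of 0 "\<lambda>k. x0"] by (rule sums_cong[THEN iffD1, rotated]) (auto simp: X0 XS gr0_conv_Suc)
    fix e :: real assume e: "0 < e"
    have "\<forall>\<^sub>F n in sequentially. \<forall>t\<in>{0..T}. dist (\<Sum>k<n. X k t) (x t) < e / (K + 1)"
      using uniform_limitD[OF ul, of "e / (K + 1)"] e K(1) by simp
    then have "\<forall>\<^sub>F n in sequentially. \<forall>t\<in>{0..T}. \<forall>h. norm ((\<Sum>k<Suc n. h *\<^sub>R Y k t) - h *\<^sub>R f t (x t)) \<le> e * norm h"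
    proof eventually_elim
      case (elim n)
      show ?case
      proof (intro ballI allI)
        fix t h assume t: "t \<in> {0..T}"
        have "(\<Sum>k<Suc n. Y k t) = f t (\<Sum>k<n. X k t)"
          unfolding sum.lessThan_Suc_shift by (simp add: Y_def linear_sum[OF lin[OF t]])
        then have "norm ((\<Sum>k<Suc n. h *\<^sub>R Y k t) - h *\<^sub>R f t (x t)) = \<bar>h\<bar> * norm (f t ((\<Sum>k<n. X k t) - x t))"
          by (simp add: scaleR_sum_right[symmetric] scaleR_diff_right[symmetric] linear_diff[OF lin[OF t]])
        also have "\<dots> \<le> \<bar>h\<bar> * (K * norm ((\<Sum>k<n. X k t) - x t))"
          by (intro mult_left_mono K(2) t) auto
        also have "\<dots> \<le> \<bar>h\<bar> * ((K + 1) * (e / (K + 1)))"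
          using elim t K(1) e by (intro mult_left_mono mult_mono) (auto simp: dist_norm less_imp_le)
        finally show "norm ((\<Sum>k<Suc n. h *\<^sub>R Y k t) - h *\<^sub>R f t (x t)) \<le> e * norm h"
          using K(1) by (simp add: mult.commute)
      qed
    qed
    then show "\<forall>\<^sub>F n in sequentially. \<forall>t\<in>{0..T}. \<forall>h. norm ((\<Sum>k<n. h *\<^sub>R Y k t) - h *\<^sub>R f t (x t)) \<le> e * norm h"
      by (rule eventually_sequentially_Suc[THEN iffD1])
  qed (use T in auto)
  then obtain g where g: "\<And>t. t \<in> {0..T} \<Longrightarrow> (\<lambda>k. X k t) sums g t"
    "\<And>t. t \<in> {0..T} \<Longrightarrow> (g has_derivative (\<lambda>h. h *\<^sub>R f t (x t))) (at t within {0..T})" by blast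
  have gx: "g t = x t" if "t \<in> {0..T}" for t
    using g(1)[OF that] by (simp add: x_def sums_iff)
  have "g 0 = x0"
  proof -
    have "(\<lambda>k. X k 0) sums x0"
      using sums_single[of 0 "\<lambda>k. x0"] by (rule sums_cong[THEN iffD1, rotated]) (auto simp: X0 XS gr0_conv_Suc)
    then show ?thesis using g(1)[of 0] T sums_unique2 by auto
  qed
  moreover have "(g has_vector_derivative f t (g t)) (at t within {0..T})" if "t \<in> {0..T}" for t
    using g(2)[OF that] by (simp add: gx[OF that] has_vector_derivative_def)
  ultimately show ?thesis by blast
qed

text \<open>Rounding time down to multiples of 1/(n+1) leaves countably many values, so the rounded
  process is jointly measurable; continuity of the paths carries this over to the limit.\<close>

lemma measurable_continuous_process:
  fixes X :: "real \<Rightarrow> 'w \<Rightarrow> 'a::euclidean_space"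
  assumes T: "0 \<le> T" and m: "\<And>t. t \<in> {0..T} \<Longrightarrow> X t \<in> borel_measurable N"
    and c: "\<And>\<omega>. \<omega> \<in> space N \<Longrightarrow> continuous_on {0..T} (\<lambda>t. X t \<omega>)"
  shows "(\<lambda>(t, \<omega>). X t \<omega>) \<in> borel_measurable (restrict_space borel {0..T} \<Otimes>\<^sub>M N)"
proof -
  \<comment> \<open>The minimum with \<open>T\<close> guards the countable decomposition below,
    which runs over all natural \<open>i\<close>, while \<open>X\<close> is known to be measurable
    only at times in [0,T].\<close>
  define d where "d n t = min T (real (nat \<lfloor>real (Suc n) * t\<rfloor>) / real (Suc n))" for n and t :: real
  have [measurable]: "(\<lambda>p. fst p) \<in> borel_measurable (restrict_space borel {0..T} \<Otimes>\<^sub>M N)"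
    by (rule measurable_compose[OF measurable_fst]) (rule measurable_restrict_space1, simp)
  show ?thesis
  proof (rule borel_measurable_LIMSEQ_metric)
    fix n
    have "(\<lambda>p. X (min T (real (nat \<lfloor>real (Suc n) * fst p\<rfloor>) / real (Suc n))) (snd p))
       \<in> borel_measurable (restrict_space borel {0..T} \<Otimes>\<^sub>M N)"
    proof (rule measurable_compose_countable[where f="\<lambda>i p. X (min T (real i / real (Suc n))) (snd p)"])
      fix i :: nat
      show "(\<lambda>p. X (min T (real i / real (Suc n))) (snd p)) \<in> borel_measurable (restrict_space borel {0..T} \<Otimes>\<^sub>M N)"
        by (rule measurable_compose[OF measurable_snd]) (rule m, use T in auto)
    next
      show "(\<lambda>p. nat \<lfloor>real (Suc n) * fst p\<rfloor>) \<in> restrict_space borel {0..T} \<Otimes>\<^sub>M N \<rightarrow>\<^sub>M count_space UNIV"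
        by measurable
    qed
    then show "(\<lambda>(t, \<omega>). X (d n t) \<omega>) \<in> borel_measurable (restrict_space borel {0..T} \<Otimes>\<^sub>M N)"
      by (simp add: d_def case_prod_beta)
  next
    fix p assume "p \<in> space (restrict_space borel {0..T} \<Otimes>\<^sub>M N)"
    then obtain t \<omega> where p: "p = (t, \<omega>)" "t \<in> {0..T}" "\<omega> \<in> space N"
      by (auto simp: space_pair_measure space_restrict_space)
    have dn: "\<bar>d n t - t\<bar> \<le> 1 / real (Suc n)" "d n t \<in> {0..T}" for n
    proof -
      define k where "k = nat \<lfloor>real (Suc n) * t\<rfloor>"
      have "0 \<le> real (Suc n) * t" using p by auto
      then have k: "real k \<le> real (Suc n) * t" "real (Suc n) * t < real k + 1"
        unfolding k_def by linarith+
      have a: "real k / real (Suc n) \<le> t" using k(1) by (simp add: divide_le_eq mult.commute del: of_nat_Suc)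
      have "t < (real k + 1) / real (Suc n)"
        using k(2) by (simp add: pos_less_divide_eq mult.commute del: of_nat_Suc)
      then have b: "t - 1 / real (Suc n) \<le> real k / real (Suc n)"
        by (simp add: add_divide_distrib del: of_nat_Suc)
      have "d n t = real k / real (Suc n)" using a p by (simp add: d_def k_def[symmetric] min_def del: of_nat_Suc)
      then show "\<bar>d n t - t\<bar> \<le> 1 / real (Suc n)" "d n t \<in> {0..T}"
        using a b p by (auto simp del: of_nat_Suc)
    qed
    have "(\<lambda>n. d n t - t) \<longlonglongrightarrow> 0"
      by (rule Lim_null_comparison[where g="\<lambda>n. 1 / real (Suc n)"])
         (use dn(1) LIMSEQ_inverse_real_of_nat in \<open>auto simp: inverse_eq_divide\<close>)
    then have "(\<lambda>n. d n t) \<longlonglongrightarrow> t" by (simp add: LIM_zero_iff)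
    then have "(\<lambda>n. X (d n t) \<omega>) \<longlonglongrightarrow> X t \<omega>"
      using continuous_on_tendsto_compose[OF c[OF p(3)], of "\<lambda>n. d n t" t sequentially] p(2) dn(2) by auto
    then show "(\<lambda>n. (\<lambda>(t, \<omega>). X (d n t) \<omega>) p) \<longlonglongrightarrow> (\<lambda>(t, \<omega>). X t \<omega>) p" by (simp add: p)
  qed
qed

lemma borel_measurable_integral_continuous_process:
  fixes X :: "real \<Rightarrow> 'w \<Rightarrow> 'a::euclidean_space"
  assumes T: "0 \<le> T" and m: "\<And>t. t \<in> {0..T} \<Longrightarrow> X t \<in> borel_measurable N"
    and c: "\<And>\<omega>. \<omega> \<in> space N \<Longrightarrow> continuous_on {0..T} (\<lambda>t. X t \<omega>)"
  shows "(\<lambda>\<omega>. LINT s:{0..T}|lborel. X s \<omega>) \<in> borel_measurable N"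
proof -
  have "(\<lambda>(\<omega>, t). X t \<omega>) \<in> borel_measurable (N \<Otimes>\<^sub>M restrict_space borel {0..T})"
    using measurable_pair_swap[OF measurable_continuous_process[of T X N, OF T m c]]
    by (simp add: case_prod_beta)
  also have "borel_measurable (N \<Otimes>\<^sub>M restrict_space borel {0..T}) = borel_measurable (N \<Otimes>\<^sub>M restrict_space lborel {0..T})"
    by (intro measurable_cong_sets sets_pair_measure_cong sets_restrict_space_cong refl) simp
  finally have [measurable]: "(\<lambda>(\<omega>, t). X t \<omega>) \<in> borel_measurable (N \<Otimes>\<^sub>M restrict_space lborel {0..T})" .
  interpret sigma_finite_measure "restrict_space lborel {0..T}"
    by (rule sigma_finite_measure_restrict_space) (auto intro: lborel.sigma_finite_measure_axioms)
  have "(\<lambda>\<omega>. LINT s|restrict_space lborel {0..T}. X s \<omega>) \<in> borel_measurable N"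
    by (rule borel_measurable_lebesgue_integral) simp
  then show ?thesis
    by (simp add: integral_restrict_space set_lebesgue_integral_def)
qed

text \<open>Kolmogorov's maximal inequality for an adapted sequence with orthogonal increments.\<close>

lemma (in prob_space) maximal_inequality:
  fixes X :: "nat \<Rightarrow> 'a \<Rightarrow> 'b::euclidean_space"
  assumes a: "0 \<le> a"
    and X: "\<And>k. k \<le> n \<Longrightarrow> X k \<in> borel_measurable M"
    and sq: "\<And>k. k \<le> n \<Longrightarrow> integrable M (\<lambda>\<omega>. (norm (X k \<omega>))\<^sup>2)"
    and orth: "\<And>k. k \<le> n \<Longrightarrow>
       (LINT \<omega>|M. indicator {\<omega>\<in>space M. a < norm (X k \<omega>) \<and> (\<forall>i<k. norm (X i \<omega>) \<le> a)} \<omega> * (X k \<omega> \<bullet> (X n \<omega> - X k \<omega>))) = 0"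
  shows "a\<^sup>2 * prob {\<omega>\<in>space M. \<exists>k\<le>n. a < norm (X k \<omega>)} \<le> (LINT \<omega>|M. (norm (X n \<omega>))\<^sup>2)"
proof -
  define A where "A k = {\<omega>\<in>space M. a < norm (X k \<omega>) \<and> (\<forall>i<k. norm (X i \<omega>) \<le> a)}" for k
  have mA: "A k \<in> events" if "k \<le> n" for k
  proof -
    have [measurable]: "X k \<in> borel_measurable M" using X that by simp
    have "{\<omega>\<in>space M. i < k \<longrightarrow> norm (X i \<omega>) \<le> a} \<in> events" for i
    proof (cases "i < k")
      case True
      then have [measurable]: "X i \<in> borel_measurable M" using X that by simp
      show ?thesis by measurable
    qed simp
    then have all: "{\<omega>\<in>space M. \<forall>i<k. norm (X i \<omega>) \<le> a} \<in> events" by (rule sets.sets_Collect_countable_All)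
    have 1: "{\<omega>\<in>space M. a < norm (X k \<omega>)} \<in> events" by measurable
    have eq: "A k = {\<omega>\<in>space M. a < norm (X k \<omega>)} \<inter> {\<omega>\<in>space M. \<forall>i<k. norm (X i \<omega>) \<le> a}"
      unfolding A_def by blast
    show ?thesis unfolding eq by (rule sets.Int[OF 1 all])
  qed
  have disj: "disjoint_family_on A {..n}"
  proof -
    have "A i \<inter> A j = {}" if "i < j" for i j
    proof -
      have "\<omega> \<notin> A j" if "\<omega> \<in> A i" for \<omega>
      proof
        assume "\<omega> \<in> A j"
        then have "norm (X i \<omega>) \<le> a" using \<open>i < j\<close> by (simp add: A_def)
        then show False using that by (simp add: A_def)
      qed
      then show ?thesis by blast
    qed
    then show ?thesis unfolding disjoint_family_on_def by (metis Int_commute linorder_neqE_nat)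
  qed
  have U: "{\<omega>\<in>space M. \<exists>k\<le>n. a < norm (X k \<omega>)} = (\<Union>k\<in>{..n}. A k)"
  proof safe
    fix \<omega> k assume "\<omega> \<in> space M" "k \<le> n" "a < norm (X k \<omega>)"
    define j where "j = (LEAST k. a < norm (X k \<omega>))"
    have "a < norm (X j \<omega>)" unfolding j_def by (rule LeastI) fact
    moreover have "j \<le> k" unfolding j_def by (rule Least_le) fact
    moreover have "norm (X i \<omega>) \<le> a" if "i < j" for i
      using not_less_Least[of i "\<lambda>k. a < norm (X k \<omega>)"] that by (simp add: j_def not_less)
    ultimately show "\<omega> \<in> (\<Union>k\<in>{..n}. A k)" using \<open>\<omega> \<in> space M\<close> \<open>k \<le> n\<close> by (auto simp: A_def)
  qed (auto simp: A_def)
  have dom: "integrable M (\<lambda>\<omega>. X k \<omega> \<bullet> (X n \<omega> - X k \<omega>))" if "k \<le> n" for k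
  proof (rule Bochner_Integration.integrable_bound)
    show "integrable M (\<lambda>\<omega>. 2 * (norm (X k \<omega>))\<^sup>2 + (norm (X n \<omega>))\<^sup>2)"
      using sq[OF that] sq[of n] by simp
    show "AE \<omega> in M. norm (X k \<omega> \<bullet> (X n \<omega> - X k \<omega>)) \<le> norm (2 * (norm (X k \<omega>))\<^sup>2 + (norm (X n \<omega>))\<^sup>2)"
    proof (rule AE_I2)
      fix \<omega>
      have "norm (X k \<omega> \<bullet> (X n \<omega> - X k \<omega>)) \<le> norm (X k \<omega>) * norm (X n \<omega> - X k \<omega>)"
        by (simp add: Cauchy_Schwarz_ineq2)
      also have "\<dots> \<le> norm (X k \<omega>) * (norm (X n \<omega>) + norm (X k \<omega>))"
        by (intro mult_left_mono norm_triangle_ineq4) auto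
      also have "\<dots> \<le> 2 * (norm (X k \<omega>))\<^sup>2 + (norm (X n \<omega>))\<^sup>2"
        using sum_squares_bound[of "norm (X k \<omega>)" "norm (X n \<omega>)"] mult_nonneg_nonneg[OF norm_ge_zero[of "X k \<omega>"] norm_ge_zero[of "X n \<omega>"]]
        unfolding power2_eq_square distrib_left by linarith
      finally show "norm (X k \<omega> \<bullet> (X n \<omega> - X k \<omega>)) \<le> norm (2 * (norm (X k \<omega>))\<^sup>2 + (norm (X n \<omega>))\<^sup>2)" by simp
    qed
    have [measurable]: "X k \<in> borel_measurable M" "X n \<in> borel_measurable M" using X that by auto
    show "(\<lambda>\<omega>. X k \<omega> \<bullet> (X n \<omega> - X k \<omega>)) \<in> borel_measurable M" by measurable
  qed
  \<comment> \<open>The square of \<open>X n\<close> is expanded around \<open>X k\<close>: the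
    mixed term has mean zero over \<open>A k\<close>, and the square of the difference is
    dropped.\<close>
  have step: "a\<^sup>2 * prob (A k) \<le> (LINT \<omega>|M. indicator (A k) \<omega> * (norm (X n \<omega>))\<^sup>2)" if k: "k \<le> n" for k
  proof -
    have i1: "integrable M (\<lambda>\<omega>. indicator (A k) \<omega> * (norm (X n \<omega>))\<^sup>2)"
      using integrable_mult_indicator[OF mA[OF k] sq[of n]] by simp
    have i2: "integrable M (\<lambda>\<omega>. indicator (A k) \<omega> * (X k \<omega> \<bullet> (X n \<omega> - X k \<omega>)))"
      using integrable_mult_indicator[OF mA[OF k] dom[OF k]] by simp
    have i3: "integrable M (\<lambda>\<omega>. a\<^sup>2 * indicator (A k) \<omega>)"
      using mA[OF k] by (simp add: emeasure_eq_measure)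
    have "a\<^sup>2 * prob (A k) = (LINT \<omega>|M. a\<^sup>2 * indicator (A k) \<omega> + 2 * (indicator (A k) \<omega> * (X k \<omega> \<bullet> (X n \<omega> - X k \<omega>))))"
      using i2 i3 orth[OF k] mA[OF k] by (simp add: A_def[symmetric])
    also have "\<dots> \<le> (LINT \<omega>|M. indicator (A k) \<omega> * (norm (X n \<omega>))\<^sup>2)"
    proof (rule integral_mono)
      fix \<omega>
      show "a\<^sup>2 * indicator (A k) \<omega> + 2 * (indicator (A k) \<omega> * (X k \<omega> \<bullet> (X n \<omega> - X k \<omega>))) \<le> indicator (A k) \<omega> * (norm (X n \<omega>))\<^sup>2"
      proof (cases "\<omega> \<in> A k")
        case True
        then have "a\<^sup>2 \<le> (norm (X k \<omega>))\<^sup>2" using a by (auto simp: A_def)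
        moreover have "(norm (X n \<omega>))\<^sup>2 = (norm (X k \<omega>))\<^sup>2 + 2 * (X k \<omega> \<bullet> (X n \<omega> - X k \<omega>)) + (norm (X n \<omega> - X k \<omega>))\<^sup>2"
          by (simp add: power2_norm_eq_inner inner_diff_left inner_diff_right inner_commute)
        ultimately show ?thesis using True by (simp add: add_increasing2)
      qed simp
    qed (use i1 i2 i3 in simp_all)
    finally show ?thesis .
  qed
  have "a\<^sup>2 * prob {\<omega>\<in>space M. \<exists>k\<le>n. a < norm (X k \<omega>)} = (\<Sum>k\<le>n. a\<^sup>2 * prob (A k))"
    unfolding U using mA disj by (subst finite_measure_finite_Union) (auto simp: sum_distrib_left)
  also have "\<dots> \<le> (\<Sum>k\<le>n. LINT \<omega>|M. indicator (A k) \<omega> * (norm (X n \<omega>))\<^sup>2)"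
    by (intro sum_mono step) auto
  also have "\<dots> = (LINT \<omega>|M. (\<Sum>k\<le>n. indicator (A k) \<omega> * (norm (X n \<omega>))\<^sup>2))"
    using integrable_mult_indicator[OF mA sq[of n]] by (subst Bochner_Integration.integral_sum) auto
  also have "\<dots> \<le> (LINT \<omega>|M. (norm (X n \<omega>))\<^sup>2)"
  proof (rule integral_mono)
    show "integrable M (\<lambda>\<omega>. \<Sum>k\<le>n. indicator (A k) \<omega> * (norm (X n \<omega>))\<^sup>2)"
      using integrable_mult_indicator[OF mA sq[of n]] by (intro Bochner_Integration.integrable_sum) auto
    fix \<omega>
    have "(\<Sum>k\<le>n. indicator (A k) \<omega>) = (indicator (\<Union>k\<in>{..n}. A k) \<omega> :: real)"
      using disj by (subst indicator_UN_disjoint) auto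
    then show "(\<Sum>k\<le>n. indicator (A k) \<omega> * (norm (X n \<omega>))\<^sup>2) \<le> (norm (X n \<omega>))\<^sup>2"
      by (simp add: sum_distrib_right[symmetric] mult_left_le_one_le indicator_le_1)
  qed (rule sq, simp)
  finally show ?thesis .
qed

section \<open>The filtration of the Wiener process\<close>

lemma space_generated_algebra [simp]: "space (generated_algebra M S X) = space M"
  unfolding generated_algebra_def by (rule space_measure_of) auto

lemma sets_generated_algebra:
  "sets (generated_algebra M S X) = sigma_sets (space M) (\<Union>s\<in>S. {X s -` E \<inter> space M | E. E \<in> sets borel})"
  unfolding generated_algebra_def by (rule sets_measure_of) auto

lemma measurable_generated_algebra:
  "s \<in> S \<Longrightarrow> X s \<in> borel_measurable (generated_algebra M S X)"
  by (rule measurableI) (auto simp: sets_generated_algebra)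

lemma sets_generated_algebra_subset:
  assumes "space N = space M" "\<And>s. s \<in> S \<Longrightarrow> X s \<in> borel_measurable N"
  shows "sets (generated_algebra M S X) \<subseteq> sets N"
proof -
  have "(\<Union>s\<in>S. {X s -` E \<inter> space M | E. E \<in> sets borel}) \<subseteq> sets N"
    using assms measurable_sets[of "X _" N borel] by auto
  then show ?thesis
    unfolding sets_generated_algebra assms(1)[symmetric] by (rule sets.sigma_sets_subset)
qed

lemma measurable_subalgebra:
  assumes "f \<in> measurable N B" "space N = space M" "sets N \<subseteq> sets M"
  shows "f \<in> measurable M B"
  using assms by (auto simp: measurable_def)

locale wiener_setup = prob_space M for M :: "'w measure" +
  fixes T :: real and w :: "real \<Rightarrow> 'w \<Rightarrow> real^'p" and x0 :: "'w \<Rightarrow> real^'n" and S0 :: "real^'n^'n"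
  assumes T_pos: "0 < T" and wiener: "wiener_process M T w"
    and distributed_x0: "distributed M lborel x0 (gaussian_density S0)" and pos_def_S0: "pos_def S0"
    and indep_x0: "indep_set (sets (vimage_algebra (space M) x0 borel)) (sets (generated_algebra M {0..T} w))"
begin

abbreviation F :: "real \<Rightarrow> 'w measure" where "F \<equiv> augmented_filtration M w x0"

lemma measurable_x0 [measurable]: "x0 \<in> borel_measurable M"
  using distributed_x0 by (simp add: distributed_def)

lemma measurable_w: "t \<in> {0..T} \<Longrightarrow> w t \<in> borel_measurable M"
  using wiener by (simp add: wiener_process_def)

lemma sets_vimage_x0: "sets (vimage_algebra (space M) x0 borel) \<subseteq> events"
  using indep_setD_ev1[OF indep_x0] .

lemma sets_generated_w: "t \<le> T \<Longrightarrow> sets (generated_algebra M {0..t} w) \<subseteq> events"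
  by (rule sets_generated_algebra_subset) (auto intro: measurable_w)

lemma generators_F:
  assumes "t \<le> T"
  shows "sets (vimage_algebra (space M) x0 borel) \<union> sets (generated_algebra M {0..t} w) \<union> null_sets M \<subseteq> events"
  using sets_vimage_x0 sets_generated_w[OF assms] by auto

lemma space_F [simp]: "t \<le> T \<Longrightarrow> space (F t) = space M"
  unfolding augmented_filtration_def
  using generators_F[of t] sets.space_closed[of M] by (subst space_measure_of) auto

lemma sets_F:
  assumes "t \<le> T"
  shows "sets (F t) = sigma_sets (space M)
    (sets (vimage_algebra (space M) x0 borel) \<union> sets (generated_algebra M {0..t} w) \<union> null_sets M)"
  unfolding augmented_filtration_def
  using generators_F[OF assms] sets.space_closed[of M] by (subst sets_measure_of) auto

lemma sets_F_subset: "t \<le> T \<Longrightarrow> sets (F t) \<subseteq> events"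
  unfolding sets_F using generators_F by (rule sets.sigma_sets_subset)

lemma measurable_F_imp: "t \<le> T \<Longrightarrow> f \<in> measurable (F t) B \<Longrightarrow> f \<in> measurable M B"
  by (rule measurable_subalgebra[of f "F t"]) (simp_all add: sets_F_subset)

lemma measurable_F_x0: "t \<le> T \<Longrightarrow> x0 \<in> borel_measurable (F t)"
proof (rule measurable_subalgebra[of x0 "vimage_algebra (space M) x0 borel"])
  assume t: "t \<le> T"
  show "x0 \<in> borel_measurable (vimage_algebra (space M) x0 borel)"
    by (rule measurable_vimage_algebra1) auto
  show "sets (vimage_algebra (space M) x0 borel) \<subseteq> sets (F t)"
    unfolding sets_F[OF t] by auto
qed simp

lemma measurable_F_w:
  assumes "0 \<le> s" "s \<le> t" "t \<le> T"
  shows "w s \<in> borel_measurable (F t)"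
proof (rule measurable_subalgebra)
  show "w s \<in> borel_measurable (generated_algebra M {0..t} w)"
    by (rule measurable_generated_algebra) (use assms in auto)
  show "sets (generated_algebra M {0..t} w) \<subseteq> sets (F t)"
    unfolding sets_F[OF assms(3)] by auto
qed (use assms in simp)

lemma null_sets_F: "t \<le> T \<Longrightarrow> N \<in> null_sets M \<Longrightarrow> N \<in> sets (F t)"
  by (simp add: sets_F sigma_sets.Basic)

lemma sets_F_mono:
  assumes "s \<le> t" "t \<le> T"
  shows "sets (F s) \<subseteq> sets (F t)"
proof -
  have "sets (generated_algebra M {0..s} w) \<subseteq> sets (F t)"
    using assms by (intro sets_generated_algebra_subset) (auto intro: measurable_F_w)
  then have "sets (vimage_algebra (space M) x0 borel) \<union> sets (generated_algebra M {0..s} w) \<union> null_sets M \<subseteq> sets (F t)"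
    using assms by (auto simp: sets_F[of t])
  then have "sigma_sets (space (F t)) (sets (vimage_algebra (space M) x0 borel) \<union> sets (generated_algebra M {0..s} w) \<union> null_sets M) \<subseteq> sets (F t)"
    by (rule sets.sigma_sets_subset)
  then show ?thesis using assms by (simp add: sets_F[of s])
qed

lemma measurable_F_mono:
  assumes "f \<in> measurable (F s) B" "s \<le> t" "t \<le> T"
  shows "f \<in> measurable (F t) B"
  using sets_F_mono[OF assms(2,3)] assms(2,3) by (intro measurable_subalgebra[OF assms(1)]) simp_all

text \<open>The filtration at \<open>s\<close> is generated by intersections of an event of
  \<open>x0\<close> with an event of the past of \<open>w\<close>, together with the null sets. This
  class is stable under intersection, so independence need only be checked on it.\<close>

lemma indep_increment:
  assumes st: "0 \<le> s" "s < t" "t \<le> T" and A: "A \<in> sets (F s)" and D: "D \<in> sets borel"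
  shows "prob (A \<inter> ((\<lambda>\<omega>. w t \<omega> - w s \<omega>) -` D \<inter> space M)) = prob A * prob ((\<lambda>\<omega>. w t \<omega> - w s \<omega>) -` D \<inter> space M)"
proof -
  let ?d = "\<lambda>\<omega>. w t \<omega> - w s \<omega>"
  let ?X = "sets (vimage_algebra (space M) x0 borel)" and ?G = "\<lambda>r. sets (generated_algebra M {0..r} w)"
  let ?D = "sets (vimage_algebra (space M) ?d borel)"
  have ws: "w s \<in> borel_measurable (generated_algebra M {0..T} w)" "w t \<in> borel_measurable (generated_algebra M {0..T} w)"
    by (rule measurable_generated_algebra, use st in auto)+
  have iD: "indep_set (?G s) ?D" using wiener st by (simp add: wiener_process_def)
  have DG: "?D \<subseteq> ?G T"
  proof
    fix d assume "d \<in> ?D"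
    then obtain E where E: "E \<in> sets borel" "d = ?d -` E \<inter> space M" by (auto simp: sets_vimage_algebra2)
    have "?d \<in> borel_measurable (generated_algebra M {0..T} w)" using ws by simp
    from measurable_sets[OF this E(1)] show "d \<in> ?G T" by (simp add: E)
  qed
  have GG: "?G s \<subseteq> ?G T"
    by (rule sets_generated_algebra_subset) (use st in \<open>auto intro: measurable_generated_algebra\<close>)
  define \<G> where "\<G> = {a \<inter> b | a b. a \<in> ?X \<and> b \<in> ?G s} \<union> null_sets M"
  have G_ev: "\<G> \<subseteq> events" using sets_vimage_x0 sets_generated_w[of s] st by (auto simp: \<G>_def)
  have stable: "Int_stable \<G>"
  proof (rule Int_stableI)
    fix a b assume ab: "a \<in> \<G>" "b \<in> \<G>"
    show "a \<inter> b \<in> \<G>"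
    proof (cases "a \<in> null_sets M \<or> b \<in> null_sets M")
      case True
      then have "a \<inter> b \<in> null_sets M"
        using ab G_ev by (metis null_set_Int1 null_set_Int2 subsetD inf_commute)
      then show ?thesis by (simp add: \<G>_def)
    next
      case False
      then obtain p q p' q' where *: "a = p \<inter> q" "b = p' \<inter> q'" "p \<in> ?X" "p' \<in> ?X" "q \<in> ?G s" "q' \<in> ?G s"
        using ab by (auto simp: \<G>_def)
      then have "a \<inter> b = (p \<inter> p') \<inter> (q \<inter> q')" by auto
      moreover have "p \<inter> p' \<in> ?X" "q \<inter> q' \<in> ?G s" using * by (auto intro: sets.Int)
      ultimately show ?thesis unfolding \<G>_def by blast
    qed
  qed
  have "indep_set \<G> ?D"
  proof (rule indep_setI[OF G_ev indep_setD_ev2[OF iD]])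
    fix a d assume a: "a \<in> \<G>" and d: "d \<in> ?D"
    have dE: "d \<in> events" using indep_setD_ev2[OF iD] d by auto
    show "prob (a \<inter> d) = prob a * prob d"
    proof (cases "a \<in> null_sets M")
      case True
      then have "a \<inter> d \<in> null_sets M" using dE by (rule null_set_Int2)
      with True show ?thesis by (simp add: measure_eq_0_null_sets)
    next
      case False
      then obtain p q where *: "a = p \<inter> q" "p \<in> ?X" "q \<in> ?G s" using a by (auto simp: \<G>_def)
      \<comment> \<open>The past event and the increment both belong to the history of
        \<open>w\<close> up to \<open>T\<close>. Independence of \<open>x0\<close> from that whole
        history lets \<open>x0\<close> be split off from the two of them jointly.\<close>
      have "q \<inter> d \<in> ?G T" using * d DG GG by (auto intro: sets.Int)
      then have "prob (p \<inter> (q \<inter> d)) = prob p * prob (q \<inter> d)"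
        using indep_setD[OF indep_x0 *(2)] by auto
      also have "prob (q \<inter> d) = prob q * prob d" by (rule indep_setD[OF iD *(3) d])
      also have "prob p * (prob q * prob d) = prob (p \<inter> q) * prob d"
        using indep_setD[OF indep_x0 *(2), of q] * GG by auto
      finally show ?thesis by (simp add: * Int_assoc)
    qed
  qed
  then have ind: "indep_set (sigma_sets (space M) \<G>) (sigma_sets (space M) ?D)"
    by (rule indep_set_sigma_sets[OF _ stable]) (auto simp: Int_stable_def intro: sets.Int)
  have "?X \<union> ?G s \<union> null_sets M \<subseteq> sigma_sets (space M) \<G>"
  proof -
    have "a \<in> \<G>" if "a \<in> ?X" for a
    proof -
      have "a = a \<inter> space M" using that sets.sets_into_space[of a "vimage_algebra (space M) x0 borel"] by auto
      moreover have "space M \<in> ?G s" using sets.top[of "generated_algebra M {0..s} w"] by simp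
      ultimately show ?thesis using that unfolding \<G>_def by blast
    qed
    moreover have "b \<in> \<G>" if "b \<in> ?G s" for b
    proof -
      have "b = space M \<inter> b" using that sets.sets_into_space[of b "generated_algebra M {0..s} w"] by auto
      moreover have "space M \<in> ?X" using sets.top[of "vimage_algebra (space M) x0 borel"] by simp
      ultimately show ?thesis using that unfolding \<G>_def by blast
    qed
    ultimately show ?thesis by (auto simp: \<G>_def)
  qed
  then have "sets (F s) \<subseteq> sigma_sets (space M) \<G>"
    using st by (simp add: sets_F sigma_sets_mono)
  moreover have "?d -` D \<inter> space M \<in> sigma_sets (space M) ?D"
    using D by (intro sigma_sets.Basic) (auto intro: in_vimage_algebra)
  ultimately show ?thesis using A by (intro indep_setD[OF ind]) auto
qed

lemma distributed_increment:
  "0 \<le> s \<Longrightarrow> s < t \<Longrightarrow> t \<le> T \<Longrightarrow>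
    distributed M lborel (\<lambda>\<omega>. w t \<omega> - w s \<omega>) (gaussian_density ((t - s) *\<^sub>R mat 1))"
  using wiener by (simp add: wiener_process_def)

lemma pos_def_scaled_identity: "0 < d \<Longrightarrow> pos_def (d *\<^sub>R (mat 1 :: real^'k^'k))"
proof -
  have "(d *\<^sub>R (mat 1 :: real^'k^'k)) *v v = d *\<^sub>R v" for v
    by (simp only: scaleR_matrix_vector_assoc[symmetric] matrix_vector_mul_lid)
  then show "0 < d \<Longrightarrow> pos_def (d *\<^sub>R (mat 1 :: real^'k^'k))"
    by (simp add: pos_def_def transpose_scalar)
qed

lemma increment_covariance:
  assumes "0 \<le> s" "s \<le> t" "t \<le> T"
  shows "integrable M (\<lambda>\<omega>. (w t \<omega> - w s \<omega>) $ i * (w t \<omega> - w s \<omega>) $ j)"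
    and "(LINT \<omega>|M. (w t \<omega> - w s \<omega>) $ i * (w t \<omega> - w s \<omega>) $ j) = (if i = j then t - s else 0)"
proof -
  have "integrable M (\<lambda>\<omega>. (w t \<omega> - w s \<omega>) $ i * (w t \<omega> - w s \<omega>) $ j) \<and>
     (LINT \<omega>|M. (w t \<omega> - w s \<omega>) $ i * (w t \<omega> - w s \<omega>) $ j) = (if i = j then t - s else 0)"
  proof (cases "s = t")
    case False
    then have st: "s < t" using assms by simp
    show ?thesis
      using gaussian_covariance[OF prob_space_axioms distributed_increment[OF assms(1) st assms(3)] pos_def_scaled_identity, of i j] st
      by (auto simp: mat_def)
  qed simp
  then show "integrable M (\<lambda>\<omega>. (w t \<omega> - w s \<omega>) $ i * (w t \<omega> - w s \<omega>) $ j)"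
    "(LINT \<omega>|M. (w t \<omega> - w s \<omega>) $ i * (w t \<omega> - w s \<omega>) $ j) = (if i = j then t - s else 0)" by auto
qed

lemma indep_increment_expectation:
  fixes Z :: "'w \<Rightarrow> real"
  assumes st: "0 \<le> s" "s \<le> t" "t \<le> T" and Z: "Z \<in> borel_measurable (F s)" "integrable M Z"
  shows "integrable M (\<lambda>\<omega>. Z \<omega> * (w t \<omega> - w s \<omega>) $ i)"
    and "(LINT \<omega>|M. Z \<omega> * (w t \<omega> - w s \<omega>) $ i) = 0"
proof -
  have "integrable M (\<lambda>\<omega>. Z \<omega> * (w t \<omega> - w s \<omega>) $ i) \<and> (LINT \<omega>|M. Z \<omega> * (w t \<omega> - w s \<omega>) $ i) = 0"
  proof (cases "s = t")
    case False
    then have lt: "s < t" using st by simp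
    let ?d = "\<lambda>\<omega>. (w t \<omega> - w s \<omega>) $ i"
    have [measurable]: "w s \<in> borel_measurable M" "w t \<in> borel_measurable M"
      using st by (auto intro: measurable_w)
    have ZM: "Z \<in> borel_measurable M" using Z(1) st by (intro measurable_F_imp[of s]) auto
    have sZ: "sigma_sets (space M) {Z -` A \<inter> space M |A. A \<in> sets borel} \<subseteq> sets (F s)"
    proof -
      have "sigma_sets (space (F s)) {Z -` A \<inter> space M |A. A \<in> sets borel} \<subseteq> sets (F s)"
        by (rule sets.sigma_sets_subset) (use measurable_sets[OF Z(1)] st in auto)
      then show ?thesis using st by simp
    qed
    have sd: "sigma_sets (space M) {?d -` A \<inter> space M |A. A \<in> sets borel} \<subseteq> {(\<lambda>\<omega>. w t \<omega> - w s \<omega>) -` D \<inter> space M |D. D \<in> sets borel}"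
    proof -
      have "sets (vimage_algebra (space M) (\<lambda>\<omega>. w t \<omega> - w s \<omega>) borel) = {(\<lambda>\<omega>. w t \<omega> - w s \<omega>) -` D \<inter> space M |D. D \<in> sets borel}"
        by (rule sets_vimage_algebra2) auto
      moreover have "sigma_sets (space M) {?d -` A \<inter> space M |A. A \<in> sets borel} \<subseteq> sets (vimage_algebra (space M) (\<lambda>\<omega>. w t \<omega> - w s \<omega>) borel)"
      proof -
        have "(\<lambda>\<omega>. w t \<omega> - w s \<omega>) \<in> borel_measurable (vimage_algebra (space M) (\<lambda>\<omega>. w t \<omega> - w s \<omega>) borel)"
          by (rule measurable_vimage_algebra1) auto
        then have "?d \<in> borel_measurable (vimage_algebra (space M) (\<lambda>\<omega>. w t \<omega> - w s \<omega>) borel)"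
          by (rule borel_measurable_vec_nth)
        from measurable_sets[OF this]
        have "sigma_sets (space (vimage_algebra (space M) (\<lambda>\<omega>. w t \<omega> - w s \<omega>) borel)) {?d -` A \<inter> space M |A. A \<in> sets borel}
          \<subseteq> sets (vimage_algebra (space M) (\<lambda>\<omega>. w t \<omega> - w s \<omega>) borel)"
          by (intro sets.sigma_sets_subset) auto
        then show ?thesis by simp
      qed
      ultimately show ?thesis by simp
    qed
    have "indep_var borel Z borel ?d"
      unfolding indep_var_eq
    proof (intro conjI indep_setI)
      fix a b assume a: "a \<in> sigma_sets (space M) {Z -` A \<inter> space M |A. A \<in> sets borel}"
        and b: "b \<in> sigma_sets (space M) {?d -` A \<inter> space M |A. A \<in> sets borel}"
      obtain D where D: "D \<in> sets borel" "b = (\<lambda>\<omega>. w t \<omega> - w s \<omega>) -` D \<inter> space M" using b sd by blast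
      have aF: "a \<in> sets (F s)" using a sZ by blast
      show "prob (a \<inter> b) = prob a * prob b"
        unfolding D(2) by (rule indep_increment[OF st(1) lt st(3) aF D(1)])
    next
      show "sigma_sets (space M) {Z -` A \<inter> space M |A. A \<in> sets borel} \<subseteq> events"
        using sZ sets_F_subset[of s] st by auto
      show "sigma_sets (space M) {?d -` A \<inter> space M |A. A \<in> sets borel} \<subseteq> events"
        by (rule order_trans[OF sd]) auto
      show "Z \<in> borel_measurable M" by (rule ZM)
      show "?d \<in> borel_measurable M" by measurable
    qed
    moreover note gaussian_mean[OF prob_space_axioms distributed_increment[OF st(1) lt st(3)] pos_def_scaled_identity, of i]
    ultimately show ?thesis
      using indep_var_lebesgue_integral[of Z ?d] indep_var_integrable[of Z ?d] Z(2) lt by auto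
  qed simp
  then show "integrable M (\<lambda>\<omega>. Z \<omega> * (w t \<omega> - w s \<omega>) $ i)"
    "(LINT \<omega>|M. Z \<omega> * (w t \<omega> - w s \<omega>) $ i) = 0" by auto
qed

lemma orthogonal_increment:
  fixes Z :: "'w \<Rightarrow> real^'k" and C :: "real^'p^'k"
  assumes st: "0 \<le> s" "s \<le> t" "t \<le> T" and Z: "Z \<in> borel_measurable (F s)" "integrable M Z"
  shows "integrable M (\<lambda>\<omega>. Z \<omega> \<bullet> (C *v (w t \<omega> - w s \<omega>)))"
    and "(LINT \<omega>|M. Z \<omega> \<bullet> (C *v (w t \<omega> - w s \<omega>))) = 0"
proof -
  have eq: "Z \<omega> \<bullet> (C *v (w t \<omega> - w s \<omega>)) = (\<Sum>i\<in>UNIV. (transpose C *v Z \<omega>) $ i * (w t \<omega> - w s \<omega>) $ i)" for \<omega>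
    by (subst inner_matrix_vector) (simp add: inner_vec_def)
  have bl: "bounded_linear (\<lambda>x. (transpose C *v x) $ i)" for i
    using bounded_linear_compose[OF bounded_linear_vec_nth bounded_bilinear.bounded_linear_right[OF bounded_bilinear_matrix_vector_mult]]
    by blast
  have m: "(\<lambda>\<omega>. (transpose C *v Z \<omega>) $ i) \<in> borel_measurable (F s)" for i
    using Z(1) by measurable
  note ii = indep_increment_expectation[OF st m integrable_bounded_linear[OF bl Z(2)]]
  show "integrable M (\<lambda>\<omega>. Z \<omega> \<bullet> (C *v (w t \<omega> - w s \<omega>)))"
    unfolding eq by (intro Bochner_Integration.integrable_sum ii)
  show "(LINT \<omega>|M. Z \<omega> \<bullet> (C *v (w t \<omega> - w s \<omega>))) = 0"
    unfolding eq by (subst Bochner_Integration.integral_sum) (simp_all only: ii sum.neutral_const)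
qed

end

section \<open>The Wiener integral of a step function\<close>

lemma partition_upto_bounds:
  assumes "partition_upto t k \<tau>" "i \<le> k"
  shows "0 \<le> \<tau> i" "\<tau> i \<le> t"
proof -
  have mono: "\<tau> i \<le> \<tau> j" if "i \<le> j" "j \<le> k" for i j
    using that
  proof (induction j rule: dec_induct)
    case (step j)
    then have "\<tau> j \<le> \<tau> (Suc j)" using assms(1) by (simp add: partition_upto_def)
    then show ?case using step by simp
  qed simp
  show "0 \<le> \<tau> i" using mono[of 0 i] assms by (simp add: partition_upto_def)
  show "\<tau> i \<le> t" using mono[of i k] assms by (simp add: partition_upto_def)
qed

context wiener_setup
begin

text \<open>Up to a null set w(s) is itself an increment from time 0, and w(t) is w(s) plus an
  increment orthogonal to it.\<close>

lemma w_covariance: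
  assumes st: "0 \<le> s" "s \<le> t" "t \<le> T"
  shows "integrable M (\<lambda>\<omega>. w s \<omega> $ i * w t \<omega> $ j)"
    and "(LINT \<omega>|M. w s \<omega> $ i * w t \<omega> $ j) = (if i = j then s else 0)"
proof -
  have m[measurable]: "w s \<in> borel_measurable M" "w t \<in> borel_measurable M" "w 0 \<in> borel_measurable M"
    using st by (auto intro: measurable_w)
  have w0: "AE \<omega> in M. w 0 \<omega> = 0" using wiener by (simp add: wiener_process_def)
  note c = increment_covariance[of 0 s, OF order_refl st(1) order_trans[OF st(2,3)]]
  have AEs: "AE \<omega> in M. (w s \<omega> - w 0 \<omega>) $ i * (w s \<omega> - w 0 \<omega>) $ j = w s \<omega> $ i * w s \<omega> $ j" for i j
    using w0 by eventually_elim simp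
  have ss: "integrable M (\<lambda>\<omega>. w s \<omega> $ i * w s \<omega> $ j)" for i j
    using c(1)[of i j] integrable_cong_AE[OF _ _ AEs[of i j]] by simp
  have ess: "(LINT \<omega>|M. w s \<omega> $ i * w s \<omega> $ j) = (if i = j then s else 0)"
  proof -
    have "(LINT \<omega>|M. w s \<omega> $ i * w s \<omega> $ j) = (LINT \<omega>|M. (w s \<omega> - w 0 \<omega>) $ i * (w s \<omega> - w 0 \<omega>) $ j)"
      by (rule integral_cong_AE) (use AEs[of i j] in \<open>auto elim!: eventually_mono\<close>)
    then show ?thesis by (simp only: c(2) diff_zero)
  qed
  have "integrable M (\<lambda>\<omega>. w s \<omega> $ i)"
    by (rule square_integrable_imp_integrable[rotated]) (use ss[of i i] in \<open>simp_all add: power2_eq_square\<close>)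
  moreover have "(\<lambda>\<omega>. w s \<omega> $ i) \<in> borel_measurable (F s)"
    using measurable_F_w[of s s] st by (intro borel_measurable_vec_nth) auto
  ultimately have z: "integrable M (\<lambda>\<omega>. w s \<omega> $ i * (w t \<omega> - w s \<omega>) $ j)" "(LINT \<omega>|M. w s \<omega> $ i * (w t \<omega> - w s \<omega>) $ j) = 0"
    by (rule indep_increment_expectation[OF st, rotated])+
  have eq: "w s \<omega> $ i * w t \<omega> $ j = w s \<omega> $ i * w s \<omega> $ j + w s \<omega> $ i * (w t \<omega> - w s \<omega>) $ j" for \<omega>
    by (simp add: algebra_simps)
  show "integrable M (\<lambda>\<omega>. w s \<omega> $ i * w t \<omega> $ j)"
    unfolding eq by (intro Bochner_Integration.integrable_add ss z)
  show "(LINT \<omega>|M. w s \<omega> $ i * w t \<omega> $ j) = (if i = j then s else 0)"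
    unfolding eq using ss z ess by (subst Bochner_Integration.integral_add) auto
qed

lemma w_covariance_min:
  assumes "s \<in> {0..T}" "t \<in> {0..T}"
  shows "integrable M (\<lambda>\<omega>. w s \<omega> $ i * w t \<omega> $ j)"
    and "(LINT \<omega>|M. w s \<omega> $ i * w t \<omega> $ j) = (if i = j then min s t else 0)"
proof -
  have "integrable M (\<lambda>\<omega>. w s \<omega> $ i * w t \<omega> $ j) \<and>
    (LINT \<omega>|M. w s \<omega> $ i * w t \<omega> $ j) = (if i = j then min s t else 0)"
  proof (cases "s \<le> t")
    case True
    then show ?thesis using w_covariance[of s t i j] assms by simp
  next
    case False
    then show ?thesis using w_covariance[of t s j i] assms by (simp add: mult.commute)
  qed
  then show "integrable M (\<lambda>\<omega>. w s \<omega> $ i * w t \<omega> $ j)"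
    and "(LINT \<omega>|M. w s \<omega> $ i * w t \<omega> $ j) = (if i = j then min s t else 0)" by auto
qed

lemma w_matrix_covariance:
  fixes C D :: "real^'p^'k"
  assumes "s \<in> {0..T}" "t \<in> {0..T}"
  shows "integrable M (\<lambda>\<omega>. (C *v w s \<omega>) \<bullet> (D *v w t \<omega>))"
    and "(LINT \<omega>|M. (C *v w s \<omega>) \<bullet> (D *v w t \<omega>)) = (C \<bullet> D) * min s t"
proof -
  note c = w_covariance_min[OF assms]
  have eq: "(C *v w s \<omega>) \<bullet> (D *v w t \<omega>)
      = (\<Sum>k\<in>UNIV. \<Sum>i\<in>UNIV. \<Sum>j\<in>UNIV. (C $ k $ i * D $ k $ j) * (w s \<omega> $ i * w t \<omega> $ j))" for \<omega>
    by (simp add: inner_vec_def matrix_vector_mult_def sum_product mult_ac)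
  show "integrable M (\<lambda>\<omega>. (C *v w s \<omega>) \<bullet> (D *v w t \<omega>))"
    unfolding eq by (intro Bochner_Integration.integrable_sum integrable_mult_right c)
  have "(LINT \<omega>|M. (C *v w s \<omega>) \<bullet> (D *v w t \<omega>))
     = (\<Sum>k\<in>UNIV. \<Sum>i\<in>UNIV. \<Sum>j\<in>UNIV. (C $ k $ i * D $ k $ j) * (if i = j then min s t else 0))"
    unfolding eq using c by (simp add: Bochner_Integration.integral_sum)
  also have "\<dots> = (C \<bullet> D) * min s t"
    by (simp add: inner_vec_def sum_distrib_right if_distrib[of "\<lambda>x. _ * x"] cong: if_cong)
  finally show "(LINT \<omega>|M. (C *v w s \<omega>) \<bullet> (D *v w t \<omega>)) = (C \<bullet> D) * min s t" .
qed

text \<open>Both sides expand into double sums over \<open>J\<close>. The covariance min(s,t) of the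
  Wiener process turns the mean product of two increments into \<open>m i j\<close>, the length of
  the overlap of their intervals. The intervals may overlap in any way, so two partitions can be
  compared without a common refinement.\<close>

lemma wiener_isometry:
  fixes C :: "'j \<Rightarrow> real^'p^'k"
  assumes J: "finite J" and ab: "\<And>i. i \<in> J \<Longrightarrow> 0 \<le> a i \<and> a i \<le> b i \<and> b i \<le> T"
  shows "integrable M (\<lambda>\<omega>. (norm (\<Sum>i\<in>J. C i *v (w (b i) \<omega> - w (a i) \<omega>)))\<^sup>2)"
    and "(LINT \<omega>|M. (norm (\<Sum>i\<in>J. C i *v (w (b i) \<omega> - w (a i) \<omega>)))\<^sup>2)
       = (LINT s|lborel. (norm (\<Sum>i\<in>J. indicator {a i<..b i} s *\<^sub>R C i))\<^sup>2)"
    and "integrable lborel (\<lambda>s. (norm (\<Sum>i\<in>J. indicator {a i<..b i} s *\<^sub>R C i))\<^sup>2)"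
proof -
  define q where "q i s j t \<omega> = (C i *v w s \<omega>) \<bullet> (C j *v w t \<omega>)" for i j s t \<omega>
  have q: "integrable M (q i s j t)" "(LINT \<omega>|M. q i s j t \<omega>) = (C i \<bullet> C j) * min s t"
    if "s \<in> {0..T}" "t \<in> {0..T}" for i j s t
    unfolding q_def[abs_def] using w_matrix_covariance[OF that] by auto
  define m where "m i j = min (b i) (b j) - min (b i) (a j) - min (a i) (b j) + min (a i) (a j)" for i j
  have mem: "a i \<in> {0..T}" "b i \<in> {0..T}" if "i \<in> J" for i using ab[OF that] by auto
  have eq: "(norm (\<Sum>i\<in>J. C i *v (w (b i) \<omega> - w (a i) \<omega>)))\<^sup>2
     = (\<Sum>i\<in>J. \<Sum>j\<in>J. q i (b i) j (b j) \<omega> - q i (b i) j (a j) \<omega> - q i (a i) j (b j) \<omega> + q i (a i) j (a j) \<omega>)" for \<omega>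
  proof -
    have "(norm (\<Sum>i\<in>J. C i *v (w (b i) \<omega> - w (a i) \<omega>)))\<^sup>2
       = (\<Sum>i\<in>J. \<Sum>j\<in>J. (C i *v (w (b i) \<omega> - w (a i) \<omega>)) \<bullet> (C j *v (w (b j) \<omega> - w (a j) \<omega>)))"
      unfolding power2_norm_eq_inner inner_sum_left by (simp only: inner_sum_right)
    also have "\<dots> = (\<Sum>i\<in>J. \<Sum>j\<in>J. q i (b i) j (b j) \<omega> - q i (b i) j (a j) \<omega> - q i (a i) j (b j) \<omega> + q i (a i) j (a j) \<omega>)"
      by (intro sum.cong refl) (simp add: q_def matrix_vector_mult_diff_distrib inner_diff_left inner_diff_right)
    finally show ?thesis .
  qed
  show "integrable M (\<lambda>\<omega>. (norm (\<Sum>i\<in>J. C i *v (w (b i) \<omega> - w (a i) \<omega>)))\<^sup>2)"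
    unfolding eq by (intro Bochner_Integration.integrable_sum Bochner_Integration.integrable_add Bochner_Integration.integrable_diff q mem)
  have E: "(LINT \<omega>|M. (norm (\<Sum>i\<in>J. C i *v (w (b i) \<omega> - w (a i) \<omega>)))\<^sup>2) = (\<Sum>i\<in>J. \<Sum>j\<in>J. (C i \<bullet> C j) * m i j)"
  proof -
    have "(LINT \<omega>|M. q i (b i) j (b j) \<omega> - q i (b i) j (a j) \<omega> - q i (a i) j (b j) \<omega> + q i (a i) j (a j) \<omega>) = (C i \<bullet> C j) * m i j"
      "integrable M (\<lambda>\<omega>. q i (b i) j (b j) \<omega> - q i (b i) j (a j) \<omega> - q i (a i) j (b j) \<omega> + q i (a i) j (a j) \<omega>)"
      if "i \<in> J" "j \<in> J" for i j
      using mem[OF that(1)] mem[OF that(2)] by (simp_all add: q m_def algebra_simps)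
    then show ?thesis
      unfolding eq by (subst Bochner_Integration.integral_sum; simp add: Bochner_Integration.integral_sum)
  qed
  have eq2: "(norm (\<Sum>i\<in>J. indicator {a i<..b i} s *\<^sub>R C i))\<^sup>2
      = (\<Sum>i\<in>J. \<Sum>j\<in>J. (C i \<bullet> C j) * indicator ({a i<..b i} \<inter> {a j<..b j}) s)" for s :: real
  proof -
    have "(norm (\<Sum>i\<in>J. indicator {a i<..b i} s *\<^sub>R C i))\<^sup>2
       = (\<Sum>i\<in>J. \<Sum>j\<in>J. (indicator {a i<..b i} s *\<^sub>R C i) \<bullet> (indicator {a j<..b j} s *\<^sub>R C j))"
      unfolding power2_norm_eq_inner inner_sum_left by (simp only: inner_sum_right)
    then show ?thesis
      by (auto intro!: sum.cong split: split_indicator)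
  qed
  have ms: "integrable lborel (\<lambda>s. (C i \<bullet> C j) * indicator ({a i<..b i} \<inter> {a j<..b j}) s)"
    "(LINT s|lborel. (C i \<bullet> C j) * indicator ({a i<..b i} \<inter> {a j<..b j}) s) = (C i \<bullet> C j) * m i j"
    if "i \<in> J" "j \<in> J" for i j
  proof -
    have I: "{a i<..b i} \<inter> {a j<..b j} = {max (a i) (a j)<..min (b i) (b j)}" by auto
    have fin: "emeasure lborel {max (a i) (a j)<..min (b i) (b j)} < \<infinity>"
      by (cases "max (a i) (a j) \<le> min (b i) (b j)") auto
    then show "integrable lborel (\<lambda>s. (C i \<bullet> C j) * indicator ({a i<..b i} \<inter> {a j<..b j}) s)"
      unfolding I by (intro integrable_mult_right) simp
    have "measure lborel {max (a i) (a j)<..min (b i) (b j)} = m i j"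
      using ab[OF that(1)] ab[OF that(2)]
      by (cases "max (a i) (a j) \<le> min (b i) (b j)") (auto simp: m_def min_def max_def measure_def split: if_splits)
    then show "(LINT s|lborel. (C i \<bullet> C j) * indicator ({a i<..b i} \<inter> {a j<..b j}) s) = (C i \<bullet> C j) * m i j"
      unfolding I by simp
  qed
  show "integrable lborel (\<lambda>s. (norm (\<Sum>i\<in>J. indicator {a i<..b i} s *\<^sub>R C i))\<^sup>2)"
    unfolding eq2 by (intro Bochner_Integration.integrable_sum ms)
  have "(LINT s|lborel. (norm (\<Sum>i\<in>J. indicator {a i<..b i} s *\<^sub>R C i))\<^sup>2) = (\<Sum>i\<in>J. \<Sum>j\<in>J. (C i \<bullet> C j) * m i j)"
  proof -
    have "(LINT s|lborel. (\<Sum>j\<in>J. (C i \<bullet> C j) * indicator ({a i<..b i} \<inter> {a j<..b j}) s)) = (\<Sum>j\<in>J. (C i \<bullet> C j) * m i j)"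
      if "i \<in> J" for i
    proof -
      have "(LINT s|lborel. (\<Sum>j\<in>J. (C i \<bullet> C j) * indicator ({a i<..b i} \<inter> {a j<..b j}) s))
        = (\<Sum>j\<in>J. LINT s|lborel. (C i \<bullet> C j) * indicator ({a i<..b i} \<inter> {a j<..b j}) s)"
        by (rule Bochner_Integration.integral_sum) (rule ms(1)[OF that])
      then show ?thesis by (simp only: ms(2)[OF that] cong: sum.cong)
    qed
    moreover have "(LINT s|lborel. (norm (\<Sum>i\<in>J. indicator {a i<..b i} s *\<^sub>R C i))\<^sup>2)
      = (\<Sum>i\<in>J. LINT s|lborel. (\<Sum>j\<in>J. (C i \<bullet> C j) * indicator ({a i<..b i} \<inter> {a j<..b j}) s))"
      unfolding eq2 by (rule Bochner_Integration.integral_sum) (intro Bochner_Integration.integrable_sum ms(1))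
    ultimately show ?thesis by (simp only: cong: sum.cong)
  qed
  with E show "(LINT \<omega>|M. (norm (\<Sum>i\<in>J. C i *v (w (b i) \<omega> - w (a i) \<omega>)))\<^sup>2)
       = (LINT s|lborel. (norm (\<Sum>i\<in>J. indicator {a i<..b i} s *\<^sub>R C i))\<^sup>2)" by simp
qed

lemma step_integral_measurable:
  assumes "partition_upto t k \<tau>" "t \<le> T"
  shows "step_integral w k \<tau> C \<in> borel_measurable (F t)"
proof -
  have "w (\<tau> i) \<in> borel_measurable (F t)" if "i \<le> k" for i
    using partition_upto_bounds[OF assms(1) that] assms(2) by (intro measurable_F_w) auto
  then show ?thesis
    unfolding step_integral_def[abs_def]
    by (intro borel_measurable_sum measurable_compose[OF _ measurable_matrix_vector] borel_measurable_diff) auto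
qed

text \<open>The two partitions are joined over a disjoint sum of index sets, the second with its
  matrices negated; the difference is then a single sum of the kind treated by
  \<open>wiener_isometry\<close>.\<close>

lemma step_integral_isometry:
  assumes p: "partition_upto t k \<tau>" and p': "partition_upto t k' \<tau>'" and t: "t \<le> T"
  shows "(\<integral>\<^sup>+\<omega>. ennreal ((norm (step_integral w k \<tau> C \<omega> - step_integral w k' \<tau>' C' \<omega>))\<^sup>2) \<partial>M)
     = (\<integral>\<^sup>+s\<in>{0..t}. ennreal ((norm (step_function k \<tau> C s - step_function k' \<tau>' C' s))\<^sup>2) \<partial>lborel)"
proof -
  define J where "J = {..<k} <+> {..<k'}"
  define a where "a = case_sum \<tau> \<tau>'"
  define b where "b = case_sum (\<lambda>i. \<tau> (Suc i)) (\<lambda>i. \<tau>' (Suc i))"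
  define D where "D = case_sum C (\<lambda>i. - C' i)"
  have J: "finite J" by (simp add: J_def)
  have ab': "0 \<le> a i \<and> a i \<le> b i \<and> b i \<le> t" if "i \<in> J" for i
    using that partition_upto_bounds[OF p] partition_upto_bounds[OF p'] p p'
    by (auto simp: J_def a_def b_def partition_upto_def)
  then have ab: "0 \<le> a i \<and> a i \<le> b i \<and> b i \<le> T" if "i \<in> J" for i using t that by force
  have 1: "(\<Sum>i\<in>J. D i *v (w (b i) \<omega> - w (a i) \<omega>)) = step_integral w k \<tau> C \<omega> - step_integral w k' \<tau>' C' \<omega>" for \<omega>
    by (simp add: J_def sum.Plus step_integral_def D_def a_def b_def matrix_vector_minus_left sum_negf)
  have 2: "(\<Sum>i\<in>J. indicator {a i<..b i} s *\<^sub>R D i) = step_function k \<tau> C s - step_function k' \<tau>' C' s" for s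
    unfolding J_def by (subst sum.Plus) (simp_all add: step_function_def D_def a_def b_def sum_negf)
  \<comment> \<open>All cells lie in (0,t], so restricting the integral to [0,t] loses
    nothing.\<close>
  have 3: "ennreal ((norm (step_function k \<tau> C s - step_function k' \<tau>' C' s))\<^sup>2)
     = ennreal ((norm (step_function k \<tau> C s - step_function k' \<tau>' C' s))\<^sup>2) * indicator {0..t} s" for s
  proof (cases "s \<in> {0..t}")
    case False
    then have "indicator {a i<..b i} s = (0::real)" if "i \<in> J" for i
      using ab'[OF that] by (auto split: split_indicator)
    then have "(\<Sum>i\<in>J. indicator {a i<..b i} s *\<^sub>R D i) = 0" by (intro sum.neutral) auto
    then show ?thesis unfolding 2 by simp
  qed simp
  note iso = wiener_isometry[of J a b D, OF J ab, unfolded 1 2]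
  have "(\<integral>\<^sup>+\<omega>. ennreal ((norm (step_integral w k \<tau> C \<omega> - step_integral w k' \<tau>' C' \<omega>))\<^sup>2) \<partial>M)
    = ennreal (LINT s|lborel. (norm (step_function k \<tau> C s - step_function k' \<tau>' C' s))\<^sup>2)"
    using nn_integral_eq_integral[OF iso(1)] iso(2) by simp
  also have "\<dots> = (\<integral>\<^sup>+s. ennreal ((norm (step_function k \<tau> C s - step_function k' \<tau>' C' s))\<^sup>2) \<partial>lborel)"
    using nn_integral_eq_integral[OF iso(3)] by simp
  also have "\<dots> = (\<integral>\<^sup>+s\<in>{0..t}. ennreal ((norm (step_function k \<tau> C s - step_function k' \<tau>' C' s))\<^sup>2) \<partial>lborel)"
    by (subst 3) simp
  finally show ?thesis .
qed

end

section \<open>A continuous version of the Wiener integral\<close>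

locale wiener_integrand = wiener_setup M T w x0 S0
  for M :: "'w measure" and T and w :: "real \<Rightarrow> 'w \<Rightarrow> real^'p" and x0 :: "'w \<Rightarrow> real^'n" and S0 +
  fixes G :: "real \<Rightarrow> real^'p^'n"
  assumes continuous_G: "continuous_on {0..T} G"
begin

definition node :: "nat \<Rightarrow> nat \<Rightarrow> real" where
  "node N i = real i * T / real N"

text \<open>Stopping the nodes at \<open>t\<close> keeps the number of cells fixed while
  \<open>t\<close> varies. The sum is thereby continuous in \<open>t\<close> along continuous paths
  of \<open>w\<close>, and for each \<open>t\<close> it is still a step integral over [0,t].\<close>

definition euler :: "nat \<Rightarrow> real \<Rightarrow> 'w \<Rightarrow> real^'n" where
  "euler N t = step_integral w N (\<lambda>i. min t (node N i)) (\<lambda>i. G (node N i))"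

definition euler_step :: "nat \<Rightarrow> real \<Rightarrow> real \<Rightarrow> real^'p^'n" where
  "euler_step N t = step_function N (\<lambda>i. min t (node N i)) (\<lambda>i. G (node N i))"

lemma node_bounds: "0 < N \<Longrightarrow> i \<le> N \<Longrightarrow> node N i \<in> {0..T}"
  using T_pos by (auto simp: node_def divide_le_eq mult.commute mult_right_mono)

lemma node_mono: "i \<le> j \<Longrightarrow> node N i \<le> node N j"
  using T_pos by (auto simp: node_def intro!: divide_right_mono mult_right_mono)

lemma node_Suc: "node N (Suc i) = node N i + T / real N"
  by (simp add: node_def add_divide_distrib distrib_right)

lemma partition_node:
  assumes "0 < N" "t \<in> {0..T}"
  shows "partition_upto t N (\<lambda>i. min t (node N i))"
  unfolding partition_upto_def
proof (intro conjI allI impI)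
  show "min t (node N 0) = 0" using assms by (simp add: node_def)
  show "min t (node N N) = t" using assms by (simp add: node_def)
  fix i show "min t (node N i) \<le> min t (node N (Suc i))"
    using node_mono[of i "Suc i" N] by (simp add: min_le_iff_disj min.coboundedI2)
qed

lemma euler_step_approx:
  assumes N: "0 < N" and t: "t \<le> T" and s: "0 < s" "s \<le> t"
    and close: "\<And>r. r \<in> {0..T} \<Longrightarrow> \<bar>r - s\<bar> \<le> T / real N \<Longrightarrow> norm (G r - G s) \<le> e"
  shows "norm (euler_step N t s - G s) \<le> e"
proof -
  \<comment> \<open>Cells are open on the left and closed on the right, so the cell containing
    \<open>s\<close> is found by a ceiling minus one, not by a floor.\<close>
  define k where "k = nat (\<lceil>s * real N / T\<rceil> - 1)"
  have pos: "0 < s * real N / T" using N s T_pos by simp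
  then have ceil: "0 < \<lceil>s * real N / T\<rceil>" by simp
  have k: "real k < s * real N / T" "s * real N / T \<le> real k + 1"
    unfolding k_def using ceil by (simp_all add: of_nat_nat) linarith+
  have nk: "node N k < s" "s \<le> node N (Suc k)"
    using k N T_pos by (simp_all add: node_def field_simps)
  have kN: "k < N"
  proof -
    have "real k * T < s * real N" using k(1) T_pos by (simp add: pos_less_divide_eq)
    also have "\<dots> \<le> T * real N" using s t by (intro mult_right_mono) auto
    finally show ?thesis using T_pos by (simp add: mult.commute)
  qed
  have ind: "indicator {min t (node N i)<..min t (node N (Suc i))} s = (if i = k then 1 else 0 :: real)" for i
  proof (cases "i = k")
    case True
    then show ?thesis using nk s by (auto simp: min_def)
  next
    case False
    then consider "i < k" | "k < i" by linarith
    then show ?thesis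
    proof cases
      case 1
      then have "node N (Suc i) \<le> node N k" by (intro node_mono) simp
      then show ?thesis using False nk by (auto split: split_indicator)
    next
      case 2
      then have "node N (Suc k) \<le> node N i" by (intro node_mono) simp
      then show ?thesis using False nk s by (auto split: split_indicator)
    qed
  qed
  have "euler_step N t s = (\<Sum>i<N. if i = k then G (node N k) else 0)"
    unfolding euler_step_def step_function_def by (intro sum.cong refl) (simp add: ind)
  also have "\<dots> = G (node N k)" using kN by simp
  finally have "euler_step N t s = G (node N k)" .
  moreover have "\<bar>node N k - s\<bar> \<le> T / real N" using nk node_Suc[of N k] by simp
  ultimately show ?thesis using close[of "node N k"] node_bounds[OF N, of k] kN by simp
qed

lemma euler_measurable_F: "0 < N \<Longrightarrow> t \<in> {0..T} \<Longrightarrow> euler N t \<in> borel_measurable (F t)"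
  unfolding euler_def by (rule step_integral_measurable[OF partition_node]) auto

lemma euler_measurable: "0 < N \<Longrightarrow> t \<in> {0..T} \<Longrightarrow> euler N t \<in> borel_measurable M"
  by (rule measurable_F_imp[of t]) (auto intro: euler_measurable_F)

lemma euler_0: "0 < N \<Longrightarrow> euler N 0 \<omega> = 0"
  using node_bounds[of N] by (simp add: euler_def step_integral_def)

lemma euler_continuous:
  assumes "continuous_on {0..T} (\<lambda>t. w t \<omega>)" "0 < N"
  shows "continuous_on {0..T} (\<lambda>t. euler N t \<omega>)"
  unfolding euler_def step_integral_def
proof (intro continuous_on_sum bounded_linear.continuous_on[OF matrix_vector_mul_bounded_linear] continuous_on_diff)
  fix i assume "i \<in> {..<N}"
  then have n: "node N i \<in> {0..T}" "node N (Suc i) \<in> {0..T}" using assms node_bounds by auto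
  show "continuous_on {0..T} (\<lambda>t. w (min t (node N i)) \<omega>)"
    using n by (intro continuous_on_compose2[OF assms(1)] continuous_intros) auto
  show "continuous_on {0..T} (\<lambda>t. w (min t (node N (Suc i))) \<omega>)"
    using n by (intro continuous_on_compose2[OF assms(1)] continuous_intros) auto
qed

text \<open>The increment of the sum between \<open>s\<close> and \<open>t\<close> involves
  \<open>w\<close> only through the stopped increments \<open>d c\<close>. Such an increment is zero
  if the node \<open>c\<close> precedes \<open>s\<close>, and otherwise it is an increment of
  \<open>w\<close> starting at \<open>s\<close>.\<close>

lemma euler_orthogonal:
  fixes Z :: "'w \<Rightarrow> real^'n"
  assumes N: "0 < N" and st: "0 \<le> s" "s \<le> t" "t \<le> T" and Z: "Z \<in> borel_measurable (F s)" "integrable M Z"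
  shows "integrable M (\<lambda>\<omega>. Z \<omega> \<bullet> (euler N t \<omega> - euler N s \<omega>))"
    and "(LINT \<omega>|M. Z \<omega> \<bullet> (euler N t \<omega> - euler N s \<omega>)) = 0"
proof -
  define d where "d c \<omega> = w (min t c) \<omega> - w (min s c) \<omega>" for c \<omega>
  have d: "integrable M (\<lambda>\<omega>. Z \<omega> \<bullet> (C *v d c \<omega>)) \<and> (LINT \<omega>|M. Z \<omega> \<bullet> (C *v d c \<omega>)) = 0"
    if c: "c \<in> {0..T}" for C c
  proof (cases "c \<le> s")
    case True
    then have "min t c = c" "min s c = c" using st by auto
    then show ?thesis by (simp add: d_def)
  next
    case False
    then have "min s c = s" "s \<le> min t c" "min t c \<le> T" using st by auto
    then show ?thesis using orthogonal_increment[OF st(1) _ _ Z, of "min t c" C] by (simp add: d_def)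
  qed
  have eq: "Z \<omega> \<bullet> (euler N t \<omega> - euler N s \<omega>)
     = (\<Sum>i<N. Z \<omega> \<bullet> (G (node N i) *v d (node N (Suc i)) \<omega>) - Z \<omega> \<bullet> (G (node N i) *v d (node N i) \<omega>))" for \<omega>
    unfolding euler_def step_integral_def d_def inner_diff_right[symmetric] inner_sum_right[symmetric]
      sum_subtractf[symmetric] matrix_vector_mult_diff_distrib[symmetric]
    by (simp add: algebra_simps)
  have n: "node N i \<in> {0..T}" "node N (Suc i) \<in> {0..T}" if "i \<in> {..<N}" for i using that node_bounds[OF N] by auto
  have 1: "integrable M (\<lambda>\<omega>. Z \<omega> \<bullet> (G (node N i) *v d (node N (Suc i)) \<omega>) - Z \<omega> \<bullet> (G (node N i) *v d (node N i) \<omega>))"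
    if "i \<in> {..<N}" for i
    using d[OF n(1)[OF that]] d[OF n(2)[OF that]] by simp
  show "integrable M (\<lambda>\<omega>. Z \<omega> \<bullet> (euler N t \<omega> - euler N s \<omega>))"
    unfolding eq by (rule Bochner_Integration.integrable_sum) (rule 1)
  have "(LINT \<omega>|M. Z \<omega> \<bullet> (euler N t \<omega> - euler N s \<omega>))
     = (\<Sum>i<N. LINT \<omega>|M. Z \<omega> \<bullet> (G (node N i) *v d (node N (Suc i)) \<omega>) - Z \<omega> \<bullet> (G (node N i) *v d (node N i) \<omega>))"
    unfolding eq by (rule Bochner_Integration.integral_sum) (rule 1)
  also have "\<dots> = 0"
    using d n by (intro sum.neutral ballI) simp
  finally show "(LINT \<omega>|M. Z \<omega> \<bullet> (euler N t \<omega> - euler N s \<omega>)) = 0" .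
qed

text \<open>A mesh sequence along which the step approximations of \<open>G\<close> converge geometrically.\<close>

definition mesh :: "nat \<Rightarrow> nat" where
  "mesh j = (SOME N. j < N \<and> (\<forall>s\<in>{0..T}. \<forall>r\<in>{0..T}. \<bar>r - s\<bar> \<le> T / real N \<longrightarrow> norm (G r - G s) \<le> (1/8) ^ j))"

text \<open>Uniform continuity of \<open>G\<close> supplies the step size. The ratio 1/8 is chosen
  with the maximal inequality in view: mean squares decay like 64^-j, and testing at the level 2^-j
  costs only a factor 4^j.\<close>

lemma mesh: "j < mesh j" "s \<in> {0..T} \<Longrightarrow> r \<in> {0..T} \<Longrightarrow> \<bar>r - s\<bar> \<le> T / real (mesh j) \<Longrightarrow> norm (G r - G s) \<le> (1/8) ^ j"
proof -
  have "uniformly_continuous_on {0..T} G"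
    using continuous_G by (rule compact_uniformly_continuous) simp
  then obtain d where d: "0 < d" "\<And>s r. s \<in> {0..T} \<Longrightarrow> r \<in> {0..T} \<Longrightarrow> dist r s < d \<Longrightarrow> dist (G r) (G s) < (1/8) ^ j"
    unfolding uniformly_continuous_on_def by (metis zero_less_divide_1_iff zero_less_numeral zero_less_power)
  obtain N0 :: nat where N0: "T / d < real N0" using reals_Archimedean2 by blast
  \<comment> \<open>The bound \<open>Suc j\<close> makes the number of cells grow even if
    \<open>G\<close> is constant; later Riemann sums need the mesh width to tend to 0.\<close>
  define N where "N = max N0 (Suc j)"
  have "T / d < real N" using N0 by (simp add: N_def)
  then have "T / real N < d" using d(1) by (simp add: N_def field_simps)
  have "norm (G r - G s) \<le> (1/8) ^ j" if "s \<in> {0..T}" "r \<in> {0..T}" "\<bar>r - s\<bar> \<le> T / real N" for s r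
    using d(2)[OF that(1,2)] that(3) \<open>T / real N < d\<close> by (simp add: dist_norm)
  moreover have "j < N" by (simp add: N_def)
  ultimately have "j < N \<and> (\<forall>s\<in>{0..T}. \<forall>r\<in>{0..T}. \<bar>r - s\<bar> \<le> T / real N \<longrightarrow> norm (G r - G s) \<le> (1/8) ^ j)"
    by blast
  from someI[where P="\<lambda>N. j < N \<and> (\<forall>s\<in>{0..T}. \<forall>r\<in>{0..T}. \<bar>r - s\<bar> \<le> T / real N \<longrightarrow> norm (G r - G s) \<le> (1/8) ^ j)", OF this]
  have P: "j < mesh j \<and> (\<forall>s\<in>{0..T}. \<forall>r\<in>{0..T}. \<bar>r - s\<bar> \<le> T / real (mesh j) \<longrightarrow> norm (G r - G s) \<le> (1/8) ^ j)"
    unfolding mesh_def[symmetric] .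
  show "j < mesh j" using P by (rule conjunct1)
  show "s \<in> {0..T} \<Longrightarrow> r \<in> {0..T} \<Longrightarrow> \<bar>r - s\<bar> \<le> T / real (mesh j) \<Longrightarrow> norm (G r - G s) \<le> (1/8) ^ j"
    using P by blast
qed

lemma mesh_pos: "0 < mesh j" using mesh(1)[of j] by simp

lemma euler_step_mesh:
  assumes "t \<le> T" "0 < s" "s \<le> t"
  shows "norm (euler_step (mesh j) t s - G s) \<le> (1/8) ^ j"
  using assms by (intro euler_step_approx mesh_pos) (auto intro!: mesh)

text \<open>Time 0 is excepted because the step functions vanish there; it is a null set.\<close>

lemma nn_integral_interval_bound:
  fixes f :: "real \<Rightarrow> real"
  assumes t: "t \<in> {0..T}" and f: "\<And>s. 0 < s \<Longrightarrow> s \<le> t \<Longrightarrow> f s \<le> c" and c: "0 \<le> c"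
  shows "(\<integral>\<^sup>+s\<in>{0..t}. ennreal (f s) \<partial>lborel) \<le> ennreal (T * c)"
proof -
  have "(\<integral>\<^sup>+s\<in>{0..t}. ennreal (f s) \<partial>lborel) \<le> (\<integral>\<^sup>+s. ennreal c * indicator {0..t} s \<partial>lborel)"
  proof (rule nn_integral_mono_AE)
    show "AE s in lborel. ennreal (f s) * indicator {0..t} s \<le> ennreal c * indicator {0..t} s"
      using AE_lborel_singleton[of 0]
      by eventually_elim (auto split: split_indicator intro!: ennreal_leI f)
  qed
  also have "\<dots> = ennreal (c * t)" using t c by (subst nn_integral_cmult_indicator) (auto simp: ennreal_mult')
  also have "\<dots> \<le> ennreal (T * c)" using mult_left_mono[of t T c] t c by (intro ennreal_leI) (simp add: mult.commute)
  finally show ?thesis .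
qed

lemma euler_L2_diff:
  assumes t: "t \<in> {0..T}" and jm: "j \<le> m"
  shows "(\<integral>\<^sup>+\<omega>. ennreal ((norm (euler (mesh j) t \<omega> - euler (mesh m) t \<omega>))\<^sup>2) \<partial>M) \<le> ennreal (T * (4 * (1/64) ^ j))"
proof -
  have "(\<integral>\<^sup>+\<omega>. ennreal ((norm (euler (mesh j) t \<omega> - euler (mesh m) t \<omega>))\<^sup>2) \<partial>M)
     = (\<integral>\<^sup>+s\<in>{0..t}. ennreal ((norm (euler_step (mesh j) t s - euler_step (mesh m) t s))\<^sup>2) \<partial>lborel)"
    unfolding euler_def euler_step_def
    by (rule step_integral_isometry) (use t mesh_pos in \<open>auto intro!: partition_node\<close>)
  also have "\<dots> \<le> ennreal (T * (4 * (1/64) ^ j))"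
  proof (rule nn_integral_interval_bound[OF t])
    fix s assume s: "0 < s" "s \<le> t"
    have "norm (euler_step (mesh j) t s - euler_step (mesh m) t s)
       \<le> norm (euler_step (mesh j) t s - G s) + norm (euler_step (mesh m) t s - G s)"
      by (metis norm_triangle_ineq4 diff_diff_eq2 diff_add_cancel add_diff_cancel_right)
    also have "\<dots> \<le> (1/8) ^ j + (1/8) ^ m"
      using s t by (intro add_mono euler_step_mesh) auto
    also have "\<dots> \<le> 2 * (1/8) ^ j"
      using power_decreasing[OF jm, of "1/8::real"] by simp
    finally have "(norm (euler_step (mesh j) t s - euler_step (mesh m) t s))\<^sup>2 \<le> (2 * (1/8) ^ j)\<^sup>2"
      by (rule power_mono) simp
    also have "\<dots> = 4 * (1/64) ^ j"
      by (simp add: power_mult_distrib power2_eq_square power_mult_distrib[symmetric])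
    finally show "(norm (euler_step (mesh j) t s - euler_step (mesh m) t s))\<^sup>2 \<le> 4 * (1/64) ^ j" .
  qed simp
  finally show ?thesis .
qed

lemma euler_square_integrable:
  assumes N: "0 < N" and t: "t \<in> {0..T}"
  shows "integrable M (\<lambda>\<omega>. (norm (euler N t \<omega>))\<^sup>2)"
proof -
  have "0 \<le> min t (node N i) \<and> min t (node N i) \<le> min t (node N (Suc i)) \<and> min t (node N (Suc i)) \<le> T" if "i \<in> {..<N}" for i
    using that partition_node[OF N t] partition_upto_bounds[OF partition_node[OF N t], of i] t
    by (auto simp: partition_upto_def)
  then have "integrable M (\<lambda>\<omega>. (norm (\<Sum>i<N. G (node N i) *v (w (min t (node N (Suc i))) \<omega> - w (min t (node N i)) \<omega>)))\<^sup>2)"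
    by (rule wiener_isometry(1)[OF finite_lessThan])
  then show ?thesis by (simp only: euler_def step_integral_def)
qed

end

text \<open>Dyadic points are chosen as dense set because their grids are nested: the event of
  exceeding a level on the grid then increases with the refinement.\<close>

lemma dyadic_approximation:
  fixes t T :: real
  assumes T: "0 < T" and t: "t \<in> {0..T}"
  obtains k :: "nat \<Rightarrow> nat" where "\<And>m. k m \<le> 2 ^ m" "(\<lambda>m. real (k m) * T / 2 ^ m) \<longlonglongrightarrow> t"
proof -
  define k where "k m = nat \<lfloor>t * 2^m / T\<rfloor>" for m :: nat
  have k: "real (k m) \<le> t * 2^m / T" "t * 2^m / T < real (k m) + 1" for m
    using t T by (simp_all add: k_def)
  have k2: "k m \<le> 2^m" for m
  proof -
    have "t * 2^m / T \<le> 2^m" using t T by (simp add: divide_le_eq mult.commute)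
    then have "real (k m) \<le> 2^m" using k(1)[of m] by linarith
    then show ?thesis by (metis of_nat_le_iff of_nat_numeral of_nat_power)
  qed
  have d: "\<bar>real (k m) * T / 2^m - t\<bar> \<le> T * (1/2) ^ m" for m
  proof -
    have "real (k m) * T \<le> t * 2^m" "t * 2^m < (real (k m) + 1) * T"
      using k[of m] T by (simp_all add: pos_le_divide_eq pos_divide_less_eq)
    then have "real (k m) * T / 2^m \<le> t" "t \<le> (real (k m) * T + T) / 2^m"
      by (simp_all add: divide_le_eq le_divide_eq distrib_right)
    then show ?thesis by (simp add: add_divide_distrib power_one_over)
  qed
  have "(\<lambda>m. real (k m) * T / 2^m - t) \<longlonglongrightarrow> 0"
  proof (rule Lim_null_comparison[rotated])
    have "(\<lambda>m. T * (1/2) ^ m) \<longlonglongrightarrow> T * 0" by (intro tendsto_mult_left LIMSEQ_power_zero) simp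
    then show "(\<lambda>m. T * (1/2) ^ m) \<longlonglongrightarrow> 0" by (simp only: mult_zero_right)
    show "\<forall>\<^sub>F m in sequentially. norm (real (k m) * T / 2^m - t) \<le> T * (1/2) ^ m"
      using d by (simp only: real_norm_def eventually_True)
  qed
  then have "(\<lambda>m. real (k m) * T / 2^m) \<longlonglongrightarrow> t" by (simp add: LIM_zero_iff)
  with k2 show ?thesis by (rule that)
qed

lemma dyadic_grid:
  fixes T :: real
  assumes "0 < T" "k \<le> 2 ^ m"
  shows "real k * T / 2 ^ m \<in> {0..T}"
proof -
  have "real k \<le> 2^m" using assms(2) by (metis of_nat_le_iff of_nat_numeral of_nat_power)
  then show ?thesis using assms(1) by (auto simp: divide_le_eq mult.commute mult_left_mono)
qed

section \<open>Uniform convergence of the step sums\<close>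

context wiener_integrand
begin

definition euler_diff :: "nat \<Rightarrow> real \<Rightarrow> 'w \<Rightarrow> real^'n" where
  "euler_diff j t \<omega> = euler (mesh (Suc j)) t \<omega> - euler (mesh j) t \<omega>"

lemma euler_diff_measurable_F: "t \<in> {0..T} \<Longrightarrow> euler_diff j t \<in> borel_measurable (F t)"
  unfolding euler_diff_def[abs_def] by (intro borel_measurable_diff euler_measurable_F mesh_pos)

lemma euler_diff_measurable: "t \<in> {0..T} \<Longrightarrow> euler_diff j t \<in> borel_measurable M"
  by (rule measurable_F_imp[of t]) (auto intro: euler_diff_measurable_F)

lemma euler_diff_L2:
  assumes t: "t \<in> {0..T}"
  shows "integrable M (\<lambda>\<omega>. (norm (euler_diff j t \<omega>))\<^sup>2)"
    and "(LINT \<omega>|M. (norm (euler_diff j t \<omega>))\<^sup>2) \<le> 4 * T * (1/64) ^ j"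
proof -
  have m: "(\<lambda>\<omega>. (norm (euler_diff j t \<omega>))\<^sup>2) \<in> borel_measurable M"
    using euler_diff_measurable[OF t] by measurable
  have le: "(\<integral>\<^sup>+\<omega>. ennreal ((norm (euler_diff j t \<omega>))\<^sup>2) \<partial>M) \<le> ennreal (T * (4 * (1/64) ^ j))"
    using euler_L2_diff[OF t, of j "Suc j"] by (simp add: euler_diff_def norm_minus_commute)
  have "(\<integral>\<^sup>+\<omega>. ennreal ((norm (euler_diff j t \<omega>))\<^sup>2) \<partial>M) < \<infinity>"
    using le by (rule le_less_trans) simp
  then show i: "integrable M (\<lambda>\<omega>. (norm (euler_diff j t \<omega>))\<^sup>2)"
    using m by (intro integrableI_nonneg) auto
  have "ennreal (LINT \<omega>|M. (norm (euler_diff j t \<omega>))\<^sup>2) \<le> ennreal (T * (4 * (1/64) ^ j))"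
    using le nn_integral_eq_integral[OF i] by simp
  then show "(LINT \<omega>|M. (norm (euler_diff j t \<omega>))\<^sup>2) \<le> 4 * T * (1/64) ^ j"
    using T_pos by (subst (asm) ennreal_le_iff) (auto simp: mult_ac)
qed

lemma square_integrable_norm_imp_integrable:
  fixes Z :: "'w \<Rightarrow> real^'k"
  assumes "Z \<in> borel_measurable M" "integrable M (\<lambda>\<omega>. (norm (Z \<omega>))\<^sup>2)"
  shows "integrable M Z"
proof -
  have "integrable M (\<lambda>\<omega>. norm (Z \<omega>))"
    by (rule square_integrable_imp_integrable[rotated]) (use assms in simp_all)
  then show ?thesis using integrable_norm_iff[OF assms(1)] by simp
qed

text \<open>The maximal inequality at the level 2^-j: the factor 4^j is paid out of the mean square
  4 T 64^-j. The bound does not depend on the fineness \<open>m\<close> of the grid.\<close>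

lemma euler_diff_max:
  "prob {\<omega>\<in>space M. \<exists>k\<le>2^m. (1/2) ^ j < norm (euler_diff j (real k * T / 2^m) \<omega>)} \<le> 4 * T * (1/16) ^ j"
proof -
  define \<theta> where "\<theta> k = real k * T / 2^m" for k :: nat
  have \<theta>: "\<theta> k \<in> {0..T}" if "k \<le> 2^m" for k
    unfolding \<theta>_def by (rule dyadic_grid[OF T_pos that])
  have \<theta>_mono: "\<theta> i \<le> \<theta> k" if "i \<le> k" for i k
    using that T_pos by (simp add: \<theta>_def divide_right_mono)
  define X where "X k = euler_diff j (\<theta> k)" for k
  define n :: nat where "n = 2^m"
  have "((1/2) ^ j)\<^sup>2 * prob {\<omega>\<in>space M. \<exists>k\<le>n. (1/2) ^ j < norm (X k \<omega>)} \<le> (LINT \<omega>|M. (norm (X n \<omega>))\<^sup>2)"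
  proof (rule maximal_inequality)
    show "X k \<in> borel_measurable M" if "k \<le> n" for k
      unfolding X_def by (rule euler_diff_measurable[OF \<theta>]) (use that n_def in simp)
    show "integrable M (\<lambda>\<omega>. (norm (X k \<omega>))\<^sup>2)" if "k \<le> n" for k
      unfolding X_def by (rule euler_diff_L2[OF \<theta>]) (use that n_def in simp)
    fix k assume k: "k \<le> n"
    have kT: "\<theta> k \<in> {0..T}" "\<theta> n \<in> {0..T}" using \<theta> k by (auto simp: n_def)
    define A where "A = {\<omega>\<in>space M. (1/2) ^ j < norm (X k \<omega>) \<and> (\<forall>i<k. norm (X i \<omega>) \<le> (1/2) ^ j)}"
    have XF: "X i \<in> borel_measurable (F (\<theta> k))" if "i \<le> k" for i
      unfolding X_def
      by (rule measurable_F_mono[OF euler_diff_measurable_F[OF \<theta>] \<theta>_mono[OF that]])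
         (use kT k that n_def in auto)
    have AF: "A \<in> sets (F (\<theta> k))"
    proof -
      have sp: "space (F (\<theta> k)) = space M" using kT by simp
      have "{\<omega>\<in>space (F (\<theta> k)). i < k \<longrightarrow> norm (X i \<omega>) \<le> (1/2) ^ j} \<in> sets (F (\<theta> k))" for i
      proof (cases "i < k")
        case True
        then have [measurable]: "X i \<in> borel_measurable (F (\<theta> k))" using XF by simp
        show ?thesis by measurable
      qed simp
      then have 1: "{\<omega>\<in>space (F (\<theta> k)). \<forall>i<k. norm (X i \<omega>) \<le> (1/2) ^ j} \<in> sets (F (\<theta> k))"
        by (rule sets.sets_Collect_countable_All)
      have [measurable]: "X k \<in> borel_measurable (F (\<theta> k))" using XF by simp
      have 2: "{\<omega>\<in>space (F (\<theta> k)). (1/2) ^ j < norm (X k \<omega>)} \<in> sets (F (\<theta> k))" by measurable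
      have eq: "A = {\<omega>\<in>space (F (\<theta> k)). (1/2) ^ j < norm (X k \<omega>)} \<inter> {\<omega>\<in>space (F (\<theta> k)). \<forall>i<k. norm (X i \<omega>) \<le> (1/2) ^ j}"
        unfolding A_def sp by blast
      show ?thesis unfolding eq by (rule sets.Int[OF 2 1])
    qed
    \<comment> \<open>Absorbing the first-passage event into \<open>Z\<close> keeps it measurable at
      time \<open>\<theta> k\<close>, so the orthogonality of later increments applies to
      it.\<close>
    define Z where "Z \<omega> = indicator A \<omega> *\<^sub>R X k \<omega>" for \<omega>
    have ZF: "Z \<in> borel_measurable (F (\<theta> k))"
      unfolding Z_def[abs_def] by (intro borel_measurable_scaleR borel_measurable_indicator AF XF order_refl)
    have "integrable M (X k)"
      unfolding X_def by (rule square_integrable_norm_imp_integrable[OF euler_diff_measurable euler_diff_L2(1)]) (rule kT)+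
    then have Zi: "integrable M Z"
      unfolding Z_def[abs_def] using AF sets_F_subset[of "\<theta> k"] kT by (intro integrable_mult_indicator) auto
    have o: "integrable M (\<lambda>\<omega>. Z \<omega> \<bullet> (euler (mesh i) (\<theta> n) \<omega> - euler (mesh i) (\<theta> k) \<omega>))"
      "(LINT \<omega>|M. Z \<omega> \<bullet> (euler (mesh i) (\<theta> n) \<omega> - euler (mesh i) (\<theta> k) \<omega>)) = 0" for i
      using kT k by (intro euler_orthogonal[OF mesh_pos _ _ _ ZF Zi] \<theta>_mono; simp)+
    have eq: "indicator A \<omega> * (X k \<omega> \<bullet> (X n \<omega> - X k \<omega>))
       = Z \<omega> \<bullet> (euler (mesh (Suc j)) (\<theta> n) \<omega> - euler (mesh (Suc j)) (\<theta> k) \<omega>)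
        - Z \<omega> \<bullet> (euler (mesh j) (\<theta> n) \<omega> - euler (mesh j) (\<theta> k) \<omega>)" for \<omega>
      by (simp add: Z_def X_def euler_diff_def inner_diff_left inner_diff_right algebra_simps)
    show "(LINT \<omega>|M. indicator {\<omega>\<in>space M. (1/2) ^ j < norm (X k \<omega>) \<and> (\<forall>i<k. norm (X i \<omega>) \<le> (1/2) ^ j)} \<omega> * (X k \<omega> \<bullet> (X n \<omega> - X k \<omega>))) = 0"
      unfolding A_def[symmetric] eq using o by simp
  qed simp
  also have "\<dots> \<le> 4 * T * (1/64) ^ j"
    unfolding X_def by (rule euler_diff_L2(2)[OF \<theta>]) (simp add: n_def)
  finally have "4 ^ j * (((1/2) ^ j)\<^sup>2 * prob {\<omega>\<in>space M. \<exists>k\<le>n. (1/2) ^ j < norm (X k \<omega>)}) \<le> 4 ^ j * (4 * T * (1/64) ^ j)"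
    by (rule mult_left_mono) simp
  moreover have "4 ^ j * ((1/2) ^ j)\<^sup>2 = (1::real)"
    by (simp add: power_mult[symmetric] power_mult_distrib[symmetric] mult.commute[of j] power_mult power2_eq_square)
  moreover have "4 ^ j * (4 * T * (1/64) ^ j) = 4 * T * (1/16) ^ j"
    using power_mult_distrib[of "4::real" "1/64" j] by simp
  ultimately have "prob {\<omega>\<in>space M. \<exists>k\<le>n. (1/2) ^ j < norm (X k \<omega>)} \<le> 4 * T * (1/16) ^ j"
    by (simp only: mult.assoc[symmetric] mult_1)
  then show ?thesis by (simp add: X_def \<theta>_def n_def)
qed

text \<open>Over finer grids the events increase, so their union obeys the same bound, and
  Borel-Cantelli applies because 16^-j is summable. Continuity of the paths extends the estimate
  from dyadic times to all of [0,T].\<close>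

lemma AE_euler_diff_bound:
  "AE \<omega> in M. \<forall>\<^sub>F j in sequentially. \<forall>t\<in>{0..T}. norm (euler_diff j t \<omega>) \<le> (1/2) ^ j"
proof -
  define E where "E j m = {\<omega>\<in>space M. \<exists>k\<le>2^m. (1/2) ^ j < norm (euler_diff j (real k * T / 2^m) \<omega>)}" for j m :: nat
  have Em: "E j m \<in> events" for j m
  proof -
    have "{\<omega>\<in>space M. k \<le> 2^m \<and> (1/2) ^ j < norm (euler_diff j (real k * T / 2^m) \<omega>)} \<in> events" for k :: nat
    proof (cases "k \<le> 2^m")
      case True
      then have [measurable]: "euler_diff j (real k * T / 2^m) \<in> borel_measurable M"
        by (intro euler_diff_measurable dyadic_grid[OF T_pos])
      have "{\<omega>\<in>space M. (1/2) ^ j < norm (euler_diff j (real k * T / 2^m) \<omega>)} \<in> events" by measurable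
      then show ?thesis using True by simp
    qed simp
    then show ?thesis unfolding E_def by (rule sets.sets_Collect_countable_Ex)
  qed
  have inc: "incseq (E j)" for j
  proof (rule incseq_SucI)
    fix m
    show "E j m \<subseteq> E j (Suc m)"
    proof
      fix \<omega> assume "\<omega> \<in> E j m"
      then obtain k where k: "\<omega> \<in> space M" "k \<le> 2^m" "(1/2) ^ j < norm (euler_diff j (real k * T / 2^m) \<omega>)"
        by (auto simp: E_def)
      have "real (2 * k) * T / 2 ^ Suc m = real k * T / 2 ^ m" by simp
      then show "\<omega> \<in> E j (Suc m)" using k unfolding E_def by (auto intro!: exI[of _ "2 * k"])
    qed
  qed
  define U where "U j = (\<Union>m. E j m)" for j
  have Um: "U j \<in> events" for j unfolding U_def using Em by auto
  have Up: "prob (U j) \<le> 4 * T * (1/16) ^ j" for j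
  proof (rule LIMSEQ_le_const2)
    show "(\<lambda>m. prob (E j m)) \<longlonglongrightarrow> prob (U j)"
      unfolding U_def using Em inc by (intro finite_Lim_measure_incseq) auto
    show "\<exists>N. \<forall>m\<ge>N. prob (E j m) \<le> 4 * T * (1/16) ^ j"
      using euler_diff_max by (auto simp: E_def)
  qed
  have "summable (\<lambda>j. prob (U j))"
  proof (rule summable_comparison_test)
    show "\<exists>N. \<forall>j\<ge>N. norm (prob (U j)) \<le> 4 * T * (1/16) ^ j" using Up by auto
    show "summable (\<lambda>j. 4 * T * (1/16) ^ j)" by (intro summable_mult summable_geometric) simp
  qed
  then have "AE \<omega> in M. \<forall>\<^sub>F j in sequentially. \<omega> \<in> space M - U j"
    by (intro borel_cantelli_AE1 Um) (auto simp: emeasure_eq_measure)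
  moreover have "AE \<omega> in M. continuous_on {0..T} (\<lambda>t. w t \<omega>)"
    using wiener by (simp add: wiener_process_def)
  ultimately show ?thesis
  proof eventually_elim
    case (elim \<omega>)
    show ?case
      using elim(1)
    proof eventually_elim
      case (elim j)
      have cont: "continuous_on {0..T} (\<lambda>t. norm (euler_diff j t \<omega>))"
        unfolding euler_diff_def
        by (intro continuous_on_norm continuous_on_diff euler_continuous mesh_pos) (rule \<open>continuous_on {0..T} (\<lambda>t. w t \<omega>)\<close>)+
      have bd: "norm (euler_diff j (real k * T / 2^m) \<omega>) \<le> (1/2) ^ j" if "k \<le> 2^m" for k m
        using elim that by (auto simp: U_def E_def not_less)
      show ?case
      proof
        fix t assume t: "t \<in> {0..T}"
        obtain k :: "nat \<Rightarrow> nat" where k2: "\<And>m. k m \<le> 2 ^ m" and kt: "(\<lambda>m. real (k m) * T / 2 ^ m) \<longlonglongrightarrow> t"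
          using dyadic_approximation[OF T_pos t] by blast
        have "(\<lambda>m. norm (euler_diff j (real (k m) * T / 2^m) \<omega>)) \<longlonglongrightarrow> norm (euler_diff j t \<omega>)"
          by (rule continuous_on_tendsto_compose[OF cont kt t always_eventually[OF allI[OF dyadic_grid[OF T_pos k2]]]])
        then show "norm (euler_diff j t \<omega>) \<le> (1/2) ^ j"
          by (rule LIMSEQ_le_const2) (use bd[OF k2] in auto)
      qed
    qed
  qed
qed

text \<open>Successive step sums differ by at most 2^-j eventually, uniformly in time, so the
  Weierstrass test gives uniform convergence and continuity of the limit.\<close>

lemma wiener_path_exists:
  "\<exists>I. (\<forall>\<omega>\<in>space M. continuous_on {0..T} (\<lambda>t. I t \<omega>)) \<and>
      (\<forall>t\<in>{0..T}. I t \<in> borel_measurable (F t)) \<and>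
      (AE \<omega> in M. uniform_limit {0..T} (\<lambda>j t. euler (mesh j) t \<omega>) (\<lambda>t. I t \<omega>) sequentially)"
proof -
  have "AE \<omega> in M. continuous_on {0..T} (\<lambda>t. w t \<omega>) \<and>
      (\<forall>\<^sub>F j in sequentially. \<forall>t\<in>{0..T}. norm (euler_diff j t \<omega>) \<le> (1/2) ^ j)"
    using AE_euler_diff_bound wiener by (auto simp: wiener_process_def)
  then obtain N where N: "N \<in> null_sets M" and good: "\<And>\<omega>. \<omega> \<in> space M - N \<Longrightarrow>
     continuous_on {0..T} (\<lambda>t. w t \<omega>) \<and> (\<forall>\<^sub>F j in sequentially. \<forall>t\<in>{0..T}. norm (euler_diff j t \<omega>) \<le> (1/2) ^ j)"
    by (auto elim!: AE_E3)
  \<comment> \<open>The value 0 on the exceptional set makes every path continuous; the process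
    stays adapted because the filtration contains the null sets.\<close>
  define I where "I t \<omega> = (if \<omega> \<in> N then 0 else lim (\<lambda>j. euler (mesh j) t \<omega>))" for t \<omega>
  have ul: "uniform_limit {0..T} (\<lambda>j t. euler (mesh j) t \<omega>) (\<lambda>t. I t \<omega>) sequentially"
    if \<omega>: "\<omega> \<in> space M - N" for \<omega>
  proof -
    have "summable (\<lambda>j. (1/2) ^ j :: real)" by (rule summable_geometric) simp
    then have "uniform_limit {0..T} (\<lambda>n t. \<Sum>j<n. euler_diff j t \<omega>) (\<lambda>t. \<Sum>j. euler_diff j t \<omega>) sequentially"
      using good[OF \<omega>] by (intro Weierstrass_m_test_ev) auto
    then have "uniform_limit {0..T} (\<lambda>n t. (\<Sum>j<n. euler_diff j t \<omega>) + euler (mesh 0) t \<omega>)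
       (\<lambda>t. (\<Sum>j. euler_diff j t \<omega>) + euler (mesh 0) t \<omega>) sequentially"
      by (intro uniform_limit_intros)
    moreover have "(\<Sum>j<n. euler_diff j t \<omega>) + euler (mesh 0) t \<omega> = euler (mesh n) t \<omega>" for n t
      using sum_lessThan_telescope[of "\<lambda>j. euler (mesh j) t \<omega>" n] by (simp add: euler_diff_def)
    ultimately have u: "uniform_limit {0..T} (\<lambda>n t. euler (mesh n) t \<omega>) (\<lambda>t. (\<Sum>j. euler_diff j t \<omega>) + euler (mesh 0) t \<omega>) sequentially"
      by simp
    have eq: "I t \<omega> = (\<Sum>j. euler_diff j t \<omega>) + euler (mesh 0) t \<omega>" if "t \<in> {0..T}" for t
      using tendsto_uniform_limitI[OF u that] \<omega> by (simp add: I_def limI)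
    show ?thesis by (rule uniform_limit_cong'[THEN iffD2, OF refl eq u])
  qed
  have "continuous_on {0..T} (\<lambda>t. I t \<omega>)" if "\<omega> \<in> space M" for \<omega>
  proof (cases "\<omega> \<in> N")
    case False
    then have \<omega>: "\<omega> \<in> space M - N" using that by simp
    show ?thesis
      by (rule uniform_limit_theorem[OF _ ul[OF \<omega>]])
         (use good[OF \<omega>] in \<open>auto intro!: always_eventually euler_continuous mesh_pos\<close>)
  qed (simp add: I_def)
  moreover have "I t \<in> borel_measurable (F t)" if t: "t \<in> {0..T}" for t
  proof (rule borel_measurable_LIMSEQ_metric)
    have sp: "space (F t) = space M" using t by simp
    have "N \<in> sets (F t)" using null_sets_F[of t N] N t by simp
    then have "space (F t) - N \<in> sets (F t)" by auto
    then show "(\<lambda>\<omega>. indicator (space (F t) - N) \<omega> *\<^sub>R euler (mesh j) t \<omega>) \<in> borel_measurable (F t)" for j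
      by (intro borel_measurable_scaleR borel_measurable_indicator euler_measurable_F mesh_pos t)
    fix \<omega> assume "\<omega> \<in> space (F t)"
    then have \<omega>: "\<omega> \<in> space M" by (simp add: sp)
    show "(\<lambda>j. indicator (space (F t) - N) \<omega> *\<^sub>R euler (mesh j) t \<omega>) \<longlonglongrightarrow> I t \<omega>"
    proof (cases "\<omega> \<in> N")
      case True then show ?thesis by (simp add: I_def)
    next
      case False
      then have "\<omega> \<in> space M - N" using \<omega> by simp
      from tendsto_uniform_limitI[OF ul[OF this] t] show ?thesis using False \<omega> by (simp add: sp)
    qed
  qed
  moreover have "AE \<omega> in M. uniform_limit {0..T} (\<lambda>j t. euler (mesh j) t \<omega>) (\<lambda>t. I t \<omega>) sequentially"
    using AE_not_in[OF N] AE_space by eventually_elim (rule ul, simp)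
  ultimately show ?thesis by blast
qed

end

section \<open>Square-integrable vectors and the limit process\<close>

lemma norm_diff_square_le: "(norm (x - z))\<^sup>2 \<le> 2 * (norm (x - y))\<^sup>2 + 2 * (norm (y - z))\<^sup>2" for x y z :: "'a::real_inner"
proof -
  have "norm (x - z) \<le> norm (x - y) + norm (y - z)"
    using norm_triangle_ineq[of "x - y" "y - z"] by simp
  then have "(norm (x - z))\<^sup>2 \<le> (norm (x - y) + norm (y - z))\<^sup>2" by (rule power_mono) simp
  also have "\<dots> \<le> 2 * (norm (x - y))\<^sup>2 + 2 * (norm (y - z))\<^sup>2"
    using sum_squares_bound[of "norm (x - y)" "norm (y - z)"] by (simp add: power2_sum)
  finally show ?thesis .
qed

text \<open>Young's inequality with a free weight. It will be used with \<open>d\<close> equal to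
  (1/8)^j, for which both terms tend to 0 at the same rate.\<close>

lemma abs_inner_le_weighted:
  fixes x y :: "'a::real_inner"
  assumes "0 < d"
  shows "\<bar>x \<bullet> y\<bar> \<le> (d * (norm x)\<^sup>2 + (norm y)\<^sup>2 / d) / 2"
proof -
  have "0 \<le> (d * norm x - norm y)\<^sup>2 / d" using assms by simp
  also have "\<dots> = d * (norm x)\<^sup>2 + (norm y)\<^sup>2 / d - 2 * (norm x * norm y)"
    using assms by (simp add: power2_eq_square field_simps)
  finally show ?thesis using Cauchy_Schwarz_ineq2[of x y] by simp
qed

lemma integrable_inner_square:
  fixes X Y :: "'w \<Rightarrow> 'a::euclidean_space"
  assumes [measurable]: "X \<in> borel_measurable M" "Y \<in> borel_measurable M"
    and "integrable M (\<lambda>\<omega>. (norm (X \<omega>))\<^sup>2)" "integrable M (\<lambda>\<omega>. (norm (Y \<omega>))\<^sup>2)"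
  shows "integrable M (\<lambda>\<omega>. X \<omega> \<bullet> Y \<omega>)"
proof (rule Bochner_Integration.integrable_bound)
  show "integrable M (\<lambda>\<omega>. (1 * (norm (X \<omega>))\<^sup>2 + (norm (Y \<omega>))\<^sup>2 / 1) / 2)" using assms by simp
  show "AE \<omega> in M. norm (X \<omega> \<bullet> Y \<omega>) \<le> norm ((1 * (norm (X \<omega>))\<^sup>2 + (norm (Y \<omega>))\<^sup>2 / 1) / 2)"
    using abs_inner_le_weighted[of 1 "X _" "Y _"] by (intro AE_I2) simp
qed measurable

lemma integrable_square_diff:
  fixes X Y :: "'w \<Rightarrow> 'a::euclidean_space"
  assumes [measurable]: "X \<in> borel_measurable M" "Y \<in> borel_measurable M"
    and "integrable M (\<lambda>\<omega>. (norm (X \<omega>))\<^sup>2)" "integrable M (\<lambda>\<omega>. (norm (Y \<omega>))\<^sup>2)"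
  shows "integrable M (\<lambda>\<omega>. (norm (X \<omega> - Y \<omega>))\<^sup>2)"
proof (rule Bochner_Integration.integrable_bound)
  show "integrable M (\<lambda>\<omega>. 2 * (norm (X \<omega>))\<^sup>2 + 2 * (norm (Y \<omega>))\<^sup>2)" using assms by simp
  show "AE \<omega> in M. norm ((norm (X \<omega> - Y \<omega>))\<^sup>2) \<le> norm (2 * (norm (X \<omega>))\<^sup>2 + 2 * (norm (Y \<omega>))\<^sup>2)"
    using norm_diff_square_le[of "X _" "Y _" 0] by (intro AE_I2) simp
qed measurable

locale wiener_path = wiener_integrand M T w x0 S0 G
  for M :: "'w measure" and T and w :: "real \<Rightarrow> 'w \<Rightarrow> real^'p" and x0 :: "'w \<Rightarrow> real^'n" and S0 G +
  fixes I :: "real \<Rightarrow> 'w \<Rightarrow> real^'n"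
  assumes I_continuous: "\<omega> \<in> space M \<Longrightarrow> continuous_on {0..T} (\<lambda>t. I t \<omega>)"
    and I_measurable_F: "t \<in> {0..T} \<Longrightarrow> I t \<in> borel_measurable (F t)"
    and I_uniform: "AE \<omega> in M. uniform_limit {0..T} (\<lambda>j t. euler (mesh j) t \<omega>) (\<lambda>t. I t \<omega>) sequentially"
begin

lemma I_measurable: "t \<in> {0..T} \<Longrightarrow> I t \<in> borel_measurable M"
  by (rule measurable_F_imp[of t]) (auto intro: I_measurable_F)

lemma I_lim:
  assumes "t \<in> {0..T}"
  shows "AE \<omega> in M. (\<lambda>j. euler (mesh j) t \<omega>) \<longlonglongrightarrow> I t \<omega>"
  using I_uniform by eventually_elim (rule tendsto_uniform_limitI[OF _ assms])

lemma I_0: "AE \<omega> in M. I 0 \<omega> = 0"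
  using I_lim[of 0] T_pos by (auto simp: euler_0 mesh_pos LIMSEQ_const_iff elim!: eventually_mono)

text \<open>Fatou's lemma in \<open>m\<close>, applied to the estimate between two meshes.\<close>

lemma I_L2_nn:
  assumes t: "t \<in> {0..T}"
  shows "(\<integral>\<^sup>+\<omega>. ennreal ((norm (euler (mesh j) t \<omega> - I t \<omega>))\<^sup>2) \<partial>M) \<le> ennreal (T * (4 * (1/64) ^ j))"
proof -
  have [measurable]: "euler (mesh i) t \<in> borel_measurable M" for i by (rule euler_measurable[OF mesh_pos t])
  have "(\<integral>\<^sup>+\<omega>. ennreal ((norm (euler (mesh j) t \<omega> - I t \<omega>))\<^sup>2) \<partial>M)
     = (\<integral>\<^sup>+\<omega>. liminf (\<lambda>m. ennreal ((norm (euler (mesh j) t \<omega> - euler (mesh m) t \<omega>))\<^sup>2)) \<partial>M)"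
  proof (rule nn_integral_cong_AE)
    show "AE \<omega> in M. ennreal ((norm (euler (mesh j) t \<omega> - I t \<omega>))\<^sup>2)
       = liminf (\<lambda>m. ennreal ((norm (euler (mesh j) t \<omega> - euler (mesh m) t \<omega>))\<^sup>2))"
      using I_lim[OF t]
    proof eventually_elim
      case (elim \<omega>)
      have "(\<lambda>m. ennreal ((norm (euler (mesh j) t \<omega> - euler (mesh m) t \<omega>))\<^sup>2)) \<longlonglongrightarrow> ennreal ((norm (euler (mesh j) t \<omega> - I t \<omega>))\<^sup>2)"
        by (intro tendsto_intros elim)
      then show ?case by (rule lim_imp_Liminf[OF trivial_limit_sequentially, symmetric])
    qed
  qed
  also have "\<dots> \<le> liminf (\<lambda>m. \<integral>\<^sup>+\<omega>. ennreal ((norm (euler (mesh j) t \<omega> - euler (mesh m) t \<omega>))\<^sup>2) \<partial>M)"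
    by (rule nn_integral_liminf) measurable
  also have "\<dots> \<le> ennreal (T * (4 * (1/64) ^ j))"
  proof (rule Liminf_le)
    show "\<forall>\<^sub>F m in sequentially. (\<integral>\<^sup>+\<omega>. ennreal ((norm (euler (mesh j) t \<omega> - euler (mesh m) t \<omega>))\<^sup>2) \<partial>M) \<le> ennreal (T * (4 * (1/64) ^ j))"
      using eventually_ge_at_top[of j] by eventually_elim (rule euler_L2_diff[OF t])
  qed simp
  finally show ?thesis .
qed

lemma I_L2:
  assumes t: "t \<in> {0..T}"
  shows "integrable M (\<lambda>\<omega>. (norm (euler (mesh j) t \<omega> - I t \<omega>))\<^sup>2)"
    and "(LINT \<omega>|M. (norm (euler (mesh j) t \<omega> - I t \<omega>))\<^sup>2) \<le> 4 * T * (1/64) ^ j"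
proof -
  have [measurable]: "euler (mesh j) t \<in> borel_measurable M" "I t \<in> borel_measurable M"
    by (rule euler_measurable[OF mesh_pos t] I_measurable[OF t])+
  have "(\<integral>\<^sup>+\<omega>. ennreal ((norm (euler (mesh j) t \<omega> - I t \<omega>))\<^sup>2) \<partial>M) < \<infinity>"
    using I_L2_nn[OF t] by (rule le_less_trans) simp
  then show i: "integrable M (\<lambda>\<omega>. (norm (euler (mesh j) t \<omega> - I t \<omega>))\<^sup>2)"
    by (intro integrableI_nonneg) auto
  have "ennreal (LINT \<omega>|M. (norm (euler (mesh j) t \<omega> - I t \<omega>))\<^sup>2) \<le> ennreal (T * (4 * (1/64) ^ j))"
    using I_L2_nn[OF t, of j] nn_integral_eq_integral[OF i] by simp
  then show "(LINT \<omega>|M. (norm (euler (mesh j) t \<omega> - I t \<omega>))\<^sup>2) \<le> 4 * T * (1/64) ^ j"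
    using T_pos by (subst (asm) ennreal_le_iff) (auto simp: mult_ac)
qed

lemma I_square_integrable:
  assumes t: "t \<in> {0..T}"
  shows "integrable M (\<lambda>\<omega>. (norm (I t \<omega>))\<^sup>2)"
proof -
  have [measurable]: "euler (mesh 0) t \<in> borel_measurable M" "I t \<in> borel_measurable M"
    by (rule euler_measurable[OF mesh_pos t] I_measurable[OF t])+
  have "integrable M (\<lambda>\<omega>. (norm (euler (mesh 0) t \<omega> - (euler (mesh 0) t \<omega> - I t \<omega>)))\<^sup>2)"
    by (rule integrable_square_diff) (use euler_square_integrable[OF mesh_pos t] I_L2(1)[OF t] in simp_all)
  then show ?thesis by simp
qed

text \<open>The single sum for \<open>mesh 0\<close> suffices: its step function differs from
  \<open>G\<close> by at most (1/8)^0 = 1 after time 0, whence \<open>1 + B\<close>, and its mean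
  square distance from \<open>I t\<close> is at most 4 T.\<close>

lemma I_second_moment_bounded:
  "\<exists>C\<ge>0. \<forall>t\<in>{0..T}. (LINT \<omega>|M. (norm (I t \<omega>))\<^sup>2) \<le> C"
proof -
  have "compact (G ` {0..T})" by (rule compact_continuous_image[OF continuous_G]) simp
  then obtain B where B: "\<And>s. s \<in> {0..T} \<Longrightarrow> norm (G s) \<le> B"
    by (meson bounded_iff compact_imp_bounded imageI)
  define C where "C = 2 * (T * (1 + B)\<^sup>2) + 2 * (4 * T)"
  have "(LINT \<omega>|M. (norm (I t \<omega>))\<^sup>2) \<le> C" if t: "t \<in> {0..T}" for t
  proof -
    define e where "e = euler (mesh 0) t"
    have e2: "integrable M (\<lambda>\<omega>. (norm (e \<omega>))\<^sup>2)" unfolding e_def by (rule euler_square_integrable[OF mesh_pos t])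
    \<comment> \<open>Comparing with zero coefficients on the same partition turns the isometry for
      differences into one for a single step integral.\<close>
    have z: "step_integral w (mesh 0) (\<lambda>i. min t (node (mesh 0) i)) (\<lambda>i. 0) \<omega> = 0" 
        "step_function (mesh 0) (\<lambda>i. min t (node (mesh 0) i)) (\<lambda>i. 0) s = (0 :: real^'p^'n)" for \<omega> s
      by (simp_all add: step_integral_def step_function_def)
    have "(\<integral>\<^sup>+\<omega>. ennreal ((norm (e \<omega>))\<^sup>2) \<partial>M) = (\<integral>\<^sup>+s\<in>{0..t}. ennreal ((norm (euler_step (mesh 0) t s))\<^sup>2) \<partial>lborel)"
      using step_integral_isometry[OF partition_node[OF mesh_pos[of 0] t] partition_node[OF mesh_pos[of 0] t],
          where C="\<lambda>i. G (node (mesh 0) i)" and C'="\<lambda>i. 0"] t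
      by (simp add: z e_def euler_def euler_step_def)
    also have "\<dots> \<le> ennreal (T * (1 + B)\<^sup>2)"
    proof (rule nn_integral_interval_bound[OF t])
      fix s assume s: "0 < s" "s \<le> t"
      have "norm (euler_step (mesh 0) t s) \<le> norm (euler_step (mesh 0) t s - G s) + norm (G s)"
        using norm_triangle_ineq[of "euler_step (mesh 0) t s - G s" "G s"] by simp
      also have "\<dots> \<le> 1 + B"
        using euler_step_mesh[of t s 0] B[of s] s t by (intro add_mono) auto
      finally show "(norm (euler_step (mesh 0) t s))\<^sup>2 \<le> (1 + B)\<^sup>2" by (rule power_mono) simp
    qed simp
    finally have "(LINT \<omega>|M. (norm (e \<omega>))\<^sup>2) \<le> T * (1 + B)\<^sup>2"
      using nn_integral_eq_integral[OF e2] T_pos by simp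
    moreover have "(LINT \<omega>|M. (norm (e \<omega> - I t \<omega>))\<^sup>2) \<le> 4 * T"
      using I_L2(2)[OF t, of 0] by (simp add: e_def)
    moreover have "(LINT \<omega>|M. (norm (I t \<omega>))\<^sup>2) \<le> (LINT \<omega>|M. 2 * (norm (e \<omega>))\<^sup>2 + 2 * (norm (e \<omega> - I t \<omega>))\<^sup>2)"
    proof (rule integral_mono)
      show "integrable M (\<lambda>\<omega>. 2 * (norm (e \<omega>))\<^sup>2 + 2 * (norm (e \<omega> - I t \<omega>))\<^sup>2)"
        using e2 I_L2(1)[OF t, of 0] by (simp add: e_def)
      show "(norm (I t \<omega>))\<^sup>2 \<le> 2 * (norm (e \<omega>))\<^sup>2 + 2 * (norm (e \<omega> - I t \<omega>))\<^sup>2" for \<omega>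
        using norm_diff_square_le[of 0 "I t \<omega>" "e \<omega>"] by simp
    qed (rule I_square_integrable[OF t])
    ultimately show ?thesis
      using e2 I_L2(1)[OF t, of 0] by (simp add: e_def C_def)
  qed
  moreover have "0 \<le> C" using T_pos by (simp add: C_def)
  ultimately show ?thesis by blast
qed

text \<open>The martingale property of \<open>I\<close>, tested against square-integrable
  \<open>Z\<close>. It holds exactly for the step sums and passes to the limit by the mean square
  estimate.\<close>

lemma I_orthogonal:
  fixes Z :: "'w \<Rightarrow> real^'n"
  assumes st: "0 \<le> s" "s \<le> t" "t \<le> T" and Z: "Z \<in> borel_measurable (F s)" "integrable M (\<lambda>\<omega>. (norm (Z \<omega>))\<^sup>2)"
  shows "(LINT \<omega>|M. Z \<omega> \<bullet> (I t \<omega> - I s \<omega>)) = 0"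
proof -
  have sT: "s \<in> {0..T}" "t \<in> {0..T}" using st by auto
  have ZM[measurable]: "Z \<in> borel_measurable M" using Z(1) sT by (intro measurable_F_imp[of s]) auto
  have Zi: "integrable M Z" using ZM Z(2) by (rule square_integrable_norm_imp_integrable)
  define c where "c = (LINT \<omega>|M. (norm (Z \<omega>))\<^sup>2) + 4 * T"
  have small: "integrable M (\<lambda>\<omega>. Z \<omega> \<bullet> (euler (mesh j) r \<omega> - I r \<omega>)) \<and>
     \<bar>LINT \<omega>|M. Z \<omega> \<bullet> (euler (mesh j) r \<omega> - I r \<omega>)\<bar> \<le> (1/8) ^ j * c / 2" if r: "r \<in> {0..T}" for r j
  proof -
    have [measurable]: "euler (mesh j) r \<in> borel_measurable M" "I r \<in> borel_measurable M"
      by (rule euler_measurable[OF mesh_pos r] I_measurable[OF r])+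
    define d :: real where "d = (1/8) ^ j"
    have d: "0 < d" by (simp add: d_def)
    have i: "integrable M (\<lambda>\<omega>. Z \<omega> \<bullet> (euler (mesh j) r \<omega> - I r \<omega>))"
      by (rule integrable_inner_square) (use Z(2) I_L2(1)[OF r] in simp_all)
    have "\<bar>LINT \<omega>|M. Z \<omega> \<bullet> (euler (mesh j) r \<omega> - I r \<omega>)\<bar> \<le> (LINT \<omega>|M. \<bar>Z \<omega> \<bullet> (euler (mesh j) r \<omega> - I r \<omega>)\<bar>)"
      using integral_norm_bound[of M "\<lambda>\<omega>. Z \<omega> \<bullet> (euler (mesh j) r \<omega> - I r \<omega>)"] by simp
    also have "\<dots> \<le> (LINT \<omega>|M. (d * (norm (Z \<omega>))\<^sup>2 + (norm (euler (mesh j) r \<omega> - I r \<omega>))\<^sup>2 / d) / 2)"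
      by (rule integral_mono) (use i Z(2) I_L2(1)[OF r] abs_inner_le_weighted[OF d] in simp_all)
    also have "\<dots> = (d * (LINT \<omega>|M. (norm (Z \<omega>))\<^sup>2) + (LINT \<omega>|M. (norm (euler (mesh j) r \<omega> - I r \<omega>))\<^sup>2) / d) / 2"
      using Z(2) I_L2(1)[OF r] by simp
    also have "\<dots> \<le> (d * (LINT \<omega>|M. (norm (Z \<omega>))\<^sup>2) + (4 * T * (1/64) ^ j) / d) / 2"
      using I_L2(2)[OF r, of j] d by (intro divide_right_mono add_mono) auto
    also have "(4 * T * (1/64) ^ j) / d = d * (4 * T)"
    proof -
      have "(1/64) ^ j = d * d" unfolding d_def power_mult_distrib[symmetric] by simp
      then show ?thesis using d by simp
    qed
    finally show ?thesis using i by (simp add: c_def d_def distrib_left)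
  qed
  have "\<bar>LINT \<omega>|M. Z \<omega> \<bullet> (I t \<omega> - I s \<omega>)\<bar> \<le> (1/8) ^ j * c" for j
  proof -
    note o = euler_orthogonal[OF mesh_pos st Z(1) Zi, of j]
    have "(LINT \<omega>|M. Z \<omega> \<bullet> (I t \<omega> - I s \<omega>))
      = (LINT \<omega>|M. Z \<omega> \<bullet> (euler (mesh j) t \<omega> - euler (mesh j) s \<omega>)
         - Z \<omega> \<bullet> (euler (mesh j) t \<omega> - I t \<omega>) + Z \<omega> \<bullet> (euler (mesh j) s \<omega> - I s \<omega>))"
      by (intro Bochner_Integration.integral_cong) (simp_all add: inner_diff_right)
    also have "\<dots> = - (LINT \<omega>|M. Z \<omega> \<bullet> (euler (mesh j) t \<omega> - I t \<omega>)) + (LINT \<omega>|M. Z \<omega> \<bullet> (euler (mesh j) s \<omega> - I s \<omega>))"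
      using o small[OF sT(1), of j] small[OF sT(2), of j] by simp
    finally show ?thesis using small[OF sT(1), of j] small[OF sT(2), of j] by linarith
  qed
  moreover have "(\<lambda>j. (1/8) ^ j * c) \<longlonglongrightarrow> 0 * c"
    by (intro tendsto_mult_right LIMSEQ_power_zero) simp
  ultimately have "\<bar>LINT \<omega>|M. Z \<omega> \<bullet> (I t \<omega> - I s \<omega>)\<bar> \<le> 0"
    by (intro LIMSEQ_le_const[where X="\<lambda>j. (1/8) ^ j * c"]) auto
  then show ?thesis by simp
qed

lemma euler_step_L2_lim:
  assumes t: "t \<in> {0..T}"
  shows "(\<lambda>j. \<integral>\<^sup>+s\<in>{0..t}. ennreal ((norm (euler_step (mesh j) t s - G s))\<^sup>2) \<partial>lborel) \<longlonglongrightarrow> 0"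
proof (rule tendsto_sandwich[OF _ _ tendsto_const])
  show "\<forall>\<^sub>F j in sequentially. (\<integral>\<^sup>+s\<in>{0..t}. ennreal ((norm (euler_step (mesh j) t s - G s))\<^sup>2) \<partial>lborel) \<le> ennreal (T * (1/64) ^ j)"
  proof (rule always_eventually, rule allI, rule nn_integral_interval_bound[OF t])
    fix j s assume "0 < s" "s \<le> t"
    then have "(norm (euler_step (mesh j) t s - G s))\<^sup>2 \<le> ((1/8) ^ j)\<^sup>2"
      using t by (intro power_mono euler_step_mesh) auto
    also have "\<dots> = (1/64) ^ j" by (simp add: power2_eq_square power_mult_distrib[symmetric])
    finally show "(norm (euler_step (mesh j) t s - G s))\<^sup>2 \<le> (1/64) ^ j" .
  qed simp
  have "(\<lambda>j. T * (1/64) ^ j) \<longlonglongrightarrow> T * 0" by (intro tendsto_mult_left LIMSEQ_power_zero) simp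
  then show "(\<lambda>j. ennreal (T * (1/64) ^ j)) \<longlonglongrightarrow> 0"
    using tendsto_ennrealI by fastforce
qed simp

lemma I_L2_lim:
  assumes t: "t \<in> {0..T}"
  shows "(\<lambda>j. \<integral>\<^sup>+\<omega>. ennreal ((norm (euler (mesh j) t \<omega> - I t \<omega>))\<^sup>2) \<partial>M) \<longlonglongrightarrow> 0"
proof (rule tendsto_sandwich[OF _ _ tendsto_const])
  show "\<forall>\<^sub>F j in sequentially. (\<integral>\<^sup>+\<omega>. ennreal ((norm (euler (mesh j) t \<omega> - I t \<omega>))\<^sup>2) \<partial>M) \<le> ennreal (T * (4 * (1/64) ^ j))"
    using I_L2_nn[OF t] by (intro always_eventually allI)
  have "(\<lambda>j. T * (4 * (1/64) ^ j)) \<longlonglongrightarrow> T * (4 * 0)" by (intro tendsto_mult_left LIMSEQ_power_zero) simp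
  then show "(\<lambda>j. ennreal (T * (4 * (1/64) ^ j))) \<longlonglongrightarrow> 0"
    using tendsto_ennrealI by fastforce
qed simp

lemma I_has_wiener_integral:
  assumes t: "t \<in> {0..T}"
  shows "has_wiener_integral M w G t (I t)"
  unfolding has_wiener_integral_def
proof (intro conjI exI)
  show "I t \<in> borel_measurable M" by (rule I_measurable[OF t])
  show "\<forall>j. partition_upto t (mesh j) (\<lambda>i. min t (node (mesh j) i))" using partition_node[OF mesh_pos t] by simp
  show "(\<lambda>j. \<integral>\<^sup>+s\<in>{0..t}. ennreal ((norm (step_function (mesh j) (\<lambda>i. min t (node (mesh j) i)) (\<lambda>i. G (node (mesh j) i)) s - G s))\<^sup>2) \<partial>lborel) \<longlonglongrightarrow> 0"
    using euler_step_L2_lim[OF t] by (simp add: euler_step_def)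
  show "(\<lambda>j. \<integral>\<^sup>+\<omega>. ennreal ((norm (step_integral w (mesh j) (\<lambda>i. min t (node (mesh j) i)) (\<lambda>i. G (node (mesh j) i)) \<omega> - I t \<omega>))\<^sup>2) \<partial>M) \<longlonglongrightarrow> 0"
    using I_L2_lim[OF t] by (simp add: euler_def)
qed

text \<open>Two approximations are compared through the isometry: the mean square distance of the
  step integrals is that of the step functions, and both of these tend to \<open>G\<close>. So the
  freedom in choosing partitions does not affect the value.\<close>

lemma wiener_integral_unique:
  assumes t: "t \<in> {0..T}" and J: "has_wiener_integral M w G t J"
  shows "AE \<omega> in M. J \<omega> = I t \<omega>"
proof -
  obtain k \<tau> C where Jm: "J \<in> borel_measurable M" and p: "\<And>j. partition_upto t (k j) (\<tau> j)"
    and sl: "(\<lambda>j. \<integral>\<^sup>+s\<in>{0..t}. ennreal ((norm (step_function (k j) (\<tau> j) (C j) s - G s))\<^sup>2) \<partial>lborel) \<longlonglongrightarrow> 0"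
    and il: "(\<lambda>j. \<integral>\<^sup>+\<omega>. ennreal ((norm (step_integral w (k j) (\<tau> j) (C j) \<omega> - J \<omega>))\<^sup>2) \<partial>M) \<longlonglongrightarrow> 0"
    using J unfolding has_wiener_integral_def by blast
  have [measurable]: "J \<in> borel_measurable M" "I t \<in> borel_measurable M" using Jm I_measurable[OF t] by auto
  have [measurable]: "euler (mesh j) t \<in> borel_measurable M" for j by (rule euler_measurable[OF mesh_pos t])
  define S where "S j = step_integral w (k j) (\<tau> j) (C j)" for j
  define f where "f j = step_function (k j) (\<tau> j) (C j)" for j
  have [measurable]: "S j \<in> borel_measurable M" for j
    unfolding S_def by (rule measurable_F_imp[of t]) (use t step_integral_measurable[OF p] in auto)
  have [measurable]: "f j \<in> borel_measurable borel" for j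
    unfolding f_def step_function_def[abs_def] by measurable
  have [measurable]: "euler_step N t \<in> borel_measurable borel" for N
    unfolding euler_step_def step_function_def[abs_def] by measurable
  \<comment> \<open>Continuity of \<open>G\<close> is known only on [0,T]; the cut-off version is
    Borel measurable on the whole line.\<close>
  define g where "g s = indicator {0..t} s *\<^sub>R G s" for s
  have [measurable]: "g \<in> borel_measurable borel"
    unfolding g_def[abs_def] using t
    by (intro borel_measurable_continuous_on_indicator continuous_on_subset[OF continuous_G]) auto
  define a where "a j = (\<integral>\<^sup>+\<omega>. ennreal ((norm (S j \<omega> - J \<omega>))\<^sup>2) \<partial>M)" for j
  define b where "b j = (\<integral>\<^sup>+s\<in>{0..t}. ennreal ((norm (f j s - G s))\<^sup>2) \<partial>lborel)" for j
  define c where "c j = (\<integral>\<^sup>+s\<in>{0..t}. ennreal ((norm (euler_step (mesh j) t s - G s))\<^sup>2) \<partial>lborel)" for j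
  define e where "e j = (\<integral>\<^sup>+\<omega>. ennreal ((norm (euler (mesh j) t \<omega> - I t \<omega>))\<^sup>2) \<partial>M)" for j
  have bg: "b j = (\<integral>\<^sup>+s. ennreal ((norm (f j s - g s))\<^sup>2) * indicator {0..t} s \<partial>lborel)" for j
    unfolding b_def g_def by (intro nn_integral_cong) (auto split: split_indicator)
  have cg: "c j = (\<integral>\<^sup>+s. ennreal ((norm (euler_step (mesh j) t s - g s))\<^sup>2) * indicator {0..t} s \<partial>lborel)" for j
    unfolding c_def g_def by (intro nn_integral_cong) (auto split: split_indicator)
  \<comment> \<open>The route leads from \<open>J\<close> to \<open>S j\<close>, then to the step
    sum of the mesh, then to \<open>I t\<close>. Two uses of \<open>norm_diff_square_le\<close>
    produce the factors 2, 4 and 4, and the isometry converts the middle distance into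
    \<open>b j\<close> and \<open>c j\<close>.\<close>
  have le: "(\<integral>\<^sup>+\<omega>. ennreal ((norm (J \<omega> - I t \<omega>))\<^sup>2) \<partial>M) \<le> 2 * a j + 4 * (2 * b j + 2 * c j) + 4 * e j" for j
  proof -
    have "(\<integral>\<^sup>+\<omega>. ennreal ((norm (S j \<omega> - euler (mesh j) t \<omega>))\<^sup>2) \<partial>M)
       = (\<integral>\<^sup>+s\<in>{0..t}. ennreal ((norm (f j s - euler_step (mesh j) t s))\<^sup>2) \<partial>lborel)"
      unfolding S_def euler_def f_def euler_step_def
      by (rule step_integral_isometry[OF p partition_node[OF mesh_pos t]]) (use t in auto)
    also have "\<dots> \<le> (\<integral>\<^sup>+s. 2 * (ennreal ((norm (f j s - g s))\<^sup>2) * indicator {0..t} s)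
         + 2 * (ennreal ((norm (euler_step (mesh j) t s - g s))\<^sup>2) * indicator {0..t} s) \<partial>lborel)"
    proof (rule nn_integral_mono)
      fix s
      have "ennreal ((norm (f j s - euler_step (mesh j) t s))\<^sup>2)
         \<le> ennreal (2 * (norm (f j s - g s))\<^sup>2 + 2 * (norm (euler_step (mesh j) t s - g s))\<^sup>2)"
        using norm_diff_square_le[of "f j s" "euler_step (mesh j) t s" "g s"]
        by (intro ennreal_leI) (simp add: norm_minus_commute)
      also have "\<dots> = 2 * ennreal ((norm (f j s - g s))\<^sup>2) + 2 * ennreal ((norm (euler_step (mesh j) t s - g s))\<^sup>2)"
        by (simp add: ennreal_mult')
      finally show "ennreal ((norm (f j s - euler_step (mesh j) t s))\<^sup>2) * indicator {0..t} s
         \<le> 2 * (ennreal ((norm (f j s - g s))\<^sup>2) * indicator {0..t} s)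
         + 2 * (ennreal ((norm (euler_step (mesh j) t s - g s))\<^sup>2) * indicator {0..t} s)"
        by (auto split: split_indicator)
    qed
    also have "\<dots> = 2 * b j + 2 * c j"
      unfolding bg cg by (subst nn_integral_add) (simp_all add: nn_integral_cmult)
    finally have mid: "(\<integral>\<^sup>+\<omega>. ennreal ((norm (S j \<omega> - euler (mesh j) t \<omega>))\<^sup>2) \<partial>M) \<le> 2 * b j + 2 * c j" .
    have "(\<integral>\<^sup>+\<omega>. ennreal ((norm (J \<omega> - I t \<omega>))\<^sup>2) \<partial>M)
      \<le> (\<integral>\<^sup>+\<omega>. 2 * ennreal ((norm (S j \<omega> - J \<omega>))\<^sup>2) + 4 * ennreal ((norm (S j \<omega> - euler (mesh j) t \<omega>))\<^sup>2)
          + 4 * ennreal ((norm (euler (mesh j) t \<omega> - I t \<omega>))\<^sup>2) \<partial>M)"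
    proof (rule nn_integral_mono)
      fix \<omega>
      have "(norm (J \<omega> - I t \<omega>))\<^sup>2 \<le> 2 * (norm (S j \<omega> - J \<omega>))\<^sup>2 + 4 * (norm (S j \<omega> - euler (mesh j) t \<omega>))\<^sup>2
          + 4 * (norm (euler (mesh j) t \<omega> - I t \<omega>))\<^sup>2"
        using norm_diff_square_le[of "J \<omega>" "I t \<omega>" "S j \<omega>"] norm_diff_square_le[of "S j \<omega>" "I t \<omega>" "euler (mesh j) t \<omega>"]
        by (simp add: norm_minus_commute)
      then have "ennreal ((norm (J \<omega> - I t \<omega>))\<^sup>2) \<le> ennreal (2 * (norm (S j \<omega> - J \<omega>))\<^sup>2 + 4 * (norm (S j \<omega> - euler (mesh j) t \<omega>))\<^sup>2
          + 4 * (norm (euler (mesh j) t \<omega> - I t \<omega>))\<^sup>2)"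
        by (rule ennreal_leI)
      then show "ennreal ((norm (J \<omega> - I t \<omega>))\<^sup>2) \<le> 2 * ennreal ((norm (S j \<omega> - J \<omega>))\<^sup>2) + 4 * ennreal ((norm (S j \<omega> - euler (mesh j) t \<omega>))\<^sup>2)
          + 4 * ennreal ((norm (euler (mesh j) t \<omega> - I t \<omega>))\<^sup>2)"
        by (simp add: ennreal_mult')
    qed
    also have "\<dots> = 2 * a j + 4 * (\<integral>\<^sup>+\<omega>. ennreal ((norm (S j \<omega> - euler (mesh j) t \<omega>))\<^sup>2) \<partial>M) + 4 * e j"
      unfolding a_def e_def by (simp add: nn_integral_add nn_integral_cmult)
    also have "\<dots> \<le> 2 * a j + 4 * (2 * b j + 2 * c j) + 4 * e j"
      by (intro add_mono mult_left_mono mid) auto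
    finally show ?thesis .
  qed
  have "(\<lambda>j. 2 * a j + 4 * (2 * b j + 2 * c j) + 4 * e j) \<longlonglongrightarrow> 2 * 0 + 4 * (2 * 0 + 2 * 0) + 4 * 0"
    using sl il euler_step_L2_lim[OF t] I_L2_lim[OF t]
    by (intro tendsto_add ennreal_tendsto_cmult) (simp_all add: a_def b_def c_def e_def S_def f_def)
  then have "(\<integral>\<^sup>+\<omega>. ennreal ((norm (J \<omega> - I t \<omega>))\<^sup>2) \<partial>M) \<le> 0"
    by (intro LIMSEQ_le_const) (use le in auto)
  then have "(\<integral>\<^sup>+\<omega>. ennreal ((norm (J \<omega> - I t \<omega>))\<^sup>2) \<partial>M) = 0" by simp
  then have "AE \<omega> in M. ennreal ((norm (J \<omega> - I t \<omega>))\<^sup>2) = 0"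
    by (subst (asm) nn_integral_0_iff_AE) auto
  then show ?thesis by eventually_elim simp
qed

end

section \<open>Linear equations driven by a continuous path\<close>

lemma continuous_zero_dyadic:
  fixes \<phi> :: "real \<Rightarrow> 'a::real_normed_vector"
  assumes T: "0 < T" and c: "continuous_on {0..T} \<phi>"
    and z: "\<And>k m. k \<le> 2 ^ m \<Longrightarrow> \<phi> (real k * T / 2 ^ m) = 0" and t: "t \<in> {0..T}"
  shows "\<phi> t = 0"
proof -
  obtain k :: "nat \<Rightarrow> nat" where k: "\<And>m. k m \<le> 2 ^ m" "(\<lambda>m. real (k m) * T / 2 ^ m) \<longlonglongrightarrow> t"
    using dyadic_approximation[OF T t] by blast
  have "(\<lambda>m. \<phi> (real (k m) * T / 2 ^ m)) \<longlonglongrightarrow> \<phi> t"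
    by (rule continuous_on_tendsto_compose[OF c k(2) t always_eventually[OF allI[OF dyadic_grid[OF T k(1)]]]])
  then have "(\<lambda>m. 0) \<longlonglongrightarrow> \<phi> t" by (simp only: z[OF k(1)])
  then show ?thesis by (simp add: LIMSEQ_const_iff)
qed

lemma matrix_bound_on:
  fixes A :: "real \<Rightarrow> real^'n^'m"
  assumes "continuous_on {0..T} A"
  shows "\<exists>K\<ge>0. \<forall>t\<in>{0..T}. norm (A t) \<le> K"
proof -
  have "compact (A ` {0..T})" by (rule compact_continuous_image[OF assms]) simp
  then obtain K where "\<And>t. t \<in> {0..T} \<Longrightarrow> norm (A t) \<le> K"
    by (meson bounded_iff compact_imp_bounded imageI)
  then show ?thesis by (intro exI[of _ "max 0 K"]) (auto simp: le_max_iff_disj)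
qed

lemmas continuous_on_matrix_mult = bounded_bilinear.continuous_on[OF bounded_bilinear_matrix_mult]
lemmas continuous_on_matrix_vector = bounded_bilinear.continuous_on[OF bounded_bilinear_matrix_vector_mult]

text \<open>\<open>V\<close> is built as the solution of the adjoint equation and not as a pointwise
  inverse, so that its derivative is known from the start.\<close>

lemma fundamental_matrix:
  fixes A :: "real \<Rightarrow> real^'n^'n"
  assumes T: "0 < T" and A: "continuous_on {0..T} A"
  shows "\<exists>\<Psi> V. \<Psi> 0 = mat 1 \<and> V 0 = mat 1 \<and>
     (\<forall>t\<in>{0..T}. (\<Psi> has_vector_derivative A t ** \<Psi> t) (at t within {0..T})) \<and>
     (\<forall>t\<in>{0..T}. (V has_vector_derivative - (V t ** A t)) (at t within {0..T})) \<and>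
     (\<forall>t\<in>{0..T}. V t ** \<Psi> t = mat 1 \<and> \<Psi> t ** V t = mat 1)"
proof -
  obtain K where K: "0 \<le> K" "\<And>t. t \<in> {0..T} \<Longrightarrow> norm (A t) \<le> K" using matrix_bound_on[OF A] by blast
  interpret m: bounded_bilinear "\<lambda>(X::real^'n^'n) (Y::real^'n^'n). X ** Y" by (rule bounded_bilinear_matrix_mult)
  have "\<exists>\<Psi>. \<Psi> 0 = mat 1 \<and> (\<forall>t\<in>{0..T}. (\<Psi> has_vector_derivative A t ** \<Psi> t) (at t within {0..T}))"
  proof (rule linear_ode_exists[OF T])
    show "linear (\<lambda>X::real^'n^'n. A t ** X)" for t by (rule bounded_linear.linear[OF m.bounded_linear_right])
    show "continuous_on {0..T} (\<lambda>t. A t ** x t)" if "continuous_on {0..T} x" for x :: "real \<Rightarrow> real^'n^'n"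
      by (intro m.continuous_on A that)
    show "norm (A t ** X) \<le> K * norm X" if "t \<in> {0..T}" for t and X :: "real^'n^'n"
      using norm_matrix_mult_le[of "A t" X] mult_right_mono[OF K(2)[OF that], of "norm X"] by simp
  qed (rule K)
  then obtain \<Psi> where P: "\<Psi> 0 = mat 1" "\<And>t. t \<in> {0..T} \<Longrightarrow> (\<Psi> has_vector_derivative A t ** \<Psi> t) (at t within {0..T})" by blast
  have "\<exists>V. V 0 = mat 1 \<and> (\<forall>t\<in>{0..T}. (V has_vector_derivative - (V t ** A t)) (at t within {0..T}))"
  proof (rule linear_ode_exists[OF T])
    show "linear (\<lambda>X::real^'n^'n. - (X ** A t))" for t by (rule bounded_linear.linear[OF bounded_linear_minus[OF m.bounded_linear_left]])
    show "continuous_on {0..T} (\<lambda>t. - (x t ** A t))" if "continuous_on {0..T} x" for x :: "real \<Rightarrow> real^'n^'n"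
      by (intro continuous_on_minus m.continuous_on A that)
    show "norm (- (X ** A t)) \<le> K * norm X" if "t \<in> {0..T}" for t and X :: "real^'n^'n"
      using norm_matrix_mult_le[of X "A t"] mult_left_mono[OF K(2)[OF that], of "norm X"] by (simp add: mult.commute)
  qed (rule K)
  then obtain V where V: "V 0 = mat 1" "\<And>t. t \<in> {0..T} \<Longrightarrow> (V has_vector_derivative - (V t ** A t)) (at t within {0..T})" by blast
  have inv: "V t ** \<Psi> t = mat 1" if t: "t \<in> {0..T}" for t
  proof -
    \<comment> \<open>This difference starts at 0 and has derivative zero, so the uniqueness lemma
      applies with growth constant 0.\<close>
    have "V t ** \<Psi> t - mat 1 = 0"
    proof (rule linear_ode_zero[where x="\<lambda>t. V t ** \<Psi> t - mat 1" and y="\<lambda>_. 0" and K=0 and T=T, OF _ _ _ _ t])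
      fix s assume s: "s \<in> {0..T}"
      have "((\<lambda>t. V t ** \<Psi> t - mat 1) has_vector_derivative V s ** (A s ** \<Psi> s) + (- (V s ** A s)) ** \<Psi> s - 0) (at s within {0..T})"
        by (intro has_vector_derivative_diff m.has_vector_derivative P V s has_vector_derivative_const)
      then show "((\<lambda>t. V t ** \<Psi> t - mat 1) has_vector_derivative 0) (at s within {0..T})"
        by (simp add: m.minus_left matrix_mul_assoc)
    qed (auto simp: P V)
    then show ?thesis by simp
  qed
  have "\<Psi> t ** V t = mat 1" if "t \<in> {0..T}" for t using inv[OF that] matrix_left_right_inverse by blast
  then show ?thesis using P V inv by blast
qed

lemma set_lebesgue_integral_eq_integral:
  fixes f :: "real \<Rightarrow> 'a::euclidean_space"
  assumes "set_integrable lborel {0..T} f" "t \<le> T"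
  shows "(LINT s:{0..t}|lborel. f s) = integral {0..t} f"
  by (rule set_borel_integral_eq_integral(2), rule set_integrable_subset[OF assms(1)]) (use assms in auto)

lemma continuous_on_indefinite_set_integral:
  fixes f :: "real \<Rightarrow> 'a::euclidean_space"
  assumes "set_integrable lborel {0..T} f"
  shows "continuous_on {0..T} (\<lambda>t. LINT s:{0..t}|lborel. f s)"
proof -
  have "continuous_on {0..T} (\<lambda>t. integral {0..t} f)"
    by (rule indefinite_integral_continuous_1) (rule set_borel_integral_eq_integral(1)[OF assms])
  then show ?thesis
    by (rule continuous_on_eq) (simp add: set_lebesgue_integral_eq_integral[OF assms])
qed

text \<open>Variation of constants for a forcing path \<open>i\<close> that is merely continuous.
  With y = x - i the equation becomes y' = A y + A i, in which \<open>i\<close> is not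
  differentiated.\<close>

lemma linear_path_solution:
  fixes A \<Psi> V :: "real \<Rightarrow> real^'n^'n" and i :: "real \<Rightarrow> real^'n" and c :: "real^'n"
  assumes T: "0 < T" and A: "continuous_on {0..T} A" and i: "continuous_on {0..T} i"
    and P: "\<Psi> 0 = mat 1" "\<And>t. t \<in> {0..T} \<Longrightarrow> (\<Psi> has_vector_derivative A t ** \<Psi> t) (at t within {0..T})"
    and V: "\<And>t. t \<in> {0..T} \<Longrightarrow> (V has_vector_derivative - (V t ** A t)) (at t within {0..T})"
    and PV: "\<And>t. t \<in> {0..T} \<Longrightarrow> \<Psi> t ** V t = mat 1"
  defines "x \<equiv> (\<lambda>t. \<Psi> t *v (c + (LINT s:{0..t}|lborel. (V s ** A s) *v i s)) + i t)"
  shows "continuous_on {0..T} x"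
    and "t \<in> {0..T} \<Longrightarrow> x t = c + (LINT s:{0..t}|lborel. A s *v x s) + i t"
proof -
  interpret v: bounded_bilinear "\<lambda>(X::real^'n^'n) (y::real^'n). X *v y" by (rule bounded_bilinear_matrix_vector_mult)
  have cV: "continuous_on {0..T} V" using V by (meson continuous_on_eq_continuous_within has_vector_derivative_continuous)
  have cP: "continuous_on {0..T} \<Psi>" using P(2) by (meson continuous_on_eq_continuous_within has_vector_derivative_continuous)
  have cf: "continuous_on {0..T} (\<lambda>s. (V s ** A s) *v i s)"
    by (intro continuous_on_matrix_vector continuous_on_matrix_mult cV A i)
  have sf: "set_integrable lborel {0..T} (\<lambda>s. (V s ** A s) *v i s)" by (rule borel_integrable_atLeastAtMost'[OF cf])
  define z where "z t = c + integral {0..t} (\<lambda>s. (V s ** A s) *v i s)" for t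
  define y where "y t = \<Psi> t *v z t" for t
  have xy: "x t = y t + i t" if "t \<in> {0..T}" for t
    using that unfolding x_def y_def z_def by (simp add: set_lebesgue_integral_eq_integral[OF sf])
  have dz: "(z has_vector_derivative (V t ** A t) *v i t) (at t within {0..T})" if "t \<in> {0..T}" for t
    unfolding z_def using has_vector_derivative_add[OF has_vector_derivative_const integral_has_vector_derivative[OF cf that]] by simp
  have dy: "(y has_vector_derivative A t *v x t) (at t within {0..T})" if t: "t \<in> {0..T}" for t
  proof -
    have "(y has_vector_derivative \<Psi> t *v ((V t ** A t) *v i t) + (A t ** \<Psi> t) *v z t) (at t within {0..T})"
      unfolding y_def by (rule v.has_vector_derivative[OF P(2)[OF t] dz[OF t]])
    moreover have "\<Psi> t *v ((V t ** A t) *v i t) + (A t ** \<Psi> t) *v z t = A t *v x t"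
    proof -
      have "\<Psi> t *v ((V t ** A t) *v i t) = ((\<Psi> t ** V t) ** A t) *v i t"
        by (simp only: matrix_vector_mul_assoc matrix_mul_assoc)
      then show ?thesis
        by (simp add: PV[OF t] xy[OF t] y_def matrix_vector_right_distrib matrix_vector_mul_assoc)
    qed
    ultimately show ?thesis by simp
  qed
  have cy: "continuous_on {0..T} y" using dy by (meson continuous_on_eq_continuous_within has_vector_derivative_continuous)
  show cx: "continuous_on {0..T} x"
    by (rule continuous_on_eq[of _ "\<lambda>t. y t + i t"]) (auto intro!: continuous_intros cy i simp: xy)
  show "x t = c + (LINT s:{0..t}|lborel. A s *v x s) + i t" if t: "t \<in> {0..T}"
  proof -
    have "((\<lambda>s. A s *v x s) has_integral (y t - y 0)) {0..t}"
      using t by (intro fundamental_theorem_of_calculus has_vector_derivative_within_subset[OF dy]) auto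
    moreover have "y 0 = c" by (simp add: y_def z_def P)
    ultimately have "integral {0..t} (\<lambda>s. A s *v x s) = y t - c" by (simp add: integral_unique)
    moreover have "set_integrable lborel {0..T} (\<lambda>s. A s *v x s)"
      by (intro borel_integrable_atLeastAtMost' continuous_on_matrix_vector A cx)
    ultimately show ?thesis using t by (simp add: set_lebesgue_integral_eq_integral xy)
  qed
qed

text \<open>With y = x - i the derivative of V y is V A i, which is free of the unknown; integrating
  it recovers the formula.\<close>

lemma linear_path_unique:
  fixes A \<Psi> V :: "real \<Rightarrow> real^'n^'n" and i x :: "real \<Rightarrow> real^'n" and c :: "real^'n"
  assumes T: "0 < T" and A: "continuous_on {0..T} A" and i: "continuous_on {0..T} i" and x: "continuous_on {0..T} x"
    and V: "V 0 = mat 1" "\<And>t. t \<in> {0..T} \<Longrightarrow> (V has_vector_derivative - (V t ** A t)) (at t within {0..T})"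
    and PV: "\<And>t. t \<in> {0..T} \<Longrightarrow> \<Psi> t ** V t = mat 1"
    and eq: "\<And>t. t \<in> {0..T} \<Longrightarrow> x t = c + (LINT s:{0..t}|lborel. A s *v x s) + i t"
    and t: "t \<in> {0..T}"
  shows "x t = \<Psi> t *v (c + integral {0..t} (\<lambda>s. (V s ** A s) *v i s)) + i t"
proof -
  interpret v: bounded_bilinear "\<lambda>(X::real^'n^'n) (y::real^'n). X *v y" by (rule bounded_bilinear_matrix_vector_mult)
  have cf: "continuous_on {0..T} (\<lambda>s. A s *v x s)" by (intro continuous_on_matrix_vector A x)
  have sf: "set_integrable lborel {0..T} (\<lambda>s. A s *v x s)" by (rule borel_integrable_atLeastAtMost'[OF cf])
  define y where "y t = c + integral {0..t} (\<lambda>s. A s *v x s)" for t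
  have xy: "x t = y t + i t" if "t \<in> {0..T}" for t
    using that eq[OF that] unfolding y_def by (simp add: set_lebesgue_integral_eq_integral[OF sf])
  have dy: "(y has_vector_derivative A t *v x t) (at t within {0..T})" if "t \<in> {0..T}" for t
    unfolding y_def using has_vector_derivative_add[OF has_vector_derivative_const integral_has_vector_derivative[OF cf that]] by simp
  have dVy: "((\<lambda>t. V t *v y t) has_vector_derivative (V s ** A s) *v i s) (at s within {0..T})" if s: "s \<in> {0..T}" for s
  proof -
    have "((\<lambda>t. V t *v y t) has_vector_derivative V s *v (A s *v x s) + (- (V s ** A s)) *v y s) (at s within {0..T})"
      by (rule v.has_vector_derivative[OF V(2)[OF s] dy[OF s]])
    then show ?thesis
      by (simp add: v.minus_left xy[OF s] matrix_vector_right_distrib matrix_vector_mul_assoc)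
  qed
  have "((\<lambda>s. (V s ** A s) *v i s) has_integral (V t *v y t - V 0 *v y 0)) {0..t}"
    using t by (intro fundamental_theorem_of_calculus has_vector_derivative_within_subset[OF dVy]) auto
  then have "c + integral {0..t} (\<lambda>s. (V s ** A s) *v i s) = V t *v y t"
    by (simp add: integral_unique V(1) y_def)
  then show ?thesis using xy[OF t] by (simp add: matrix_vector_mul_assoc PV[OF t])
qed

context wiener_path
begin

text \<open>The definition of a strong solution permits a separate null set and a separate version
  of the integral for every time. Identification with \<open>I\<close> at the countably many dyadic
  times leaves one null set, outside which both sides are continuous in \<open>t\<close> and
  therefore agree everywhere.\<close>

lemma strong_solution_pathwise:
  assumes x: "strong_solution M T w x0 b G x"
  shows "AE \<omega> in M. set_integrable lborel {0..T} (\<lambda>s. b s \<omega>) \<and>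
     (\<forall>t\<in>{0..T}. x t \<omega> = x0 \<omega> + (LINT s:{0..t}|lborel. b s \<omega>) + I t \<omega>)"
proof -
  have eq: "AE \<omega> in M. x t \<omega> = x0 \<omega> + (LINT s:{0..t}|lborel. b s \<omega>) + I t \<omega>" if t: "t \<in> {0..T}" for t
  proof -
    obtain J where J: "has_wiener_integral M w G t J" "AE \<omega> in M. x t \<omega> = x0 \<omega> + (LINT s:{0..t}|lborel. b s \<omega>) + J \<omega>"
      using x t unfolding strong_solution_def by blast
    from wiener_integral_unique[OF t J(1)] J(2) show ?thesis by eventually_elim simp
  qed
  have "AE \<omega> in M. k \<le> 2 ^ m \<longrightarrow> x (real k * T / 2 ^ m) \<omega> = x0 \<omega> + (LINT s:{0..real k * T / 2 ^ m}|lborel. b s \<omega>) + I (real k * T / 2 ^ m) \<omega>"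
    for k m :: nat
  proof (cases "k \<le> 2 ^ m")
    case True
    from eq[OF dyadic_grid[OF T_pos this]] show ?thesis by eventually_elim simp
  qed simp
  then have grid: "AE \<omega> in M. \<forall>k m. k \<le> 2 ^ m \<longrightarrow> x (real k * T / 2 ^ m) \<omega> = x0 \<omega> + (LINT s:{0..real k * T / 2 ^ m}|lborel. b s \<omega>) + I (real k * T / 2 ^ m) \<omega>"
    by (intro AE_all_countable[THEN iffD2] allI)
  have int: "AE \<omega> in M. set_integrable lborel {0..T} (\<lambda>s. b s \<omega>)" using x by (simp add: strong_solution_def)
  show ?thesis
    using grid int AE_space
  proof eventually_elim
    case (elim \<omega>)
    have cx: "continuous_on {0..T} (\<lambda>t. x t \<omega>)" using x elim(3) by (simp add: strong_solution_def)
    define \<phi> where "\<phi> t = x t \<omega> - (x0 \<omega> + (LINT s:{0..t}|lborel. b s \<omega>) + I t \<omega>)" for t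
    have c\<phi>: "continuous_on {0..T} \<phi>"
      unfolding \<phi>_def
      by (intro continuous_on_diff continuous_on_add continuous_on_const cx I_continuous[OF elim(3)] continuous_on_indefinite_set_integral[OF elim(2)])
    have "\<phi> (real k * T / 2 ^ m) = 0" if "k \<le> 2 ^ m" for k m :: nat
      using elim(1) that by (simp add: \<phi>_def)
    from continuous_zero_dyadic[OF T_pos c\<phi> this] have "\<phi> t = 0" if "t \<in> {0..T}" for t
      using that by blast
    then show ?case using elim(2) by (simp add: \<phi>_def)
  qed
qed

text \<open>Variation of constants is applied path by path. The explicit formula makes adaptedness
  visible: \<open>x t\<close> is built from \<open>x0\<close> and the values of \<open>I\<close> up
  to time \<open>t\<close>.\<close>

lemma strong_solution_exists:
  assumes A: "continuous_on {0..T} A"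
  shows "\<exists>x. strong_solution M T w x0 (\<lambda>t \<omega>. A t *v x t \<omega>) G x"
proof -
  obtain \<Psi> V where P: "\<Psi> 0 = mat 1" "\<And>t. t \<in> {0..T} \<Longrightarrow> (\<Psi> has_vector_derivative A t ** \<Psi> t) (at t within {0..T})"
    and V: "V 0 = mat 1" "\<And>t. t \<in> {0..T} \<Longrightarrow> (V has_vector_derivative - (V t ** A t)) (at t within {0..T})"
    and PV: "\<And>t. t \<in> {0..T} \<Longrightarrow> \<Psi> t ** V t = mat 1"
    using fundamental_matrix[OF T_pos A] by blast
  define x where "x t \<omega> = \<Psi> t *v (x0 \<omega> + (LINT s:{0..t}|lborel. (V s ** A s) *v I s \<omega>)) + I t \<omega>" for t \<omega>
  have sol1: "continuous_on {0..T} (\<lambda>t. x t \<omega>)" if "\<omega> \<in> space M" for \<omega>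
    unfolding x_def by (rule linear_path_solution(1)[OF T_pos A I_continuous[OF that] P V(2) PV])
  have sol2: "x t \<omega> = x0 \<omega> + (LINT s:{0..t}|lborel. A s *v x s \<omega>) + I t \<omega>" if "\<omega> \<in> space M" "t \<in> {0..T}" for \<omega> t
    unfolding x_def by (rule linear_path_solution(2)[OF T_pos A I_continuous[OF that(1)] P V(2) PV that(2)])
  have cV: "continuous_on {0..T} V" using V(2) by (meson continuous_on_eq_continuous_within has_vector_derivative_continuous)
  have "strong_solution M T w x0 (\<lambda>t \<omega>. A t *v x t \<omega>) G x"
    unfolding strong_solution_def
  proof (intro conjI ballI)
    show cx: "continuous_on {0..T} (\<lambda>t. x t \<omega>)" if "\<omega> \<in> space M" for \<omega>
      by (rule sol1[OF that])
    show "x t \<in> borel_measurable (F t)" if t: "t \<in> {0..T}" for t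
    proof -
      have IF: "I s \<in> borel_measurable (F t)" if "s \<in> {0..t}" for s
        by (rule measurable_F_mono[OF I_measurable_F]) (use that t in auto)
      have "(\<lambda>\<omega>. LINT s:{0..t}|lborel. (V s ** A s) *v I s \<omega>) \<in> borel_measurable (F t)"
      proof (rule borel_measurable_integral_continuous_process)
        show "(\<lambda>\<omega>. (V s ** A s) *v I s \<omega>) \<in> borel_measurable (F t)" if "s \<in> {0..t}" for s
          by (rule measurable_compose[OF IF[OF that] measurable_matrix_vector])
        show "continuous_on {0..t} (\<lambda>s. (V s ** A s) *v I s \<omega>)" if "\<omega> \<in> space (F t)" for \<omega>
          using that t by (intro continuous_on_matrix_vector continuous_on_matrix_mult continuous_on_subset[OF cV]
              continuous_on_subset[OF A] continuous_on_subset[OF I_continuous]) auto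
      qed (use t in auto)
      moreover have "x0 \<in> borel_measurable (F t)" using t by (intro measurable_F_x0) auto
      moreover have "I t \<in> borel_measurable (F t)" by (rule I_measurable_F[OF t])
      ultimately show ?thesis
        unfolding x_def[abs_def]
        by (intro borel_measurable_add measurable_compose[OF _ measurable_matrix_vector])
    qed
    show "AE \<omega> in M. x 0 \<omega> = x0 \<omega>"
      using I_0 AE_space
    proof eventually_elim
      case (elim \<omega>)
      have "(LINT s:{0..0}|lborel. A s *v x s \<omega>) = 0"
        using T_pos by (subst set_lebesgue_integral_eq_integral[of T])
          (auto intro!: borel_integrable_atLeastAtMost' continuous_on_matrix_vector A cx[OF elim(2)])
      then show ?case using sol2[OF elim(2), of 0] T_pos elim(1) by simp
    qed
    show "AE \<omega> in M. set_integrable lborel {0..T} (\<lambda>s. A s *v x s \<omega>)"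
      using AE_space by eventually_elim (intro borel_integrable_atLeastAtMost' continuous_on_matrix_vector A cx)
    show "\<exists>J. has_wiener_integral M w G t J \<and>
        (AE \<omega> in M. x t \<omega> = x0 \<omega> + (LINT s:{0..t}|lborel. A s *v x s \<omega>) + J \<omega>)" if t: "t \<in> {0..T}" for t
      using I_has_wiener_integral[OF t] sol2[OF _ t] by (intro exI[of _ "I t"]) auto
  qed
  then show ?thesis by blast
qed

end

section \<open>Expectation of a quadratic form of the state\<close>

lemma borel_measurable_matrix_vector [measurable (raw)]:
  fixes u :: "'a \<Rightarrow> real^'n^'m"
  assumes "u \<in> borel_measurable N" "v \<in> borel_measurable N"
  shows "(\<lambda>x. u x *v v x) \<in> borel_measurable N"
  using assms
  by (rule borel_measurable_continuous_Pair)
     (intro bounded_bilinear.continuous_on[OF bounded_bilinear_matrix_vector_mult] continuous_intros)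

text \<open>Linearizes bilinear forms: by \<open>inner_outer\<close> one expectation of an outer
  product determines the mean of the form for every matrix at once.\<close>

definition outer :: "real^'n \<Rightarrow> real^'n \<Rightarrow> real^'n^'n" where
  "outer u v = (\<chi> i j. u $ i * v $ j)"

lemma inner_outer: "R \<bullet> outer u v = u \<bullet> (R *v v)"
  by (simp add: outer_def inner_vec_def matrix_vector_mult_def sum_distrib_left mult_ac)

lemma norm_outer: "norm (outer u v) = norm u * norm v"
proof -
  have "(norm (outer u v))\<^sup>2 = (norm u)\<^sup>2 * (norm v)\<^sup>2"
    by (simp only: power2_norm_eq_inner) (simp add: outer_def inner_vec_def sum_product mult_ac)
  then show ?thesis by (simp add: power_mult_distrib[symmetric])
qed

lemma bounded_bilinear_outer: "bounded_bilinear outer"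
proof (rule bounded_bilinear.intro)
  show "\<exists>K. \<forall>a b. norm (outer a b :: real^'n^'n) \<le> norm a * norm b * K"
    by (intro exI[of _ 1]) (simp add: norm_outer)
qed (simp_all add: outer_def vec_eq_iff algebra_simps)

lemma borel_measurable_outer [measurable (raw)]:
  assumes "u \<in> borel_measurable N" "v \<in> borel_measurable N"
  shows "(\<lambda>x. outer (u x) (v x)) \<in> borel_measurable N"
  using assms
  by (rule borel_measurable_continuous_Pair)
     (intro bounded_bilinear.continuous_on[OF bounded_bilinear_outer] continuous_intros)

lemma integrable_outer:
  fixes u v :: "'a \<Rightarrow> real^'n"
  assumes [measurable]: "u \<in> borel_measurable N" "v \<in> borel_measurable N"
    and "integrable N (\<lambda>x. (norm (u x))\<^sup>2)" "integrable N (\<lambda>x. (norm (v x))\<^sup>2)"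
  shows "integrable N (\<lambda>x. outer (u x) (v x))"
proof (rule Bochner_Integration.integrable_bound)
  show "integrable N (\<lambda>x. (norm (u x))\<^sup>2 + (norm (v x))\<^sup>2)" using assms by simp
  show "AE x in N. norm (outer (u x) (v x)) \<le> norm ((norm (u x))\<^sup>2 + (norm (v x))\<^sup>2)"
  proof (rule AE_I2)
    fix x
    have "2 * (norm (u x) * norm (v x)) \<le> (norm (u x))\<^sup>2 + (norm (v x))\<^sup>2"
      using sum_squares_bound[of "norm (u x)" "norm (v x)"] by simp
    moreover have "0 \<le> norm (u x) * norm (v x)" by simp
    ultimately have "norm (u x) * norm (v x) \<le> (norm (u x))\<^sup>2 + (norm (v x))\<^sup>2" by linarith
    then show "norm (outer (u x) (v x)) \<le> norm ((norm (u x))\<^sup>2 + (norm (v x))\<^sup>2)" by (simp add: norm_outer)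
  qed
qed measurable

lemma integrable_bilinear_form:
  fixes u v :: "'a \<Rightarrow> real^'n" and R :: "'a \<Rightarrow> real^'n^'n"
  assumes [measurable]: "u \<in> borel_measurable N" "v \<in> borel_measurable N" "R \<in> borel_measurable N"
    and i: "integrable N (\<lambda>x. (norm (u x))\<^sup>2)" "integrable N (\<lambda>x. (norm (v x))\<^sup>2)"
    and K: "\<And>x. x \<in> space N \<Longrightarrow> norm (R x) \<le> K"
  shows "integrable N (\<lambda>x. u x \<bullet> (R x *v v x))"
proof (rule Bochner_Integration.integrable_bound)
  show "integrable N (\<lambda>x. K * norm (outer (u x) (v x)))"
    using integrable_outer[OF assms(1,2) i] by simp
  show "AE x in N. norm (u x \<bullet> (R x *v v x)) \<le> norm (K * norm (outer (u x) (v x)))"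
  proof (rule AE_I2)
    fix x assume x: "x \<in> space N"
    have "0 \<le> K" using K[OF x] norm_ge_zero order_trans by blast
    have "norm (u x \<bullet> (R x *v v x)) \<le> norm (R x) * norm (outer (u x) (v x))"
      unfolding inner_outer[symmetric] by (simp add: Cauchy_Schwarz_ineq2)
    also have "\<dots> \<le> K * norm (outer (u x) (v x))" by (rule mult_right_mono[OF K[OF x]]) simp
    finally show "norm (u x \<bullet> (R x *v v x)) \<le> norm (K * norm (outer (u x) (v x)))"
      using \<open>0 \<le> K\<close> by (simp add: abs_mult)
  qed
qed measurable

lemma integrable_constant_form:
  fixes u v :: "'a \<Rightarrow> real^'n"
  assumes "u \<in> borel_measurable N" "v \<in> borel_measurable N"
    and "integrable N (\<lambda>x. (norm (u x))\<^sup>2)" "integrable N (\<lambda>x. (norm (v x))\<^sup>2)"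
  shows "integrable N (\<lambda>x. u x \<bullet> (R *v v x))"
  by (rule integrable_bilinear_form[OF assms(1,2) _ assms(3,4), of _ "norm R"]) auto

text \<open>Nonnegativity of the variance about the mean \<open>m\<close>.\<close>

lemma (in finite_measure) square_integral_le:
  fixes h :: "'a \<Rightarrow> real"
  assumes i: "integrable M h" "integrable M (\<lambda>x. (h x)\<^sup>2)" and pos: "0 < measure M (space M)"
  shows "(LINT x|M. h x)\<^sup>2 \<le> measure M (space M) * (LINT x|M. (h x)\<^sup>2)"
proof -
  define m where "m = (LINT x|M. h x) / measure M (space M)"
  have "0 \<le> (LINT x|M. (h x - m)\<^sup>2)" by (rule integral_nonneg_AE) simp
  also have "\<dots> = (LINT x|M. (h x)\<^sup>2 - 2 * m * h x + m\<^sup>2)"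
    by (intro Bochner_Integration.integral_cong) (simp_all add: power2_diff)
  also have "\<dots> = (LINT x|M. (h x)\<^sup>2) - 2 * m * (LINT x|M. h x) + m\<^sup>2 * measure M (space M)"
    using i by simp
  also have "\<dots> = (LINT x|M. (h x)\<^sup>2) - (LINT x|M. h x)\<^sup>2 / measure M (space M)"
    using pos by (simp add: m_def power2_eq_square field_simps)
  finally show ?thesis using pos by (simp add: field_simps)
qed

context wiener_path
begin

text \<open>Time as a finite measure space; its product with \<open>M\<close> is where all
  expectations of time integrals are taken.\<close>

definition L :: "real measure" where "L = restrict_space lborel {0..T}"

lemma space_L [simp]: "space L = {0..T}" by (simp add: L_def space_restrict_space)

lemma emeasure_L: "emeasure L (space L) = ennreal T"
  unfolding L_def using T_pos by (simp add: space_restrict_space emeasure_restrict_space)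

sublocale L: finite_measure L
  by (rule finite_measureI) (use emeasure_L in simp)

lemma measure_L: "measure L {0..T} = T"
  using emeasure_L T_pos by (simp add: measure_def)

sublocale LM: pair_sigma_finite L M ..

lemma borel_measurable_L: "borel_measurable L = borel_measurable (restrict_space borel {0..T})"
  unfolding L_def by (intro measurable_cong_sets sets_restrict_space_cong refl) simp

text \<open>Admissibility speaks of the restricted Borel space, integration of \<open>L\<close>; the
  two products with \<open>M\<close> have the same measurable functions.\<close>

lemma borel_measurable_LM: "borel_measurable (L \<Otimes>\<^sub>M M) = borel_measurable (restrict_space borel {0..T} \<Otimes>\<^sub>M M)"
  unfolding L_def by (intro measurable_cong_sets sets_pair_measure_cong sets_restrict_space_cong refl) simp

lemma continuous_measurable_L:
  fixes f :: "real \<Rightarrow> 'a::euclidean_space"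
  shows "continuous_on {0..T} f \<Longrightarrow> f \<in> borel_measurable L"
  unfolding borel_measurable_L by (rule borel_measurable_continuous_on_restrict)

lemma process_measurable_LM:
  fixes X :: "real \<Rightarrow> 'w \<Rightarrow> 'a::euclidean_space"
  assumes "\<And>t. t \<in> {0..T} \<Longrightarrow> X t \<in> borel_measurable M"
    and "\<And>\<omega>. \<omega> \<in> space M \<Longrightarrow> continuous_on {0..T} (\<lambda>t. X t \<omega>)"
  shows "(\<lambda>(t, \<omega>). X t \<omega>) \<in> borel_measurable (L \<Otimes>\<^sub>M M)"
  unfolding borel_measurable_LM using T_pos by (intro measurable_continuous_process assms) auto

lemma integral_L:
  fixes f :: "real \<Rightarrow> 'a::euclidean_space"
  shows "(LINT s:{0..T}|lborel. f s) = (LINT s|L. f s)"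
  unfolding set_lebesgue_integral_def L_def by (subst integral_restrict_space) auto

lemma I_measurable_LM: "(\<lambda>(t, \<omega>). I t \<omega>) \<in> borel_measurable (L \<Otimes>\<^sub>M M)"
  by (rule process_measurable_LM[OF I_measurable I_continuous])

lemma integrable_LM_bounded_second_moment:
  fixes X :: "real \<Rightarrow> 'w \<Rightarrow> real^'k"
  assumes m: "(\<lambda>(t, \<omega>). X t \<omega>) \<in> borel_measurable (L \<Otimes>\<^sub>M M)"
    and i: "\<And>t. t \<in> {0..T} \<Longrightarrow> integrable M (\<lambda>\<omega>. (norm (X t \<omega>))\<^sup>2)"
    and C: "\<And>t. t \<in> {0..T} \<Longrightarrow> (LINT \<omega>|M. (norm (X t \<omega>))\<^sup>2) \<le> C"
  shows "integrable (L \<Otimes>\<^sub>M M) (\<lambda>(t, \<omega>). (norm (X t \<omega>))\<^sup>2)"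
proof (rule LM.Fubini_integrable)
  have [measurable]: "(\<lambda>p. X (fst p) (snd p)) \<in> borel_measurable (L \<Otimes>\<^sub>M M)" using m by (simp add: case_prod_beta')
  show m2: "(\<lambda>(t, \<omega>). (norm (X t \<omega>))\<^sup>2) \<in> borel_measurable (L \<Otimes>\<^sub>M M)" unfolding case_prod_beta by measurable
  show "AE t in L. integrable M (\<lambda>\<omega>. case (t, \<omega>) of (t, \<omega>) \<Rightarrow> (norm (X t \<omega>))\<^sup>2)"
    using i by (intro AE_I2) simp
  show "integrable L (\<lambda>t. LINT \<omega>|M. norm (case (t, \<omega>) of (t, \<omega>) \<Rightarrow> (norm (X t \<omega>))\<^sup>2))"
  proof (rule L.integrable_const_bound[where B=C])
    show "AE t in L. norm (LINT \<omega>|M. norm (case (t, \<omega>) of (t, \<omega>) \<Rightarrow> (norm (X t \<omega>))\<^sup>2)) \<le> C"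
      using C by (intro AE_I2) (simp add: integral_nonneg_AE)
    show "(\<lambda>t. LINT \<omega>|M. norm (case (t, \<omega>) of (t, \<omega>) \<Rightarrow> (norm (X t \<omega>))\<^sup>2)) \<in> borel_measurable L"
      using m2 by measurable
  qed
qed

lemma I_square_integrable_LM: "integrable (L \<Otimes>\<^sub>M M) (\<lambda>(t, \<omega>). (norm (I t \<omega>))\<^sup>2)"
proof -
  obtain C where "\<And>t. t \<in> {0..T} \<Longrightarrow> (LINT \<omega>|M. (norm (I t \<omega>))\<^sup>2) \<le> C" using I_second_moment_bounded by blast
  then show ?thesis by (intro integrable_LM_bounded_second_moment[where C=C] I_measurable_LM I_square_integrable)
qed

lemma x0_square_integrable: "integrable M (\<lambda>\<omega>. (norm (x0 \<omega>))\<^sup>2)"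
  by (rule gaussian_norm_square_integrable[OF prob_space_axioms distributed_x0 pos_def_S0])

end

text \<open>A drift process \<open>b\<close> and the absolutely continuous part \<open>y\<close> of the state \<open>y + I\<close> driven by it.\<close>

locale drift = wiener_path M T w x0 S0 G I
  for M :: "'w measure" and T and w :: "real \<Rightarrow> 'w \<Rightarrow> real^'p" and x0 :: "'w \<Rightarrow> real^'n" and S0 G I +
  fixes b y :: "real \<Rightarrow> 'w \<Rightarrow> real^'n"
  assumes b_measurable: "(\<lambda>(s, \<omega>). b s \<omega>) \<in> borel_measurable (L \<Otimes>\<^sub>M M)"
    and b_adapted: "s \<in> {0..T} \<Longrightarrow> b s \<in> borel_measurable (F s)"
    and b_square: "integrable (L \<Otimes>\<^sub>M M) (\<lambda>(s, \<omega>). (norm (b s \<omega>))\<^sup>2)"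
    and y_measurable: "t \<in> {0..T} \<Longrightarrow> y t \<in> borel_measurable M"
    and y_continuous: "\<omega> \<in> space M \<Longrightarrow> continuous_on {0..T} (\<lambda>t. y t \<omega>)"
    and y_eq: "AE \<omega> in M. set_integrable lborel {0..T} (\<lambda>s. b s \<omega>) \<and>
       (\<forall>t\<in>{0..T}. y t \<omega> = x0 \<omega> + (LINT s:{0..t}|lborel. b s \<omega>))"
begin

lemma y_measurable_LM: "(\<lambda>(t, \<omega>). y t \<omega>) \<in> borel_measurable (L \<Otimes>\<^sub>M M)"
  by (rule process_measurable_LM[OF y_measurable y_continuous])

lemma measurable_LM_pairs [measurable]:
  "(\<lambda>p. b (fst p) (snd p)) \<in> borel_measurable (L \<Otimes>\<^sub>M M)"
  "(\<lambda>p. y (fst p) (snd p)) \<in> borel_measurable (L \<Otimes>\<^sub>M M)"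
  "(\<lambda>p. I (fst p) (snd p)) \<in> borel_measurable (L \<Otimes>\<^sub>M M)"
  using b_measurable y_measurable_LM I_measurable_LM by (simp_all add: case_prod_beta')

text \<open>A single random variable dominates all times at once, which is what gives second moments
  bounded uniformly in \<open>t\<close>. The factor \<open>T\<close> comes from Cauchy-Schwarz in
  time.\<close>

lemma y_bound:
  "AE \<omega> in M. \<forall>t\<in>{0..T}. (norm (y t \<omega>))\<^sup>2 \<le> 2 * (norm (x0 \<omega>))\<^sup>2 + 2 * (T * (LINT s|L. (norm (b s \<omega>))\<^sup>2))"
  using y_eq LM.AE_integrable_snd[OF b_square]
proof eventually_elim
  case (elim \<omega>)
  have bi: "integrable L (\<lambda>s. b s \<omega>)"
    using elim(1) unfolding L_def by (simp add: set_integrable_eq_restrict_space)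
  show ?case
  proof
    fix t assume t: "t \<in> {0..T}"
    have "norm (LINT s:{0..t}|lborel. b s \<omega>) \<le> (LINT s|L. norm (b s \<omega>))"
    proof -
      have mt: "{0..t} \<in> sets L" unfolding L_def using t by (auto simp: sets_restrict_space_iff)
      have "(LINT s:{0..t}|lborel. b s \<omega>) = (LINT s|L. indicator {0..t} s *\<^sub>R b s \<omega>)"
        unfolding L_def using t by (intro set_integral_eq_restrict_space) auto
      also have "norm \<dots> \<le> (LINT s|L. norm (indicator {0..t} s *\<^sub>R b s \<omega>))" by (rule integral_norm_bound)
      also have "\<dots> \<le> (LINT s|L. norm (b s \<omega>))"
        by (rule integral_mono[OF integrable_norm[OF integrable_mult_indicator[OF mt bi]] integrable_norm[OF bi]]) (auto split: split_indicator)
      finally show ?thesis .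
    qed
    then have "(norm (LINT s:{0..t}|lborel. b s \<omega>))\<^sup>2 \<le> (LINT s|L. norm (b s \<omega>))\<^sup>2" by (rule power_mono) simp
    also have "\<dots> \<le> T * (LINT s|L. (norm (b s \<omega>))\<^sup>2)"
      using L.square_integral_le[of "\<lambda>s. norm (b s \<omega>)"] bi elim(2) T_pos by (simp add: measure_L)
    finally have "(norm (LINT s:{0..t}|lborel. b s \<omega>))\<^sup>2 \<le> T * (LINT s|L. (norm (b s \<omega>))\<^sup>2)" .
    moreover have "(norm (y t \<omega>))\<^sup>2 \<le> 2 * (norm (x0 \<omega>))\<^sup>2 + 2 * (norm (LINT s:{0..t}|lborel. b s \<omega>))\<^sup>2"
      using norm_diff_square_le[of "x0 \<omega>" "- (LINT s:{0..t}|lborel. b s \<omega>)" 0] elim(1) t by simp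
    ultimately show "(norm (y t \<omega>))\<^sup>2 \<le> 2 * (norm (x0 \<omega>))\<^sup>2 + 2 * (T * (LINT s|L. (norm (b s \<omega>))\<^sup>2))" by linarith
  qed
qed

lemma y_bound_integrable: "integrable M (\<lambda>\<omega>. 2 * (norm (x0 \<omega>))\<^sup>2 + 2 * (T * (LINT s|L. (norm (b s \<omega>))\<^sup>2)))"
  using x0_square_integrable LM.integrable_snd[OF b_square] by simp

lemma y_square_integrable:
  assumes t: "t \<in> {0..T}"
  shows "integrable M (\<lambda>\<omega>. (norm (y t \<omega>))\<^sup>2)"
proof (rule Bochner_Integration.integrable_bound[OF y_bound_integrable])
  show "(\<lambda>\<omega>. (norm (y t \<omega>))\<^sup>2) \<in> borel_measurable M" using y_measurable[OF t] by measurable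
  show "AE \<omega> in M. norm ((norm (y t \<omega>))\<^sup>2) \<le> norm (2 * (norm (x0 \<omega>))\<^sup>2 + 2 * (T * (LINT s|L. (norm (b s \<omega>))\<^sup>2)))"
    using y_bound
  proof eventually_elim
    case (elim \<omega>)
    then show ?case using t by (auto intro: order_trans[OF _ abs_ge_self])
  qed
qed

lemma y_square_integrable_LM: "integrable (L \<Otimes>\<^sub>M M) (\<lambda>(t, \<omega>). (norm (y t \<omega>))\<^sup>2)"
proof (rule integrable_LM_bounded_second_moment[OF y_measurable_LM y_square_integrable])
  show "(LINT \<omega>|M. (norm (y t \<omega>))\<^sup>2) \<le> (LINT \<omega>|M. 2 * (norm (x0 \<omega>))\<^sup>2 + 2 * (T * (LINT s|L. (norm (b s \<omega>))\<^sup>2)))"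
    if t: "t \<in> {0..T}" for t
    by (rule integral_mono_AE[OF y_square_integrable[OF t] y_bound_integrable])
       (use y_bound t in \<open>auto elim!: eventually_mono\<close>)
qed

lemma b_square_AE: "AE s in L. integrable M (\<lambda>\<omega>. (norm (b s \<omega>))\<^sup>2)"
  using LM.AE_integrable_fst[OF b_square] .

lemma bI_outer: "integrable (L \<Otimes>\<^sub>M M) (\<lambda>(s, \<omega>). outer (b s \<omega>) (I s \<omega>))"
  using integrable_outer[of "\<lambda>p. b (fst p) (snd p)" "L \<Otimes>\<^sub>M M" "\<lambda>p. I (fst p) (snd p)"]
    b_square I_square_integrable_LM by (simp add: case_prod_beta')

definition cross :: "real \<Rightarrow> real^'n^'n" where
  "cross s = (LINT \<omega>|M. outer (b s \<omega>) (I s \<omega>))"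

lemma cross_integrable: "integrable L cross"
  unfolding cross_def[abs_def] using LM.integrable_fst[OF bI_outer] .

text \<open>The exceptional set of times does not depend on \<open>R\<close>. This matters because
  \<open>R\<close> will be a matrix that varies with the time itself.\<close>

lemma cross_inner: "AE s in L. \<forall>R. integrable M (\<lambda>\<omega>. b s \<omega> \<bullet> (R *v I s \<omega>)) \<and> (LINT \<omega>|M. b s \<omega> \<bullet> (R *v I s \<omega>)) = R \<bullet> cross s"
  using LM.AE_integrable_fst[OF bI_outer]
proof eventually_elim
  case (elim s)
  have "integrable M (\<lambda>\<omega>. R \<bullet> outer (b s \<omega>) (I s \<omega>))" for R
    by (rule integrable_bounded_linear[OF bounded_linear_inner_right elim])
  moreover have "(LINT \<omega>|M. R \<bullet> outer (b s \<omega>) (I s \<omega>)) = R \<bullet> cross s" for R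
    unfolding cross_def by (rule integral_bounded_linear[OF bounded_linear_inner_right elim])
  ultimately show ?case by (simp add: inner_outer)
qed

text \<open>Write y(t) as \<open>x0\<close> plus the integral of the drift. For s \<le> t the
  increment of \<open>I\<close> after s is orthogonal to b(s), so I(t) may be replaced by I(s) under
  the expectation; the term with \<open>x0\<close> vanishes by the same orthogonality. The result is
  absolutely continuous in \<open>t\<close>, although paths of \<open>I\<close> need not be.\<close>

lemma cross_expectation:
  assumes t: "t \<in> {0..T}"
  shows "(LINT \<omega>|M. y t \<omega> \<bullet> (R *v I t \<omega>)) = R \<bullet> (LINT s:{0..t}|lborel. cross s)"
proof -
  have [measurable]: "I t \<in> borel_measurable M" by (rule I_measurable[OF t])
  have mt: "{0..t} \<in> sets L" unfolding L_def using t by (auto simp: sets_restrict_space_iff)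
  have [measurable]: "(\<lambda>p. I t (snd p)) \<in> borel_measurable (L \<Otimes>\<^sub>M M)" by measurable
  have It: "integrable (L \<Otimes>\<^sub>M M) (\<lambda>(s, \<omega>). (norm (I t \<omega>))\<^sup>2)"
    using integrable_LM_bounded_second_moment[of "\<lambda>s. I t", OF _ I_square_integrable[OF t] order_refl]
    by (simp add: case_prod_beta')
  have bRI: "integrable (L \<Otimes>\<^sub>M M) (\<lambda>(s, \<omega>). indicator {0..t} s * (b s \<omega> \<bullet> (R *v I t \<omega>)))"
  proof -
    have "integrable (L \<Otimes>\<^sub>M M) (\<lambda>p. b (fst p) (snd p) \<bullet> (R *v I t (snd p)))"
      by (rule integrable_constant_form) (use b_square It in \<open>simp_all add: case_prod_beta'\<close>)
    moreover have "{0..t} \<times> space M \<in> sets (L \<Otimes>\<^sub>M M)" using mt by simp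
    ultimately have "integrable (L \<Otimes>\<^sub>M M) (\<lambda>p. indicator ({0..t} \<times> space M) p *\<^sub>R (b (fst p) (snd p) \<bullet> (R *v I t (snd p))))"
      by (intro integrable_mult_indicator)
    then show ?thesis
      by (rule Bochner_Integration.integrable_cong[THEN iffD1, rotated -1])
         (auto simp: space_pair_measure indicator_def)
  qed
  have x0I: "integrable M (\<lambda>\<omega>. x0 \<omega> \<bullet> (R *v I t \<omega>))"
    by (rule integrable_constant_form) (use x0_square_integrable I_square_integrable[OF t] in simp_all)
  have x0I0: "(LINT \<omega>|M. x0 \<omega> \<bullet> (R *v I t \<omega>)) = 0"
  proof -
    have [measurable]: "I 0 \<in> borel_measurable M" using T_pos by (intro I_measurable) auto
    have zF: "(\<lambda>\<omega>. transpose R *v x0 \<omega>) \<in> borel_measurable (F 0)"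
      using T_pos measurable_F_x0[of 0] by (intro measurable_compose[OF _ measurable_matrix_vector]) auto
    have "integrable M (\<lambda>\<omega>. (norm (transpose R *v x0 \<omega>))\<^sup>2)"
    proof (rule Bochner_Integration.integrable_bound)
      show "integrable M (\<lambda>\<omega>. (norm (transpose R))\<^sup>2 * (norm (x0 \<omega>))\<^sup>2)" using x0_square_integrable by simp
      show "AE \<omega> in M. norm ((norm (transpose R *v x0 \<omega>))\<^sup>2) \<le> norm ((norm (transpose R))\<^sup>2 * (norm (x0 \<omega>))\<^sup>2)"
        using norm_matrix_vector_le[of "transpose R"]
        by (intro AE_I2) (auto simp: power_mult_distrib[symmetric] intro!: power_mono)
    qed measurable
    then have "(LINT \<omega>|M. (transpose R *v x0 \<omega>) \<bullet> (I t \<omega> - I 0 \<omega>)) = 0"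
      using t by (intro I_orthogonal[OF _ _ _ zF]) auto
    \<comment> \<open>\<open>I 0\<close> vanishes almost surely; subtracting it creates the
      increment to which orthogonality applies.\<close>
    moreover have "(LINT \<omega>|M. x0 \<omega> \<bullet> (R *v I t \<omega>)) = (LINT \<omega>|M. (transpose R *v x0 \<omega>) \<bullet> (I t \<omega> - I 0 \<omega>))"
    proof (rule integral_cong_AE)
      show "AE \<omega> in M. x0 \<omega> \<bullet> (R *v I t \<omega>) = (transpose R *v x0 \<omega>) \<bullet> (I t \<omega> - I 0 \<omega>)"
        using I_0 by eventually_elim (simp add: inner_matrix_vector[of "x0 _" R])
    qed measurable
    ultimately show ?thesis by simp
  qed
  have "(LINT \<omega>|M. y t \<omega> \<bullet> (R *v I t \<omega>))
      = (LINT \<omega>|M. x0 \<omega> \<bullet> (R *v I t \<omega>) + (LINT s|L. indicator {0..t} s * (b s \<omega> \<bullet> (R *v I t \<omega>))))"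
  proof (rule integral_cong_AE)
    show "(\<lambda>\<omega>. y t \<omega> \<bullet> (R *v I t \<omega>)) \<in> borel_measurable M" using y_measurable[OF t] by measurable
    show "(\<lambda>\<omega>. x0 \<omega> \<bullet> (R *v I t \<omega>) + (LINT s|L. indicator {0..t} s * (b s \<omega> \<bullet> (R *v I t \<omega>)))) \<in> borel_measurable M"
      using borel_measurable_integrable[OF x0I] borel_measurable_integrable[OF LM.integrable_snd[OF bRI]] by (rule borel_measurable_add)
    show "AE \<omega> in M. y t \<omega> \<bullet> (R *v I t \<omega>) = x0 \<omega> \<bullet> (R *v I t \<omega>) + (LINT s|L. indicator {0..t} s * (b s \<omega> \<bullet> (R *v I t \<omega>)))"
      using y_eq
    proof eventually_elim
      case (elim \<omega>)
      have bi: "integrable L (\<lambda>s. b s \<omega>)"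
        using elim unfolding L_def by (simp add: set_integrable_eq_restrict_space)
      have "(LINT s:{0..t}|lborel. b s \<omega>) = (LINT s|L. indicator {0..t} s *\<^sub>R b s \<omega>)"
        unfolding L_def using t by (intro set_integral_eq_restrict_space) auto
      then have "(LINT s:{0..t}|lborel. b s \<omega>) \<bullet> (R *v I t \<omega>) = (LINT s|L. (indicator {0..t} s *\<^sub>R b s \<omega>) \<bullet> (R *v I t \<omega>))"
        using integral_bounded_linear[OF bounded_linear_inner_left integrable_mult_indicator[OF mt bi], of "R *v I t \<omega>"] by simp
      then show ?case using elim t by (simp add: inner_add_left)
    qed
  qed
  also have "\<dots> = (LINT \<omega>|M. (LINT s|L. indicator {0..t} s * (b s \<omega> \<bullet> (R *v I t \<omega>))))"
    using x0I LM.integrable_snd[OF bRI] x0I0 by simp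
  also have "\<dots> = (LINT s|L. (LINT \<omega>|M. indicator {0..t} s * (b s \<omega> \<bullet> (R *v I t \<omega>))))"
    by (rule LM.Fubini_integral[OF bRI])
  also have "\<dots> = (LINT s|L. R \<bullet> (indicator {0..t} s *\<^sub>R cross s))"
  proof (rule integral_cong_AE)
    show "(\<lambda>s. LINT \<omega>|M. indicator {0..t} s * (b s \<omega> \<bullet> (R *v I t \<omega>))) \<in> borel_measurable L"
      using borel_measurable_integrable[OF LM.integrable_fst[OF bRI]] .
    show "(\<lambda>s. R \<bullet> (indicator {0..t} s *\<^sub>R cross s)) \<in> borel_measurable L"
      using borel_measurable_integrable[OF integrable_mult_indicator[OF mt cross_integrable]] by measurable
    show "AE s in L. (LINT \<omega>|M. indicator {0..t} s * (b s \<omega> \<bullet> (R *v I t \<omega>))) = R \<bullet> (indicator {0..t} s *\<^sub>R cross s)"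
      using b_square_AE cross_inner AE_space
    proof eventually_elim
      case (elim s)
      show ?case
      proof (cases "s \<in> {0..t}")
        case True
        have sT: "s \<in> {0..T}" using elim by simp
        have [measurable]: "I s \<in> borel_measurable M" by (rule I_measurable[OF sT])
        have [measurable]: "b s \<in> borel_measurable M"
          by (rule measurable_F_imp[OF _ b_adapted[OF sT]]) (use sT in simp)
        have zF: "(\<lambda>\<omega>. transpose R *v b s \<omega>) \<in> borel_measurable (F s)"
          by (rule measurable_compose[OF b_adapted[OF sT] measurable_matrix_vector])
        have "integrable M (\<lambda>\<omega>. (norm (transpose R *v b s \<omega>))\<^sup>2)"
        proof (rule Bochner_Integration.integrable_bound)
          show "integrable M (\<lambda>\<omega>. (norm (transpose R))\<^sup>2 * (norm (b s \<omega>))\<^sup>2)" using elim(1) by simp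
          show "AE \<omega> in M. norm ((norm (transpose R *v b s \<omega>))\<^sup>2) \<le> norm ((norm (transpose R))\<^sup>2 * (norm (b s \<omega>))\<^sup>2)"
            using norm_matrix_vector_le[of "transpose R"]
            by (intro AE_I2) (auto simp: power_mult_distrib[symmetric] intro!: power_mono)
        qed measurable
        then have o: "(LINT \<omega>|M. (transpose R *v b s \<omega>) \<bullet> (I t \<omega> - I s \<omega>)) = 0"
          using True t by (intro I_orthogonal[OF _ _ _ zF]) auto
        have i: "integrable M (\<lambda>\<omega>. b s \<omega> \<bullet> (R *v I t \<omega>))" "integrable M (\<lambda>\<omega>. b s \<omega> \<bullet> (R *v I s \<omega>))"
          by (rule integrable_constant_form, use elim(1) I_square_integrable[OF t] I_square_integrable[OF sT] in simp_all)+
        have "(transpose R *v b s \<omega>) \<bullet> (I t \<omega> - I s \<omega>) = b s \<omega> \<bullet> (R *v I t \<omega>) - b s \<omega> \<bullet> (R *v I s \<omega>)" for \<omega>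
          by (simp add: inner_matrix_vector[of "b s \<omega>" R] inner_diff_right)
        then have "(LINT \<omega>|M. b s \<omega> \<bullet> (R *v I t \<omega>)) = (LINT \<omega>|M. b s \<omega> \<bullet> (R *v I s \<omega>))"
          using o i by simp
        then show ?thesis using True elim(2) by simp
      qed simp
    qed
  qed
  also have "\<dots> = R \<bullet> (LINT s|L. indicator {0..t} s *\<^sub>R cross s)"
    by (rule integral_bounded_linear[OF bounded_linear_inner_right integrable_mult_indicator[OF mt cross_integrable]])
  also have "(LINT s|L. indicator {0..t} s *\<^sub>R cross s) = (LINT s:{0..t}|lborel. cross s)"
    unfolding L_def using t by (intro set_integral_eq_restrict_space[symmetric]) auto
  finally show ?thesis .
qed

end

section \<open>Quadratic expectations of the state y + I\<close>

lemma (in wiener_path) bilinear_form_integrable_LM: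
  fixes u v :: "real \<Rightarrow> 'w \<Rightarrow> real^'n" and R :: "real \<Rightarrow> real^'n^'n"
  assumes "(\<lambda>(t, \<omega>). u t \<omega>) \<in> borel_measurable (L \<Otimes>\<^sub>M M)" "(\<lambda>(t, \<omega>). v t \<omega>) \<in> borel_measurable (L \<Otimes>\<^sub>M M)"
    and "continuous_on {0..T} R"
    and "integrable (L \<Otimes>\<^sub>M M) (\<lambda>(t, \<omega>). (norm (u t \<omega>))\<^sup>2)" "integrable (L \<Otimes>\<^sub>M M) (\<lambda>(t, \<omega>). (norm (v t \<omega>))\<^sup>2)"
  shows "integrable (L \<Otimes>\<^sub>M M) (\<lambda>(t, \<omega>). u t \<omega> \<bullet> (R t *v v t \<omega>))"
proof -
  obtain K where K: "\<And>t. t \<in> {0..T} \<Longrightarrow> norm (R t) \<le> K" using matrix_bound_on[OF assms(3)] by blast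
  have [measurable]: "R \<in> borel_measurable L" by (rule continuous_measurable_L[OF assms(3)])
  have "integrable (L \<Otimes>\<^sub>M M) (\<lambda>p. u (fst p) (snd p) \<bullet> (R (fst p) *v v (fst p) (snd p)))"
    by (rule integrable_bilinear_form[where K=K])
       (use assms K in \<open>auto simp: case_prod_beta' space_pair_measure\<close>)
  then show ?thesis by (simp add: case_prod_beta')
qed

text \<open>When \<open>N\<close> is the derivative of \<open>P\<close>, Ito's formula would
  evaluate this as the time integral of the trace of G' P G. Only its independence of the control
  matters, so it is left unevaluated.\<close>

definition (in wiener_path) wiener_constant :: "(real \<Rightarrow> real^'n^'n) \<Rightarrow> (real \<Rightarrow> real^'n^'n) \<Rightarrow> real" where
  "wiener_constant P N = (LINT \<omega>|M. I T \<omega> \<bullet> (P T *v I T \<omega>)) - integral\<^sup>L (L \<Otimes>\<^sub>M M) (\<lambda>(t, \<omega>). I t \<omega> \<bullet> (N t *v I t \<omega>))"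

context drift
begin

context
  fixes P N :: "real \<Rightarrow> real^'n^'n"
  assumes dP: "\<And>t. t \<in> {0..T} \<Longrightarrow> (P has_vector_derivative N t) (at t within {0..T})"
    and cN: "continuous_on {0..T} N"
    and symP: "\<And>t. t \<in> {0..T} \<Longrightarrow> transpose (P t) = P t"
    and symN: "\<And>t. t \<in> {0..T} \<Longrightarrow> transpose (N t) = N t"
begin

lemma P_continuous: "continuous_on {0..T} P"
  using dP by (meson continuous_on_eq_continuous_within has_vector_derivative_continuous)

lemma P_integral: "t \<in> {0..T} \<Longrightarrow> P t = P 0 + (LINT s:{0..t}|lborel. N s)"
proof -
  assume t: "t \<in> {0..T}"
  have "(N has_integral (P t - P 0)) {0..t}"
    using t by (intro fundamental_theorem_of_calculus has_vector_derivative_within_subset[OF dP]) auto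
  then show ?thesis
    using t by (simp add: set_lebesgue_integral_eq_integral[OF borel_integrable_atLeastAtMost'[OF cN]] integral_unique)
qed

lemma P_sym: "t \<in> {0..T} \<Longrightarrow> u \<bullet> (P t *v v) = v \<bullet> (P t *v u)"
  by (subst inner_matrix_vector) (simp add: symP inner_commute)

lemma N_sym: "t \<in> {0..T} \<Longrightarrow> u \<bullet> (N t *v v) = v \<bullet> (N t *v u)"
  by (subst inner_matrix_vector) (simp add: symN inner_commute)

lemma yNy_integrable: "integrable (L \<Otimes>\<^sub>M M) (\<lambda>(t, \<omega>). y t \<omega> \<bullet> (N t *v y t \<omega>))"
  by (rule bilinear_form_integrable_LM[OF y_measurable_LM y_measurable_LM cN y_square_integrable_LM y_square_integrable_LM])

lemma bPy_integrable: "integrable (L \<Otimes>\<^sub>M M) (\<lambda>(t, \<omega>). b t \<omega> \<bullet> (P t *v y t \<omega>))"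
  by (rule bilinear_form_integrable_LM[OF b_measurable y_measurable_LM P_continuous b_square y_square_integrable_LM])

lemma yNI_integrable: "integrable (L \<Otimes>\<^sub>M M) (\<lambda>(t, \<omega>). y t \<omega> \<bullet> (N t *v I t \<omega>))"
  by (rule bilinear_form_integrable_LM[OF y_measurable_LM I_measurable_LM cN y_square_integrable_LM I_square_integrable_LM])

lemma bPI_integrable: "integrable (L \<Otimes>\<^sub>M M) (\<lambda>(t, \<omega>). b t \<omega> \<bullet> (P t *v I t \<omega>))"
  by (rule bilinear_form_integrable_LM[OF b_measurable I_measurable_LM P_continuous b_square I_square_integrable_LM])

lemma INI_integrable: "integrable (L \<Otimes>\<^sub>M M) (\<lambda>(t, \<omega>). I t \<omega> \<bullet> (N t *v I t \<omega>))"
  by (rule bilinear_form_integrable_LM[OF I_measurable_LM I_measurable_LM cN I_square_integrable_LM I_square_integrable_LM])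

text \<open>Two integrations by parts: first for \<open>P\<close> applied to \<open>y\<close>, which
  gives the density \<open>g\<close>, then for the inner product of \<open>y\<close> with the
  result. Symmetry of \<open>P\<close> merges the two terms in which the drift occurs.\<close>

lemma quadratic_pathwise:
  "AE \<omega> in M. y T \<omega> \<bullet> (P T *v y T \<omega>) = x0 \<omega> \<bullet> (P 0 *v x0 \<omega>)
     + (LINT t|L. y t \<omega> \<bullet> (N t *v y t \<omega>) + 2 * (b t \<omega> \<bullet> (P t *v y t \<omega>)))"
  using y_eq
proof eventually_elim
  case (elim \<omega>)
  have T0: "0 \<in> {0..T}" "T \<in> {0..T}" "0 \<le> T" using T_pos by auto
  have si: "set_integrable lborel {0..T} (\<lambda>s. b s \<omega>)" using elim by simp
  have y0: "y 0 \<omega> = x0 \<omega>"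
    using elim T0 by (simp add: set_lebesgue_integral_eq_integral[OF si])
  have ye: "y t \<omega> = y 0 \<omega> + (LINT s:{0..t}|lborel. b s \<omega>)" if "t \<in> {0..T}" for t
    using elim that y0 by simp
  have siN: "set_integrable lborel {0..T} N" by (rule borel_integrable_atLeastAtMost'[OF cN])
  define g where "g t = N t *v y t \<omega> + P t *v b t \<omega>" for t
  note ip = lebesgue_integration_by_parts[OF bounded_bilinear_matrix_vector_mult]
  have Py: "P t *v y t \<omega> = P 0 *v y 0 \<omega> + (LINT s:{0..t}|lborel. g s)" if t: "t \<in> {0..T}" for t
    unfolding g_def
    by (rule ip(3)[where T=t])
       (use t in \<open>auto intro!: set_integrable_subset[OF siN] set_integrable_subset[OF si] P_integral ye\<close>)
  have sg: "set_integrable lborel {0..T} g"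
    unfolding g_def[abs_def] using ip(1,2)[OF T0(3) siN si P_integral ye] by (rule set_integral_add(1))
  have "y T \<omega> \<bullet> (P T *v y T \<omega>) = y 0 \<omega> \<bullet> (P 0 *v y 0 \<omega>) + (LINT t:{0..T}|lborel. b t \<omega> \<bullet> (P t *v y t \<omega>) + y t \<omega> \<bullet> g t)"
    by (rule lebesgue_integration_by_parts(3)[OF bounded_bilinear_inner T0(3) si sg ye Py])
  also have "(LINT t:{0..T}|lborel. b t \<omega> \<bullet> (P t *v y t \<omega>) + y t \<omega> \<bullet> g t)
      = (LINT t|L. b t \<omega> \<bullet> (P t *v y t \<omega>) + y t \<omega> \<bullet> g t)"
    by (rule integral_L)
  also have "\<dots> = (LINT t|L. y t \<omega> \<bullet> (N t *v y t \<omega>) + 2 * (b t \<omega> \<bullet> (P t *v y t \<omega>)))"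
    by (intro Bochner_Integration.integral_cong refl) (auto simp: g_def inner_add_right P_sym[of _ "y _ \<omega>" "b _ \<omega>"])
  finally show ?case by (simp add: y0)
qed

lemma yPy_expectation:
  "(LINT \<omega>|M. y T \<omega> \<bullet> (P T *v y T \<omega>)) = (LINT \<omega>|M. x0 \<omega> \<bullet> (P 0 *v x0 \<omega>))
     + integral\<^sup>L (L \<Otimes>\<^sub>M M) (\<lambda>(t, \<omega>). y t \<omega> \<bullet> (N t *v y t \<omega>)) + 2 * integral\<^sup>L (L \<Otimes>\<^sub>M M) (\<lambda>(t, \<omega>). b t \<omega> \<bullet> (P t *v y t \<omega>))"
proof -
  let ?f = "\<lambda>t \<omega>. y t \<omega> \<bullet> (N t *v y t \<omega>) + 2 * (b t \<omega> \<bullet> (P t *v y t \<omega>))"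
  have f: "integrable (L \<Otimes>\<^sub>M M) (\<lambda>(t, \<omega>). ?f t \<omega>)"
    using yNy_integrable bPy_integrable by (simp add: case_prod_beta')
  have x0i: "integrable M (\<lambda>\<omega>. x0 \<omega> \<bullet> (P 0 *v x0 \<omega>))"
    by (rule integrable_constant_form[OF _ _ x0_square_integrable x0_square_integrable]) auto
  have [measurable]: "y T \<in> borel_measurable M" using T_pos by (intro y_measurable) auto
  have "(LINT \<omega>|M. y T \<omega> \<bullet> (P T *v y T \<omega>)) = (LINT \<omega>|M. x0 \<omega> \<bullet> (P 0 *v x0 \<omega>) + (LINT t|L. ?f t \<omega>))"
    by (rule integral_cong_AE[OF _ _ quadratic_pathwise])
       (use x0i LM.integrable_snd[OF f] in \<open>auto intro!: borel_measurable_add borel_measurable_integrable\<close>)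
  also have "\<dots> = (LINT \<omega>|M. x0 \<omega> \<bullet> (P 0 *v x0 \<omega>)) + (LINT \<omega>|M. (LINT t|L. ?f t \<omega>))"
    by (rule Bochner_Integration.integral_add[OF x0i LM.integrable_snd[OF f]])
  also have "(LINT \<omega>|M. (LINT t|L. ?f t \<omega>)) = integral\<^sup>L (L \<Otimes>\<^sub>M M) (\<lambda>(t, \<omega>). ?f t \<omega>)"
    by (rule LM.integral_snd[OF f])
  also have "\<dots> = integral\<^sup>L (L \<Otimes>\<^sub>M M) (\<lambda>(t, \<omega>). y t \<omega> \<bullet> (N t *v y t \<omega>)) + 2 * integral\<^sup>L (L \<Otimes>\<^sub>M M) (\<lambda>(t, \<omega>). b t \<omega> \<bullet> (P t *v y t \<omega>))"
    using yNy_integrable bPy_integrable by (simp add: case_prod_beta')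
  finally show ?thesis by simp
qed

text \<open>The integration by parts takes place between the deterministic functions
  \<open>P\<close> and \<open>C\<close>, the primitive of \<open>cross\<close>; nothing is
  integrated along the paths of \<open>I\<close>.\<close>

lemma yPI_expectation:
  "(LINT \<omega>|M. y T \<omega> \<bullet> (P T *v I T \<omega>))
     = integral\<^sup>L (L \<Otimes>\<^sub>M M) (\<lambda>(t, \<omega>). b t \<omega> \<bullet> (P t *v I t \<omega>)) + integral\<^sup>L (L \<Otimes>\<^sub>M M) (\<lambda>(t, \<omega>). y t \<omega> \<bullet> (N t *v I t \<omega>))"
proof -
  have T0: "0 \<in> {0..T}" "T \<in> {0..T}" "0 \<le> T" using T_pos by auto
  define C where "C t = (LINT s:{0..t}|lborel. cross s)" for t
  have sc: "set_integrable lborel {0..T} cross"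
    using cross_integrable unfolding L_def by (simp add: set_integrable_eq_restrict_space)
  have C0: "C 0 = 0" unfolding C_def by (subst set_lebesgue_integral_eq_integral[OF sc]) (use T0 in auto)
  have siN: "set_integrable lborel {0..T} N" by (rule borel_integrable_atLeastAtMost'[OF cN])
  have Ce: "C t = C 0 + (LINT s:{0..t}|lborel. cross s)" if "t \<in> {0..T}" for t
    by (simp add: C0 C_def[of t])
  note ip = lebesgue_integration_by_parts[OF bounded_bilinear_inner T0(3) siN sc P_integral Ce]
  have "(LINT \<omega>|M. y T \<omega> \<bullet> (P T *v I T \<omega>)) = P T \<bullet> C T"
    unfolding C_def by (rule cross_expectation[OF T0(2)])
  also have "\<dots> = (LINT t:{0..T}|lborel. N t \<bullet> C t + P t \<bullet> cross t)"
    using ip(3) by (simp add: C0)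
  also have "\<dots> = (LINT t:{0..T}|lborel. N t \<bullet> C t) + (LINT t:{0..T}|lborel. P t \<bullet> cross t)"
    by (rule set_integral_add(2)[OF ip(1,2)])
  also have "(LINT t:{0..T}|lborel. P t \<bullet> cross t) = (LINT t|L. (LINT \<omega>|M. b t \<omega> \<bullet> (P t *v I t \<omega>)))"
    unfolding integral_L
  proof (rule integral_cong_AE)
    show "(\<lambda>t. P t \<bullet> cross t) \<in> borel_measurable L"
      using continuous_measurable_L[OF P_continuous] borel_measurable_integrable[OF cross_integrable] by (rule borel_measurable_inner)
    show "(\<lambda>t. LINT \<omega>|M. b t \<omega> \<bullet> (P t *v I t \<omega>)) \<in> borel_measurable L"
      by (rule borel_measurable_integrable[OF LM.integrable_fst[OF bPI_integrable]])
    show "AE t in L. P t \<bullet> cross t = (LINT \<omega>|M. b t \<omega> \<bullet> (P t *v I t \<omega>))"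
      using cross_inner by eventually_elim simp
  qed
  also have "\<dots> = integral\<^sup>L (L \<Otimes>\<^sub>M M) (\<lambda>(t, \<omega>). b t \<omega> \<bullet> (P t *v I t \<omega>))"
    by (rule LM.integral_fst[OF bPI_integrable])
  also have "(LINT t:{0..T}|lborel. N t \<bullet> C t) = (LINT t|L. (LINT \<omega>|M. y t \<omega> \<bullet> (N t *v I t \<omega>)))"
    unfolding integral_L
    by (intro Bochner_Integration.integral_cong refl) (simp add: C_def cross_expectation)
  also have "\<dots> = integral\<^sup>L (L \<Otimes>\<^sub>M M) (\<lambda>(t, \<omega>). y t \<omega> \<bullet> (N t *v I t \<omega>))"
    by (rule LM.integral_fst[OF yNI_integrable])
  finally show ?thesis by simp
qed

text \<open>Expanding the quadratic form of y + I leaves a part in \<open>y\<close> alone, handled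
  pathwise, a mixed part, handled in expectation, and a part in \<open>I\<close> alone, which is
  what \<open>wiener_constant\<close> collects.\<close>

lemma quadratic_expectation:
  shows "integrable (L \<Otimes>\<^sub>M M) (\<lambda>(t, \<omega>). (y t \<omega> + I t \<omega>) \<bullet> (N t *v (y t \<omega> + I t \<omega>)) + 2 * (b t \<omega> \<bullet> (P t *v (y t \<omega> + I t \<omega>))))"
    and "(LINT \<omega>|M. (y T \<omega> + I T \<omega>) \<bullet> (P T *v (y T \<omega> + I T \<omega>)))
      = (LINT \<omega>|M. x0 \<omega> \<bullet> (P 0 *v x0 \<omega>))
       + integral\<^sup>L (L \<Otimes>\<^sub>M M) (\<lambda>(t, \<omega>). (y t \<omega> + I t \<omega>) \<bullet> (N t *v (y t \<omega> + I t \<omega>)) + 2 * (b t \<omega> \<bullet> (P t *v (y t \<omega> + I t \<omega>))))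
       + wiener_constant P N"
proof -
  note i = yNy_integrable bPy_integrable yNI_integrable bPI_integrable INI_integrable
  let ?f = "\<lambda>(t, \<omega>). (y t \<omega> + I t \<omega>) \<bullet> (N t *v (y t \<omega> + I t \<omega>)) + 2 * (b t \<omega> \<bullet> (P t *v (y t \<omega> + I t \<omega>)))"
  let ?g = "\<lambda>(t, \<omega>). y t \<omega> \<bullet> (N t *v y t \<omega>) + 2 * (b t \<omega> \<bullet> (P t *v y t \<omega>))
      + 2 * (y t \<omega> \<bullet> (N t *v I t \<omega>)) + 2 * (b t \<omega> \<bullet> (P t *v I t \<omega>)) + I t \<omega> \<bullet> (N t *v I t \<omega>)"
  have fg: "?f p = ?g p" if p: "p \<in> space (L \<Otimes>\<^sub>M M)" for p
  proof -
    obtain t \<omega> where p: "p = (t, \<omega>)" "t \<in> {0..T}" using p by (auto simp: space_pair_measure)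
    show ?thesis
      unfolding p(1) prod.case using N_sym[OF p(2), of "I t \<omega>" "y t \<omega>"]
      by (simp add: matrix_vector_right_distrib inner_add_left inner_add_right)
  qed
  have gi: "integrable (L \<Otimes>\<^sub>M M) ?g" using i by (simp add: case_prod_beta')
  show "integrable (L \<Otimes>\<^sub>M M) ?f"
    by (rule iffD2[OF Bochner_Integration.integrable_cong[OF refl] gi]) (rule fg)
  have "integral\<^sup>L (L \<Otimes>\<^sub>M M) ?f = integral\<^sup>L (L \<Otimes>\<^sub>M M) ?g"
    by (rule Bochner_Integration.integral_cong[OF refl]) (rule fg)
  also have "\<dots> = integral\<^sup>L (L \<Otimes>\<^sub>M M) (\<lambda>(t, \<omega>). y t \<omega> \<bullet> (N t *v y t \<omega>))
     + 2 * integral\<^sup>L (L \<Otimes>\<^sub>M M) (\<lambda>(t, \<omega>). b t \<omega> \<bullet> (P t *v y t \<omega>))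
     + 2 * integral\<^sup>L (L \<Otimes>\<^sub>M M) (\<lambda>(t, \<omega>). y t \<omega> \<bullet> (N t *v I t \<omega>))
     + 2 * integral\<^sup>L (L \<Otimes>\<^sub>M M) (\<lambda>(t, \<omega>). b t \<omega> \<bullet> (P t *v I t \<omega>))
     + integral\<^sup>L (L \<Otimes>\<^sub>M M) (\<lambda>(t, \<omega>). I t \<omega> \<bullet> (N t *v I t \<omega>))"
    using i by (simp add: case_prod_beta')
  finally have F: "integral\<^sup>L (L \<Otimes>\<^sub>M M) ?f = \<dots>" .
  have T0: "T \<in> {0..T}" using T_pos by auto
  have [measurable]: "y T \<in> borel_measurable M" "I T \<in> borel_measurable M"
    by (rule y_measurable[OF T0] I_measurable[OF T0])+
  note sq = y_square_integrable[OF T0] I_square_integrable[OF T0]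
  have j: "integrable M (\<lambda>\<omega>. y T \<omega> \<bullet> (P T *v y T \<omega>))" "integrable M (\<lambda>\<omega>. y T \<omega> \<bullet> (P T *v I T \<omega>))"
    "integrable M (\<lambda>\<omega>. I T \<omega> \<bullet> (P T *v I T \<omega>))"
    by (rule integrable_constant_form, use sq in simp_all)+
  have "(LINT \<omega>|M. (y T \<omega> + I T \<omega>) \<bullet> (P T *v (y T \<omega> + I T \<omega>)))
     = (LINT \<omega>|M. y T \<omega> \<bullet> (P T *v y T \<omega>) + 2 * (y T \<omega> \<bullet> (P T *v I T \<omega>)) + I T \<omega> \<bullet> (P T *v I T \<omega>))"
    using P_sym[OF T0, of "I T _" "y T _"]
    by (intro Bochner_Integration.integral_cong refl)
       (simp add: matrix_vector_right_distrib inner_add_left inner_add_right)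
  also have "\<dots> = (LINT \<omega>|M. y T \<omega> \<bullet> (P T *v y T \<omega>)) + 2 * (LINT \<omega>|M. y T \<omega> \<bullet> (P T *v I T \<omega>)) + (LINT \<omega>|M. I T \<omega> \<bullet> (P T *v I T \<omega>))"
    using j by simp
  finally show "(LINT \<omega>|M. (y T \<omega> + I T \<omega>) \<bullet> (P T *v (y T \<omega> + I T \<omega>)))
      = (LINT \<omega>|M. x0 \<omega> \<bullet> (P 0 *v x0 \<omega>)) + integral\<^sup>L (L \<Otimes>\<^sub>M M) ?f + wiener_constant P N"
    unfolding F wiener_constant_def yPy_expectation yPI_expectation by simp
qed

end

end

section \<open>Second moments of the state and the energy\<close>

context wiener_path
begin

lemma state_continuous: "strong_solution M T w x0 b G x \<Longrightarrow> \<omega> \<in> space M \<Longrightarrow> continuous_on {0..T} (\<lambda>t. x t \<omega>)"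
  by (simp add: strong_solution_def)

lemma state_measurable_F: "strong_solution M T w x0 b G x \<Longrightarrow> t \<in> {0..T} \<Longrightarrow> x t \<in> borel_measurable (F t)"
  by (simp add: strong_solution_def)

lemma state_measurable: "strong_solution M T w x0 b G x \<Longrightarrow> t \<in> {0..T} \<Longrightarrow> x t \<in> borel_measurable M"
  using measurable_F_imp[of t "x t" borel] state_measurable_F by auto

lemma state_measurable_LM:
  assumes "strong_solution M T w x0 b G x"
  shows "(\<lambda>(t, \<omega>). x t \<omega>) \<in> borel_measurable (L \<Otimes>\<^sub>M M)"
  by (rule process_measurable_LM[OF state_measurable[OF assms] state_continuous[OF assms]])

text \<open>Gronwall's inequality along one path, squared. It is arranged so that only squares of
  the initial value, the noise and \<open>f\<close> appear; the factor 3 in \<open>h\<close> comes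
  from the square of a sum of three terms.\<close>

lemma state_path_bound:
  fixes i x f :: "real \<Rightarrow> real^'n" and c :: "real^'n"
  assumes ix: "continuous_on {0..T} x" "continuous_on {0..T} i" and cA: "continuous_on {0..T} A"
    and K: "0 \<le> K" "\<And>t. t \<in> {0..T} \<Longrightarrow> norm (A t) \<le> K"
    and f: "integrable L f" "integrable L (\<lambda>s. (norm (f s))\<^sup>2)"
    and eq: "\<And>t. t \<in> {0..T} \<Longrightarrow> x t = c + (LINT s:{0..t}|lborel. A s *v x s + f s) + i t"
    and t: "t \<in> {0..T}"
  defines "h \<equiv> (\<lambda>t. 3 * ((norm c)\<^sup>2 + (norm (i t))\<^sup>2 + T * (LINT s|L. (norm (f s))\<^sup>2)))"
  shows "(norm (x t))\<^sup>2 \<le> 2 * h t + 2 * (K * exp (K * T))\<^sup>2 * (T * (LINT s|L. h s))"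
proof -
  define D where "D = (LINT s|L. norm (f s))"
  have D0: "0 \<le> D" unfolding D_def by (rule integral_nonneg_AE) simp
  have sf: "set_integrable lborel {0..T} f" using f(1) unfolding L_def by (simp add: set_integrable_eq_restrict_space)
  have cAx: "continuous_on {0..T} (\<lambda>s. A s *v x s)" by (intro continuous_on_matrix_vector cA ix)
  have sAx: "set_integrable lborel {0..T} (\<lambda>s. A s *v x s)" by (rule borel_integrable_atLeastAtMost'[OF cAx])
  define g where "g t = norm c + norm (i t) + D" for t
  have cg: "continuous_on {0..T} g" unfolding g_def by (intro continuous_intros ix)
  have g0: "0 \<le> g s" for s using D0 by (simp add: g_def)
  have le: "norm (x s) \<le> g s + K * integral {0..s} (\<lambda>r. norm (x r))" if s: "s \<in> {0..T}" for s
  proof -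
    have ss: "{0..s} \<subseteq> {0..T}" using s by auto
    have ms: "{0..s} \<in> sets L" unfolding L_def using s by (auto simp: sets_restrict_space_iff)
    have 1: "(LINT r:{0..s}|lborel. A r *v x r + f r) = (LINT r:{0..s}|lborel. A r *v x r) + (LINT r:{0..s}|lborel. f r)"
      by (rule set_integral_add(2)[OF set_integrable_subset[OF sAx _ ss] set_integrable_subset[OF sf _ ss]]) auto
    have "norm (LINT r:{0..s}|lborel. A r *v x r) \<le> integral {0..s} (\<lambda>r. K * norm (x r))"
      using s unfolding set_lebesgue_integral_eq_integral[OF sAx, of s, simplified]
      by (subst set_lebesgue_integral_eq_integral[OF sAx], simp, intro integral_norm_bound_integral integrable_continuous_interval
          continuous_on_subset[OF cAx] continuous_intros continuous_on_subset[OF ix(1)])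
         (auto intro!: order_trans[OF norm_matrix_vector_le] mult_right_mono K)
    moreover have "norm (LINT r:{0..s}|lborel. f r) \<le> D"
    proof -
      have "(LINT r:{0..s}|lborel. f r) = (LINT r|L. indicator {0..s} r *\<^sub>R f r)"
        unfolding L_def using s by (intro set_integral_eq_restrict_space) auto
      also have "norm \<dots> \<le> (LINT r|L. norm (indicator {0..s} r *\<^sub>R f r))" by (rule integral_norm_bound)
      also have "\<dots> \<le> D"
        unfolding D_def
        by (rule integral_mono[OF integrable_norm[OF integrable_mult_indicator[OF ms f(1)]] integrable_norm[OF f(1)]])
           (auto split: split_indicator)
      finally show ?thesis .
    qed
    moreover have "norm (x s) \<le> norm c + norm (LINT r:{0..s}|lborel. A r *v x r) + norm (LINT r:{0..s}|lborel. f r) + norm (i s)"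
    proof -
      let ?P = "LINT r:{0..s}|lborel. A r *v x r" and ?Q = "LINT r:{0..s}|lborel. f r"
      have "norm (c + (?P + ?Q) + i s) \<le> norm c + norm ?P + norm ?Q + norm (i s)"
        using norm_triangle_ineq[of "c + (?P + ?Q)" "i s"] norm_triangle_ineq[of c "?P + ?Q"] norm_triangle_ineq[of ?P ?Q]
        by linarith
      then show ?thesis by (simp only: eq[OF s] 1)
    qed
    ultimately show ?thesis by (simp add: g_def)
  qed
  have gron: "norm (x t) \<le> g t + K * exp (K * T) * integral {0..T} g"
    by (rule gronwall[OF _ cg _ K(1) le t]) (use g0 in \<open>auto intro!: continuous_intros ix\<close>)
  have ig: "integral {0..T} g = (LINT s|L. g s)"
    using set_lebesgue_integral_eq_integral[OF borel_integrable_atLeastAtMost'[OF cg], of T] integral_L[of g] by simp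
  have Lc: "integrable L u" if "continuous_on {0..T} u" for u :: "real \<Rightarrow> real"
    using borel_integrable_atLeastAtMost'[OF that] unfolding L_def by (simp add: set_integrable_eq_restrict_space)
  have gh: "(g s)\<^sup>2 \<le> h s" for s
  proof -
    have "D\<^sup>2 \<le> T * (LINT s|L. (norm (f s))\<^sup>2)"
      unfolding D_def using L.square_integral_le[of "\<lambda>s. norm (f s)"] f T_pos by (simp add: measure_L)
    moreover have "(g s)\<^sup>2 \<le> 3 * ((norm c)\<^sup>2 + (norm (i s))\<^sup>2 + D\<^sup>2)"
    proof -
      have "0 \<le> (norm c - norm (i s))\<^sup>2 + (norm c - D)\<^sup>2 + (norm (i s) - D)\<^sup>2" by simp
      then show ?thesis by (simp add: g_def power2_eq_square algebra_simps)
    qed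
    ultimately show ?thesis by (simp add: h_def)
  qed
  have "(LINT s|L. g s)\<^sup>2 \<le> T * (LINT s|L. (g s)\<^sup>2)"
    using L.square_integral_le[OF Lc[OF cg] Lc[of "\<lambda>s. (g s)\<^sup>2"]] cg T_pos
    by (simp add: measure_L continuous_on_power)
  also have "\<dots> \<le> T * (LINT s|L. h s)"
    using T_pos by (intro mult_left_mono integral_mono Lc continuous_on_power cg gh)
      (auto simp: h_def intro!: continuous_intros ix)
  finally have Lg: "(LINT s|L. g s)\<^sup>2 \<le> T * (LINT s|L. h s)" .
  have "(norm (x t))\<^sup>2 \<le> (g t + K * exp (K * T) * integral {0..T} g)\<^sup>2"
    using gron by (rule power_mono) simp
  also have "\<dots> \<le> 2 * (g t)\<^sup>2 + 2 * (K * exp (K * T) * integral {0..T} g)\<^sup>2"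
    using sum_squares_bound[of "g t" "K * exp (K * T) * integral {0..T} g"] by (simp add: power2_sum)
  also have "\<dots> = 2 * (g t)\<^sup>2 + 2 * (K * exp (K * T))\<^sup>2 * (LINT s|L. g s)\<^sup>2"
    by (simp add: ig power_mult_distrib)
  also have "\<dots> \<le> 2 * h t + 2 * (K * exp (K * T))\<^sup>2 * (T * (LINT s|L. h s))"
    by (intro add_mono mult_left_mono gh Lg) auto
  finally show ?thesis .
qed

text \<open>A strong solution is only required to have a pathwise integrable drift, so its second
  moments must be derived. The pathwise bound is integrated over the probability space, where
  initial state, noise and \<open>f\<close> all have finite second moments.\<close>

lemma state_square_integrable_LM:
  assumes A: "continuous_on {0..T} A"
    and f: "(\<lambda>(s, \<omega>). f s \<omega>) \<in> borel_measurable (L \<Otimes>\<^sub>M M)" "integrable (L \<Otimes>\<^sub>M M) (\<lambda>(s, \<omega>). (norm (f s \<omega>))\<^sup>2)"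
    and x: "strong_solution M T w x0 (\<lambda>s \<omega>. A s *v x s \<omega> + f s \<omega>) G x"
  shows "integrable (L \<Otimes>\<^sub>M M) (\<lambda>(t, \<omega>). (norm (x t \<omega>))\<^sup>2)"
proof -
  obtain K where K: "0 \<le> K" "\<And>t. t \<in> {0..T} \<Longrightarrow> norm (A t) \<le> K" using matrix_bound_on[OF A] by blast
  define h where "h t \<omega> = 3 * ((norm (x0 \<omega>))\<^sup>2 + (norm (I t \<omega>))\<^sup>2 + T * (LINT s|L. (norm (f s \<omega>))\<^sup>2))" for t \<omega>
  define c where "c = 2 * (K * exp (K * T))\<^sup>2"
  have bound: "AE \<omega> in M. \<forall>t\<in>{0..T}. (norm (x t \<omega>))\<^sup>2 \<le> 2 * h t \<omega> + c * (T * (LINT s|L. h s \<omega>))"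
    using strong_solution_pathwise[OF x] LM.AE_integrable_snd[OF f(2)] AE_space
  proof eventually_elim
    case (elim \<omega>)
    have cx: "continuous_on {0..T} (\<lambda>t. x t \<omega>)" by (rule state_continuous[OF x elim(3)])
    \<comment> \<open>Only the whole drift is known to be integrable in time; \<open>f\<close>
      inherits this because the other part of the drift is continuous.\<close>
    have "set_integrable lborel {0..T} (\<lambda>s. A s *v x s \<omega>)"
      by (intro borel_integrable_atLeastAtMost' continuous_on_matrix_vector A cx)
    with elim(1) have "set_integrable lborel {0..T} (\<lambda>s. (A s *v x s \<omega> + f s \<omega>) - A s *v x s \<omega>)"
      by (intro set_integral_diff(1)) auto
    then have "integrable L (\<lambda>s. f s \<omega>)" unfolding L_def by (simp add: set_integrable_eq_restrict_space)
    then show ?case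
      unfolding h_def c_def
      by (intro ballI state_path_bound[OF cx I_continuous[OF elim(3)] A K _ elim(2)]) (use elim(1) in auto)
  qed
  have hLM: "integrable (L \<Otimes>\<^sub>M M) (\<lambda>(t, \<omega>). (norm (I t \<omega>))\<^sup>2)" by (rule I_square_integrable_LM)
  have fi: "integrable M (\<lambda>\<omega>. LINT s|L. (norm (f s \<omega>))\<^sup>2)" by (rule LM.integrable_snd[OF f(2)])
  define H where "H \<omega> = 3 * (T * (norm (x0 \<omega>))\<^sup>2 + (LINT t|L. (norm (I t \<omega>))\<^sup>2) + T * (T * (LINT s|L. (norm (f s \<omega>))\<^sup>2)))" for \<omega>
  have HM: "integrable M H"
    unfolding H_def[abs_def] using x0_square_integrable LM.integrable_snd[OF hLM] fi by simp
  have hH: "(LINT t|L. h t \<omega>) = H \<omega>" if "\<omega> \<in> space M" for \<omega>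
  proof -
    have "integrable L (\<lambda>t. (norm (I t \<omega>))\<^sup>2)"
      using borel_integrable_atLeastAtMost'[of 0 T "\<lambda>t. (norm (I t \<omega>))\<^sup>2"] I_continuous[OF that]
      unfolding L_def by (simp add: set_integrable_eq_restrict_space continuous_on_power continuous_on_norm)
    then show ?thesis unfolding h_def H_def by (simp add: measure_L)
  qed
  have hi: "integrable M (h t)" if "t \<in> {0..T}" for t
    unfolding h_def[abs_def] using x0_square_integrable I_square_integrable[OF that] fi by simp
  obtain C where C: "\<And>t. t \<in> {0..T} \<Longrightarrow> (LINT \<omega>|M. (norm (I t \<omega>))\<^sup>2) \<le> C" using I_second_moment_bounded by blast
  define C' where "C' = 3 * ((LINT \<omega>|M. (norm (x0 \<omega>))\<^sup>2) + C + T * (LINT \<omega>|M. (LINT s|L. (norm (f s \<omega>))\<^sup>2)))"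
  have hC: "(LINT \<omega>|M. h t \<omega>) \<le> C'" if "t \<in> {0..T}" for t
    unfolding h_def C'_def using x0_square_integrable I_square_integrable[OF that] fi C[OF that] by simp
  have dom: "integrable M (\<lambda>\<omega>. 2 * h t \<omega> + c * (T * H \<omega>))" if "t \<in> {0..T}" for t
    using hi[OF that] HM by simp
  have bnd: "AE \<omega> in M. (norm (x t \<omega>))\<^sup>2 \<le> 2 * h t \<omega> + c * (T * H \<omega>)" if "t \<in> {0..T}" for t
    using bound AE_space by eventually_elim (use that hH in auto)
  have xi: "integrable M (\<lambda>\<omega>. (norm (x t \<omega>))\<^sup>2)" if t: "t \<in> {0..T}" for t
  proof (rule Bochner_Integration.integrable_bound[OF dom[OF t]])
    show "(\<lambda>\<omega>. (norm (x t \<omega>))\<^sup>2) \<in> borel_measurable M" using state_measurable[OF x t] by measurable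
    show "AE \<omega> in M. norm ((norm (x t \<omega>))\<^sup>2) \<le> norm (2 * h t \<omega> + c * (T * H \<omega>))"
      using bnd[OF t] by eventually_elim (auto intro: order_trans[OF _ abs_ge_self])
  qed
  show ?thesis
  proof (rule integrable_LM_bounded_second_moment[OF state_measurable_LM[OF x] xi])
    fix t assume t: "t \<in> {0..T}"
    have "(LINT \<omega>|M. (norm (x t \<omega>))\<^sup>2) \<le> (LINT \<omega>|M. 2 * h t \<omega> + c * (T * H \<omega>))"
      by (rule integral_mono_AE[OF xi[OF t] dom[OF t] bnd[OF t]])
    also have "\<dots> = 2 * (LINT \<omega>|M. h t \<omega>) + c * (T * (LINT \<omega>|M. H \<omega>))"
      using hi[OF t] HM by simp
    also have "\<dots> \<le> 2 * C' + c * (T * (LINT \<omega>|M. H \<omega>))" using hC[OF t] by simp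
    finally show "(LINT \<omega>|M. (norm (x t \<omega>))\<^sup>2) \<le> 2 * C' + c * (T * (LINT \<omega>|M. H \<omega>))" .
  qed
qed

lemma energy_eq_nn_integral:
  fixes v :: "real \<Rightarrow> 'w \<Rightarrow> real^'m"
  assumes v: "(\<lambda>(t, \<omega>). v t \<omega>) \<in> borel_measurable (L \<Otimes>\<^sub>M M)"
  shows "energy M T v = (\<integral>\<^sup>+(t, \<omega>). ennreal ((norm (v t \<omega>))\<^sup>2) \<partial>(L \<Otimes>\<^sub>M M))"
proof -
  have [measurable]: "(\<lambda>p. v (fst p) (snd p)) \<in> borel_measurable (L \<Otimes>\<^sub>M M)" using v by (simp add: case_prod_beta')
  have "energy M T v = (\<integral>\<^sup>+\<omega>. (\<integral>\<^sup>+t. ennreal ((norm (v t \<omega>))\<^sup>2) \<partial>L) \<partial>M)"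
    unfolding energy_def L_def
    by (subst nn_integral_restrict_space) (simp_all add: power2_norm_eq_inner)
  also have "\<dots> = (\<integral>\<^sup>+(t, \<omega>). ennreal ((norm (v t \<omega>))\<^sup>2) \<partial>(L \<Otimes>\<^sub>M M))"
    using LM.nn_integral_snd[of "\<lambda>p. ennreal ((norm (v (fst p) (snd p)))\<^sup>2)"] by (simp add: case_prod_beta')
  finally show ?thesis .
qed

lemma energy_finite_imp_integrable:
  fixes v :: "real \<Rightarrow> 'w \<Rightarrow> real^'m"
  assumes v: "(\<lambda>(t, \<omega>). v t \<omega>) \<in> borel_measurable (L \<Otimes>\<^sub>M M)" and fin: "energy M T v < \<infinity>"
  shows "integrable (L \<Otimes>\<^sub>M M) (\<lambda>(t, \<omega>). (norm (v t \<omega>))\<^sup>2)"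
proof -
  have [measurable]: "(\<lambda>p. v (fst p) (snd p)) \<in> borel_measurable (L \<Otimes>\<^sub>M M)" using v by (simp add: case_prod_beta')
  show ?thesis
    using fin unfolding energy_eq_nn_integral[OF v]
    by (intro integrableI_nonneg) (auto simp: case_prod_beta')
qed

lemma energy_eq_integral:
  fixes v :: "real \<Rightarrow> 'w \<Rightarrow> real^'m"
  assumes v: "(\<lambda>(t, \<omega>). v t \<omega>) \<in> borel_measurable (L \<Otimes>\<^sub>M M)"
    and i: "integrable (L \<Otimes>\<^sub>M M) (\<lambda>(t, \<omega>). (norm (v t \<omega>))\<^sup>2)"
  shows "energy M T v = ennreal (integral\<^sup>L (L \<Otimes>\<^sub>M M) (\<lambda>(t, \<omega>). (norm (v t \<omega>))\<^sup>2))"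
  unfolding energy_eq_nn_integral[OF v]
  using nn_integral_eq_integral[OF i] by (simp add: case_prod_beta')

end

section \<open>The cost identity\<close>

lemma inner_transpose_matrix: "(B *v u) \<bullet> z = u \<bullet> (transpose B *v z)" for B :: "real^'m^'n"
  using inner_matrix_vector[of z B u] by (simp add: inner_commute)

text \<open>The terms with \<open>A\<close> cancel between the Riccati equation and the drift. What
  is left is |B'Px|^2 + 2 v . B'Px, which lacks only |v|^2 to be a complete square.\<close>

lemma riccati_integrand:
  fixes A P :: "real^'n^'n" and B :: "real^'m^'n"
  assumes P: "transpose P = P"
  shows "x \<bullet> ((- (transpose A ** P) - P ** A + P ** B ** transpose B ** P) *v x) + 2 * ((A *v x + B *v v) \<bullet> (P *v x))
     = (norm (v + transpose B *v (P *v x)))\<^sup>2 - (norm v)\<^sup>2"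
proof -
  have sym: "u \<bullet> (P *v z) = (P *v u) \<bullet> z" for u z by (subst inner_matrix_vector) (simp add: P)
  have "x \<bullet> ((transpose A ** P) *v x) = (A *v x) \<bullet> (P *v x)"
    unfolding matrix_vector_mul_assoc[symmetric] by (rule inner_transpose_matrix[symmetric])
  moreover have "x \<bullet> ((P ** A) *v x) = (A *v x) \<bullet> (P *v x)"
    unfolding matrix_vector_mul_assoc[symmetric] sym[of x] by (rule inner_commute)
  moreover have "x \<bullet> ((P ** B ** transpose B ** P) *v x) = (norm (transpose B *v (P *v x)))\<^sup>2"
  proof -
    have "x \<bullet> ((P ** B ** transpose B ** P) *v x) = x \<bullet> (P *v (B *v (transpose B *v (P *v x))))"
      by (simp only: matrix_vector_mul_assoc[symmetric])
    also have "\<dots> = (P *v x) \<bullet> (B *v (transpose B *v (P *v x)))" by (rule sym)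
    also have "\<dots> = (transpose B *v (P *v x)) \<bullet> (transpose B *v (P *v x))" by (rule inner_matrix_vector)
    finally show ?thesis by (simp add: power2_norm_eq_inner)
  qed
  moreover have "(B *v v) \<bullet> (P *v x) = v \<bullet> (transpose B *v (P *v x))" by (rule inner_transpose_matrix)
  ultimately show ?thesis
    by (simp add: matrix_vector_mult_add_rdistrib matrix_vector_mult_diff_rdistrib matrix_vector_minus_left inner_add_right inner_diff_right
        inner_add_left power2_norm_eq_inner inner_commute)
qed

lemma transpose_add: "transpose (X + Y) = transpose X + transpose Y" for X Y :: "real^'n^'m"
  by (simp add: transpose_def vec_eq_iff)

lemma transpose_diff: "transpose (X - Y) = transpose X - transpose Y" for X Y :: "real^'n^'m"
  by (simp add: transpose_def vec_eq_iff)

lemma transpose_minus: "transpose (- X) = - transpose X" for X :: "real^'n^'m"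
  by (simp add: transpose_def vec_eq_iff)

lemmas continuous_on_transpose = bounded_linear.continuous_on[OF bounded_linear_transpose]

context wiener_path
begin

text \<open>The state is adapted to the augmented filtration, so a control determined by the past of
  the state is adapted too. This is what the orthogonality of later noise requires.\<close>

lemma measurable_generated_imp_F:
  assumes x: "strong_solution M T w x0 b G x" and t: "t \<in> {0..T}"
    and u: "u \<in> borel_measurable (generated_algebra M {0..t} x)"
  shows "u \<in> borel_measurable (F t)"
proof (rule measurable_subalgebra[OF u])
  show "space (generated_algebra M {0..t} x) = space (F t)" using t by simp
  show "sets (generated_algebra M {0..t} x) \<subseteq> sets (F t)"
  proof (rule sets_generated_algebra_subset)
    show "space (F t) = space M" using t by simp
    show "x s \<in> borel_measurable (F t)" if "s \<in> {0..t}" for s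
      by (rule measurable_F_mono[OF state_measurable_F[OF x]]) (use that t in auto)
  qed
qed

text \<open>The drift A x + B v is square integrable, by the hypothesis on \<open>v\<close> and the
  resulting second moments of the state. Therefore \<open>quadratic_expectation\<close> applies to
  the splitting of the state into y and \<open>I\<close>, and \<open>riccati_integrand\<close>
  rewrites its integrand pointwise.\<close>

lemma cost_identity:
  fixes A P :: "real \<Rightarrow> real^'n^'n" and B :: "real \<Rightarrow> real^'m^'n" and v :: "real \<Rightarrow> 'w \<Rightarrow> real^'m"
  assumes A: "continuous_on {0..T} A" and B: "continuous_on {0..T} B"
    and symP: "\<And>t. t \<in> {0..T} \<Longrightarrow> transpose (P t) = P t"
    and dP: "\<And>t. t \<in> {0..T} \<Longrightarrow> (P has_vector_derivative
           (- (transpose (A t) ** P t) - P t ** A t + P t ** B t ** transpose (B t) ** P t)) (at t within {0..T})"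
    and v: "(\<lambda>(t, \<omega>). v t \<omega>) \<in> borel_measurable (L \<Otimes>\<^sub>M M)"
    and vF: "\<And>t. t \<in> {0..T} \<Longrightarrow> v t \<in> borel_measurable (F t)"
    and vi: "integrable (L \<Otimes>\<^sub>M M) (\<lambda>(t, \<omega>). (norm (v t \<omega>))\<^sup>2)"
    and x: "strong_solution M T w x0 (\<lambda>s \<omega>. A s *v x s \<omega> + B s *v v s \<omega>) G x"
  shows "integrable (L \<Otimes>\<^sub>M M) (\<lambda>(t, \<omega>). (norm (v t \<omega> + transpose (B t) *v (P t *v x t \<omega>)))\<^sup>2)"
    and "integral\<^sup>L (L \<Otimes>\<^sub>M M) (\<lambda>(t, \<omega>). (norm (v t \<omega>))\<^sup>2)
       = integral\<^sup>L (L \<Otimes>\<^sub>M M) (\<lambda>(t, \<omega>). (norm (v t \<omega> + transpose (B t) *v (P t *v x t \<omega>)))\<^sup>2)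
        + (LINT \<omega>|M. x0 \<omega> \<bullet> (P 0 *v x0 \<omega>)) - (LINT \<omega>|M. x T \<omega> \<bullet> (P T *v x T \<omega>))
        + wiener_constant P (\<lambda>t. - (transpose (A t) ** P t) - P t ** A t + P t ** B t ** transpose (B t) ** P t)"
proof -
  define N where "N t = - (transpose (A t) ** P t) - P t ** A t + P t ** B t ** transpose (B t) ** P t" for t
  have cP: "continuous_on {0..T} P" using dP by (meson continuous_on_eq_continuous_within has_vector_derivative_continuous)
  have cN: "continuous_on {0..T} N"
    unfolding N_def by (intro continuous_intros continuous_on_matrix_mult continuous_on_transpose A B cP)
  have symN: "transpose (N t) = N t" if "t \<in> {0..T}" for t
    by (simp add: N_def transpose_add transpose_diff transpose_minus matrix_transpose_mul symP[OF that] matrix_mul_assoc)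
  obtain KB where KB: "0 \<le> KB" "\<And>t. t \<in> {0..T} \<Longrightarrow> norm (B t) \<le> KB" using matrix_bound_on[OF B] by blast
  obtain KA where KA: "0 \<le> KA" "\<And>t. t \<in> {0..T} \<Longrightarrow> norm (A t) \<le> KA" using matrix_bound_on[OF A] by blast
  have [measurable]: "A \<in> borel_measurable L" "B \<in> borel_measurable L" by (rule continuous_measurable_L[OF A] continuous_measurable_L[OF B])+
  have [measurable]: "(\<lambda>p. v (fst p) (snd p)) \<in> borel_measurable (L \<Otimes>\<^sub>M M)" "(\<lambda>p. x (fst p) (snd p)) \<in> borel_measurable (L \<Otimes>\<^sub>M M)"
    using v state_measurable_LM[OF x] by (simp_all add: case_prod_beta')
  have Bv: "integrable (L \<Otimes>\<^sub>M M) (\<lambda>(s, \<omega>). (norm (B s *v v s \<omega>))\<^sup>2)"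
  proof (rule Bochner_Integration.integrable_bound)
    show "integrable (L \<Otimes>\<^sub>M M) (\<lambda>(s, \<omega>). KB\<^sup>2 * (norm (v s \<omega>))\<^sup>2)" using vi by (simp add: case_prod_beta')
    show "AE p in L \<Otimes>\<^sub>M M. norm (case p of (s, \<omega>) \<Rightarrow> (norm (B s *v v s \<omega>))\<^sup>2) \<le> norm (case p of (s, \<omega>) \<Rightarrow> KB\<^sup>2 * (norm (v s \<omega>))\<^sup>2)"
    proof (rule AE_I2)
      fix p assume "p \<in> space (L \<Otimes>\<^sub>M M)"
      then obtain s \<omega> where p: "p = (s, \<omega>)" "s \<in> {0..T}" by (auto simp: space_pair_measure)
      have "norm (B s *v v s \<omega>) \<le> KB * norm (v s \<omega>)"
        using norm_matrix_vector_le[of "B s" "v s \<omega>"] mult_right_mono[OF KB(2)[OF p(2)], of "norm (v s \<omega>)"] by simp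
      then have "(norm (B s *v v s \<omega>))\<^sup>2 \<le> (KB * norm (v s \<omega>))\<^sup>2" by (rule power_mono) simp
      then show "norm (case p of (s, \<omega>) \<Rightarrow> (norm (B s *v v s \<omega>))\<^sup>2) \<le> norm (case p of (s, \<omega>) \<Rightarrow> KB\<^sup>2 * (norm (v s \<omega>))\<^sup>2)"
        by (simp add: p power_mult_distrib)
    qed
  qed (unfold case_prod_beta', measurable)
  have Bvm: "(\<lambda>(s, \<omega>). B s *v v s \<omega>) \<in> borel_measurable (L \<Otimes>\<^sub>M M)" unfolding case_prod_beta' by measurable
  have xi: "integrable (L \<Otimes>\<^sub>M M) (\<lambda>(t, \<omega>). (norm (x t \<omega>))\<^sup>2)"
    by (rule state_square_integrable_LM[OF A Bvm Bv x])
  define b where "b s \<omega> = A s *v x s \<omega> + B s *v v s \<omega>" for s \<omega>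
  define y where "y t \<omega> = x t \<omega> - I t \<omega>" for t \<omega>
  interpret D: drift M T w x0 S0 G I b y
  proof
    show bm: "(\<lambda>(s, \<omega>). b s \<omega>) \<in> borel_measurable (L \<Otimes>\<^sub>M M)" unfolding case_prod_beta' b_def by measurable
    show "b s \<in> borel_measurable (F s)" if "s \<in> {0..T}" for s
      unfolding b_def[abs_def]
      by (intro borel_measurable_add measurable_compose[OF _ measurable_matrix_vector] vF[OF that] state_measurable_F[OF x that])
    show "integrable (L \<Otimes>\<^sub>M M) (\<lambda>(s, \<omega>). (norm (b s \<omega>))\<^sup>2)"
    proof (rule Bochner_Integration.integrable_bound)
      show "integrable (L \<Otimes>\<^sub>M M) (\<lambda>(s, \<omega>). 2 * (KA\<^sup>2 * (norm (x s \<omega>))\<^sup>2) + 2 * (norm (B s *v v s \<omega>))\<^sup>2)"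
        using xi Bv by (simp add: case_prod_beta')
      show "AE p in L \<Otimes>\<^sub>M M. norm (case p of (s, \<omega>) \<Rightarrow> (norm (b s \<omega>))\<^sup>2)
          \<le> norm (case p of (s, \<omega>) \<Rightarrow> 2 * (KA\<^sup>2 * (norm (x s \<omega>))\<^sup>2) + 2 * (norm (B s *v v s \<omega>))\<^sup>2)"
      proof (rule AE_I2)
        fix p assume "p \<in> space (L \<Otimes>\<^sub>M M)"
        then obtain s \<omega> where p: "p = (s, \<omega>)" "s \<in> {0..T}" by (auto simp: space_pair_measure)
        have "norm (A s *v x s \<omega>) \<le> KA * norm (x s \<omega>)"
          using norm_matrix_vector_le[of "A s" "x s \<omega>"] mult_right_mono[OF KA(2)[OF p(2)], of "norm (x s \<omega>)"] by simp
        then have "(norm (A s *v x s \<omega>))\<^sup>2 \<le> (KA * norm (x s \<omega>))\<^sup>2" by (rule power_mono) simp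
        moreover have "(norm (b s \<omega>))\<^sup>2 \<le> 2 * (norm (A s *v x s \<omega>))\<^sup>2 + 2 * (norm (B s *v v s \<omega>))\<^sup>2"
          using norm_diff_square_le[of "A s *v x s \<omega>" "- (B s *v v s \<omega>)" 0] by (simp add: b_def)
        ultimately show "norm (case p of (s, \<omega>) \<Rightarrow> (norm (b s \<omega>))\<^sup>2)
          \<le> norm (case p of (s, \<omega>) \<Rightarrow> 2 * (KA\<^sup>2 * (norm (x s \<omega>))\<^sup>2) + 2 * (norm (B s *v v s \<omega>))\<^sup>2)"
          by (simp add: p power_mult_distrib)
      qed
    qed (use bm in \<open>unfold case_prod_beta', measurable\<close>)
    show "y t \<in> borel_measurable M" if "t \<in> {0..T}" for t
      unfolding y_def[abs_def] by (intro borel_measurable_diff state_measurable[OF x that] I_measurable[OF that])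
    show "continuous_on {0..T} (\<lambda>t. y t \<omega>)" if "\<omega> \<in> space M" for \<omega>
      unfolding y_def by (intro continuous_on_diff state_continuous[OF x that] I_continuous[OF that])
    show "AE \<omega> in M. set_integrable lborel {0..T} (\<lambda>s. b s \<omega>) \<and>
       (\<forall>t\<in>{0..T}. y t \<omega> = x0 \<omega> + (LINT s:{0..t}|lborel. b s \<omega>))"
      using strong_solution_pathwise[OF x] by eventually_elim (simp add: b_def y_def)
  qed
  let ?r = "\<lambda>(t, \<omega>). (norm (v t \<omega> + transpose (B t) *v (P t *v x t \<omega>)))\<^sup>2"
  let ?q = "\<lambda>(t, \<omega>). x t \<omega> \<bullet> (N t *v x t \<omega>) + 2 * (b t \<omega> \<bullet> (P t *v x t \<omega>))"
  have yI: "y t \<omega> + I t \<omega> = x t \<omega>" for t \<omega> by (simp add: y_def)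
  have dP': "(P has_vector_derivative N t) (at t within {0..T})" if "t \<in> {0..T}" for t
    unfolding N_def by (rule dP[OF that])
  have qi: "integrable (L \<Otimes>\<^sub>M M) ?q" and
    q: "(LINT \<omega>|M. x T \<omega> \<bullet> (P T *v x T \<omega>)) = (LINT \<omega>|M. x0 \<omega> \<bullet> (P 0 *v x0 \<omega>)) + integral\<^sup>L (L \<Otimes>\<^sub>M M) ?q + wiener_constant P N"
    using D.quadratic_expectation[OF dP' cN symP symN] unfolding yI by auto
  have rq: "?r p = ?q p + (case p of (t, \<omega>) \<Rightarrow> (norm (v t \<omega>))\<^sup>2)" if pp: "p \<in> space (L \<Otimes>\<^sub>M M)" for p
  proof -
    obtain t \<omega> where p: "p = (t, \<omega>)" "t \<in> {0..T}" using pp by (auto simp: space_pair_measure)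
    show ?thesis using riccati_integrand[OF symP[OF p(2)], of "x t \<omega>" "A t" "B t" "v t \<omega>"]
      by (simp add: p(1) N_def b_def)
  qed
  have ri: "integrable (L \<Otimes>\<^sub>M M) (\<lambda>p. ?q p + (case p of (t, \<omega>) \<Rightarrow> (norm (v t \<omega>))\<^sup>2))"
    by (rule Bochner_Integration.integrable_add[OF qi vi])
  show "integrable (L \<Otimes>\<^sub>M M) ?r"
    by (rule iffD2[OF Bochner_Integration.integrable_cong[OF refl] ri]) (rule rq)
  have "integral\<^sup>L (L \<Otimes>\<^sub>M M) ?r = integral\<^sup>L (L \<Otimes>\<^sub>M M) (\<lambda>p. ?q p + (case p of (t, \<omega>) \<Rightarrow> (norm (v t \<omega>))\<^sup>2))"
    by (rule Bochner_Integration.integral_cong[OF refl]) (rule rq)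
  also have "\<dots> = integral\<^sup>L (L \<Otimes>\<^sub>M M) ?q + integral\<^sup>L (L \<Otimes>\<^sub>M M) (\<lambda>(t, \<omega>). (norm (v t \<omega>))\<^sup>2)"
    by (rule Bochner_Integration.integral_add[OF qi vi])
  finally show "integral\<^sup>L (L \<Otimes>\<^sub>M M) (\<lambda>(t, \<omega>). (norm (v t \<omega>))\<^sup>2)
       = integral\<^sup>L (L \<Otimes>\<^sub>M M) ?r
        + (LINT \<omega>|M. x0 \<omega> \<bullet> (P 0 *v x0 \<omega>)) - (LINT \<omega>|M. x T \<omega> \<bullet> (P T *v x T \<omega>))
        + wiener_constant P (\<lambda>t. - (transpose (A t) ** P t) - P t ** A t + P t ** B t ** transpose (B t) ** P t)"
    using q unfolding N_def[abs_def] by simp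
qed

end

section \<open>The terminal distribution of a linear equation\<close>

context wiener_integrand
begin

lemma node_cell: "0 < N \<Longrightarrow> k < N \<Longrightarrow> {node N k..node N (Suc k)} \<subseteq> {0..T}"
  using node_bounds[of N k] node_bounds[of N "Suc k"] by auto

text \<open>The integrands \<open>g k\<close> may vary within a cell. This covers Riemann sums,
  where \<open>g k\<close> is constant, as well as sums in which only one of two factors is
  frozen.\<close>

lemma riemann_approx:
  fixes f :: "real \<Rightarrow> 'a::euclidean_space"
  assumes f: "continuous_on {0..T} f" and N: "0 < N"
    and g: "\<And>k. k < N \<Longrightarrow> continuous_on {node N k..node N (Suc k)} (g k)"
    and close: "\<And>k s. k < N \<Longrightarrow> s \<in> {node N k..node N (Suc k)} \<Longrightarrow> norm (g k s - f s) \<le> e"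
  shows "norm ((\<Sum>k<N. integral {node N k..node N (Suc k)} (g k)) - integral {0..T} f) \<le> e * T"
proof -
  have fi: "f integrable_on {0..T}" by (rule integrable_continuous_interval[OF f])
  have split: "integral {0..node N n} f = (\<Sum>k<n. integral {node N k..node N (Suc k)} f)" if "n \<le> N" for n
    using that
  proof (induction n)
    case (Suc n)
    have "integral {0..node N n} f + integral {node N n..node N (Suc n)} f = integral {0..node N (Suc n)} f"
      using node_bounds[OF N, of n] node_bounds[OF N, of "Suc n"] node_mono[of n "Suc n" N] Suc.prems
      by (intro Henstock_Kurzweil_Integration.integral_combine integrable_on_subinterval[OF fi]) auto
    then show ?case using Suc by simp
  qed (simp add: node_def)
  have NT: "node N N = T" using N by (simp add: node_def)
  have cell: "norm (integral {node N k..node N (Suc k)} (g k) - integral {node N k..node N (Suc k)} f) \<le> e * (T / real N)" if k: "k < N" for k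
  proof -
    have cf: "continuous_on {node N k..node N (Suc k)} f" by (rule continuous_on_subset[OF f node_cell[OF N k]])
    have "integral {node N k..node N (Suc k)} (g k) - integral {node N k..node N (Suc k)} f
      = integral {node N k..node N (Suc k)} (\<lambda>s. g k s - f s)"
      by (rule Henstock_Kurzweil_Integration.integral_diff[symmetric]) (intro integrable_continuous_interval g k cf)+
    also have "norm \<dots> \<le> e * (node N (Suc k) - node N k)"
      by (rule integral_bound) (use node_mono[of k "Suc k" N] close[OF k] in \<open>auto intro!: continuous_intros g k cf\<close>)
    finally show ?thesis by (simp add: node_Suc)
  qed
  have "(\<Sum>k<N. integral {node N k..node N (Suc k)} (g k)) - integral {0..T} f
     = (\<Sum>k<N. integral {node N k..node N (Suc k)} (g k) - integral {node N k..node N (Suc k)} f)"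
    using split[of N] by (simp add: NT sum_subtractf)
  also have "norm \<dots> \<le> (\<Sum>k<N. e * (T / real N))"
    by (rule sum_norm_le) (use cell in auto)
  also have "\<dots> = e * T" using N by simp
  finally show ?thesis .
qed

lemma mesh_small:
  assumes "0 < d"
  shows "\<forall>\<^sub>F j in sequentially. T / real (mesh j) < d"
proof -
  obtain n :: nat where n: "T / d < real n" using reals_Archimedean2 by blast
  show ?thesis
    using eventually_ge_at_top[of n]
  proof eventually_elim
    case (elim j)
    have "T / d < real (mesh j)" using n elim mesh(1)[of j] by linarith
    then show ?case using assms mesh_pos[of j] by (simp add: field_simps)
  qed
qed

text \<open>Both end points of a cell are compared, because summation by parts produces values at
  right ends and the Gram sums produce values at left ends.\<close>

lemma mesh_uniform:
  fixes f :: "real \<Rightarrow> 'a::euclidean_space"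
  assumes "continuous_on {0..T} f" "0 < e"
  shows "\<forall>\<^sub>F j in sequentially. \<forall>k<mesh j. \<forall>s\<in>{node (mesh j) k..node (mesh j) (Suc k)}.
    norm (f (node (mesh j) k) - f s) \<le> e \<and> norm (f (node (mesh j) (Suc k)) - f s) \<le> e"
proof -
  have "uniformly_continuous_on {0..T} f" by (rule compact_uniformly_continuous[OF assms(1)]) simp
  then obtain d where d: "0 < d" "\<And>s r. s \<in> {0..T} \<Longrightarrow> r \<in> {0..T} \<Longrightarrow> dist r s < d \<Longrightarrow> dist (f r) (f s) < e"
    unfolding uniformly_continuous_on_def using assms(2) by meson
  show ?thesis
    using mesh_small[OF d(1)]
  proof eventually_elim
    case (elim j)
    show ?case
    proof (intro allI impI ballI)
      fix k s assume k: "k < mesh j" and s: "s \<in> {node (mesh j) k..node (mesh j) (Suc k)}"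
      have sT: "s \<in> {0..T}" using node_cell[OF mesh_pos k] s by blast
      have n: "node (mesh j) k \<in> {0..T}" "node (mesh j) (Suc k) \<in> {0..T}" using node_bounds[OF mesh_pos[of j], of k] node_bounds[OF mesh_pos[of j], of "Suc k"] k by auto
      have "dist (node (mesh j) k) s < d" "dist (node (mesh j) (Suc k)) s < d"
        using s elim node_Suc[of "mesh j" k] by (auto simp: dist_real_def)
      from d(2)[OF sT n(1) this(1)] d(2)[OF sT n(2) this(2)]
      show "norm (f (node (mesh j) k) - f s) \<le> e \<and> norm (f (node (mesh j) (Suc k)) - f s) \<le> e"
        by (simp add: dist_norm)
    qed
  qed
qed

text \<open>Starting from \<open>x0\<close> keeps every covariance positive definite, so that a
  density exists although the Gram matrices may be singular. Measurability is part of the induction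
  because it yields independence of the partial sum from the next increment.\<close>

lemma increment_sum_gaussian:
  fixes C :: "nat \<Rightarrow> real^'p^'n"
  assumes N: "0 < N" and k: "k \<le> N"
  shows "pos_def (S0 + (\<Sum>i<k. (T / real N) *\<^sub>R (C i ** transpose (C i)))) \<and>
    (\<lambda>\<omega>. x0 \<omega> + (\<Sum>i<k. C i *v (w (node N (Suc i)) \<omega> - w (node N i) \<omega>))) \<in> borel_measurable (F (node N k)) \<and>
    distributed M lborel (\<lambda>\<omega>. x0 \<omega> + (\<Sum>i<k. C i *v (w (node N (Suc i)) \<omega> - w (node N i) \<omega>)))
      (gaussian_density (S0 + (\<Sum>i<k. (T / real N) *\<^sub>R (C i ** transpose (C i)))))"
  using k
proof (induction k)
  case 0
  then show ?case using pos_def_S0 distributed_x0 measurable_F_x0[of 0] T_pos by (simp add: node_def)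
next
  case (Suc k)
  define Y where "Y \<omega> = x0 \<omega> + (\<Sum>i<k. C i *v (w (node N (Suc i)) \<omega> - w (node N i) \<omega>))" for \<omega>
  define R where "R = S0 + (\<Sum>i<k. (T / real N) *\<^sub>R (C i ** transpose (C i)))"
  define d where "d \<omega> = w (node N (Suc k)) \<omega> - w (node N k) \<omega>" for \<omega>
  have IH: "pos_def R" "Y \<in> borel_measurable (F (node N k))" "distributed M lborel Y (gaussian_density R)"
    using Suc unfolding R_def Y_def[abs_def] by auto
  have n: "node N k \<in> {0..T}" "node N (Suc k) \<in> {0..T}" "node N k < node N (Suc k)"
    using node_bounds[OF N, of k] node_bounds[OF N, of "Suc k"] Suc.prems N T_pos by (auto simp: node_Suc)
  have TN: "0 < T / real N" using N T_pos by simp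
  have dd: "distributed M lborel d (gaussian_density ((T / real N) *\<^sub>R mat 1))"
    using distributed_increment[of "node N k" "node N (Suc k)"] n unfolding d_def[abs_def] by (simp add: node_Suc)
  have "distributed M lborel (\<lambda>\<omega>. Y \<omega> + C k *v d \<omega>) (gaussian_density (R + (T / real N) *\<^sub>R (C k ** transpose (C k))))"
  proof (rule distributed_gaussian_add[OF prob_space_axioms IH(3,1) dd TN])
    fix D :: "(real^'n) set" and E :: "(real^'p) set" assume "D \<in> sets borel" and E: "E \<in> sets borel"
    then have "Y -` D \<inter> space M \<in> sets (F (node N k))"
      using measurable_sets[OF IH(2)] n by simp
    then show "prob ((Y -` D \<inter> space M) \<inter> (d -` E \<inter> space M)) = prob (Y -` D \<inter> space M) * prob (d -` E \<inter> space M)"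
      unfolding d_def[abs_def] using n E by (intro indep_increment) auto
  qed
  moreover have "pos_def (R + (T / real N) *\<^sub>R (C k ** transpose (C k)))"
    using pos_def_add_Gram[OF IH(1) less_imp_le[OF TN], of "C k"] .
  moreover have "(\<lambda>\<omega>. Y \<omega> + C k *v d \<omega>) \<in> borel_measurable (F (node N (Suc k)))"
    unfolding d_def
    using n by (intro borel_measurable_add measurable_compose[OF _ measurable_matrix_vector] borel_measurable_diff
       measurable_F_mono[OF IH(2)] measurable_F_w) auto
  ultimately show ?case
    by (simp add: Y_def R_def d_def add.assoc)
qed

lemma euler_node:
  assumes N: "0 < N" and k: "k \<le> N"
  shows "euler N (node N k) \<omega> = (\<Sum>i<k. G (node N i) *v (w (node N (Suc i)) \<omega> - w (node N i) \<omega>))"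
proof -
  have "euler N (node N k) \<omega> = (\<Sum>i<N. G (node N i) *v (w (min (node N k) (node N (Suc i))) \<omega> - w (min (node N k) (node N i)) \<omega>))"
    by (simp add: euler_def step_integral_def)
  also have "\<dots> = (\<Sum>i<k. G (node N i) *v (w (min (node N k) (node N (Suc i))) \<omega> - w (min (node N k) (node N i)) \<omega>))"
  proof (rule sum.mono_neutral_right)
    show "\<forall>i\<in>{..<N} - {..<k}. G (node N i) *v (w (min (node N k) (node N (Suc i))) \<omega> - w (min (node N k) (node N i)) \<omega>) = 0"
    proof
      fix i assume "i \<in> {..<N} - {..<k}"
      then have "node N k \<le> node N i" "node N k \<le> node N (Suc i)" by (auto intro!: node_mono)
      then show "G (node N i) *v (w (min (node N k) (node N (Suc i))) \<omega> - w (min (node N k) (node N i)) \<omega>) = 0"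
        by (simp add: min_def)
    qed
  qed (use k in auto)
  also have "\<dots> = (\<Sum>i<k. G (node N i) *v (w (node N (Suc i)) \<omega> - w (node N i) \<omega>))"
  proof (rule sum.cong[OF refl])
    fix i assume "i \<in> {..<k}"
    then have "node N i \<le> node N k" "node N (Suc i) \<le> node N k" by (auto intro!: node_mono)
    then show "G (node N i) *v (w (min (node N k) (node N (Suc i))) \<omega> - w (min (node N k) (node N i)) \<omega>)
      = G (node N i) *v (w (node N (Suc i)) \<omega> - w (node N i) \<omega>)" by (simp add: min_absorb2)
  qed
  finally show ?thesis .
qed

end

section \<open>Passage to the limit in the terminal state\<close>

context wiener_path
begin

text \<open>Summation by parts moves the differences from \<open>w\<close> to the smooth function
  \<open>V\<close>. Uniform convergence of the step sums to \<open>I\<close> then gives the limit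
  path by path, with no stochastic integral of V G.\<close>

lemma terminal_sum_limit:
  fixes V V' :: "real \<Rightarrow> real^'n^'n"
  assumes V: "\<And>t. t \<in> {0..T} \<Longrightarrow> (V has_vector_derivative V' t) (at t within {0..T})" and cV': "continuous_on {0..T} V'"
    and unif: "uniform_limit {0..T} (\<lambda>j t. euler (mesh j) t \<omega>) (\<lambda>t. I t \<omega>) sequentially" and \<omega>: "\<omega> \<in> space M"
  shows "(\<lambda>j. \<Sum>k<mesh j. (V (node (mesh j) k) ** G (node (mesh j) k)) *v (w (node (mesh j) (Suc k)) \<omega> - w (node (mesh j) k) \<omega>))
     \<longlonglongrightarrow> V T *v I T \<omega> - integral {0..T} (\<lambda>s. V' s *v I s \<omega>)"
proof -
  define e where "e j k = euler (mesh j) (node (mesh j) k) \<omega>" for j k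
  have cI: "continuous_on {0..T} (\<lambda>t. I t \<omega>)" by (rule I_continuous[OF \<omega>])
  obtain K where K: "0 \<le> K" "\<And>t. t \<in> {0..T} \<Longrightarrow> norm (V' t) \<le> K" using matrix_bound_on[OF cV'] by blast
  define B where "B j = (\<Sum>k<mesh j. integral {node (mesh j) k..node (mesh j) (Suc k)} (\<lambda>s. V' s *v e j (Suc k)))" for j
  have abel: "(\<Sum>k<mesh j. (V (node (mesh j) k) ** G (node (mesh j) k)) *v (w (node (mesh j) (Suc k)) \<omega> - w (node (mesh j) k) \<omega>))
     = V T *v euler (mesh j) T \<omega> - B j" for j
  proof -
    let ?N = "mesh j" and ?n = "node (mesh j)"
    have "(\<Sum>k<n. (V (?n k) ** G (?n k)) *v (w (?n (Suc k)) \<omega> - w (?n k) \<omega>))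
       = V (?n n) *v e j n - (\<Sum>k<n. (V (?n (Suc k)) - V (?n k)) *v e j (Suc k))" if "n \<le> ?N" for n
      using that
    proof (induction n)
      case 0
      then show ?case by (simp add: e_def euler_node[OF mesh_pos])
    next
      case (Suc n)
      have "e j (Suc n) = e j n + G (?n n) *v (w (?n (Suc n)) \<omega> - w (?n n) \<omega>)"
        using Suc.prems by (simp add: e_def euler_node[OF mesh_pos])
      then have "(V (?n n) ** G (?n n)) *v (w (?n (Suc n)) \<omega> - w (?n n) \<omega>) = V (?n n) *v e j (Suc n) - V (?n n) *v e j n"
        by (simp add: matrix_vector_right_distrib matrix_vector_mul_assoc[symmetric])
      then show ?case using Suc by (simp add: matrix_vector_mult_diff_rdistrib)
    qed
    from this[of ?N] have "(\<Sum>k<?N. (V (?n k) ** G (?n k)) *v (w (?n (Suc k)) \<omega> - w (?n k) \<omega>))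
       = V (?n ?N) *v e j ?N - (\<Sum>k<?N. (V (?n (Suc k)) - V (?n k)) *v e j (Suc k))" by simp
    moreover have "?n ?N = T" using mesh_pos[of j] by (simp add: node_def)
    moreover have "(V (?n (Suc k)) - V (?n k)) *v c = integral {?n k..?n (Suc k)} (\<lambda>s. V' s *v c)" if k: "k < ?N" for k c
    proof -
      have "(V' has_integral (V (?n (Suc k)) - V (?n k))) {?n k..?n (Suc k)}"
        by (rule fundamental_theorem_of_calculus)
           (use node_mono[of k "Suc k" ?N] node_cell[OF mesh_pos k] in \<open>auto intro!: has_vector_derivative_within_subset[OF V]\<close>)
      from has_integral_linear[OF this bounded_bilinear.bounded_linear_left[OF bounded_bilinear_matrix_vector_mult, of c]]
      have "((\<lambda>s. V' s *v c) has_integral (V (?n (Suc k)) - V (?n k)) *v c) {?n k..?n (Suc k)}"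
        unfolding o_def .
      then show ?thesis by (simp add: integral_unique)
    qed
    ultimately show ?thesis by (simp add: B_def e_def)
  qed
  have "B \<longlonglongrightarrow> integral {0..T} (\<lambda>s. V' s *v I s \<omega>)"
  proof (rule metric_LIMSEQ_I)
    fix r :: real assume r: "0 < r"
    \<comment> \<open>The error will be at most K * 2 * d * T, which this choice keeps below r / 2
      or equal to it: one \<open>d\<close> stems from uniform convergence, one from moving to the
      right end of the cell. Adding 1 to \<open>K\<close> keeps the denominator positive when
      \<open>K\<close> is 0.\<close>
    define d where "d = r / (4 * (K + 1) * (T + 1))"
    have d: "0 < d" using r K(1) T_pos by (simp add: d_def)
    have "\<forall>\<^sub>F j in sequentially. \<forall>t\<in>{0..T}. dist (euler (mesh j) t \<omega>) (I t \<omega>) < d"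
      by (rule uniform_limitD[OF unif d])
    moreover note mesh_uniform[OF cI d]
    ultimately have "\<forall>\<^sub>F j in sequentially. norm (B j - integral {0..T} (\<lambda>s. V' s *v I s \<omega>)) \<le> (K * (2 * d)) * T"
    proof eventually_elim
      case (elim j)
      show ?case
        unfolding B_def
      proof (rule riemann_approx[OF _ mesh_pos])
        show "continuous_on {0..T} (\<lambda>s. V' s *v I s \<omega>)" by (intro continuous_on_matrix_vector cV' cI)
        fix k assume k: "k < mesh j"
        show "continuous_on {node (mesh j) k..node (mesh j) (Suc k)} (\<lambda>s. V' s *v e j (Suc k))"
          by (intro continuous_on_matrix_vector continuous_on_const continuous_on_subset[OF cV' node_cell[OF mesh_pos k]])
        fix s assume s: "s \<in> {node (mesh j) k..node (mesh j) (Suc k)}"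
        have sT: "s \<in> {0..T}" using node_cell[OF mesh_pos k] s by blast
        have nT: "node (mesh j) (Suc k) \<in> {0..T}" using k by (intro node_bounds mesh_pos) simp
        have "norm (e j (Suc k) - I s \<omega>) \<le> norm (e j (Suc k) - I (node (mesh j) (Suc k)) \<omega>) + norm (I (node (mesh j) (Suc k)) \<omega> - I s \<omega>)"
          using norm_triangle_ineq[of "e j (Suc k) - I (node (mesh j) (Suc k)) \<omega>" "I (node (mesh j) (Suc k)) \<omega> - I s \<omega>"] by simp
        also have "\<dots> \<le> d + d"
        proof (rule add_mono)
          show "norm (e j (Suc k) - I (node (mesh j) (Suc k)) \<omega>) \<le> d"
            using bspec[OF elim(1) nT] by (simp add: e_def dist_norm)
          show "norm (I (node (mesh j) (Suc k)) \<omega> - I s \<omega>) \<le> d" using elim(2) k s by blast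
        qed
        finally have "norm (e j (Suc k) - I s \<omega>) \<le> 2 * d" by simp
        then have "norm (V' s) * norm (e j (Suc k) - I s \<omega>) \<le> K * (2 * d)"
          by (intro mult_mono K(2)[OF sT] K(1)) auto
        with norm_matrix_vector_le[of "V' s" "e j (Suc k) - I s \<omega>"] have "norm (V' s *v (e j (Suc k) - I s \<omega>)) \<le> K * (2 * d)"
          by linarith
        then show "norm (V' s *v e j (Suc k) - V' s *v I s \<omega>) \<le> K * (2 * d)"
          by (simp add: matrix_vector_mult_diff_distrib)
      qed
    qed
    moreover have "(K * (2 * d)) * T < r"
    proof -
      have "(K * (2 * d)) * T \<le> ((K + 1) * (2 * d)) * (T + 1)"
        using K(1) d T_pos by (intro mult_mono) auto
      also have "\<dots> = (d * (4 * (K + 1) * (T + 1))) / 2" by (simp add: field_simps)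
      also have "d * (4 * (K + 1) * (T + 1)) = r"
        unfolding d_def by (rule nonzero_eq_divide_eq[THEN iffD1, OF _ refl]) (use K(1) T_pos in simp)
      also have "r / 2 < r" using r by simp
      finally show ?thesis .
    qed
    ultimately have "\<forall>\<^sub>F j in sequentially. dist (B j) (integral {0..T} (\<lambda>s. V' s *v I s \<omega>)) < r"
      by (auto elim!: eventually_mono simp: dist_norm)
    then show "\<exists>no. \<forall>n\<ge>no. dist (B n) (integral {0..T} (\<lambda>s. V' s *v I s \<omega>)) < r"
      by (simp add: eventually_sequentially)
  qed
  moreover have "(\<lambda>j. V T *v euler (mesh j) T \<omega>) \<longlonglongrightarrow> V T *v I T \<omega>"
    using T_pos by (intro bounded_linear.tendsto[OF matrix_vector_mul_bounded_linear] tendsto_uniform_limitI[OF unif]) auto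
  ultimately show ?thesis unfolding abel by (intro tendsto_diff)
qed

lemma gram_sum_limit:
  fixes C :: "real \<Rightarrow> real^'p^'n"
  assumes C: "continuous_on {0..T} C"
  shows "(\<lambda>j. S0 + (\<Sum>k<mesh j. (T / real (mesh j)) *\<^sub>R (C (node (mesh j) k) ** transpose (C (node (mesh j) k)))))
     \<longlonglongrightarrow> S0 + integral {0..T} (\<lambda>s. C s ** transpose (C s))"
proof (intro tendsto_add tendsto_const metric_LIMSEQ_I)
  fix r :: real assume r: "0 < r"
  define H where "H s = C s ** transpose (C s)" for s
  have cH: "continuous_on {0..T} H" unfolding H_def by (intro continuous_on_matrix_mult continuous_on_transpose C)
  define d where "d = r / (2 * T)"
  have d: "0 < d" using r T_pos by (simp add: d_def)
  have "\<forall>\<^sub>F j in sequentially. dist (\<Sum>k<mesh j. (T / real (mesh j)) *\<^sub>R H (node (mesh j) k)) (integral {0..T} H) < r"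
    using mesh_uniform[OF cH d]
  proof eventually_elim
    case (elim j)
    have eq: "integral {node (mesh j) k..node (mesh j) (Suc k)} (\<lambda>_. H (node (mesh j) k)) = (T / real (mesh j)) *\<^sub>R H (node (mesh j) k)" for k
    proof -
      have "node (mesh j) k \<le> node (mesh j) (Suc k)" by (rule node_mono) simp
      then show ?thesis using node_Suc[of "mesh j" k] by (simp only: integral_const_real measure_lborel_Icc) (simp add: algebra_simps)
    qed
    have "norm ((\<Sum>k<mesh j. integral {node (mesh j) k..node (mesh j) (Suc k)} (\<lambda>_. H (node (mesh j) k))) - integral {0..T} H) \<le> d * T"
      by (rule riemann_approx[OF cH mesh_pos]) (use elim in auto)
    then have "norm ((\<Sum>k<mesh j. (T / real (mesh j)) *\<^sub>R H (node (mesh j) k)) - integral {0..T} H) \<le> d * T"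
      by (simp only: eq)
    also have "\<dots> < r" using r T_pos by (simp add: d_def)
    finally show ?case by (simp add: dist_norm)
  qed
  then show "\<exists>no. \<forall>n\<ge>no. dist (\<Sum>k<mesh n. (T / real (mesh n)) *\<^sub>R (C (node (mesh n) k) ** transpose (C (node (mesh n) k)))) (integral {0..T} (\<lambda>s. C s ** transpose (C s))) < r"
    unfolding eventually_sequentially H_def[abs_def] .
qed

text \<open>The quadratic form of the integral is an integral of squared norms; strict positivity is
  contributed by \<open>S0\<close>.\<close>

lemma pos_def_gram_integral:
  fixes C :: "real \<Rightarrow> real^'p^'n"
  assumes C: "continuous_on {0..T} C"
  shows "pos_def (S0 + integral {0..T} (\<lambda>s. C s ** transpose (C s)))"
proof (rule pos_def_add_semidef[OF pos_def_S0])
  have i: "(\<lambda>s. C s ** transpose (C s)) integrable_on {0..T}"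
    by (intro integrable_continuous_interval continuous_on_matrix_mult continuous_on_transpose C)
  show "transpose (integral {0..T} (\<lambda>s. C s ** transpose (C s))) = integral {0..T} (\<lambda>s. C s ** transpose (C s))"
    using integral_linear[OF i bounded_linear_transpose] by (simp add: o_def matrix_transpose_mul)
  fix v :: "real^'n"
  have bl: "bounded_linear (\<lambda>X. v \<bullet> (X *v v))"
    by (rule bounded_linear_compose[OF bounded_linear_inner_right bounded_bilinear.bounded_linear_left[OF bounded_bilinear_matrix_vector_mult]])
  have "v \<bullet> (integral {0..T} (\<lambda>s. C s ** transpose (C s)) *v v) = integral {0..T} (\<lambda>s. v \<bullet> ((C s ** transpose (C s)) *v v))"
    using integral_linear[OF i bl] by (simp add: o_def)
  also have "\<dots> = integral {0..T} (\<lambda>s. (norm (transpose (C s) *v v))\<^sup>2)" by (simp only: inner_Gram)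
  also have "0 \<le> \<dots>" by (rule integral_nonneg) (intro integrable_continuous_interval continuous_intros
      continuous_on_matrix_vector continuous_on_transpose C, simp)
  finally show "0 \<le> v \<bullet> (integral {0..T} (\<lambda>s. C s ** transpose (C s)) *v v)" .
qed

text \<open>Multiplication by \<open>V T\<close> removes the flow: V(T) x(T) is the limit of
  \<open>x0\<close> plus sums with coefficients V(s) G(s) at the nodes. Its law is found first and
  then carried forward by \<open>\<Psi> T\<close>.\<close>

lemma distributed_terminal:
  fixes A \<Psi> V :: "real \<Rightarrow> real^'n^'n"
  assumes A: "continuous_on {0..T} A" and x: "strong_solution M T w x0 (\<lambda>t \<omega>. A t *v x t \<omega>) G x"
    and V: "V 0 = mat 1" "\<And>t. t \<in> {0..T} \<Longrightarrow> (V has_vector_derivative - (V t ** A t)) (at t within {0..T})"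
    and PV: "\<And>t. t \<in> {0..T} \<Longrightarrow> \<Psi> t ** V t = mat 1"
  shows "distributed M lborel (x T) (gaussian_density
     (\<Psi> T ** (S0 + integral {0..T} (\<lambda>s. (V s ** G s) ** transpose (V s ** G s))) ** transpose (\<Psi> T)))"
proof -
  have T0: "T \<in> {0..T}" using T_pos by simp
  have cV: "continuous_on {0..T} V" using V(2) by (meson continuous_on_eq_continuous_within has_vector_derivative_continuous)
  have cVG: "continuous_on {0..T} (\<lambda>s. V s ** G s)" by (intro continuous_on_matrix_mult cV continuous_G)
  have cV': "continuous_on {0..T} (\<lambda>s. - (V s ** A s))" by (intro continuous_on_minus continuous_on_matrix_mult cV A)
  define R where "R = S0 + integral {0..T} (\<lambda>s. (V s ** G s) ** transpose (V s ** G s))"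
  \<comment> \<open>The integral of V A I and the boundary term at \<open>T\<close> are what
    integration by parts makes of the integral of V against \<open>I\<close>, since the derivative
    of \<open>V\<close> is - V A.\<close>
  define Y where "Y \<omega> = x0 \<omega> + integral {0..T} (\<lambda>s. (V s ** A s) *v I s \<omega>) + V T *v I T \<omega>" for \<omega>
  have xY: "AE \<omega> in M. x T \<omega> = \<Psi> T *v Y \<omega>"
    using strong_solution_pathwise[OF x] AE_space
  proof eventually_elim
    case (elim \<omega>)
    have "x T \<omega> = \<Psi> T *v (x0 \<omega> + integral {0..T} (\<lambda>s. (V s ** A s) *v I s \<omega>)) + I T \<omega>"
      by (rule linear_path_unique[OF T_pos A I_continuous[OF elim(2)] state_continuous[OF x elim(2)] V PV _ T0])
         (use elim(1) in auto)
    also have "\<dots> = \<Psi> T *v Y \<omega>"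
      by (simp add: Y_def matrix_vector_right_distrib matrix_vector_mul_assoc PV[OF T0])
    finally show ?case .
  qed
  define Z where "Z j \<omega> = x0 \<omega> + (\<Sum>k<mesh j. (V (node (mesh j) k) ** G (node (mesh j) k)) *v (w (node (mesh j) (Suc k)) \<omega> - w (node (mesh j) k) \<omega>))" for j \<omega>
  define Q where "Q j = S0 + (\<Sum>k<mesh j. (T / real (mesh j)) *\<^sub>R ((V (node (mesh j) k) ** G (node (mesh j) k)) ** transpose (V (node (mesh j) k) ** G (node (mesh j) k))))" for j
  have ZQ: "pos_def (Q j)" "distributed M lborel (Z j) (gaussian_density (Q j))" for j
    using increment_sum_gaussian[OF mesh_pos[of j] order_refl, of "\<lambda>k. V (node (mesh j) k) ** G (node (mesh j) k)"]
    unfolding Q_def Z_def[abs_def] by auto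
  have ZY: "AE \<omega> in M. (\<lambda>j. Z j \<omega>) \<longlonglongrightarrow> Y \<omega>"
    using I_uniform AE_space
  proof eventually_elim
    case (elim \<omega>)
    have "(\<lambda>j. Z j \<omega>) \<longlonglongrightarrow> x0 \<omega> + (V T *v I T \<omega> - integral {0..T} (\<lambda>s. (- (V s ** A s)) *v I s \<omega>))"
      unfolding Z_def by (intro tendsto_add tendsto_const terminal_sum_limit[OF V(2) cV' elim])
    then show ?case by (simp add: matrix_vector_minus_left Y_def algebra_simps)
  qed
  have xm: "x T \<in> borel_measurable M" by (rule state_measurable[OF x T0])
  have VPx: "AE \<omega> in M. (\<lambda>j. Z j \<omega>) \<longlonglongrightarrow> V T *v x T \<omega>"
    using ZY xY
  proof eventually_elim
    case (elim \<omega>)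
    have "V T ** \<Psi> T = mat 1" using PV[OF T0] matrix_left_right_inverse by blast
    then show ?case using elim by (simp add: matrix_vector_mul_assoc)
  qed
  have pR: "pos_def R" unfolding R_def by (rule pos_def_gram_integral[OF cVG])
  have "distributed M lborel (\<lambda>\<omega>. V T *v x T \<omega>) (gaussian_density R)"
  proof (rule distributed_gaussian_limit[OF prob_space_axioms ZQ(2) _ ZQ(1) pR _ VPx])
    show "Q \<longlonglongrightarrow> R" unfolding Q_def[abs_def] R_def by (rule gram_sum_limit[OF cVG])
    show "(\<lambda>\<omega>. V T *v x T \<omega>) \<in> borel_measurable M" by (rule measurable_compose[OF xm measurable_matrix_vector])
  qed
  then have "distributed M lborel (\<lambda>\<omega>. \<Psi> T *v (V T *v x T \<omega>)) (gaussian_density (\<Psi> T ** R ** transpose (\<Psi> T)))"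
    using pR PV[OF T0] by (intro distributed_gaussian_linear) (auto simp: invertible_right_inverse)
  then show ?thesis by (simp add: matrix_vector_mul_assoc PV[OF T0] R_def)
qed

end

section \<open>The covariance along the closed loop\<close>

text \<open>If \<open>S\<close> solves the Lyapunov equation then the defect \<open>Q S - 1\<close> solves a homogeneous linear
  equation.\<close>

lemma lyapunov_riccati_inverse:
  fixes A D Q S :: "real \<Rightarrow> real^'n^'n"
  assumes cA: "continuous_on {0..T} A" and cD: "continuous_on {0..T} D"
    and dQ: "\<And>t. t \<in> {0..T} \<Longrightarrow> (Q has_vector_derivative
       (- (transpose (A t) ** Q t) - Q t ** A t - Q t ** D t ** Q t)) (at t within {0..T})"
    and dS: "\<And>t. t \<in> {0..T} \<Longrightarrow> (S has_vector_derivative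
       (A t ** S t + D t + S t ** transpose (A t))) (at t within {0..T})"
    and init: "Q 0 ** S 0 = mat 1" and t: "t \<in> {0..T}"
  shows "Q t ** S t = mat 1"
proof -
  interpret m: bounded_bilinear "\<lambda>(X::real^'n^'n) (Y::real^'n^'n). X ** Y" by (rule bounded_bilinear_matrix_mult)
  define E where "E t = Q t ** S t - mat 1" for t
  define E' where "E' t = E t ** transpose (A t) - transpose (A t) ** E t - (Q t ** D t) ** E t" for t
  have dE: "(E has_vector_derivative E' t) (at t within {0..T})" if t: "t \<in> {0..T}" for t
  proof -
    have "((\<lambda>t. Q t ** S t - mat 1) has_vector_derivative
       ((Q t ** (A t ** S t + D t + S t ** transpose (A t))
        + (- (transpose (A t) ** Q t) - Q t ** A t - Q t ** D t ** Q t) ** S t) - 0)) (at t within {0..T})"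
      by (intro has_vector_derivative_diff has_vector_derivative_const m.has_vector_derivative dQ[OF t] dS[OF t])
    moreover have "(Q t ** (A t ** S t + D t + S t ** transpose (A t))
        + (- (transpose (A t) ** Q t) - Q t ** A t - Q t ** D t ** Q t) ** S t) - 0 = E' t"
      unfolding E'_def E_def
      by (simp add: m.add_left m.add_right m.diff_left m.diff_right m.minus_left m.minus_right matrix_mul_assoc)
    ultimately show ?thesis unfolding E_def[abs_def] by simp
  qed
  have cQ: "continuous_on {0..T} Q"
    using dQ by (meson continuous_on_eq_continuous_within has_vector_derivative_continuous)
  obtain K where K: "0 \<le> K" "\<And>t. t \<in> {0..T} \<Longrightarrow> norm (transpose (A t)) \<le> K"
    using matrix_bound_on[OF continuous_on_transpose[OF cA]] by blast
  obtain N where N: "0 \<le> N" "\<And>t. t \<in> {0..T} \<Longrightarrow> norm (Q t ** D t) \<le> N"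
    using matrix_bound_on[OF continuous_on_matrix_mult[OF cQ cD]] by blast
  have "E t = 0"
  proof (rule linear_ode_zero[OF dE _ _ _ t])
    fix s assume s: "s \<in> {0..T}"
    have "norm (E' s) \<le> norm (E s ** transpose (A s)) + norm (transpose (A s) ** E s) + norm ((Q s ** D s) ** E s)"
      unfolding E'_def using norm_triangle_ineq4[of "E s ** transpose (A s) - transpose (A s) ** E s" "(Q s ** D s) ** E s"]
        norm_triangle_ineq4[of "E s ** transpose (A s)" "transpose (A s) ** E s"] by linarith
    also have "\<dots> \<le> norm (E s) * K + K * norm (E s) + N * norm (E s)"
      using norm_matrix_mult_le[of "E s" "transpose (A s)"] norm_matrix_mult_le[of "transpose (A s)" "E s"]
        norm_matrix_mult_le[of "Q s ** D s" "E s"]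
        mult_left_mono[OF K(2)[OF s] norm_ge_zero[of "E s"]] mult_right_mono[OF K(2)[OF s] norm_ge_zero[of "E s"]]
        mult_right_mono[OF N(2)[OF s] norm_ge_zero[of "E s"]]
      by linarith
    finally show "norm (E' s) \<le> (2 * K + N) * norm (E s)" by (simp add: algebra_simps)
  next
    show "0 \<le> 2 * K + N" using K(1) N(1) by simp
    show "E 0 = 0" using init by (simp add: E_def)
  qed
  then show ?thesis by (simp add: E_def)
qed

text \<open>The terms H B B' H cancel, and the remaining ones with B B' are exactly what replacing
  \<open>A\<close> by the closed-loop matrix contributes. This is the purpose of the coupling term
  in the second Riccati equation.\<close>

lemma closed_loop_riccati:
  fixes A P H :: "real^'n^'n" and B :: "real^'m^'n" and C :: "real^'p^'n"
  assumes "transpose P = P"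
  shows "(- (transpose A ** P) - P ** A + P ** B ** transpose B ** P)
    + (- (transpose A ** H) - H ** A - H ** B ** transpose B ** H
       + (P + H) ** (B ** transpose B - C ** transpose C) ** (P + H))
    = - (transpose (A - B ** transpose B ** P) ** (P + H)) - (P + H) ** (A - B ** transpose B ** P)
       - (P + H) ** (C ** transpose C) ** (P + H)"
proof -
  interpret m: bounded_bilinear "\<lambda>(X::real^'n^'n) (Y::real^'n^'n). X ** Y" by (rule bounded_bilinear_matrix_mult)
  define N where "N = B ** transpose B"
  define D where "D = C ** transpose C"
  have N: "X ** B ** transpose B = X ** N" for X :: "real^'n^'n" by (simp add: N_def matrix_mul_assoc)
  have t: "transpose (A - N ** P) = transpose A - P ** N"
    by (simp add: transpose_diff matrix_transpose_mul assms N_def)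
  show ?thesis
    unfolding N N_def[symmetric] D_def[symmetric] t
    by (simp add: m.add_left m.add_right m.diff_left m.diff_right m.minus_left m.minus_right matrix_mul_assoc)
qed

context wiener_path
begin

text \<open>The matrix \<open>S\<close>, which at time \<open>T\<close> is the covariance found in
  \<open>distributed_terminal\<close>, solves the Lyapunov equation. \<open>Q\<close> inverts it at
  time 0 and hence at all times, and the value of \<open>Q T\<close> then forces it to be
  \<open>ST\<close>.\<close>

lemma distributed_terminal_riccati:
  fixes A Q :: "real \<Rightarrow> real^'n^'n" and ST :: "real^'n^'n"
  assumes cA: "continuous_on {0..T} A" and x: "strong_solution M T w x0 (\<lambda>t \<omega>. A t *v x t \<omega>) G x"
    and dQ: "\<And>t. t \<in> {0..T} \<Longrightarrow> (Q has_vector_derivative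
       (- (transpose (A t) ** Q t) - Q t ** A t - Q t ** (G t ** transpose (G t)) ** Q t)) (at t within {0..T})"
    and Q0: "Q 0 = matrix_inv S0" and QT: "Q T = matrix_inv ST" and ST: "pos_def ST"
  shows "distributed M lborel (x T) (gaussian_density ST)"
proof -
  interpret m: bounded_bilinear "\<lambda>(X::real^'n^'n) (Y::real^'n^'n). X ** Y" by (rule bounded_bilinear_matrix_mult)
  have T0: "T \<in> {0..T}" using T_pos by simp
  obtain \<Psi> V where P: "\<Psi> 0 = mat 1" "\<And>t. t \<in> {0..T} \<Longrightarrow> (\<Psi> has_vector_derivative A t ** \<Psi> t) (at t within {0..T})"
    and V: "V 0 = mat 1" "\<And>t. t \<in> {0..T} \<Longrightarrow> (V has_vector_derivative - (V t ** A t)) (at t within {0..T})"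
    and PV: "\<And>t. t \<in> {0..T} \<Longrightarrow> \<Psi> t ** V t = mat 1"
    using fundamental_matrix[OF T_pos cA] by blast
  have cV: "continuous_on {0..T} V" using V(2) by (meson continuous_on_eq_continuous_within has_vector_derivative_continuous)
  define C where "C s = (V s ** G s) ** transpose (V s ** G s)" for s
  have cC: "continuous_on {0..T} C"
    unfolding C_def by (intro continuous_on_matrix_mult continuous_on_transpose cV continuous_G)
  define W where "W t = S0 + integral {0..t} C" for t
  define S where "S t = \<Psi> t ** W t ** transpose (\<Psi> t)" for t
  have dW: "(W has_vector_derivative C t) (at t within {0..T})" if "t \<in> {0..T}" for t
    unfolding W_def
    using has_vector_derivative_add[OF has_vector_derivative_const integral_has_vector_derivative[OF cC that]] by simp
  have dS: "(S has_vector_derivative (A t ** S t + G t ** transpose (G t) + S t ** transpose (A t))) (at t within {0..T})"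
    if t: "t \<in> {0..T}" for t
  proof -
    have "transpose (V t) ** transpose (\<Psi> t) = mat 1"
      using PV[OF t] by (simp add: matrix_transpose_mul[symmetric] transpose_mat)
    then have VP: "X ** transpose (V t) ** transpose (\<Psi> t) = X" for X :: "real^'n^'n"
      by (simp add: matrix_mul_assoc[symmetric])
    have "(S has_vector_derivative ((\<Psi> t ** W t) ** transpose (A t ** \<Psi> t) + (\<Psi> t ** C t + (A t ** \<Psi> t) ** W t) ** transpose (\<Psi> t)))
       (at t within {0..T})"
      unfolding S_def[abs_def]
      by (intro m.has_vector_derivative bounded_linear.has_vector_derivative[OF bounded_linear_transpose] P(2) dW t)
    moreover have "(\<Psi> t ** W t) ** transpose (A t ** \<Psi> t) = S t ** transpose (A t)"
      by (simp add: S_def matrix_transpose_mul matrix_mul_assoc)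
    moreover have "\<Psi> t ** C t ** transpose (\<Psi> t) = G t ** transpose (G t)"
      by (simp add: C_def matrix_transpose_mul matrix_mul_assoc VP PV[OF t])
    moreover have "(A t ** \<Psi> t) ** W t ** transpose (\<Psi> t) = A t ** S t"
      by (simp add: S_def matrix_mul_assoc)
    ultimately show ?thesis by (simp add: m.add_left add_ac)
  qed
  have "S 0 = S0" by (simp add: S_def W_def P(1) transpose_mat)
  then have "Q 0 ** S 0 = mat 1" by (simp add: Q0 invertible_matrix_inv[OF pos_def_invertible[OF pos_def_S0]])
  from lyapunov_riccati_inverse[OF cA _ dQ dS this T0]
  have "Q T ** S T = mat 1" by (simp add: continuous_on_matrix_mult continuous_on_transpose continuous_G)
  then have "ST ** (matrix_inv ST ** S T) = ST" by (simp add: QT)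
  then have "S T = ST" by (simp add: matrix_mul_assoc invertible_matrix_inv[OF pos_def_invertible[OF ST]])
  then show ?thesis
    using distributed_terminal[OF cA x V PV] unfolding S_def W_def C_def[abs_def] by simp
qed

section \<open>Admissibility and optimality of the feedback law\<close>

lemma feedback_measurable:
  fixes K :: "real \<Rightarrow> real^'n^'m"
  assumes cK: "continuous_on {0..T} K" and x: "strong_solution M T w x0 b G x"
  shows "t \<in> {0..T} \<Longrightarrow> (\<lambda>\<omega>. K t *v x t \<omega>) \<in> borel_measurable (generated_algebra M {0..t} x)"
    and "(\<lambda>(t, \<omega>). K t *v x t \<omega>) \<in> borel_measurable (L \<Otimes>\<^sub>M M)"
proof -
  show "(\<lambda>\<omega>. K t *v x t \<omega>) \<in> borel_measurable (generated_algebra M {0..t} x)" if "t \<in> {0..T}" for t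
    by (rule measurable_compose[OF measurable_generated_algebra measurable_matrix_vector]) (use that in simp)
  show "(\<lambda>(t, \<omega>). K t *v x t \<omega>) \<in> borel_measurable (L \<Otimes>\<^sub>M M)"
  proof (rule process_measurable_LM)
    show "(\<lambda>\<omega>. K t *v x t \<omega>) \<in> borel_measurable M" if "t \<in> {0..T}" for t
      by (rule measurable_compose[OF state_measurable[OF x that] measurable_matrix_vector])
    show "continuous_on {0..T} (\<lambda>t. K t *v x t \<omega>)" if "\<omega> \<in> space M" for \<omega>
      by (intro continuous_on_matrix_vector cK state_continuous[OF x that])
  qed
qed

text \<open>The closed loop is a linear equation without control, so its second moments are finite
  before any energy is known; a gain that is bounded in time then makes the energy finite.\<close>

lemma feedback_square_integrable:
  fixes K :: "real \<Rightarrow> real^'n^'m" and A :: "real \<Rightarrow> real^'n^'n"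
  assumes cK: "continuous_on {0..T} K" and cA: "continuous_on {0..T} A"
    and x: "strong_solution M T w x0 (\<lambda>t \<omega>. A t *v x t \<omega>) G x"
  shows "integrable (L \<Otimes>\<^sub>M M) (\<lambda>(t, \<omega>). (norm (K t *v x t \<omega>))\<^sup>2)"
proof -
  obtain k where k: "0 \<le> k" "\<And>t. t \<in> {0..T} \<Longrightarrow> norm (K t) \<le> k" using matrix_bound_on[OF cK] by blast
  have "integrable (L \<Otimes>\<^sub>M M) (\<lambda>(t, \<omega>). (norm (x t \<omega>))\<^sup>2)"
    by (rule state_square_integrable_LM[OF cA, where f = "\<lambda>_ _. 0"]) (use x in \<open>simp_all add: case_prod_beta'\<close>)
  then have i: "integrable (L \<Otimes>\<^sub>M M) (\<lambda>p. k\<^sup>2 * (norm (x (fst p) (snd p)))\<^sup>2)"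
    by (simp add: case_prod_beta')
  have m: "(\<lambda>p. K (fst p) *v x (fst p) (snd p)) \<in> borel_measurable (L \<Otimes>\<^sub>M M)"
    using feedback_measurable(2)[OF cK x] by (simp add: case_prod_beta')
  have "integrable (L \<Otimes>\<^sub>M M) (\<lambda>p. (norm (K (fst p) *v x (fst p) (snd p)))\<^sup>2)"
  proof (rule Bochner_Integration.integrable_bound[OF i])
    show "(\<lambda>p. (norm (K (fst p) *v x (fst p) (snd p)))\<^sup>2) \<in> borel_measurable (L \<Otimes>\<^sub>M M)" using m by simp
    show "AE p in L \<Otimes>\<^sub>M M. norm ((norm (K (fst p) *v x (fst p) (snd p)))\<^sup>2) \<le> norm (k\<^sup>2 * (norm (x (fst p) (snd p)))\<^sup>2)"
    proof (rule AE_I2)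
      fix p assume "p \<in> space (L \<Otimes>\<^sub>M M)"
      then have "fst p \<in> {0..T}" by (auto simp: space_pair_measure)
      from mult_right_mono[OF k(2)[OF this] norm_ge_zero[of "x (fst p) (snd p)"]] norm_matrix_vector_le[of "K (fst p)" "x (fst p) (snd p)"]
      have "norm (K (fst p) *v x (fst p) (snd p)) \<le> k * norm (x (fst p) (snd p))" by linarith
      from power_mono[OF this norm_ge_zero, of 2]
      show "norm ((norm (K (fst p) *v x (fst p) (snd p)))\<^sup>2) \<le> norm (k\<^sup>2 * (norm (x (fst p) (snd p)))\<^sup>2)"
        by (simp add: power_mult_distrib)
    qed
  qed
  then show ?thesis by (simp add: case_prod_beta')
qed

end


context wiener_path
begin

lemma feedback_optimal:
  fixes A P H :: "real \<Rightarrow> real^'n^'n" and B :: "real \<Rightarrow> real^'m^'n" and ST :: "real^'n^'n"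
  defines "K \<equiv> \<lambda>t. - (transpose (B t) ** P t)"
  assumes A: "continuous_on {0..T} A" and B: "continuous_on {0..T} B" and ST: "pos_def ST"
    and symP: "\<And>t. t \<in> {0..T} \<Longrightarrow> transpose (P t) = P t"
    and dP: "\<And>t. t \<in> {0..T} \<Longrightarrow> (P has_vector_derivative
           (- (transpose (A t) ** P t) - P t ** A t + P t ** B t ** transpose (B t) ** P t)) (at t within {0..T})"
    and dH: "\<And>t. t \<in> {0..T} \<Longrightarrow> (H has_vector_derivative
           (- (transpose (A t) ** H t) - H t ** A t - H t ** B t ** transpose (B t) ** H t
            + (P t + H t) ** (B t ** transpose (B t) - G t ** transpose (G t)) ** (P t + H t))) (at t within {0..T})"
    and S0: "matrix_inv S0 = P 0 + H 0" and QT: "matrix_inv ST = P T + H T"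
    and x: "strong_solution M T w x0 (\<lambda>t \<omega>. (A t - B t ** transpose (B t) ** P t) *v x t \<omega>) G x"
  shows "controlled_state M T w x0 A B G (\<lambda>t \<omega>. K t *v x t \<omega>) x"
    and "(\<lambda>t \<omega>. K t *v x t \<omega>) \<in> admissible_controls M T w x0 A B G ST"
    and "v \<in> admissible_controls M T w x0 A B G ST \<Longrightarrow> energy M T (\<lambda>t \<omega>. K t *v x t \<omega>) \<le> energy M T v"
proof -
  define A' where "A' t = A t - B t ** transpose (B t) ** P t" for t
  define u where "u t \<omega> = K t *v x t \<omega>" for t \<omega>
  have T0: "T \<in> {0..T}" using T_pos by simp
  have u: "u t \<omega> = - (transpose (B t) *v (P t *v x t \<omega>))" for t \<omega>
    by (simp add: u_def K_def matrix_vector_minus_left matrix_vector_mul_assoc)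
  have cP: "continuous_on {0..T} P" using dP by (meson continuous_on_eq_continuous_within has_vector_derivative_continuous)
  have cK: "continuous_on {0..T} K"
    unfolding K_def by (intro continuous_on_minus continuous_on_matrix_mult continuous_on_transpose B cP)
  have cA': "continuous_on {0..T} A'"
    unfolding A'_def[abs_def] by (intro continuous_on_diff continuous_on_matrix_mult continuous_on_transpose A B cP)
  have x': "strong_solution M T w x0 (\<lambda>t \<omega>. A' t *v x t \<omega>) G x" using x by (simp add: A'_def)
  have "A' t *v x t \<omega> = A t *v x t \<omega> + B t *v u t \<omega>" for t \<omega>
    unfolding u A'_def by (simp add: matrix_vector_mult_diff_rdistrib matrix_vector_mul_assoc[symmetric] matrix_vector_minus_right)
  then have xu: "strong_solution M T w x0 (\<lambda>t \<omega>. A t *v x t \<omega> + B t *v u t \<omega>) G x"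
    using x' by simp
  then show cs: "controlled_state M T w x0 A B G (\<lambda>t \<omega>. K t *v x t \<omega>) x"
    by (simp add: controlled_state_def u_def)
  have um: "(\<lambda>(t, \<omega>). u t \<omega>) \<in> borel_measurable (L \<Otimes>\<^sub>M M)"
    and ug: "t \<in> {0..T} \<Longrightarrow> u t \<in> borel_measurable (generated_algebra M {0..t} x)" for t
    unfolding u_def[abs_def] using feedback_measurable[OF cK x] by auto
  have ui: "integrable (L \<Otimes>\<^sub>M M) (\<lambda>(t, \<omega>). (norm (u t \<omega>))\<^sup>2)"
    unfolding u_def by (rule feedback_square_integrable[OF cK cA' x'])
  have law: "distributed M lborel (x T) (gaussian_density ST)"
  proof (rule distributed_terminal_riccati[OF cA' x' _ _ _ ST, where Q = "\<lambda>t. P t + H t"])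
    fix t assume t: "t \<in> {0..T}"
    show "((\<lambda>t. P t + H t) has_vector_derivative
       (- (transpose (A' t) ** (P t + H t)) - (P t + H t) ** A' t
         - (P t + H t) ** (G t ** transpose (G t)) ** (P t + H t))) (at t within {0..T})"
      using has_vector_derivative_add[OF dP[OF t] dH[OF t]]
      unfolding closed_loop_riccati[OF symP[OF t]] A'_def .
  qed (simp_all add: S0 QT)
  have "energy M T u < \<infinity>" unfolding energy_eq_integral[OF um ui] by simp
  then show "(\<lambda>t \<omega>. K t *v x t \<omega>) \<in> admissible_controls M T w x0 A B G ST"
    using um ug cs law unfolding admissible_controls_def u_def[abs_def] borel_measurable_LM by auto
  \<comment> \<open>Written as an integral against the prescribed density, so that the terminal
    states of two different controls visibly give the same number.\<close>
  have terminal: "(LINT \<omega>|M. Y \<omega> \<bullet> (P T *v Y \<omega>)) = (\<integral>z. gaussian_density ST z * (z \<bullet> (P T *v z)) \<partial>lborel)"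
    if "distributed M lborel Y (gaussian_density ST)" for Y :: "'w \<Rightarrow> real^'n"
    by (rule distributed_integral[OF that, symmetric]) (simp_all add: borel_measurable_inner)
  show "energy M T (\<lambda>t \<omega>. K t *v x t \<omega>) \<le> energy M T v" if v: "v \<in> admissible_controls M T w x0 A B G ST"
  proof -
    obtain y where y: "strong_solution M T w x0 (\<lambda>s \<omega>. A s *v y s \<omega> + B s *v v s \<omega>) G y"
      and vg: "\<And>t. t \<in> {0..T} \<Longrightarrow> v t \<in> borel_measurable (generated_algebra M {0..t} y)"
      and yT: "distributed M lborel (y T) (gaussian_density ST)"
      using v unfolding admissible_controls_def controlled_state_def by blast
    have vm: "(\<lambda>(t, \<omega>). v t \<omega>) \<in> borel_measurable (L \<Otimes>\<^sub>M M)" and fin: "energy M T v < \<infinity>"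
      using v unfolding admissible_controls_def borel_measurable_LM by auto
    have vi: "integrable (L \<Otimes>\<^sub>M M) (\<lambda>(t, \<omega>). (norm (v t \<omega>))\<^sup>2)"
      by (rule energy_finite_imp_integrable[OF vm fin])
    note cost_v = cost_identity(2)[OF A B symP dP vm measurable_generated_imp_F[OF y _ vg] vi y]
    note cost_u = cost_identity(2)[OF A B symP dP um measurable_generated_imp_F[OF xu _ ug] ui xu]
    have "integral\<^sup>L (L \<Otimes>\<^sub>M M) (\<lambda>(t, \<omega>). (norm (u t \<omega>))\<^sup>2) \<le> integral\<^sup>L (L \<Otimes>\<^sub>M M) (\<lambda>(t, \<omega>). (norm (v t \<omega>))\<^sup>2)"
    proof -
      have "0 \<le> integral\<^sup>L (L \<Otimes>\<^sub>M M) (\<lambda>(t, \<omega>). (norm (v t \<omega> + transpose (B t) *v (P t *v y t \<omega>)))\<^sup>2)"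
        by (intro Bochner_Integration.integral_nonneg) (simp add: case_prod_beta')
      moreover have "integral\<^sup>L (L \<Otimes>\<^sub>M M) (\<lambda>(t, \<omega>). (norm (u t \<omega> + transpose (B t) *v (P t *v x t \<omega>)))\<^sup>2) = 0"
        by (simp add: u case_prod_beta')
      ultimately show ?thesis using cost_v cost_u terminal[OF law] terminal[OF yT] by linarith
    qed
    then show ?thesis
      unfolding u_def[abs_def, symmetric] energy_eq_integral[OF um ui] energy_eq_integral[OF vm vi] by (rule ennreal_leI)
  qed
qed

end

text \<open>Existence of a closed-loop solution is stated separately, so that the universal part is
  not vacuous; that part covers every solution and not only the constructed one.\<close>

theorem proposition1:
  fixes M :: "'w measure" and T :: real
    and w :: "real \<Rightarrow> 'w \<Rightarrow> real^'p" and x0 :: "'w \<Rightarrow> real^'n"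
    and A :: "real \<Rightarrow> real^'n^'n" and B :: "real \<Rightarrow> real^'m^'n" and B1 :: "real \<Rightarrow> real^'p^'n"
    and S0 ST :: "real^'n^'n" and P H :: "real \<Rightarrow> real^'n^'n"
  assumes "prob_space M"
    and "0 < T"
    and "wiener_process M T w"
    and "distributed M lborel x0 (gaussian_density S0)"
    and "prob_space.indep_set M
           (sets (vimage_algebra (space M) x0 borel)) (sets (generated_algebra M {0..T} w))"
    and "continuous_on {0..T} A" and "continuous_on {0..T} B" and "continuous_on {0..T} B1"
    and "controllable T A B"
    and "pos_def S0" and "pos_def ST"
    and "\<forall>t\<in>{0..T}. transpose (P t) = P t" and "\<forall>t\<in>{0..T}. transpose (H t) = H t"
    and "\<forall>t\<in>{0..T}. (P has_vector_derivative
           (- (transpose (A t) ** P t) - P t ** A t + P t ** B t ** transpose (B t) ** P t))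
           (at t within {0..T})"
    and "\<forall>t\<in>{0..T}. (H has_vector_derivative
           (- (transpose (A t) ** H t) - H t ** A t - H t ** B t ** transpose (B t) ** H t
            + (P t + H t) ** (B t ** transpose (B t) - B1 t ** transpose (B1 t)) ** (P t + H t)))
           (at t within {0..T})"
    and "matrix_inv S0 = P 0 + H 0"
    and "matrix_inv ST = P T + H T"
  shows "(\<exists>x. strong_solution M T w x0
                (\<lambda>t \<omega>. (A t - B t ** transpose (B t) ** P t) *v x t \<omega>) B1 x) \<and>
         (\<forall>x. strong_solution M T w x0
                (\<lambda>t \<omega>. (A t - B t ** transpose (B t) ** P t) *v x t \<omega>) B1 x \<longrightarrow>
            (let u = (\<lambda>t \<omega>. - (transpose (B t) *v (P t *v x t \<omega>))) in
               controlled_state M T w x0 A B B1 u x \<and>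
               u \<in> admissible_controls M T w x0 A B B1 ST \<and>
               (\<forall>v \<in> admissible_controls M T w x0 A B B1 ST. energy M T u \<le> energy M T v)))"
proof -
  interpret prob_space M by (rule assms(1))
  interpret wiener_integrand M T w x0 S0 B1
    by unfold_locales (use assms in auto)
  \<comment> \<open>One continuous version of the integral of \<open>B1\<close> is fixed for the
    whole argument. It depends on no control, which is what lets different controls be
    compared.\<close>
  obtain I where "\<And>\<omega>. \<omega> \<in> space M \<Longrightarrow> continuous_on {0..T} (\<lambda>t. I t \<omega>)"
      "\<And>t. t \<in> {0..T} \<Longrightarrow> I t \<in> borel_measurable (F t)"
      "AE \<omega> in M. uniform_limit {0..T} (\<lambda>j t. euler (mesh j) t \<omega>) (\<lambda>t. I t \<omega>) sequentially"
    using wiener_path_exists by blast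
  then interpret wiener_path M T w x0 S0 B1 I by unfold_locales
  have P: "(P has_vector_derivative (- (transpose (A t) ** P t) - P t ** A t + P t ** B t ** transpose (B t) ** P t))
      (at t within {0..T})" if "t \<in> {0..T}" for t
    using assms(14) that by blast
  then have "continuous_on {0..T} P"
    by (meson continuous_on_eq_continuous_within has_vector_derivative_continuous)
  then have "continuous_on {0..T} (\<lambda>t. A t - B t ** transpose (B t) ** P t)"
    by (intro continuous_on_diff continuous_on_matrix_mult continuous_on_transpose assms)
  moreover have u: "(\<lambda>t \<omega>. - (transpose (B t) *v (P t *v x t \<omega>))) = (\<lambda>t \<omega>. - (transpose (B t) ** P t) *v x t \<omega>)"
    for x :: "real \<Rightarrow> 'w \<Rightarrow> real^'n"
    by (simp add: matrix_vector_mul_assoc matrix_vector_minus_left)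
  moreover note optimal = feedback_optimal[OF assms(6,7,11) bspec[OF assms(12)] P bspec[OF assms(15)] assms(16,17)]
  ultimately show ?thesis
    unfolding Let_def u using strong_solution_exists by (intro conjI allI impI ballI) (auto intro: optimal)
qed

end
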